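(* Let $k\ge 2$ be an integer and let $G$ be a 2-connected non-Hamiltonian graph on $n$ vertices with $c(G)\le 2k+1$. If every vertex of $G$, except for at most one vertex, has degree at least $k$, then $G$ is a subgraph of one of the following graphs: (i) $H(2k+1,2k+1,k)$ (this case occurs with $n=2k+1$), or $H(n,2k+2,k)$ with $n\ge 2k+2$; (ii) $F(s,t,k)$ with $s\ge 1$, $t\ge 1$, or $F_1(t,k)$ with $t\ge 1$; (iii) when $k=3$: $K_2+M_t$ with $t\ge 6$, or $K_2+(S_s\cup M_t)$ with $s+t\ge 6$; when $k=4$: $K_3+M_t$ with $t\ge 7$.
   Context: All graphs are finite, simple and undirected. $c(G)$ (the circumference) is the length of a longest cycle in $G$. For graphs $G,H$, $G\cup H$ is their vertex-disjoint union, $G+H$ is obtained from $G\cup H$ by joining every vertex of $G$ to every vertex of $H$, and $kH$ is the disjoint union of $k$ copies of $H$. $K_m$ is the complete graph on $m$ vertices. $H(n,\ell,a)$: the $n$-vertex graph with vertex partition $A\cup B\cup C$, $|A|=a$, $|B|=n-\ell+a$, $|C|=\ell-2a$, whose edges are all pairs between $A$ and $B$ and all pairs inside $A\cup C$ (so $A\cup C$ is a clique and $B$ is independent). $F_1(t,k)=K_2+(tK_{k-1}\cup K_k\cup K_1)$. $F(s,t,k)$: take vertex-disjoint graphs $K_3$ with vertex set $\{x,y,z\}$, $sK_{k-1}\cup K_1$, and $tK_{k-1}$; join $x$ and $z$ to every vertex of $sK_{k-1}\cup K_1$, and join $y$ and $z$ to every vertex of $tK_{k-1}$. $S_s=K_{1,s-1}$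 is the star on $s$ vertices; $M_t$ is the graph on $t$ vertices consisting of a matching with $\lfloor t/2\rfloor$ edges plus one isolated vertex if $t$ is odd. *)

theory Defs
  imports Main
begin

record 'a ugraph =
  verts :: "'a set"
  edges :: "'a set set"

definition simple_graph :: "'a ugraph \<Rightarrow> bool" where
  "simple_graph G \<longleftrightarrow> finite (verts G) \<and> (\<forall>e\<in>edges G. e \<subseteq> verts G \<and> card e = 2)"

definition degree :: "'a ugraph \<Rightarrow> 'a \<Rightarrow> nat" where
  "degree G v = card {u. {v, u} \<in> edges G}"

definition is_cycle :: "'a ugraph \<Rightarrow> 'a list \<Rightarrow> bool" where
  "is_cycle G p \<longleftrightarrow> length p \<ge> 3 \<and> distinct p \<and> set p \<subseteq> verts G \<and>
     (\<forall>i<length p. {p ! i, p ! ((i + 1) mod length p)} \<in> edges G)"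

(* Meaningful for finite graphs with at least one cycle, in particular for finite
   2-connected graphs; otherwise Max of an empty or infinite set is unspecified. *)
definition circumference :: "'a ugraph \<Rightarrow> nat" where
  "circumference G = Max {length p | p. is_cycle G p}"

definition hamiltonian :: "'a ugraph \<Rightarrow> bool" where
  "hamiltonian G \<longleftrightarrow> (\<exists>p. is_cycle G p \<and> set p = verts G)"

definition connected_graph :: "'a ugraph \<Rightarrow> bool" where
  "connected_graph G \<longleftrightarrow> verts G \<noteq> {} \<and>
     (\<forall>u\<in>verts G. \<forall>v\<in>verts G. (u, v) \<in> {(a, b). {a, b} \<in> edges G}\<^sup>*)"

definition delete_verts :: "'a ugraph \<Rightarrow> 'a set \<Rightarrow> 'a ugraph" where
  "delete_verts G X = \<lparr>verts = verts G - X, edges = {e \<in> edges G. e \<inter> X = {}}\<rparr>"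

definition k_connected :: "nat \<Rightarrow> 'a ugraph \<Rightarrow> bool" where
  "k_connected k G \<longleftrightarrow> card (verts G) > k \<and>
     (\<forall>X\<subseteq>verts G. card X < k \<longrightarrow> connected_graph (delete_verts G X))"

(* "G is a subgraph of H" in the usual sense for unlabelled H: G is isomorphic to a
   (not necessarily spanning, not necessarily induced) subgraph of H. *)
definition is_subgraph :: "'a ugraph \<Rightarrow> 'b ugraph \<Rightarrow> bool" where
  "is_subgraph G H \<longleftrightarrow> (\<exists>f. inj_on f (verts G) \<and> f ` verts G \<subseteq> verts H \<and>
     (\<forall>e\<in>edges G. f ` e \<in> edges H))"

definition complete_graph :: "nat \<Rightarrow> nat ugraph" where
  "complete_graph m = \<lparr>verts = {..<m}, edges = {{u, v} | u v. u < m \<and> v < m \<and> u \<noteq> v}\<rparr>"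

definition disjoint_union :: "'a ugraph \<Rightarrow> 'b ugraph \<Rightarrow> ('a + 'b) ugraph" where
  "disjoint_union G H =
     \<lparr>verts = Inl ` verts G \<union> Inr ` verts H,
      edges = (\<lambda>e. Inl ` e) ` edges G \<union> (\<lambda>e. Inr ` e) ` edges H\<rparr>"

definition add_all_between :: "'a set \<Rightarrow> 'a set \<Rightarrow> 'a ugraph \<Rightarrow> 'a ugraph" where
  "add_all_between X Y G =
     \<lparr>verts = verts G, edges = edges G \<union> {{u, v} | u v. u \<in> X \<and> v \<in> Y}\<rparr>"

definition join_graph :: "'a ugraph \<Rightarrow> 'b ugraph \<Rightarrow> ('a + 'b) ugraph" where
  "join_graph G H =
     add_all_between (Inl ` verts G) (Inr ` verts H) (disjoint_union G H)"

definition copies :: "nat \<Rightarrow> 'a ugraph \<Rightarrow> (nat \<times> 'a) ugraph" where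
  "copies k H = \<lparr>verts = {..<k} \<times> verts H, edges = {Pair i ` e | i e. i < k \<and> e \<in> edges H}\<rparr>"

(* The parts A, B, C are consecutive intervals of {..<n}, of sizes a, n - l + a and
   l - 2 * a provided 2 * a \<le> l \<le> n; outside this range the graph is not meaningful. *)
definition H_graph :: "nat \<Rightarrow> nat \<Rightarrow> nat \<Rightarrow> nat ugraph" where
  "H_graph n l a =
     (let A = {..<a}; B = {a..<n - l + 2 * a}; C = {n - l + 2 * a..<n} in
      \<lparr>verts = A \<union> B \<union> C,
       edges = {{u, v} | u v. u \<in> A \<and> v \<in> B} \<union>
               {{u, v} | u v. u \<in> A \<union> C \<and> v \<in> A \<union> C \<and> u \<noteq> v}\<rparr>)"

definition F1_graph :: "nat \<Rightarrow> nat \<Rightarrow> (nat + ((nat \<times> nat) + nat) + nat) ugraph" where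
  "F1_graph t k =
     join_graph (complete_graph 2)
       (disjoint_union (disjoint_union (copies t (complete_graph (k - 1))) (complete_graph k))
                       (complete_graph 1))"

definition F_graph :: "nat \<Rightarrow> nat \<Rightarrow> nat \<Rightarrow> (nat + ((nat \<times> nat) + nat) + (nat \<times> nat)) ugraph" where
  "F_graph s t k =
     (let P = disjoint_union (copies s (complete_graph (k - 1))) (complete_graph 1);
          Q = copies t (complete_graph (k - 1));
          x = Inl 0; y = Inl 1; z = Inl 2
      in add_all_between {x, z} (Inr ` Inl ` verts P)
           (add_all_between {y, z} (Inr ` Inr ` verts Q)
             (disjoint_union (complete_graph 3) (disjoint_union P Q))))"

definition star_graph :: "nat \<Rightarrow> nat ugraph" where
  "star_graph s = \<lparr>verts = {..<s}, edges = {{0, v} | v. 0 < v \<and> v < s}\<rparr>"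

definition matching_graph :: "nat \<Rightarrow> nat ugraph" where
  "matching_graph t = \<lparr>verts = {..<t}, edges = {{2 * i, 2 * i + 1} | i. i < t div 2}\<rparr>"

end

theory Submission
  imports Defs
begin

text \<open>Let \<open>w\<close> be the vertex whose degree may be small, \<open>C\<close> a longest cycle, \<open>D\<close> a component of
  \<open>G - C\<close> other than \<open>{w}\<close>, and \<open>S\<close> the set of neighbours of \<open>D\<close> on \<open>C\<close>. Weight each vertex of \<open>D\<close> by its number of
  neighbours on \<open>C\<close>. By induction on \<open>|D|\<close>, every \<open>p \<in> S\<close> starts a path through \<open>D\<close> whose
  length plus the weight of its last vertex exceeds \<open>k\<close>, unless \<open>|S| + |D| = k + 1\<close> and every vertex of
  \<open>D - {w}\<close> is adjacent to all of \<open>D \<union> S\<close>. A path of the first kind would lengthen \<open>C\<close> beyond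
  \<open>2k + 1\<close>, since the neighbours of its end are pairwise non-consecutive on \<open>C\<close> and far from \<open>p\<close>. If \<open>w \<notin> D\<close>, any two
  elements of \<open>S\<close> are separated on \<open>C\<close> by at least \<open>|D|\<close> vertices, so \<open>|S| (|D| + 1) \<le> 2k + 1\<close>, which leaves
  \<open>|D| = 1\<close>, or \<open>|S| = 2\<close>, or \<open>k = 4\<close>, \<open>|S| = 3\<close>, \<open>|D| = 2\<close>.

  When \<open>|D| \<ge> 2\<close>, an arc of \<open>C\<close> between two elements of \<open>S\<close> with exactly \<open>|D|\<close> inner vertices can be exchanged with
  \<open>D\<close>; applying the above to the new longest cycle shows that the inner vertices have no neighbours off the
  arc. This leads to \<open>F\<close>, \<open>F\<^sub>1\<close>, \<open>K\<^sub>3 + M\<^sub>t\<close> and \<open>K\<^sub>2 + (S\<^sub>s \<union> M\<^sub>t)\<close>. Otherwise all complements of longest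
  cycles are independent and a vertex \<open>u \<noteq> w\<close> off \<open>C\<close> is adjacent to every other vertex of \<open>C\<close>, which leads to \<open>H\<close>
  and, for small \<open>k\<close>, to \<open>F\<close>. If \<open>w\<close> is the only vertex off any longest cycle, the analysis is
  repeated for a longest cycle through \<open>w\<close>.\<close>

section \<open>Paths and the weighted path lemma\<close>

text \<open>One count drives everything. Let a path through \<open>D\<close> have vertex set
  \<open>X\<close> and start beside \<open>p\<close>, and let its last vertex \<open>t\<close> have
  \<open>f t\<close> further neighbours on the cycle. These keep distance \<open>card X + 1\<close>
  from \<open>p\<close> in both directions and distance 2 from each other, so the cycle has at least
  \<open>2 * (card X + f t)\<close> vertices, and \<open>card X + f t\<close> cannot reach
  \<open>k + 1\<close>. A component that attains only \<open>k\<close> must be the rigid one. With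
  \<open>s + 2\<close> attachments and \<open>m + 1\<close> vertices, where
  \<open>k = s + m + 2\<close>, the bound on the gaps collapses to \<open>s * m \<le> 1\<close>; the
  solution with \<open>s = m = 1\<close> is the case special to \<open>k = 4\<close>. The obstacle
  is \<open>w\<close>: a path may be forced to end in \<open>w\<close>, whose weight is not
  controlled. So the root \<open>p\<close> is taken beside \<open>w\<close> whenever
  \<open>w\<close> has a neighbour on the cycle, and a component of at least two vertices containing
  \<open>w\<close> is removed by rerouting the cycle through it. If every longest cycle misses
  exactly \<open>w\<close>, only reroutings that keep \<open>w\<close> are bounded, so one arc can
  escape the count; \<open>card V = c + 1\<close> makes up for the loss.\<close>

locale sgraph =
  fixes E :: "'a \<Rightarrow> 'a \<Rightarrow> bool"
  assumes sym: "E u v \<Longrightarrow> E v u"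
    and irrefl: "\<not> E v v"
begin

text \<open>Only the ends and the vertex set are recorded: later arguments compare cardinalities of
  vertex sets, so the order along the path is hidden.\<close>

definition pth :: "'a \<Rightarrow> 'a \<Rightarrow> 'a set \<Rightarrow> bool" where
  "pth u v X \<longleftrightarrow> (\<exists>xs. xs \<noteq> [] \<and> distinct xs \<and> successively E xs \<and> hd xs = u \<and> last xs = v \<and> set xs = X)"

text \<open>Connectedness is stated by cuts because it is used to find an edge leaving a given part.
  The empty set counts as connected.\<close>

definition conn :: "'a set \<Rightarrow> bool" where
  "conn D \<longleftrightarrow> (\<forall>K. K \<subseteq> D \<longrightarrow> K \<noteq> {} \<longrightarrow> K \<noteq> D \<longrightarrow> (\<exists>v\<in>K. \<exists>u\<in>D - K. E v u))"

lemma pthI: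
  "xs \<noteq> [] \<Longrightarrow> distinct xs \<Longrightarrow> successively E xs \<Longrightarrow> pth (hd xs) (last xs) (set xs)"
  unfolding pth_def by blast

lemma pth_single: "pth u u {u}"
  using pthI[of "[u]"] by simp

lemma pth_finite: "pth u v X \<Longrightarrow> finite X"
  unfolding pth_def by auto

lemma pth_ends: "pth u v X \<Longrightarrow> u \<in> X \<and> v \<in> X"
  unfolding pth_def by auto

lemma pth_rev:
  assumes "pth u v X" shows "pth v u X"
proof -
  obtain xs where xs: "xs \<noteq> []" "distinct xs" "successively E xs" "hd xs = u" "last xs = v" "set xs = X"
    using assms unfolding pth_def by blast
  have "successively E (rev xs)"
    using xs(3) by (auto intro: successively_mono sym)
  then show ?thesis
    unfolding pth_def using xs by (intro exI[of _ "rev xs"]) (auto simp: hd_rev last_rev)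
qed

lemma pth_join:
  assumes "pth u v X" "E v u'" "pth u' v' Y" "X \<inter> Y = {}"
  shows "pth u v' (X \<union> Y)"
proof -
  obtain xs where xs: "xs \<noteq> []" "distinct xs" "successively E xs" "hd xs = u" "last xs = v" "set xs = X"
    using assms unfolding pth_def by blast
  obtain ys where ys: "ys \<noteq> []" "distinct ys" "successively E ys" "hd ys = u'" "last ys = v'" "set ys = Y"
    using assms unfolding pth_def by blast
  show ?thesis
    unfolding pth_def using xs ys assms
    by (intro exI[of _ "xs @ ys"]) (auto simp: successively_append_iff)
qed

lemma pth_Cons: "E p x \<Longrightarrow> pth x t X \<Longrightarrow> p \<notin> X \<Longrightarrow> pth p t (insert p X)"
  using pth_join[OF pth_single, of p x t X] by auto

lemma pth_snoc: "pth x t X \<Longrightarrow> E t q \<Longrightarrow> q \<notin> X \<Longrightarrow> pth x q (insert q X)"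
  using pth_join[OF _ _ pth_single, of x t X q] by auto

lemma pth_prefix:
  assumes "pth u v X" "b \<in> X" shows "\<exists>Y\<subseteq>X. pth u b Y"
proof -
  obtain xs where xs: "xs \<noteq> []" "distinct xs" "successively E xs" "hd xs = u" "last xs = v" "set xs = X"
    using assms unfolding pth_def by blast
  obtain ys zs where s: "xs = ys @ b # zs" using xs(6) assms(2) by (metis split_list)
  have "pth (hd (ys @ [b])) (last (ys @ [b])) (set (ys @ [b]))"
    using xs s by (intro pthI) (auto simp: successively_append_iff)
  moreover have "hd (ys @ [b]) = u" using xs(4) s by (cases ys) auto
  moreover have "set (ys @ [b]) \<subseteq> X" using xs(6) s by auto
  ultimately show ?thesis by (intro exI[of _ "set (ys @ [b])"]) simp
qed

lemma pth_seg:
  assumes "i \<le> j" "\<And>l. i \<le> l \<Longrightarrow> l < j \<Longrightarrow> E (P l) (P (Suc l))" "inj_on P {i..j}"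
  shows "pth (P i) (P j) (P ` {i..j})"
  using assms
proof (induction j rule: dec_induct)
  case base
  then show ?case by (simp add: pth_single)
next
  case (step n)
  have "pth (P i) (P n) (P ` {i..n})"
    using step by (intro step.IH) (auto simp: inj_on_def)
  moreover have "P (Suc n) \<notin> P ` {i..n}"
  proof
    assume "P (Suc n) \<in> P ` {i..n}"
    then obtain l where l: "l \<in> {i..n}" "P (Suc n) = P l" by auto
    then have "Suc n = l" using step.hyps by (intro inj_onD[OF step.prems(2)]) auto
    then show False using l by simp
  qed
  ultimately have "pth (P i) (P (Suc n)) (insert (P (Suc n)) (P ` {i..n}))"
    using step by (intro pth_snoc) auto
  then show ?case using step.hyps by (simp add: atLeastAtMostSuc_conv)
qed

text \<open>\<open>Z\<close> collects the ends of the paths from \<open>x\<close> inside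
  \<open>R\<close>; an edge leaving \<open>Z\<close> would extend such a path.\<close>

lemma reach:
  assumes "x \<in> R"
  shows "\<exists>Z\<subseteq>R. x \<in> Z \<and> (\<forall>a\<in>Z. \<forall>b\<in>R - Z. \<not> E a b) \<and> (\<forall>u\<in>Z. \<exists>X\<subseteq>R. pth x u X)"
proof -
  define Z where "Z = {u. \<exists>X\<subseteq>R. pth x u X}"
  have "Z \<subseteq> R" unfolding Z_def using pth_ends by blast
  moreover have "x \<in> Z" unfolding Z_def using assms pth_single by blast
  moreover have "\<not> E a b" if ab: "a \<in> Z" "b \<in> R - Z" for a b
  proof
    assume "E a b"
    obtain X where X: "X \<subseteq> R" "pth x a X" using ab unfolding Z_def by blast
    have nZ: "\<not> pth x b Y" if "Y \<subseteq> R" for Y using ab(2) that unfolding Z_def by auto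
    \<comment> \<open>An edge back to a vertex of the path is no obstacle, since the prefix up to
      that vertex already reaches it.\<close>
    have "b \<notin> X" using pth_prefix[OF X(2), of b] X(1) nZ by (meson order_trans)
    then have "pth x b (insert b X)" using pth_snoc[OF X(2) \<open>E a b\<close>] by simp
    moreover have "insert b X \<subseteq> R" using ab(2) X(1) by simp
    ultimately show False using nZ by simp
  qed
  moreover have "\<forall>u\<in>Z. \<exists>X\<subseteq>R. pth x u X" unfolding Z_def by simp
  ultimately show ?thesis by (intro exI[of _ Z]) simp
qed

text \<open>Take a closed subset of \<open>R\<close> containing \<open>x\<close> of least
  cardinality. A part \<open>L\<close> without edges to the rest would make \<open>L\<close> or
  \<open>K - L\<close> a smaller closed set containing \<open>x\<close>.\<close>

lemma component_exists:
  assumes "finite R" "x \<in> R"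
  shows "\<exists>K\<subseteq>R. x \<in> K \<and> (\<forall>a\<in>K. \<forall>b\<in>R - K. \<not> E a b) \<and> conn K"
proof -
  define F where "F = {K. K \<subseteq> R \<and> x \<in> K \<and> (\<forall>a\<in>K. \<forall>b\<in>R - K. \<not> E a b)}"
  have "R \<in> F" unfolding F_def using assms by auto
  then obtain K where K: "K \<in> F" "\<And>K'. K' \<in> F \<Longrightarrow> card K \<le> card K'"
    using ex_has_least_nat[of "\<lambda>K. K \<in> F" R card] by blast
  have KR: "K \<subseteq> R" "finite K" using K(1) assms unfolding F_def by (auto intro: finite_subset)
  have "conn K"
    unfolding conn_def
  proof (intro allI impI, rule ccontr)
    fix L assume L: "L \<subseteq> K" "L \<noteq> {}" "L \<noteq> K" and no: "\<not> (\<exists>v\<in>L. \<exists>u\<in>K - L. E v u)"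
    show False
    proof (cases "x \<in> L")
      case True
      then have "L \<in> F" using K(1) L(1) no unfolding F_def by blast
      then show False using K(2) L KR by (metis card_seteq)
    next
      case False
      then have "K - L \<in> F" using K(1) L(1) no sym unfolding F_def by blast
      then have "card K \<le> card (K - L)" using K(2) by blast
      moreover have "card (K - L) < card K"
        using L KR by (intro psubset_card_mono) auto
      ultimately show False by simp
    qed
  qed
  then show ?thesis using K(1) unfolding F_def by blast
qed

lemma clique_pth:
  assumes "finite D" "\<And>u v. u \<in> D \<Longrightarrow> v \<in> D \<Longrightarrow> u \<noteq> v \<Longrightarrow> E u v" "a \<in> D" "b \<in> D" "a \<noteq> b"
  shows "pth a b D"
proof -
  have fin: "finite (D - {a, b})" using assms by auto
  then obtain ys where ys: "set ys = D - {a, b}" "distinct ys"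
    using finite_distinct_list[OF fin] by auto
  have "sorted_wrt E xs" if "distinct xs" "set xs \<subseteq> D" for xs
    using that by (induction xs) (auto intro!: assms(2))
  then have "successively E (a # ys @ [b])"
    using ys assms by (intro successively_if_sorted_wrt) auto
  then have "pth a b (set (a # ys @ [b]))"
    using pthI[of "a # ys @ [b]"] ys assms(5) by auto
  moreover have "set (a # ys @ [b]) = D" using ys assms by auto
  ultimately show ?thesis by simp
qed

text \<open>In the applications \<open>D\<close> is a component of the complement of a cycle, \<open>p\<close> is a vertex of that cycle,
  and \<open>f v\<close> is the number of neighbours of \<open>v\<close> on the cycle other than \<open>p\<close>.\<close>

definition linked :: "'a \<Rightarrow> 'a set \<Rightarrow> ('a \<Rightarrow> nat) \<Rightarrow> bool" where
  "linked p D f \<longleftrightarrow> (\<forall>K z. K \<subseteq> D \<longrightarrow> K \<noteq> {} \<longrightarrow> (\<forall>v\<in>K. f v = 0) \<longrightarrow>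
     (\<exists>v\<in>K. \<exists>u\<in>insert p D - K. u \<noteq> z \<and> E v u))"

definition wpath :: "'a \<Rightarrow> 'a set \<Rightarrow> ('a \<Rightarrow> nat) \<Rightarrow> nat \<Rightarrow> bool" where
  "wpath p D f k \<longleftrightarrow> (\<exists>x t X. E p x \<and> pth x t X \<and> X \<subseteq> D \<and> 1 \<le> f t \<and> k \<le> card X + f t)"

lemma linkedD:
  "linked p D f \<Longrightarrow> K \<subseteq> D \<Longrightarrow> K \<noteq> {} \<Longrightarrow> (\<And>v. v \<in> K \<Longrightarrow> f v = 0) \<Longrightarrow>
     \<exists>v\<in>K. \<exists>u\<in>insert p D - K. u \<noteq> z \<and> E v u"
  unfolding linked_def by blast

lemma connD:
  "conn D \<Longrightarrow> K \<subseteq> D \<Longrightarrow> K \<noteq> {} \<Longrightarrow> K \<noteq> D \<Longrightarrow> \<exists>v\<in>K. \<exists>u\<in>D - K. E v u"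
  unfolding conn_def by blast

lemma wpath_mono: "wpath p D f k \<Longrightarrow> j \<le> k \<Longrightarrow> wpath p D f j"
  unfolding wpath_def by (meson order_trans)

lemma wpath_step:
  assumes "wpath p' K f j" "E p p'" "p' \<notin> K" "K \<subseteq> D" "p' \<in> D"
  shows "wpath p D f (Suc j)"
proof -
  obtain x t X where X: "E p' x" "pth x t X" "X \<subseteq> K" "1 \<le> f t" "j \<le> card X + f t"
    using assms(1) unfolding wpath_def by blast
  have "p' \<notin> X" using X assms by auto
  then have "pth p' t (insert p' X)" "card (insert p' X) = Suc (card X)"
    using pth_Cons X pth_finite by auto
  then show ?thesis unfolding wpath_def using X assms
    by (intro exI[of _ p'] exI[of _ t] exI[of _ "insert p' X"]) auto
qed

text \<open>If some weightless part \<open>K\<close> hangs on a single vertex \<open>b\<close> of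
  \<open>D\<close>, it is crossed from \<open>p\<close> to \<open>b\<close> and the path goes on to
  a weighted vertex behind \<open>b\<close>. Otherwise a neighbour \<open>p'\<close> of
  \<open>p\<close> is removed and becomes the new root, which costs at most one in the degrees and
  gains one vertex on the path. The last assumption makes a \<open>w\<close> that is not beside
  \<open>p\<close> weightless, so that no path ends in it.\<close>

lemma weighted_path:
  assumes "finite D" "p \<notin> D" "conn D" "\<exists>v\<in>D. E p v" "linked p D f"
    and "\<And>v. v \<in> D \<Longrightarrow> v \<noteq> w \<Longrightarrow> k \<le> card {u \<in> insert p D. E v u} + f v"
    and "\<not> D \<subseteq> {w}" and "w \<in> D \<Longrightarrow> E p w \<or> f w = 0"
  shows "wpath p D f k \<and> (wpath p D f (Suc k) \<or>
    (\<forall>v\<in>D. v \<noteq> w \<longrightarrow> 1 \<le> f v \<and> f v + card D = k \<and> (\<forall>u\<in>insert p D. u \<noteq> v \<longrightarrow> E v u)))"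
  using assms
proof (induction "card D" arbitrary: D p f k rule: less_induct)
  case less
  note finD = less.prems(1) and pD = less.prems(2) and connDD = less.prems(3) and att = less.prems(4)
    and lnk = less.prems(5) and deg = less.prems(6) and Dw = less.prems(7) and side = less.prems(8)
  \<comment> \<open>\<open>b\<close> is a cut vertex with the weightless part \<open>K\<close>
    behind it. Parts inside \<open>{w}\<close> are excluded because no degree bound would hold
    there.\<close>
  let ?sep = "\<lambda>b K. b \<in> D \<and> K \<subseteq> D - {b} \<and> (\<forall>v\<in>K. f v = 0) \<and> \<not> K \<subseteq> {w} \<and>
     (\<forall>v\<in>K. \<forall>u\<in>D. E v u \<longrightarrow> u \<in> K \<or> u = b)"
  show ?case
  proof (cases "\<exists>b K. ?sep b K")
    case True
    then obtain b K0 where "?sep b K0" by blast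
    then have "\<exists>K. ?sep b K \<and> (\<forall>K'. ?sep b K' \<longrightarrow> card K \<le> card K')"
      by (rule ex_has_least_nat)
    then obtain K where sep: "?sep b K" and minK: "\<And>K'. ?sep b K' \<Longrightarrow> card K \<le> card K'"
      by blast
    have b: "b \<in> D" "b \<notin> K" and KD: "K \<subseteq> D" and f0: "\<And>v. v \<in> K \<Longrightarrow> f v = 0" and Kw: "\<not> K \<subseteq> {w}"
      and cl: "\<And>v u. v \<in> K \<Longrightarrow> u \<in> D \<Longrightarrow> E v u \<Longrightarrow> u \<in> K \<or> u = b"
      using sep by blast+
    have finK: "finite K" using KD finD finite_subset by blast
    have "card K < card D" using finD KD b by (intro psubset_card_mono) auto
    have pb: "p \<noteq> b" "p \<notin> K" using pD b KD by auto
    \<comment> \<open>A cut of \<open>K\<close> would leave a piece not contained in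
      \<open>{w}\<close> that is again separated by \<open>b\<close>, against minimality.\<close>
    have connK: "conn K"
      unfolding conn_def
    proof (intro allI impI, rule ccontr)
      fix L assume L: "L \<subseteq> K" "L \<noteq> {}" "L \<noteq> K" and no: "\<not> (\<exists>v\<in>L. \<exists>u\<in>K - L. E v u)"
      have c1: "\<forall>v\<in>L. \<forall>u\<in>D. E v u \<longrightarrow> u \<in> L \<or> u = b"
        using L(1) no cl by blast
      have c2: "\<forall>v\<in>K - L. \<forall>u\<in>D. E v u \<longrightarrow> u \<in> K - L \<or> u = b"
        using L(1) no cl sym by blast
      have "L \<subset> K" "K - L \<subset> K" using L by auto
      then have lt: "card L < card K" "card (K - L) < card K"
        using finK psubset_card_mono by blast+
      show False
      proof (cases "L \<subseteq> {w}")
        case False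
        have "?sep b L" using c1 sep L False by auto
        then show False using minK[of L] lt by linarith
      next
        case True
        have "?sep b (K - L)" using c2 sep L Kw True by auto
        then show False using minK[of "K - L"] lt by linarith
      qed
    qed
    have nbK: "\<exists>v\<in>K'. \<exists>u\<in>insert p (insert b K) - K'. u \<noteq> z \<and> E v u" if K': "K' \<subseteq> K" "K' \<noteq> {}" for K' z
    proof -
      have "K' \<subseteq> D" "\<And>v. v \<in> K' \<Longrightarrow> f v = 0" using K'(1) KD f0 by auto
      then obtain v u where vu: "v \<in> K'" "u \<in> insert p D - K'" "u \<noteq> z" "E v u"
        using linkedD[OF lnk, of K' z] K'(2) by metis
      then have "u \<in> insert p (insert b K) - K'" using cl that by blast
      then show ?thesis using vu by blast
    qed
    \<comment> \<open>Vertices of \<open>K\<close> are weightless, so their whole degree comes from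
      \<open>K\<close>, \<open>b\<close> and \<open>p\<close>.\<close>
    have dK: "k \<le> card {u \<in> insert p (insert b K). E v u}" if "v \<in> K" "v \<noteq> w" for v
    proof -
      have "{u \<in> insert p D. E v u} \<subseteq> {u \<in> insert p (insert b K). E v u}"
        using cl that by blast
      then have "card {u \<in> insert p D. E v u} \<le> card {u \<in> insert p (insert b K). E v u}"
        using finK by (intro card_mono) auto
      then show ?thesis using deg[of v] f0 that KD by fastforce
    qed
    \<comment> \<open>The induction hypothesis for \<open>K\<close> with root \<open>r\<close>, and
      weight 1 exactly at the neighbours of \<open>s\<close>, yields a path from \<open>r\<close> to
      \<open>s\<close> through at least \<open>k - 1\<close> vertices of \<open>K\<close>.\<close>
    have pth1: "\<exists>x t X. E r x \<and> pth x t X \<and> X \<subseteq> K \<and> E t s \<and> k \<le> Suc (card X)"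
      if rs: "{r, s} = {p, b}" "r \<noteq> s" "w \<in> K \<Longrightarrow> E r w \<or> \<not> E s w" for r s
    proof -
      define g where "g v = (if E v s then 1 else 0 :: nat)" for v
      have ins: "insert p (insert b K) = insert s (insert r K)" using rs by auto
      have rK: "r \<notin> K" "s \<notin> K" using rs pb b by (metis insert_iff singletonD)+
      have "wpath r K g k"
      proof (rule conjunct1[OF less.hyps])
        show "\<exists>v\<in>K. E r v" using nbK[of K s] Kw ins rK sym by blast
        show "linked r K g"
          unfolding linked_def
        proof (intro allI impI)
          fix K' z assume K': "K' \<subseteq> K" "K' \<noteq> {}" "\<forall>v\<in>K'. g v = 0"
          obtain v u where vu: "v \<in> K'" "u \<in> insert p (insert b K) - K'" "u \<noteq> z" "E v u"
            using nbK[of K' z] K' by blast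
          then have "u \<noteq> s" using K'(3) unfolding g_def by auto
          then show "\<exists>v\<in>K'. \<exists>u\<in>insert r K - K'. u \<noteq> z \<and> E v u" using vu ins by blast
        qed
        show "k \<le> card {u \<in> insert r K. E v u} + g v" if "v \<in> K" "v \<noteq> w" for v
        proof -
          have "{u \<in> insert p (insert b K). E v u} = {u \<in> insert r K. E v u} \<union> (if E v s then {s} else {})"
            using ins by auto
          then have "card {u \<in> insert p (insert b K). E v u} \<le> card {u \<in> insert r K. E v u} + card (if E v s then {s} else {})"
            using card_Un_le[of "{u \<in> insert r K. E v u}" "if E v s then {s} else {}"] by simp
          then show ?thesis using dK[OF that] unfolding g_def by (auto split: if_splits)
        qed
        show "w \<in> K \<Longrightarrow> E r w \<or> g w = 0" using rs(3) sym unfolding g_def by auto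
      qed (use \<open>card K < card D\<close> finK rK connK Kw in auto)
      then show ?thesis unfolding wpath_def g_def by (auto split: if_splits)
    qed
    have "\<exists>x t X. E p x \<and> pth x t X \<and> X \<subseteq> K \<and> E t b \<and> k \<le> Suc (card X)"
    \<comment> \<open>If \<open>w\<close> is beside \<open>b\<close> but not beside
      \<open>p\<close>, the side condition holds for the root \<open>b\<close> only; the path is
      then reversed.\<close>
    proof (cases "E p w \<or> \<not> E b w")
      case True then show ?thesis using pth1[of p b] pb by auto
    next
      case False
      then obtain x t X where "E b x" "pth x t X" "X \<subseteq> K" "E t p" "k \<le> Suc (card X)"
        using pth1[of b p] pb by blast
      then show ?thesis using pth_rev sym by blast
    qed
    then obtain x t X where X: "E p x" "pth x t X" "X \<subseteq> K" "E t b" "k \<le> Suc (card X)" by blast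
    obtain Z where Z: "Z \<subseteq> D - K" "b \<in> Z" "\<And>a c. a \<in> Z \<Longrightarrow> c \<in> D - K - Z \<Longrightarrow> \<not> E a c"
      "\<And>u. u \<in> Z \<Longrightarrow> \<exists>X\<subseteq>D - K. pth b u X" using reach[of b "D - K"] b by (metis DiffI)
    \<comment> \<open>Otherwise \<open>Z \<union> K\<close> is weightless, and after deletion of
      \<open>p\<close> it has no exit, against \<open>linked\<close>.\<close>
    have "\<exists>u\<in>Z. 1 \<le> f u"
    proof (rule ccontr)
      assume "\<not> (\<exists>u\<in>Z. 1 \<le> f u)"
      then have "\<exists>v\<in>Z \<union> K. \<exists>u\<in>insert p D - (Z \<union> K). u \<noteq> p \<and> E v u"
        using linkedD[OF lnk, of "Z \<union> K" p] f0 Z(1,2) KD by fastforce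
      then obtain v u where vu: "v \<in> Z \<union> K" "u \<in> D" "u \<notin> Z" "u \<notin> K" "E v u" by blast
      then show False using cl Z(2,3) by blast
    qed
    then obtain u Y where Y: "1 \<le> f u" "Y \<subseteq> D - K" "pth b u Y" using Z(4) by metis
    have dis: "X \<inter> Y = {}" using X Y by auto
    have "pth x u (X \<union> Y)" using pth_join[OF X(2) X(4) Y(3) dis] .
    moreover have "card (X \<union> Y) = card X + card Y" "1 \<le> card Y"
      using dis pth_finite[OF X(2)] pth_finite[OF Y(3)] pth_ends[OF Y(3)]
      by (auto simp: card_Un_disjoint Suc_le_eq card_gt_0_iff)
    \<comment> \<open>\<open>X\<close> contributes at least \<open>k - 1\<close> vertices,
      \<open>Y\<close> at least one, and the final weight is at least one.\<close>
    ultimately have "wpath p D f (Suc k)"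
      unfolding wpath_def using X Y KD
      by (intro exI[of _ x] exI[of _ u] exI[of _ "X \<union> Y"]) auto
    then show ?thesis using wpath_mono by (meson le_SucI order_refl)
  next
    case nosep: False
    \<comment> \<open>A \<open>w\<close> that is not beside \<open>p\<close> is weightless, so
      \<open>linked\<close> gives it a neighbour in \<open>D\<close> other than any prescribed
      \<open>z\<close>.\<close>
    have lonely: False if lon: "w \<in> D" "\<not> E p w" "\<And>u. u \<in> D \<Longrightarrow> E w u \<Longrightarrow> u = z" for z
    proof -
      have "f w = 0" using side that by blast
      then obtain v u where "v \<in> {w}" "u \<in> insert p D - {w}" "u \<noteq> z" "E v u"
        using linkedD[OF lnk, of "{w}" z] lon(1) by (metis empty_subsetI insert_not_empty insert_subset singletonD)
      then have "E w u" "u \<noteq> z" "u \<in> insert p D" by auto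
      then show False using that sym by blast
    qed
    let ?good = "\<lambda>v. 1 \<le> f v \<and> f v + card D = k \<and> (\<forall>u\<in>insert p D. u \<noteq> v \<longrightarrow> E v u)"
    \<comment> \<open>The choice of \<open>p'\<close> prefers \<open>w\<close>. Hence
      \<open>w\<close> stays in \<open>D - {p'}\<close> only if it is not beside \<open>p\<close>,
      and then it has weight 0, which re-establishes the side condition for the new root.\<close>
    have key: "wpath p D f k \<and> (wpath p D f (Suc k) \<or> (\<forall>v\<in>D. v \<noteq> w \<longrightarrow> v \<noteq> p' \<longrightarrow> ?good v))"
      if p': "p' \<in> D" "E p p'" and pw: "w \<in> D \<Longrightarrow> E p w \<Longrightarrow> p' = w" and nw: "\<not> D - {p'} \<subseteq> {w}" for p'
    proof -
      let ?D' = "D - {p'}"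
      have sub: "wpath p' K f j \<and> (wpath p' K f (Suc j) \<or>
          (\<forall>v\<in>K. v \<noteq> w \<longrightarrow> 1 \<le> f v \<and> f v + card K = j \<and> (\<forall>u\<in>insert p' K. u \<noteq> v \<longrightarrow> E v u)))"
        if K: "K \<subseteq> ?D'" "K \<noteq> {}" "conn K" and clK: "\<And>a b. a \<in> K \<Longrightarrow> b \<in> ?D' - K \<Longrightarrow> \<not> E a b"
          and dj: "\<And>v. v \<in> K \<Longrightarrow> v \<noteq> w \<Longrightarrow> j \<le> card {u \<in> insert p' K. E v u} + f v" for K j
      proof (rule less.hyps)
        show "card K < card D" using finD K p' by (intro psubset_card_mono) auto
        show "finite K" using K finD finite_subset by blast
        show "p' \<notin> K" "conn K" using K by auto
        show "\<exists>v\<in>K. E p' v"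
          using connD[OF connDD, of K] K p' clK sym by blast
        have wK: "\<not> E p w" if "w \<in> K" using pw that K by blast
        show "\<not> K \<subseteq> {w}"
        proof
          assume "K \<subseteq> {w}"
          then have "w \<in> K" using K by blast
          then show False using lonely[of p'] wK clK K \<open>K \<subseteq> {w}\<close> irrefl by blast
        qed
        show "w \<in> K \<Longrightarrow> E p' w \<or> f w = 0" using wK side K(1) by auto
        show "j \<le> card {u \<in> insert p' K. E v u} + f v" if "v \<in> K" "v \<noteq> w" for v using dj that .
        \<comment> \<open>A part cut off by a single vertex \<open>z\<close> is excluded by
          \<open>nosep\<close>, unless it is \<open>{w}\<close>, and then by
          \<open>lonely\<close>.\<close>
        show "linked p' K f"
          unfolding linked_def
        proof (intro allI impI, rule ccontr)
          fix L z assume L: "L \<subseteq> K" "L \<noteq> {}" "\<forall>v\<in>L. f v = 0"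
            and no: "\<not> (\<exists>v\<in>L. \<exists>u\<in>insert p' K - L. u \<noteq> z \<and> E v u)"
          have nz: "u \<in> L \<or> u = z" if "v \<in> L" "u \<in> D" "E v u" for u v
            using no that L(1) clK by blast
          have zD: "z \<in> D - L"
          proof (rule ccontr)
            assume "z \<notin> D - L"
            then show False using linkedD[OF lnk, of L p] L K nz by blast
          qed
          have "L \<subseteq> {w}"
          proof (rule ccontr)
            assume "\<not> L \<subseteq> {w}"
            moreover have "L \<subseteq> D - {z}" using zD L(1) K(1) by auto
            ultimately have "?sep z L" using zD L(3) nz by auto
            then have "\<exists>b K. ?sep b K" by (intro exI)
            with nosep show False by (rule notE)
          qed
          then have "L = {w}" using L by blast
          then show False using lonely[of z] nz wK L K irrefl by blast
        qed
      qed
      \<comment> \<open>Moving the root from \<open>p\<close> to \<open>p'\<close> can cost a vertex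
        only the neighbour \<open>p\<close>.\<close>
      have d1: "k - 1 \<le> card {u \<in> insert p' K. E v u} + f v"
        if "K \<subseteq> ?D'" "\<And>a b. a \<in> K \<Longrightarrow> b \<in> ?D' - K \<Longrightarrow> \<not> E a b" "v \<in> K" "v \<noteq> w" for K v
      proof -
        have fin: "finite {u \<in> insert p' K. E v u}" using that(1) finD by (auto intro: finite_subset)
        have "{u \<in> insert p D. E v u} \<subseteq> insert p {u \<in> insert p' K. E v u}" using that by blast
        then have "card {u \<in> insert p D. E v u} \<le> card (insert p {u \<in> insert p' K. E v u})"
          using fin by (intro card_mono) auto
        also have "\<dots> \<le> Suc (card {u \<in> insert p' K. E v u})" by (simp add: card_insert_le_m1)
        finally show ?thesis using deg[of v] that by fastforce
      qed
      show ?thesis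
      proof (cases "conn ?D'")
        case True
        have ne: "?D' \<noteq> {}" using nw by blast
        have S: "wpath p' ?D' f (k - 1) \<and> (wpath p' ?D' f (Suc (k - 1)) \<or>
          (\<forall>v\<in>?D'. v \<noteq> w \<longrightarrow> 1 \<le> f v \<and> f v + card ?D' = k - 1 \<and> (\<forall>u\<in>insert p' ?D'. u \<noteq> v \<longrightarrow> E v u)))"
        proof (rule sub)
          show "k - 1 \<le> card {u \<in> insert p' ?D'. E v u} + f v" if "v \<in> ?D'" "v \<noteq> w" for v
            using d1[of ?D' v] that by simp
        qed (use True ne in auto)
        have st: "wpath p' ?D' f j \<Longrightarrow> wpath p D f (Suc j)" for j
          using wpath_step[of p' ?D' f j p D] p' by blast
        have cD: "card D = Suc (card ?D')" using card.remove[OF finD p'(1)] .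
        have one: "wpath p D f k" using wpath_mono[OF st[OF conjunct1[OF S]], of k] by simp
        show ?thesis
        proof (cases "wpath p' ?D' f (Suc (k - 1))")
          case True
          then have "wpath p D f (Suc k)" using wpath_mono[OF st[OF True], of "Suc k"] by simp
          then show ?thesis using one by blast
        next
          case False
          have "?good v" if v: "v \<in> D" "v \<noteq> w" "v \<noteq> p'" for v
          proof -
            have g: "1 \<le> f v" "f v + card ?D' = k - 1" "\<And>u. u \<in> D \<Longrightarrow> u \<noteq> v \<Longrightarrow> E v u"
              using S False v by blast+
            \<comment> \<open>Without \<open>p\<close>, the vertex \<open>v\<close> has at most
              \<open>card (D - {p'})\<close> neighbours in \<open>insert p D\<close>; together with
              \<open>f v\<close> these are only \<open>k - 1\<close>.\<close>
            have "E v p"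
            proof (rule ccontr)
              assume "\<not> E v p"
              then have "{u \<in> insert p D. E v u} \<subseteq> D - {v}" using irrefl by blast
              then have "card {u \<in> insert p D. E v u} \<le> card (D - {v})" using finD by (intro card_mono) auto
              also have "\<dots> = card ?D'" using v p' finD by simp
              finally show False using deg[of v] v g by fastforce
            qed
            then show ?thesis using g cD by auto
          qed
          then show ?thesis using one by blast
        qed
      next
        case False
        then have big: "wpath p D f (Suc k)"
        proof -
          have neD: "\<And>K. conn K \<Longrightarrow> K \<noteq> ?D'" using False by blast
          \<comment> \<open>The path first visits a component other than \<open>K\<close>, passes
            \<open>p'\<close> and then enters \<open>K\<close>. The detour supplies at least one
            vertex beyond \<open>p'\<close> and the \<open>k - 1\<close> from the induction.\<close>
          have route: "wpath p D f (Suc k)"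
            if K: "K \<subseteq> ?D'" "K \<noteq> {}" "conn K" and clK: "\<And>a b. a \<in> K \<Longrightarrow> b \<in> ?D' - K \<Longrightarrow> \<not> E a b"
              and x: "x \<in> ?D' - K" "E p x" for K x
          proof -
            have "wpath p' K f (k - 1)" using sub[of K "k - 1"] K clK d1[of K] by blast
            then obtain y t Y where Y: "E p' y" "pth y t Y" "Y \<subseteq> K" "1 \<le> f t" "k - 1 \<le> card Y + f t"
              unfolding wpath_def by blast
            obtain Z where Z: "Z \<subseteq> ?D' - K" "x \<in> Z" "\<And>a c. a \<in> Z \<Longrightarrow> c \<in> ?D' - K - Z \<Longrightarrow> \<not> E a c"
              "\<And>u. u \<in> Z \<Longrightarrow> \<exists>X\<subseteq>?D' - K. pth x u X" using reach[OF x(1)] by metis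
            have "\<exists>v\<in>Z. \<exists>u\<in>D - Z. E v u" using connD[OF connDD, of Z] Z(1,2) p' by blast
            then obtain z where z: "z \<in> Z" "E z p'" using Z(1,3) clK sym by blast
            obtain X where X: "X \<subseteq> ?D' - K" "pth x z X" using Z(4) z by blast
            have yn: "p' \<notin> Y" "p' \<notin> X" "X \<inter> insert p' Y = {}" using X Y K by auto
            have "pth x t (X \<union> insert p' Y)"
              using pth_join[OF X(2) z(2) pth_Cons[OF Y(1,2) yn(1)] yn(3)] .
            moreover have "card (X \<union> insert p' Y) = card X + Suc (card Y)" "1 \<le> card X"
              using yn pth_finite[OF X(2)] pth_finite[OF Y(2)] pth_ends[OF X(2)]
              by (auto simp: card_Un_disjoint Suc_le_eq card_gt_0_iff)
            moreover have "X \<union> insert p' Y \<subseteq> D" using X Y K p' by auto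
            ultimately show ?thesis unfolding wpath_def using Y x
              by (intro exI[of _ x] exI[of _ t] exI[of _ "X \<union> insert p' Y"]) auto
          qed
          obtain x0 where "x0 \<in> ?D'" using nw by blast
          then obtain K where K: "K \<subseteq> ?D'" "K \<noteq> {}" "conn K" "\<And>a b. a \<in> K \<Longrightarrow> b \<in> ?D' - K \<Longrightarrow> \<not> E a b"
            using component_exists[of ?D' x0] finD by blast
          show ?thesis
          proof (cases "\<exists>x\<in>?D' - K. E p x")
            case True then show ?thesis using route K by blast
          next
            case noK: False
            obtain x1 where "x1 \<in> ?D' - K" using neD K(1,3) by blast
            then obtain L where L: "L \<subseteq> ?D' - K" "L \<noteq> {}" "conn L" "\<And>a b. a \<in> L \<Longrightarrow> b \<in> ?D' - K - L \<Longrightarrow> \<not> E a b"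
              using component_exists[of "?D' - K" x1] finD by (metis empty_iff finite_Diff)
            have L4: "\<And>a b. a \<in> L \<Longrightarrow> b \<in> ?D' - L \<Longrightarrow> \<not> E a b" using L(1,4) K(4) sym by blast
            show ?thesis
            proof (cases "\<exists>x\<in>?D' - L. E p x")
              case True then show ?thesis using route[of L] L L4 by blast
            next
              case False
              then have nop: "\<And>x. x \<in> ?D' \<Longrightarrow> \<not> E p x" using noK L by blast
              \<comment> \<open>With no neighbour of \<open>p\<close> in \<open>D - {p'}\<close>,
                moving the root costs no degree, so the induction runs with \<open>k\<close> instead
                of \<open>k - 1\<close>.\<close>
              have "k \<le> card {u \<in> insert p' K. E v u} + f v" if "v \<in> K" "v \<noteq> w" for v
              proof -
                have "{u \<in> insert p D. E v u} \<subseteq> {u \<in> insert p' K. E v u}"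
                  using that nop K sym by blast
                then have "card {u \<in> insert p D. E v u} \<le> card {u \<in> insert p' K. E v u}"
                  using K(1) finD by (intro card_mono) (auto intro: finite_subset)
                then show ?thesis using deg[of v] that K by fastforce
              qed
              then have "wpath p' K f k" using sub[of K k] K by blast
              then show ?thesis using wpath_step[of p' K f k p D] p' K by blast
            qed
          qed
        qed
        then show ?thesis using wpath_mono by (meson le_SucI order_refl)
      qed
    qed
    obtain p' where p': "p' \<in> D" "E p p'" "w \<in> D \<Longrightarrow> E p w \<Longrightarrow> p' = w" using att by blast
    show ?thesis
    proof (cases "D - {p'} \<subseteq> {w}")
      case False
      note K1 = key[OF p' this]
      show ?thesis
      proof (cases "wpath p D f (Suc k) \<or> p' = w")
        case True then show ?thesis using K1 by blast
      next
        case F2: False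
        then have g: "\<forall>v\<in>D. v \<noteq> w \<longrightarrow> v \<noteq> p' \<longrightarrow> ?good v" using K1 by blast
        \<comment> \<open>\<open>key\<close> says nothing about the removed vertex \<open>p'\<close>
          itself; a second round that removes \<open>v\<close> instead covers it.\<close>
        obtain v where v: "v \<in> D" "v \<noteq> p'" "v \<noteq> w" using False by blast
        then have "?good v" using g by simp
        then have "E v p" using pD v(1) by auto
        then have "E p v" by (rule sym)
        moreover have "\<not> (w \<in> D \<and> E p w)" using p'(3) F2 by blast
        moreover have "\<not> D - {v} \<subseteq> {w}" using p' F2 v by blast
        ultimately have "\<forall>v'\<in>D. v' \<noteq> w \<longrightarrow> v' \<noteq> v \<longrightarrow> ?good v'" using key[of v] v F2 by blast
        then show ?thesis using g K1 v by blast
      qed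
    next
      case True
      have p'w: "p' \<noteq> w" using True Dw by blast
      have "D = {p'}"
      proof (rule ccontr)
        assume "D \<noteq> {p'}"
        then have wD: "w \<in> D" using True p' by blast
        then have "\<not> E p w" using p' p'w by blast
        then show False using lonely[of p'] wD True irrefl by blast
      qed
      have "{u \<in> insert p D. E p' u} = {p}" using \<open>D = {p'}\<close> p' sym irrefl by auto
      then have kf: "k \<le> 1 + f p'" using deg[of p'] p'w p' by auto
      have f1: "1 \<le> f p'" using linkedD[OF lnk, of D p] \<open>D = {p'}\<close> by fastforce
      have wp: "wpath p D f (1 + f p')"
        unfolding wpath_def using p' pth_single[of p'] f1 by fastforce
      have nb: "\<And>u. u \<in> insert p D \<Longrightarrow> u \<noteq> p' \<Longrightarrow> E p' u" using \<open>D = {p'}\<close> p' sym by blast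
      show ?thesis
      proof (cases "k = 1 + f p'")
        case True
        then show ?thesis using wp f1 nb \<open>D = {p'}\<close> by auto
      next
        case False
        then have "Suc k \<le> 1 + f p'" using kf by simp
        then show ?thesis using wp wpath_mono kf by blast
      qed
    qed
  qed
qed

end

section \<open>Cycles\<close>

lemma spread:
  fixes A :: "nat set"
  assumes "finite A" "A \<noteq> {}" "\<And>i j. i \<in> A \<Longrightarrow> j \<in> A \<Longrightarrow> i < j \<Longrightarrow> i + d \<le> j"
  shows "\<exists>a b. a \<in> A \<and> b \<in> A \<and> a + d * (card A - 1) \<le> b"
  using assms
proof (induction "card A" arbitrary: A)
  case 0
  then show ?case by simp
next
  case (Suc n)
  show ?case
  proof (cases "n = 0")
    case True
    obtain a where "a \<in> A" using Suc.prems by blast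
    then show ?thesis using Suc.hyps(2) True by (intro exI[of _ a]) auto
  next
    case False
    let ?M = "Max A"
    have M: "?M \<in> A" "finite A" using Suc.prems by auto
    have cB: "card (A - {?M}) = n" using Suc.hyps(2) M by simp
    then have "A - {?M} \<noteq> {}" using False by force
    then obtain a b where ab: "a \<in> A - {?M}" "b \<in> A - {?M}" "a + d * (n - 1) \<le> b"
      using Suc.hyps(1)[of "A - {?M}"] cB Suc.prems by (metis DiffD1 finite_Diff)
    have "b < ?M" using ab M by (metis Diff_iff Max_ge le_neq_implies_less singletonI)
    then have "b + d \<le> ?M" using Suc.prems(3) ab M by blast
    then have "a + d * n \<le> ?M" using ab False by (cases n) auto
    then show ?thesis using ab M Suc.hyps(2) by (metis DiffD1 diff_Suc_1)
  qed
qed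

context sgraph
begin

text \<open>Cycles are numbered for arguments about gaps; \<open>cycset\<close> forgets the
  numbering and keeps the vertex set.\<close>

definition cyc :: "(nat \<Rightarrow> 'a) \<Rightarrow> nat \<Rightarrow> bool" where
  "cyc P c \<longleftrightarrow> 3 \<le> c \<and> inj_on P {..<c} \<and> (\<forall>i. Suc i < c \<longrightarrow> E (P i) (P (Suc i))) \<and> E (P (c - 1)) (P 0)"

definition cycset :: "'a set \<Rightarrow> bool" where
  "cycset Y \<longleftrightarrow> (\<exists>u v. pth u v Y \<and> E u v \<and> 3 \<le> card Y)"

lemma cycsetI: "pth u v Y \<Longrightarrow> E v u \<Longrightarrow> 3 \<le> card Y \<Longrightarrow> cycset Y"
  unfolding cycset_def using sym by blast

lemma cycset_finite: "cycset Y \<Longrightarrow> finite Y"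
  unfolding cycset_def using pth_finite by blast

lemma cyc_inj: "cyc P c \<Longrightarrow> i < c \<Longrightarrow> j < c \<Longrightarrow> P i = P j \<longleftrightarrow> i = j"
  unfolding cyc_def by (auto dest: inj_onD)

lemma cyc_card: "cyc P c \<Longrightarrow> A \<subseteq> {..<c} \<Longrightarrow> card (P ` A) = card A"
  unfolding cyc_def by (meson card_image inj_on_subset)

lemma cyc_edge: "cyc P c \<Longrightarrow> Suc i < c \<Longrightarrow> E (P i) (P (Suc i))"
  unfolding cyc_def by blast

lemma cyc_close: "cyc P c \<Longrightarrow> E (P (c - 1)) (P 0)"
  unfolding cyc_def by blast

lemma cyc_seg: "cyc P c \<Longrightarrow> i \<le> j \<Longrightarrow> j < c \<Longrightarrow> pth (P i) (P j) (P ` {i..j})"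
  unfolding cyc_def by (intro pth_seg) (auto simp: inj_on_def)

lemma cyc_cycset: "cyc P c \<Longrightarrow> cycset (P ` {..<c})"
proof -
  assume C: "cyc P c"
  then have c: "3 \<le> c" unfolding cyc_def by blast
  have "{0..c - 1} = {..<c}" using c by auto
  moreover have "pth (P 0) (P (c - 1)) (P ` {0..c - 1})" using c by (intro cyc_seg[OF C]) auto
  ultimately show ?thesis
    using cyc_close[OF C] cyc_card[OF C, of "{..<c}"] c by (intro cycsetI) auto
qed

lemma cyc_outer:
  assumes "cyc P c" "i < j" "j < c"
  shows "pth (P j) (P i) (P ` ({..i} \<union> {j..<c}))"
proof -
  have e: "{j..c - 1} = {j..<c}" "{0..i} = {..i}" using assms by auto
  have "P ` {j..c - 1} \<inter> P ` {0..i} = {}" using assms cyc_inj[OF assms(1)] by fastforce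
  then have "pth (P j) (P i) (P ` {j..c - 1} \<union> P ` {0..i})"
    using assms cyc_close[OF assms(1)] by (intro pth_join[OF cyc_seg[OF assms(1)] _ cyc_seg[OF assms(1)]]) auto
  then show ?thesis using e by (simp add: image_Un Un_commute)
qed

lemma cycset_cyc:
  assumes "cycset Y"
  shows "\<exists>P. cyc P (card Y) \<and> P ` {..<card Y} = Y"
proof -
  obtain u v where uv: "pth u v Y" "E u v" "3 \<le> card Y" using assms unfolding cycset_def by blast
  obtain xs where xs: "xs \<noteq> []" "distinct xs" "successively E xs" "hd xs = u" "last xs = v" "set xs = Y"
    using uv(1) unfolding pth_def by blast
  have l: "length xs = card Y" using distinct_card[OF xs(2)] xs(6) by simp
  have "cyc (nth xs) (card Y)"
    unfolding cyc_def
  proof (intro conjI allI impI)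
    show "inj_on ((!) xs) {..<card Y}" using l xs(2) by (auto simp: inj_on_def nth_eq_iff_index_eq)
    show "E (xs ! i) (xs ! Suc i)" if "Suc i < card Y" for i using xs(3) l that by (simp add: successively_nth)
    show "E (xs ! (card Y - 1)) (xs ! 0)" 
    proof -
      have "xs ! (card Y - 1) = v" "xs ! 0 = u" using xs(1,4,5) l by (auto simp: hd_conv_nth last_conv_nth)
      then show ?thesis using uv(2) sym by simp
    qed
  qed (rule uv)
  moreover have "(!) xs ` {..<card Y} = Y" using xs(6) l by (auto simp: set_conv_nth)
  ultimately show ?thesis by blast
qed

lemma cyc_rotate:
  assumes "cyc P c" "r < c"
  shows "cyc (\<lambda>i. P ((i + r) mod c)) c" "(\<lambda>i. P ((i + r) mod c)) ` {..<c} = P ` {..<c}"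
proof -
  have c: "3 \<le> c" "inj_on P {..<c}" using assms unfolding cyc_def by blast+
  have inj: "inj_on (\<lambda>i. (i + r) mod c) {..<c}"
  proof (rule inj_onI)
    fix i j assume ij: "i \<in> {..<c}" "j \<in> {..<c}" "(i + r) mod c = (j + r) mod c"
    have "(a + r) mod c = (if a + r < c then a + r else a + r - c)" if "a < c" for a
      using that assms(2) by (simp add: le_mod_geq)
    then show "i = j" using ij assms(2) by (auto split: if_splits)
  qed
  have img: "(\<lambda>i. (i + r) mod c) ` {..<c} = {..<c}"
    using c by (intro endo_inj_surj[OF _ _ inj]) auto
  show "(\<lambda>i. P ((i + r) mod c)) ` {..<c} = P ` {..<c}"
    using img by (metis image_image)
  have st: "E (P (a mod c)) (P (Suc a mod c))" for a
  proof (cases "Suc (a mod c) < c")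
    case True
    then have "Suc a mod c = Suc (a mod c)" by (simp add: mod_Suc)
    then show ?thesis using cyc_edge[OF assms(1) True] by simp
  next
    case False
    then have "a mod c = c - 1" using c by (metis One_nat_def Suc_diff_Suc Suc_lessI diff_Suc_1 less_le_trans mod_less_divisor zero_less_numeral)
    moreover have "Suc a mod c = 0" using False c by (metis Suc_lessI less_le_trans mod_Suc mod_less_divisor zero_less_numeral)
    ultimately show ?thesis using cyc_close[OF assms(1)] by simp
  qed
  show "cyc (\<lambda>i. P ((i + r) mod c)) c"
    unfolding cyc_def
  proof (intro conjI allI impI)
    show "inj_on (\<lambda>i. P ((i + r) mod c)) {..<c}"
      using comp_inj_on[OF inj] c(2) img unfolding comp_def by auto
    show "E (P ((i + r) mod c)) (P ((Suc i + r) mod c))" for i using st[of "i + r"] by simp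
    have "Suc (c - 1 + r) mod c = (0 + r) mod c" using c by simp
    then show "E (P ((c - 1 + r) mod c)) (P ((0 + r) mod c))" using st[of "c - 1 + r"] by metis
  qed (use c in auto)
qed

lemma cyc_cong:
  assumes "cyc P c" "\<And>i. i < c \<Longrightarrow> P i = Q i"
  shows "cyc Q c"
proof -
  have "inj_on Q {..<c}"
    using assms unfolding cyc_def by (metis inj_on_cong lessThan_iff)
  then show ?thesis using assms unfolding cyc_def by auto
qed

lemma cyc_reverse:
  assumes "cyc P c"
  shows "cyc (\<lambda>i. P (c - 1 - i)) c" "(\<lambda>i. P (c - 1 - i)) ` {..<c} = P ` {..<c}"
proof -
  have c: "3 \<le> c" "inj_on P {..<c}" using assms unfolding cyc_def by blast+
  have "(\<lambda>i. c - 1 - i) ` {..<c} = {..<c}"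
  proof (rule endo_inj_surj)
    show "inj_on (\<lambda>i. c - 1 - i) {..<c}" by (auto simp: inj_on_def)
  qed auto
  then show "(\<lambda>i. P (c - 1 - i)) ` {..<c} = P ` {..<c}" by (metis image_image)
  show "cyc (\<lambda>i. P (c - 1 - i)) c"
    unfolding cyc_def
  proof (intro conjI allI impI)
    show "inj_on (\<lambda>i. P (c - 1 - i)) {..<c}"
    proof (rule inj_onI)
      fix i j assume "i \<in> {..<c}" "j \<in> {..<c}" "P (c - 1 - i) = P (c - 1 - j)"
      then show "i = j" using cyc_inj[OF assms, of "c - 1 - i" "c - 1 - j"] by auto
    qed
    show "E (P (c - 1 - i)) (P (c - 1 - Suc i))" if "Suc i < c" for i
      using cyc_edge[OF assms, of "c - 1 - Suc i"] that sym by (simp add: Suc_diff_Suc)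
    show "E (P (c - 1 - (c - 1))) (P (c - 1 - 0))" using cyc_close[OF assms] sym by simp
  qed (use c in auto)
qed

lemma cyc_reflect:
  assumes "cyc P c"
  shows "cyc (\<lambda>i. P ((c - i) mod c)) c" "(\<lambda>i. P ((c - i) mod c)) ` {..<c} = P ` {..<c}"
proof -
  have c: "3 \<le> c" using assms unfolding cyc_def by blast
  let ?Q = "\<lambda>i. P ((i + 1) mod c)"
  have Q: "cyc ?Q c" "?Q ` {..<c} = P ` {..<c}" using cyc_rotate[OF assms, of 1] c by auto
  have eq: "?Q (c - 1 - i) = P ((c - i) mod c)" if "i < c" for i
  proof -
    have "c - 1 - i + 1 = c - i" using that by simp
    then show ?thesis by (simp only:)
  qed
  have R: "cyc (\<lambda>i. ?Q (c - 1 - i)) c" "(\<lambda>i. ?Q (c - 1 - i)) ` {..<c} = P ` {..<c}"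
    using cyc_reverse[OF Q(1)] Q(2) by auto
  show "(\<lambda>i. P ((c - i) mod c)) ` {..<c} = P ` {..<c}" using R(2) eq by (metis (no_types, lifting) image_cong lessThan_iff)
  show "cyc (\<lambda>i. P ((c - i) mod c)) c"
    using cyc_cong[OF R(1)] eq by simp
qed

lemma cycset_at:
  assumes "cycset Y" "p \<in> Y"
  shows "\<exists>P. cyc P (card Y) \<and> P ` {..<card Y} = Y \<and> P 0 = p"
proof -
  obtain P where P: "cyc P (card Y)" "P ` {..<card Y} = Y" using cycset_cyc[OF assms(1)] by blast
  then obtain r where r: "r < card Y" "P r = p" using assms(2) by (metis imageE lessThan_iff)
  show ?thesis using cyc_rotate[OF P(1) r(1)] P(2) r
    by (intro exI[of _ "\<lambda>i. P ((i + r) mod card Y)"]) auto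
qed

text \<open>An ear closes a cycle with either of the two arcs between its feet: here with the arc of
  positions from \<open>i\<close> to \<open>j\<close>, in \<open>ear_out\<close> with the one
  through the closing edge.\<close>

lemma ear_in:
  assumes "cyc P c" "i < j" "j < c" "pth x t X" "X \<inter> P ` {..<c} = {}" "E (P i) x" "E t (P j)"
  shows "cycset (X \<union> P ` {i..j})" "card (X \<union> P ` {i..j}) = card X + (j - i + 1)"
proof -
  have fin: "finite X" "x \<in> X" using pth_finite pth_ends assms(4) by blast+
  have dis: "X \<inter> P ` {i..j} = {}" using assms(3,5) by fastforce
  show cd: "card (X \<union> P ` {i..j}) = card X + (j - i + 1)"
  proof -
    have "card (P ` {i..j}) = card {i..j}" using assms(3) by (intro cyc_card[OF assms(1)]) auto
    then show ?thesis using dis fin(1) assms(2) by (simp add: card_Un_disjoint)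
  qed
  have X1: "1 \<le> card X" using fin by (simp add: Suc_le_eq card_gt_0_iff) blast
  have "pth x (P i) (X \<union> P ` {i..j})"
    using assms dis by (intro pth_join[OF assms(4) _ pth_rev[OF cyc_seg[OF assms(1)]]]) auto
  then show "cycset (X \<union> P ` {i..j})" using assms cd X1 by (intro cycsetI) auto
qed

lemma ear_out:
  assumes "cyc P c" "i < j" "j < c" "pth x t X" "X \<inter> P ` {..<c} = {}" "E (P i) x" "E t (P j)"
  shows "cycset (X \<union> P ` ({..i} \<union> {j..<c}))"
    "card (X \<union> P ` ({..i} \<union> {j..<c})) + j = card X + c + i + 1"
proof -
  have fin: "finite X" "x \<in> X" using pth_finite pth_ends assms(4) by blast+
  have dis: "X \<inter> P ` ({..i} \<union> {j..<c}) = {}" using assms(2,3,5) by fastforce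
  have "card ({..i} \<union> {j..<c}) = i + 1 + (c - j)"
    using assms(2) by (subst card_Un_disjoint) auto
  then show cd: "card (X \<union> P ` ({..i} \<union> {j..<c})) + j = card X + c + i + 1"
  proof -
    have "card (P ` ({..i} \<union> {j..<c})) = card ({..i} \<union> {j..<c})"
      using assms(2,3) by (intro cyc_card[OF assms(1)]) auto
    then show ?thesis using dis fin(1) assms(2,3) \<open>card ({..i} \<union> {j..<c}) = i + 1 + (c - j)\<close>
      by (subst card_Un_disjoint) auto
  qed
  have X1: "1 \<le> card X" using fin by (simp add: Suc_le_eq card_gt_0_iff) blast
  have "pth x (P i) (X \<union> P ` ({..i} \<union> {j..<c}))"
    using assms dis by (intro pth_join[OF assms(4) _ cyc_outer[OF assms(1)]]) auto
  then show "cycset (X \<union> P ` ({..i} \<union> {j..<c}))" using assms cd X1 by (intro cycsetI) auto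
qed

text \<open>The standard crossing argument: two successors of attachments of an ear are non-adjacent
  on a longest cycle.\<close>

lemma cross_succ:
  assumes "cyc P c" "i < j" "j < c" "pth x t X" "X \<inter> P ` {..<c} = {}" "E (P i) x" "E t (P j)"
    and "E (P (Suc i)) (P (Suc j mod c))"
  shows "cycset (X \<union> P ` {..<c})"
proof -
  have fin: "finite X" using pth_finite assms(4) by blast
  have "card (X \<union> P ` {..<c}) \<ge> card (P ` {..<c})" using fin by (intro card_mono) auto
  then have c3: "3 \<le> card (X \<union> P ` {..<c})"
    using cyc_card[OF assms(1), of "{..<c}"] assms(1) unfolding cyc_def by simp
  have s1: "pth (P (Suc i)) (P j) (P ` {Suc i..j})" using assms by (intro cyc_seg) auto
  have d1: "P ` {Suc i..j} \<inter> X = {}" using assms(3,5) by fastforce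
  have a: "pth (P (Suc i)) x (P ` {Suc i..j} \<union> X)"
    using pth_join[OF s1 sym[OF assms(7)] pth_rev[OF assms(4)] d1] .
  show ?thesis
  proof (cases "Suc j = c")
    case True
    have s2: "pth (P i) (P 0) (P ` {0..i})" using assms by (intro pth_rev[OF cyc_seg[OF assms(1)]]) auto
    have d2: "(P ` {Suc i..j} \<union> X) \<inter> P ` {0..i} = {}"
      using assms(2,3,5) cyc_inj[OF assms(1)] by fastforce
    have "pth (P (Suc i)) (P 0) (P ` {Suc i..j} \<union> X \<union> P ` {0..i})"
      using pth_join[OF a sym[OF assms(6)] s2 d2] .
    moreover have "P ` {Suc i..j} \<union> X \<union> P ` {0..i} = X \<union> P ` {..<c}"
    proof -
      have "{Suc i..j} \<union> {0..i} = {..<c}" using True assms(2) by auto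
      then show ?thesis by (metis Un_assoc Un_commute image_Un)
    qed
    ultimately have "pth (P (Suc i)) (P 0) (X \<union> P ` {..<c})" by simp
    moreover have "E (P 0) (P (Suc i))" using assms(8) True sym by simp
    ultimately show ?thesis using c3 by (rule cycsetI)
  next
    case False
    then have j: "Suc j < c" using assms by simp
    have s2: "pth (P i) (P (Suc j)) (P ` ({..i} \<union> {Suc j..<c}))"
      using assms j by (intro pth_rev[OF cyc_outer[OF assms(1)]]) auto
    have d2: "(P ` {Suc i..j} \<union> X) \<inter> P ` ({..i} \<union> {Suc j..<c}) = {}"
      using assms(2,3,5) cyc_inj[OF assms(1)] by fastforce
    have "pth (P (Suc i)) (P (Suc j)) (P ` {Suc i..j} \<union> X \<union> P ` ({..i} \<union> {Suc j..<c}))"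
      using pth_join[OF a sym[OF assms(6)] s2 d2] .
    moreover have "P ` {Suc i..j} \<union> X \<union> P ` ({..i} \<union> {Suc j..<c}) = X \<union> P ` {..<c}"
    proof -
      have "{Suc i..j} \<union> ({..i} \<union> {Suc j..<c}) = {..<c}" using j assms(2) by auto
      then show ?thesis by (metis Un_assoc Un_commute image_Un)
    qed
    ultimately have "pth (P (Suc i)) (P (Suc j)) (X \<union> P ` {..<c})" by simp
    moreover have "E (P (Suc j)) (P (Suc i))" using assms(8) j sym by simp
    ultimately show ?thesis using c3 by (rule cycsetI)
  qed
qed

text \<open>Mirror image of \<open>cross_succ\<close>: reversing the numbering turns predecessors
  into successors.\<close>

lemma cross_pred:
  assumes "cyc P c" "0 < i" "i < j" "j < c" "pth x t X" "X \<inter> P ` {..<c} = {}" "E (P i) x" "E t (P j)"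
    and "E (P (i - 1)) (P (j - 1))"
  shows "cycset (X \<union> P ` {..<c})"
proof -
  let ?Q = "\<lambda>i. P (c - 1 - i)"
  have Q: "cyc ?Q c" "?Q ` {..<c} = P ` {..<c}" using cyc_reverse[OF assms(1)] by auto
  have "cycset (X \<union> ?Q ` {..<c})"
  proof (rule cross_succ[OF Q(1), of "c - 1 - j" "c - 1 - i" t x X])
    show "pth t x X" using assms pth_rev by blast
    show "E (?Q (Suc (c - 1 - j))) (?Q (Suc (c - 1 - i) mod c))"
    proof -
      have "Suc (c - 1 - i) mod c = c - i" "c - 1 - (c - i) = i - 1" "c - 1 - Suc (c - 1 - j) = j - 1"
        using assms(2-4) by auto
      then show ?thesis using assms(9) sym by simp
    qed
    have e: "c - 1 - (c - 1 - i) = i" "c - 1 - (c - 1 - j) = j" using assms(3,4) by auto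
    show "E (?Q (c - 1 - j)) t" "E x (?Q (c - 1 - i))"
      using e sym[OF assms(7)] sym[OF assms(8)] by simp_all
    show "c - 1 - j < c - 1 - i" "c - 1 - i < c" using assms(2-4) by auto
    show "X \<inter> ?Q ` {..<c} = {}" using assms(6) Q(2) by simp
  qed
  then show ?thesis using Q(2) by simp
qed

definition isComp :: "'a set \<Rightarrow> 'a set \<Rightarrow> 'a set \<Rightarrow> bool" where
  "isComp V Y D \<longleftrightarrow> D \<noteq> {} \<and> D \<subseteq> V - Y \<and> conn D \<and> (\<forall>v\<in>D. \<forall>u. E v u \<longrightarrow> u \<in> D \<or> u \<in> Y)"

definition att :: "'a set \<Rightarrow> 'a set \<Rightarrow> 'a set" where
  "att Y D = {s \<in> Y. \<exists>v\<in>D. E v s}"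

end

section \<open>Components outside a longest cycle\<close>

text \<open>\<open>w\<close> is the vertex whose degree may be below \<open>k\<close>, and assumption \<open>two\<close> expresses 2-connectedness:
  no single vertex \<open>z\<close> separates \<open>K\<close> from the rest.\<close>

locale degree_graph = sgraph E for E :: "'a \<Rightarrow> 'a \<Rightarrow> bool" +
  fixes V :: "'a set" and k :: nat and w :: 'a
  assumes finV: "finite V" and EV: "E u v \<Longrightarrow> u \<in> V" and V3: "3 \<le> card V"
    and two: "K \<subseteq> V \<Longrightarrow> K \<noteq> {} \<Longrightarrow> (\<And>v u. v \<in> K \<Longrightarrow> E v u \<Longrightarrow> u \<in> K \<or> u = z) \<Longrightarrow> V \<subseteq> insert z K"
    and deg: "v \<in> V \<Longrightarrow> v \<noteq> w \<Longrightarrow> k \<le> card {u. E v u}" and k2: "2 \<le> k"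
begin

abbreviation "cpt \<equiv> isComp V"

text \<open>The weight \<open>f\<close> of the weighted path lemma, for the cycle on \<open>Y\<close> and the starting vertex \<open>p\<close>.\<close>

definition nf :: "'a set \<Rightarrow> 'a \<Rightarrow> 'a \<Rightarrow> nat" where
  "nf Y p v = card {u \<in> Y - {p}. E v u}"

lemma pos_card0:
  assumes "cyc P c" "S \<subseteq> P ` {..<c}"
  shows "card {i \<in> {..<c}. P i \<in> S} = card S"
proof -
  have "P ` {i \<in> {..<c}. P i \<in> S} = S" using assms(2) by blast
  moreover have "card (P ` {i \<in> {..<c}. P i \<in> S}) = card {i \<in> {..<c}. P i \<in> S}"
    by (intro cyc_card[OF assms(1)]) auto
  ultimately show ?thesis by simp
qed

lemma pos_card:
  assumes "cyc P c" "S \<subseteq> P ` {..<c}"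
  shows "card {i \<in> {1..<c}. P i \<in> S} = card (S - {P 0})"
proof -
  have c: "0 < c" using assms(1) unfolding cyc_def by simp
  have "{i \<in> {1..<c}. P i \<in> S} = {i \<in> {..<c}. P i \<in> S - {P 0}}"
  proof -
    have "P i \<noteq> P 0 \<longleftrightarrow> 1 \<le> i" if "i < c" for i using cyc_inj[OF assms(1) that c] by auto
    then show ?thesis by auto
  qed
  then show ?thesis using pos_card0[OF assms(1), of "S - {P 0}"] assms(2) by auto
qed

lemma pos_notin:
  assumes "cyc P c" "D \<inter> P ` {..<c} = {}" "B \<subseteq> {..<c}" "i < c" "i \<notin> B"
  shows "P i \<notin> D \<union> P ` B"
proof
  assume "P i \<in> D \<union> P ` B"
  then have "P i \<in> P ` B" using assms(2,4) by blast
  then obtain j where "j \<in> B" "P i = P j" by blast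
  then show False using cyc_inj[OF assms(1,4), of j] assms(3,5) by auto
qed

lemma EV2: "E u v \<Longrightarrow> v \<in> V"
  using EV sym by blast

lemma fin_nbrs: "finite {u. E v u}"
  by (rule finite_subset[OF _ finV]) (use EV2 in blast)

lemma compD:
  assumes "cpt Y D"
  shows "D \<noteq> {}" "D \<subseteq> V" "D \<inter> Y = {}" "conn D" "finite D" "\<And>v u. v \<in> D \<Longrightarrow> E v u \<Longrightarrow> u \<in> D \<or> u \<in> Y"
  using assms finV unfolding isComp_def by (auto intro: finite_subset)

lemma comp_ex:
  assumes "v \<in> V - Y"
  shows "\<exists>D. cpt Y D \<and> v \<in> D"
proof -
  obtain K where K: "K \<subseteq> V - Y" "v \<in> K" "\<forall>a\<in>K. \<forall>b\<in>V - Y - K. \<not> E a b" "conn K"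
    using component_exists[of "V - Y" v] assms finV by auto
  have "u \<in> K \<or> u \<in> Y" if "a \<in> K" "E a u" for a u using K(3) that EV2[OF that(2)] by blast
  then have "cpt Y K" using K unfolding isComp_def by blast
  then show ?thesis using K(2) by blast
qed

lemma att_iff: "s \<in> att Y D \<longleftrightarrow> s \<in> Y \<and> (\<exists>v\<in>D. E v s)"
  unfolding att_def by auto

text \<open>A single attachment \<open>z\<close> would cut off \<open>D\<close>, and then
  \<open>Y\<close> could contain no vertex besides \<open>z\<close>.\<close>

lemma att_two:
  assumes "cpt Y D" "Y \<subseteq> V" "2 \<le> card Y"
  shows "2 \<le> card (att Y D)"
proof (rule ccontr)
  assume "\<not> ?thesis"
  then have c1: "card (att Y D) \<le> 1" by simp
  have fY: "finite Y" using assms(2) finV finite_subset by blast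
  then have fa: "finite (att Y D)" unfolding att_def by simp
  then obtain z where z: "att Y D \<subseteq> {z}"
  proof (cases "att Y D = {}")
    case False
    then have "card (att Y D) = 1" using c1 fa by (simp add: le_Suc_eq)
    then show ?thesis using that by (metis card_1_singletonE order_refl)
  qed (use that in auto)
  have "u \<in> D \<or> u = z" if "v \<in> D" "E v u" for v u
    using compD(6)[OF assms(1) that] z that by (auto simp: att_def)
  then have "V \<subseteq> insert z D"
    using compD(1,2)[OF assms(1)] by (intro two) auto
  then have "Y \<subseteq> {z}" using compD(3)[OF assms(1)] assms(2) by blast
  then have "card Y \<le> card {z}" by (intro card_mono) auto
  then show False using assms(3) by simp
qed

text \<open>A weightless part of \<open>D\<close> has no neighbour on \<open>Y\<close> except
  \<open>p\<close>, so the exit avoiding \<open>z\<close> that 2-connectedness provides lies in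
  \<open>insert p D\<close>.\<close>

lemma comp_linked:
  assumes "cpt Y D" "Y \<subseteq> V" "2 \<le> card Y"
  shows "linked p D (nf Y p)"
  unfolding linked_def
proof (intro allI impI, rule ccontr)
  fix K z assume K: "K \<subseteq> D" "K \<noteq> {}" "\<forall>v\<in>K. nf Y p v = 0"
    and no: "\<not> (\<exists>v\<in>K. \<exists>u\<in>insert p D - K. u \<noteq> z \<and> E v u)"
  note C = compD[OF assms(1)]
  have fY: "finite Y" using assms(2) finV finite_subset by blast
  have onlyp: "u = p" if "v \<in> K" "u \<in> Y" "E v u" for u v
  proof -
    have "{u \<in> Y - {p}. E v u} = {}" using K(3) that(1) fY unfolding nf_def by fastforce
    then show ?thesis using that by blast
  qed
  have "u \<in> K \<or> u = z" if "v \<in> K" "E v u" for v u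
  proof -
    have "u \<in> D \<or> u \<in> Y" using C(6) that K(1) by blast
    then show ?thesis using onlyp no that C(3) K(1) by blast
  qed
  then have "V \<subseteq> insert z K" using K(1,2) C(2) by (intro two) auto
  then have "Y \<subseteq> {z}" using C(3) assms(2) K(1) by blast
  then have "card Y \<le> card {z}" by (intro card_mono) auto
  then show False using assms(3) by simp
qed

lemma comp_wp:
  assumes "cpt Y D" "Y \<subseteq> V" "2 \<le> card Y" "p \<in> att Y D" "\<not> D \<subseteq> {w}"
    and "w \<in> D \<Longrightarrow> E p w \<or> (\<forall>u\<in>Y. \<not> E w u)" "\<not> wpath p D (nf Y p) (Suc k)"
    and "v \<in> D" "v \<noteq> w"
  shows "1 \<le> nf Y p v \<and> nf Y p v + card D = k \<and> (\<forall>u\<in>insert p D. u \<noteq> v \<longrightarrow> E v u)"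
proof -
  note C = compD[OF assms(1)]
  have fY: "finite Y" using assms(2) finV finite_subset by blast
  have p: "p \<in> Y" "\<exists>v\<in>D. E p v" using assms(4) sym by (auto simp: att_def)
  have dg: "k \<le> card {u \<in> insert p D. E v u} + nf Y p v" if "v \<in> D" "v \<noteq> w" for v
  proof -
    have "{u. E v u} \<subseteq> {u \<in> insert p D. E v u} \<union> {u \<in> Y - {p}. E v u}" using C(6) that by blast
    then have "card {u. E v u} \<le> card ({u \<in> insert p D. E v u} \<union> {u \<in> Y - {p}. E v u})"
      using C(5) fY by (intro card_mono) auto
    also have "\<dots> \<le> card {u \<in> insert p D. E v u} + nf Y p v" unfolding nf_def by (rule card_Un_le)
    finally show ?thesis using deg[of v] that C(2) by force
  qed
  have "wpath p D (nf Y p) (Suc k) \<or> (\<forall>v\<in>D. v \<noteq> w \<longrightarrow> 1 \<le> nf Y p v \<and> nf Y p v + card D = k \<and>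
      (\<forall>u\<in>insert p D. u \<noteq> v \<longrightarrow> E v u))"
  proof (rule conjunct2[OF weighted_path[of D p "nf Y p" w k]])
    show "p \<notin> D" using p C(3) by blast
    show "linked p D (nf Y p)" using comp_linked assms by blast
    show "w \<in> D \<Longrightarrow> E p w \<or> nf Y p w = 0" 
    proof -
      assume "w \<in> D"
      then consider "E p w" | "\<forall>u\<in>Y. \<not> E w u" using assms(6) by blast
      then show ?thesis
      proof cases
        case 2
        then have "{u \<in> Y - {p}. E w u} = {}" by blast
        then show ?thesis unfolding nf_def by (metis card.empty)
      qed simp
    qed
  qed (use C p dg assms in auto)
  then show ?thesis using assms(7-9) by blast
qed

text \<open>The root is a neighbour of \<open>w\<close> on \<open>Y\<close> if \<open>w\<close> lies
  in \<open>D\<close> and has one; otherwise any attachment serves. \<open>D\<close> is then a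
  clique, so a path spanning it can be led from a neighbour of \<open>p\<close> to a neighbour of
  any given attachment.\<close>

lemma comp_root:
  assumes "cpt Y D" "Y \<subseteq> V" "2 \<le> card Y" "\<not> D \<subseteq> {w}"
    and NV: "\<And>p. p \<in> Y \<Longrightarrow> \<not> wpath p D (nf Y p) (Suc k)"
  shows "\<exists>p\<in>att Y D. (\<forall>v\<in>D. v \<noteq> w \<longrightarrow> 1 \<le> nf Y p v \<and> nf Y p v + card D = k \<and> (\<forall>u\<in>insert p D. u \<noteq> v \<longrightarrow> E v u)) \<and>
     (\<forall>q\<in>att Y D. \<exists>x t. E p x \<and> E t q \<and> pth x t D)"
proof -
  note C = compD[OF assms(1)]
  obtain p where p: "p \<in> att Y D" "w \<in> D \<Longrightarrow> E p w \<or> (\<forall>u\<in>Y. \<not> E w u)"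
  proof (cases "w \<in> D \<and> (\<exists>u\<in>Y. E w u)")
    case True then show ?thesis using that sym by (auto simp: att_iff)
  next
    case False
    have "att Y D \<noteq> {}" using att_two[OF assms(1-3)] by force
    then show ?thesis using that False by blast
  qed
  have pY: "p \<in> Y" using p by (simp add: att_iff)
  have st: "1 \<le> nf Y p v \<and> nf Y p v + card D = k \<and> (\<forall>u\<in>insert p D. u \<noteq> v \<longrightarrow> E v u)"
    if "v \<in> D" "v \<noteq> w" for v
    using comp_wp[OF assms(1-3) p(1) assms(4) p(2) NV[OF pY] that] .
  have cl: "E u v" if "u \<in> D" "v \<in> D" "u \<noteq> v" for u v
    using st that sym by (metis insertCI)
  have "\<exists>x t. E p x \<and> E t q \<and> pth x t D" if q: "q \<in> att Y D" for q
  proof -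
    obtain t where t: "t \<in> D" "E t q" using q by (auto simp: att_iff)
    show ?thesis
    proof (cases "D = {t}")
      case True
      have "p \<noteq> t" using pY t(1) C(3) by blast
      then have "E t p" using st[of t] assms(4) True by auto
      then show ?thesis using t True pth_single[of t] sym by blast
    next
      case False
      have "\<exists>x\<in>D. x \<noteq> t \<and> E p x"
      proof (cases "\<exists>x\<in>D. x \<noteq> t \<and> x \<noteq> w")
        case True
        then obtain x where x: "x \<in> D" "x \<noteq> t" "x \<noteq> w" by blast
        moreover have "p \<noteq> x" using pY x(1) C(3) by blast
        ultimately show ?thesis using st[of x] sym by blast
      next
        case no: False
        then have D: "D = {t, w}" "t \<noteq> w" using False t assms(4) by blast+
        \<comment> \<open>Otherwise \<open>t\<close> would be the only neighbour of
          \<open>w\<close>.\<close>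
        have "E p w"
        proof (rule ccontr)
          assume "\<not> E p w"
          then have wY: "\<forall>u\<in>Y. \<not> E w u" using p(2) D by blast
          have "V \<subseteq> insert t {w}" using wY D C(2,6) by (intro two) blast+
          then have "card V \<le> card {t, w}" by (intro card_mono) auto
          then show False using V3 D(2) by simp
        qed
        then show ?thesis using D by auto
      qed
      then obtain x where x: "x \<in> D" "x \<noteq> t" "E p x" by blast
      then have "pth x t D" using clique_pth[OF C(5) cl, of x t] t by simp
      then show ?thesis using x t by blast
    qed
  qed
  then show ?thesis using p(1) st by (intro bexI[of _ p]) auto
qed

text \<open>With \<open>w\<close> outside \<open>D\<close> every attachment is an admissible root,
  so the rigid alternative holds from all of them.\<close>

lemma comp_struct_now:
  assumes "cpt Y D" "Y \<subseteq> V" "2 \<le> card Y" "w \<notin> D"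
    and NV: "\<And>p. p \<in> Y \<Longrightarrow> \<not> wpath p D (nf Y p) (Suc k)"
  shows "card (att Y D) + card D = Suc k" "\<And>v u. v \<in> D \<Longrightarrow> u \<in> D \<union> att Y D \<Longrightarrow> u \<noteq> v \<Longrightarrow> E v u"
proof -
  note C = compD[OF assms(1)]
  have fY: "finite Y" using assms(2) finV finite_subset by blast
  have Dw: "\<not> D \<subseteq> {w}" using C(1) assms(4) by blast
  have st: "nf Y p v + card D = k \<and> (\<forall>u\<in>insert p D. u \<noteq> v \<longrightarrow> E v u)"
    if "v \<in> D" "p \<in> att Y D" for v p
  proof -
    have "p \<in> Y" using that(2) by (simp add: att_iff)
    then show ?thesis using comp_wp[OF assms(1-3) that(2) Dw _ NV that(1)] assms(4) that(1) by blast
  qed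
  obtain v where v: "v \<in> D" using C(1) by blast
  have ne: "att Y D \<noteq> {}" using att_two[OF assms(1-3)] by force
  then obtain p where p: "p \<in> att Y D" by blast
  show E: "E v u" if "v \<in> D" "u \<in> D \<union> att Y D" "u \<noteq> v" for v u
  proof (cases "u \<in> D")
    case True then show ?thesis using st[OF that(1) p] that(3) by blast
  next
    case False
    then have "u \<in> att Y D" using that by blast
    then have "\<forall>u'\<in>insert u D. u' \<noteq> v \<longrightarrow> E v u'" using st[OF that(1)] by blast
    then show ?thesis using that(3) by simp
  qed
  have "E v u" if "u \<in> att Y D" for u
    using E[OF v, of u] that v C(3) by (auto simp: att_iff)
  then have "{u \<in> Y - {p}. E v u} = att Y D - {p}" using v by (auto simp: att_iff)
  then have "nf Y p v = card (att Y D) - 1" unfolding nf_def using p by simp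
  moreover have "1 \<le> card (att Y D)" using att_two[OF assms(1-3)] by simp
  ultimately show "card (att Y D) + card D = Suc k" using st[OF v p] by linarith
qed

end

section \<open>Counting gaps on a longest cycle\<close>

locale circumference_graph = degree_graph E V k w for E :: "'a \<Rightarrow> 'a \<Rightarrow> bool" and V k w +
  fixes c :: nat
  assumes bound: "cycset Y \<Longrightarrow> card Y \<le> c" and exc: "\<exists>Y. cycset Y \<and> card Y = c"
    and cn: "c < card V" and ck: "c \<le> 2 * k + 1"
begin

definition lcyc :: "'a set \<Rightarrow> bool" where
  "lcyc Y \<longleftrightarrow> cycset Y \<and> card Y = c"

lemma cycset_V:
  assumes "cycset Y" shows "Y \<subseteq> V"
proof
  fix y assume "y \<in> Y"
  then obtain P where P: "cyc P (card Y)" "P ` {..<card Y} = Y" "P 0 = y" using cycset_at[OF assms] by blast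
  then have "Suc 0 < card Y" unfolding cyc_def by simp
  then show "y \<in> V" using cyc_edge[OF P(1)] P(3) EV by metis
qed

lemma lcycD:
  assumes "lcyc Y"
  shows "cycset Y" "card Y = c" "Y \<subseteq> V" "finite Y" "3 \<le> c"
proof -
  show "cycset Y" "card Y = c" using assms unfolding lcyc_def by auto
  show "Y \<subseteq> V" "finite Y" using assms cycset_V cycset_finite unfolding lcyc_def by auto
  show "3 \<le> c" using assms unfolding lcyc_def cycset_def by auto
qed

lemma lcyc_at:
  assumes "lcyc Y" "p \<in> Y"
  obtains P where "cyc P c" "P ` {..<c} = Y" "P 0 = p"
  using cycset_at[of Y p] assms unfolding lcyc_def by auto

lemma lcyc_cyc: "cyc P c \<Longrightarrow> lcyc (P ` {..<c})"
  using cyc_cycset[of P c] cyc_card[of P c "{..<c}"] unfolding lcyc_def by simp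

text \<open>An ear with more vertices than the interior of the arc it bypasses would give a cycle
  longer than \<open>c\<close>; the two bounds come from the two arcs.\<close>

lemma gap:
  assumes "cyc P c" "i < j" "j < c" "pth x t X" "X \<inter> P ` {..<c} = {}" "E (P i) x" "E t (P j)"
  shows "i + card X + 1 \<le> j" "j + card X + 1 \<le> c + i"
proof -
  have "card X + c + i + 1 \<le> c + j"
    using ear_out[OF assms] bound by (metis add_le_mono1)
  then show "i + card X + 1 \<le> j" by simp
  have "card X + (j - i + 1) \<le> c" using ear_in[OF assms] bound by metis
  then show "j + card X + 1 \<le> c + i" using assms(2) by simp
qed

lemma not_consecutive:
  assumes "cyc P c" "i < j" "j < c" "E v (P i)" "E v (P j)" "v \<notin> P ` {..<c}"
  shows "i + 2 \<le> j" "j + 2 \<le> c + i"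
  using gap[OF assms(1-3) pth_single[of v]] assms sym by auto

text \<open>The neighbours of \<open>t\<close> span at least \<open>2 * (nf Y p t - 1)\<close>
  steps, and at least \<open>card X + 1\<close> steps separate that stretch from \<open>p\<close> on
  either side; in total this is at least \<open>2 * k + 2\<close>.\<close>

lemma no_wpath:
  assumes "lcyc Y" "D \<inter> Y = {}" "p \<in> Y"
  shows "\<not> wpath p D (nf Y p) (Suc k)"
proof
  assume "wpath p D (nf Y p) (Suc k)"
  then obtain x t X where X: "E p x" "pth x t X" "X \<subseteq> D" "1 \<le> nf Y p t" "Suc k \<le> card X + nf Y p t"
    unfolding wpath_def by blast
  obtain P where P: "cyc P c" "P ` {..<c} = Y" "P 0 = p" using lcyc_at[OF assms(1,3)] .
  note inj = cyc_inj[OF P(1)]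
  define A where "A = {i \<in> {1..<c}. P i \<in> {u \<in> Y. E t u}}"
  have c3: "3 \<le> c" using lcycD[OF assms(1)] by blast
  have "{u \<in> Y. E t u} - {P 0} = {u \<in> Y - {p}. E t u}" using P(3) by blast
  then have cA: "card A = nf Y p t"
    using pos_card[OF P(1), of "{u \<in> Y. E t u}"] P(2) unfolding A_def nf_def by auto
  have dX: "X \<inter> P ` {..<c} = {}" using X(3) assms(2) P(2) by blast
  have tY: "t \<notin> P ` {..<c}" using pth_ends[OF X(2)] dX by blast
  have "finite A" unfolding A_def by simp
  moreover have "A \<noteq> {}" using cA X(4) by force
  ultimately have fA: "finite A" "A \<noteq> {}" by auto
  have "i + 2 \<le> j" if "i \<in> A" "j \<in> A" "i < j" for i j
    using not_consecutive(1)[OF P(1) that(3)] that tY unfolding A_def by auto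
  then obtain a b where ab: "a \<in> A" "b \<in> A" "a + 2 * (card A - 1) \<le> b" using spread[OF fA] by blast
  have lo: "card X + 1 \<le> i" "i + card X + 1 \<le> c" if "i \<in> A" for i
    using gap[OF P(1) _ _ X(2) dX, of 0 i] X(1) P(3) that unfolding A_def by auto
  have "card X + 1 + 2 * (nf Y p t - 1) + card X + 1 \<le> c"
    using ab(3) lo(1)[OF ab(1)] lo(2)[OF ab(2)] cA by linarith
  then show False using X(4,5) ck by linarith
qed

lemma comp_root_l:
  assumes "lcyc Y" "cpt Y D" "\<not> D \<subseteq> {w}"
  shows "\<exists>p\<in>att Y D. (\<forall>v\<in>D. v \<noteq> w \<longrightarrow> 1 \<le> nf Y p v \<and> nf Y p v + card D = k \<and> (\<forall>u\<in>insert p D. u \<noteq> v \<longrightarrow> E v u)) \<and>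
     (\<forall>q\<in>att Y D. \<exists>x t. E p x \<and> E t q \<and> pth x t D)"
  using comp_root[OF assms(2) _ _ assms(3)] no_wpath[OF assms(1), of D] lcycD[OF assms(1)] compD(3)[OF assms(2)] by simp

text \<open>The other attachments keep distance \<open>card D + 1\<close> from the root, but only
  distance 2 from each other, because paths between them need not span \<open>D\<close>. This still
  bounds \<open>card (att Y D) + card D\<close> by \<open>k + 1\<close>. The rigid alternative gives
  the same sum with the neighbours of one vertex \<open>v \<noteq> w\<close> in place of
  \<open>att Y D\<close>, so \<open>v\<close> sees every attachment.\<close>

lemma comp_struct:
  assumes "lcyc Y" "cpt Y D" "\<not> D \<subseteq> {w}"
  shows "card (att Y D) + card D = Suc k" "2 \<le> card (att Y D)"
    "\<And>v u. v \<in> D \<Longrightarrow> v \<noteq> w \<Longrightarrow> u \<in> D \<union> att Y D \<Longrightarrow> u \<noteq> v \<Longrightarrow> E v u"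
    and "\<exists>p\<in>att Y D. \<forall>q\<in>att Y D. \<exists>x t. E p x \<and> E t q \<and> pth x t D"
proof -
  note L = lcycD[OF assms(1)] and C = compD[OF assms(2)]
  obtain p where p: "p \<in> att Y D"
    and st: "\<And>v. v \<in> D \<Longrightarrow> v \<noteq> w \<Longrightarrow> 1 \<le> nf Y p v \<and> nf Y p v + card D = k \<and> (\<forall>u\<in>insert p D. u \<noteq> v \<longrightarrow> E v u)"
    and sp: "\<And>q. q \<in> att Y D \<Longrightarrow> \<exists>x t. E p x \<and> E t q \<and> pth x t D"
    using comp_root_l[OF assms] by blast
  show "\<exists>p\<in>att Y D. \<forall>q\<in>att Y D. \<exists>x t. E p x \<and> E t q \<and> pth x t D" using p sp by blast
  show a2: "2 \<le> card (att Y D)" using att_two[OF assms(2) L(3)] L by simp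
  obtain P where P: "cyc P c" "P ` {..<c} = Y" "P 0 = p" using lcyc_at[OF assms(1), of p] p by (auto simp: att_iff)
  note inj = cyc_inj[OF P(1)]
  have dD: "D \<inter> P ` {..<c} = {}" using C(3) P(2) by simp
  define A where "A = {i \<in> {1..<c}. P i \<in> att Y D}"
  have "att Y D \<subseteq> P ` {..<c}" using P(2) by (auto simp: att_iff)
  then have "card A = card (att Y D - {p})" using pos_card[OF P(1)] P(3) unfolding A_def by simp
  moreover have "finite (att Y D)" using L(4) by (simp add: att_def)
  ultimately have cA: "card A + 1 = card (att Y D)" using p a2 by simp
  have lo: "card D + 1 \<le> i" "i + card D + 1 \<le> c" if "i \<in> A" for i
  proof -
    have "P i \<in> att Y D" using that unfolding A_def by blast
    then obtain x t where xt: "E p x" "E t (P i)" "pth x t D" using sp by blast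
    show "card D + 1 \<le> i" "i + card D + 1 \<le> c"
      using gap[OF P(1) _ _ xt(3) dD, of 0 i] xt P(3) that unfolding A_def by auto
  qed
  have cl: "E u v" if "u \<in> D" "v \<in> D" "u \<noteq> v" for u v
    using st that sym by (metis insertCI)
  have "i + 2 \<le> j" if "i \<in> A" "j \<in> A" "i < j" for i j
  proof -
    have "P i \<in> att Y D" "P j \<in> att Y D" using that unfolding A_def by auto
    then obtain x t where xt: "x \<in> D" "t \<in> D" "E x (P i)" "E t (P j)" unfolding att_iff by blast
    have "\<exists>X\<subseteq>D. pth x t X"
      using clique_pth[OF C(5) cl xt(1,2)] pth_single[of x] xt by (cases "x = t") auto
    then obtain X where X: "X \<subseteq> D" "pth x t X" by blast
    have "1 \<le> card X" using X pth_ends[OF X(2)] pth_finite[OF X(2)] by (auto simp: Suc_le_eq card_gt_0_iff)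
    moreover have "i + card X + 1 \<le> j"
      using gap(1)[OF P(1) that(3) _ X(2)] X(1) dD xt sym that unfolding A_def by auto
    ultimately show ?thesis by simp
  qed
  moreover have "finite A" unfolding A_def by simp
  moreover have neA: "A \<noteq> {}" using cA a2 by force
  ultimately obtain a b where ab: "a \<in> A" "b \<in> A" "a + 2 * (card A - 1) \<le> b" using spread[of A 2] by blast
  have "card D + 1 + 2 * (card A - 1) + card D + 1 \<le> c"
    using ab lo(1)[OF ab(1)] lo(2)[OF ab(2)] by linarith
  moreover have A1: "1 \<le> card A" using cA a2 by simp
  ultimately have up: "card (att Y D) + card D \<le> Suc k" using ck cA by linarith
  have Nv: "{u \<in> Y. E v u} = att Y D \<and> card (att Y D) + card D = Suc k" if v: "v \<in> D" "v \<noteq> w" for v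
  proof -
    have pv: "p \<in> {u \<in> Y. E v u}" using st[OF v] p C(3) v(1) by (auto simp: att_iff)
    have "{u \<in> Y - {p}. E v u} = {u \<in> Y. E v u} - {p}" by blast
    then have "nf Y p v = card {u \<in> Y. E v u} - 1" unfolding nf_def using pv by simp
    moreover have "card {u \<in> Y. E v u} \<ge> 1" using pv L(4) by (auto simp: Suc_le_eq card_gt_0_iff)
    ultimately have cd: "card {u \<in> Y. E v u} + card D = Suc k" using st[OF v] by linarith
    have "{u \<in> Y. E v u} \<subseteq> att Y D" using v by (auto simp: att_iff)
    moreover have "finite (att Y D)" using L(4) unfolding att_def by simp
    ultimately have "{u \<in> Y. E v u} = att Y D" using cd up by (intro card_seteq) auto
    then show ?thesis using cd by simp
  qed
  obtain v0 where "v0 \<in> D" "v0 \<noteq> w" using assms(3) by blast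
  then show "card (att Y D) + card D = Suc k" using Nv by blast
  show "E v u" if "v \<in> D" "v \<noteq> w" "u \<in> D \<union> att Y D" "u \<noteq> v" for v u
    using Nv[OF that(1,2)] cl that by blast
qed

lemma comp_clique:
  assumes "lcyc Y" "cpt Y D" "\<not> D \<subseteq> {w}" "u \<in> D" "v \<in> D" "u \<noteq> v"
  shows "E u v"
  using comp_struct(3)[OF assms(1-3)] assms sym by (metis UnI1)

text \<open>The ends of the path should avoid \<open>w\<close>, whose neighbours on the cycle are
  unknown. In a two-vertex component containing \<open>w\<close> this is impossible.\<close>

lemma span_all:
  assumes "lcyc Y" "cpt Y D" "w \<notin> D \<or> 3 \<le> card D" "s \<in> att Y D" "s' \<in> att Y D"
  shows "\<exists>x t. E s x \<and> E t s' \<and> pth x t D"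
proof -
  note C = compD[OF assms(2)]
  have Dw: "\<not> D \<subseteq> {w}"
  proof
    assume "D \<subseteq> {w}"
    then have "card D \<le> card {w}" by (intro card_mono) auto
    then show False using assms(3) C(1) \<open>D \<subseteq> {w}\<close> by auto
  qed
  note S = comp_struct(3)[OF assms(1,2) Dw]
  have sD: "s \<notin> D" "s' \<notin> D" using C(3) assms(4,5) by (auto simp: att_iff)
  have Es: "E s v" "E v s'" if "v \<in> D" "v \<noteq> w" for v using S[OF that] sD assms(4,5) that sym by blast+
  obtain v where v: "v \<in> D" "v \<noteq> w" using Dw by blast
  show ?thesis
  proof (cases "D = {v}")
    case True then show ?thesis using Es[OF v] pth_single[of v] by blast
  next
    case False
    have "\<exists>u\<in>D. u \<noteq> v \<and> u \<noteq> w"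
    proof (rule ccontr)
      assume no: "\<not> ?thesis"
      then have "D \<subseteq> {v, w}" by blast
      then have "card D \<le> card {v, w}" by (intro card_mono) auto
      then have "card D \<le> 2" using v by simp
      then show False using assms(3) False no v by auto
    qed
    then obtain u where u: "u \<in> D" "u \<noteq> v" "u \<noteq> w" by blast
    have "pth u v D" using clique_pth[OF C(5) comp_clique[OF assms(1,2) Dw]] u v by blast
    then show ?thesis using Es u v by blast
  qed
qed

lemma comp_gap:
  assumes "cyc P c" "cpt (P ` {..<c}) D" "w \<notin> D \<or> 3 \<le> card D" "i < j" "j < c"
    and "P i \<in> att (P ` {..<c}) D" "P j \<in> att (P ` {..<c}) D"
  shows "i + card D + 1 \<le> j" "j + card D + 1 \<le> c + i"
proof -
  obtain x t where xt: "E (P i) x" "E t (P j)" "pth x t D"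
    using span_all[OF lcyc_cyc[OF assms(1)] assms(2,3,6,7)] by blast
  show "i + card D + 1 \<le> j" "j + card D + 1 \<le> c + i"
    using gap[OF assms(1,4,5) xt(3) compD(3)[OF assms(2)] xt(1,2)] by auto
qed

lemma card_two: "finite D \<Longrightarrow> a \<in> D \<Longrightarrow> b \<in> D \<Longrightarrow> a \<noteq> b \<Longrightarrow> 2 \<le> card D"
  using card_mono[of D "{a, b}"] by simp

text \<open>If both arcs next to the root had more than \<open>card D\<close> inner vertices, the
  cycle would have at least \<open>2 * k + 2\<close> vertices. So one of them has exactly
  \<open>card D\<close> and is exchanged with \<open>D\<close>. The released vertices are
  consecutive, hence in a common component.\<close>

lemma longest_cycle_through:
  assumes "lcyc Y" "cpt Y D" "w \<in> D" "2 \<le> card D"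
  shows "\<exists>Z D'. lcyc Z \<and> w \<in> Z \<and> cpt Z D' \<and> 2 \<le> card D'"
proof -
  note L = lcycD[OF assms(1)] and C = compD[OF assms(2)]
  have Dw: "\<not> D \<subseteq> {w}"
  proof
    assume "D \<subseteq> {w}"
    then have "card D \<le> card {w}" by (intro card_mono) auto
    then show False using assms(4) by simp
  qed
  note S = comp_struct[OF assms(1,2) Dw]
  obtain p where p: "p \<in> att Y D" and sp: "\<And>q. q \<in> att Y D \<Longrightarrow> \<exists>x t. E p x \<and> E t q \<and> pth x t D"
    using S(4) by blast
  obtain P where P: "cyc P c" "P ` {..<c} = Y" "P 0 = p" using lcyc_at[OF assms(1), of p] p by (auto simp: att_iff)
  note inj = cyc_inj[OF P(1)]
  have dD: "D \<inter> P ` {..<c} = {}" using C(3) P(2) by simp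
  define m where "m = card D"
  define A where "A = {i \<in> {1..<c}. P i \<in> att Y D}"
  have "att Y D \<subseteq> P ` {..<c}" using P(2) by (auto simp: att_iff)
  then have "card A = card (att Y D - {p})" using pos_card[OF P(1)] P(3) unfolding A_def by simp
  moreover have "finite (att Y D)" using L(4) by (simp add: att_def)
  ultimately have cA: "card A + 1 = card (att Y D)" using p S(2) by simp
  have lo: "m + 1 \<le> i" "i + m + 1 \<le> c" if "i \<in> A" for i
  proof -
    have "P i \<in> att Y D" using that unfolding A_def by blast
    then obtain x t where xt: "E p x" "E t (P i)" "pth x t D" using sp by blast
    show "m + 1 \<le> i" "i + m + 1 \<le> c"
      using gap[OF P(1) _ _ xt(3) dD, of 0 i] xt P(3) that unfolding A_def m_def by auto
  qed
  have "i + 2 \<le> j" if "i \<in> A" "j \<in> A" "i < j" for i j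
  proof -
    obtain v where v: "v \<in> D" "v \<noteq> w" using Dw by blast
    have "E v (P i)" "E v (P j)" using S(3)[OF v] that v C(3) unfolding A_def by (auto simp: att_iff)
    then show ?thesis using not_consecutive(1)[OF P(1) that(3)] that dD v unfolding A_def by auto
  qed
  moreover have "finite A" unfolding A_def by simp
  moreover have neA: "A \<noteq> {}" using cA S(2) by force
  ultimately obtain a b where ab: "a \<in> A" "b \<in> A" "a + 2 * (card A - 1) \<le> b" using spread[of A 2] by blast
  have sm: "card A + m = k" using S(1) cA unfolding m_def by simp
  have A1: "1 \<le> card A" using cA S(2) by simp
  have m2: "2 \<le> m" using assms(4) m_def by simp
  have fin: "\<exists>D'. cpt Z D' \<and> 2 \<le> card D'"
    if Z: "P i \<notin> Z" "P (Suc i) \<notin> Z" "Suc i < c" for Z i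
  proof -
    have e: "E (P i) (P (Suc i))" using cyc_edge[OF P(1) Z(3)] .
    then obtain D' where D': "cpt Z D'" "P i \<in> D'" using comp_ex[of "P i" Z] Z EV by blast
    have "P (Suc i) \<in> D'" using compD(6)[OF D'(1)] D'(2) e Z by blast
    then have "2 \<le> card D'" using card_two[OF compD(5)[OF D'(1)] D'(2)] inj[of i "Suc i"] Z(3) by auto
    then show ?thesis using D' by blast
  qed
  consider "a = m + 1" | "b + m + 1 = c"
  proof (rule ccontr)
    assume "\<not> thesis"
    then have "m + 2 \<le> a" "b + m + 2 \<le> c" using that lo ab by fastforce+
    then have "m + 2 + 2 * (card A - 1) + m + 2 \<le> c" using ab by linarith
    then show False using ck sm A1 by linarith
  qed
  then show ?thesis
  proof cases
    case 1
    obtain x t where xt: "E p x" "E t (P a)" "pth x t D" using sp ab unfolding A_def by blast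
    let ?Z = "D \<union> P ` ({..0} \<union> {a..<c})"
    have a: "0 < a" "a < c" using ab unfolding A_def by auto
    have "E (P 0) x" using xt P(3) by simp
    note Z = ear_out[OF P(1) a xt(3) dD this xt(2)]
    have "lcyc ?Z" unfolding lcyc_def using Z 1 m_def by simp
    moreover have "P 1 \<notin> ?Z" "P (Suc 1) \<notin> ?Z"
      using 1 m2 a by (intro pos_notin[OF P(1) dD]; auto)+
    then have "\<exists>D'. cpt ?Z D' \<and> 2 \<le> card D'" using fin[of 1 ?Z] 1 m2 a by simp
    ultimately show ?thesis using assms(3) by blast
  next
    case 2
    obtain x t where xt: "E p x" "E t (P b)" "pth x t D" using sp ab unfolding A_def by blast
    let ?Z = "D \<union> P ` {0..b}"
    have b: "0 < b" "b < c" using ab unfolding A_def by auto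
    have "E (P 0) x" using xt P(3) by simp
    note Z = ear_in[OF P(1) b xt(3) dD this xt(2)]
    have "lcyc ?Z" unfolding lcyc_def using Z 2 m_def by simp
    moreover have "P (Suc b) \<notin> ?Z" "P (Suc (Suc b)) \<notin> ?Z"
      using 2 m2 b by (intro pos_notin[OF P(1) dD]; auto)+
    then have "\<exists>D'. cpt ?Z D' \<and> 2 \<le> card D'" using fin[of "Suc b" ?Z] 2 m2 b by simp
    ultimately show ?thesis using assms(3) by blast
  qed
qed

text \<open>A component of at least two vertices may contain \<open>w\<close>; rerouting puts
  \<open>w\<close> on the cycle and still leaves a component of at least two vertices off
  it.\<close>

lemma dichotomy:
  "(\<exists>Y D. lcyc Y \<and> cpt Y D \<and> w \<notin> D \<and> 2 \<le> card D \<and> (\<forall>D'. cpt Y D' \<longrightarrow> w \<in> D' \<longrightarrow> D' = {w})) \<or>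
   (\<forall>Y u v. lcyc Y \<longrightarrow> u \<in> V - Y \<longrightarrow> v \<in> V - Y \<longrightarrow> \<not> E u v)"
proof (rule disjCI)
  assume "\<not> (\<forall>Y u v. lcyc Y \<longrightarrow> u \<in> V - Y \<longrightarrow> v \<in> V - Y \<longrightarrow> \<not> E u v)"
  then obtain Y u v where uv: "lcyc Y" "u \<in> V - Y" "v \<in> V - Y" "E u v" by blast
  obtain D where D: "cpt Y D" "u \<in> D" using comp_ex[OF uv(2)] by blast
  have "v \<in> D" using compD(6)[OF D(1,2) uv(4)] uv(3) by blast
  then have D2: "2 \<le> card D" using card_two[OF compD(5)[OF D(1)] D(2)] uv(4) irrefl by metis
  show "\<exists>Y D. lcyc Y \<and> cpt Y D \<and> w \<notin> D \<and> 2 \<le> card D \<and> (\<forall>D'. cpt Y D' \<longrightarrow> w \<in> D' \<longrightarrow> D' = {w})"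
  proof (cases "\<exists>D'. cpt Y D' \<and> w \<in> D' \<and> 2 \<le> card D'")
    case True
    then obtain Z D' where "lcyc Z" "w \<in> Z" "cpt Z D'" "2 \<le> card D'" using longest_cycle_through[OF uv(1)] by blast
    then show ?thesis using compD(3) by blast
  next
    case False
    have "D' = {w}" if "cpt Y D'" "w \<in> D'" for D'
    proof (rule ccontr)
      assume "D' \<noteq> {w}"
      then have "\<exists>z\<in>D'. z \<noteq> w" using that(2) by blast
      then obtain z where "z \<in> D'" "w \<noteq> z" by blast
      then show False using card_two[OF compD(5)[OF that(1)] that(2)] that False by blast
    qed
    then show ?thesis using uv D D2 False by blast
  qed
qed

lemma comp_types:
  assumes "lcyc Y" "cpt Y D" "w \<notin> D \<or> 3 \<le> card D"
  shows "card (att Y D) * (card D + 1) \<le> c"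
    "card D = 1 \<or> card (att Y D) = 2 \<or> (card (att Y D) = 3 \<and> card D = 2 \<and> k = 4)"
proof -
  note L = lcycD[OF assms(1)] and C = compD[OF assms(2)]
  have Dw: "\<not> D \<subseteq> {w}"
  proof
    assume "D \<subseteq> {w}"
    then have "card D \<le> card {w}" by (intro card_mono) auto
    then show False using assms(3) C(1) \<open>D \<subseteq> {w}\<close> by auto
  qed
  note S = comp_struct[OF assms(1,2) Dw]
  have "att Y D \<noteq> {}" using S(2) by force
  then obtain p where p: "p \<in> att Y D" by blast
  obtain P where P: "cyc P c" "P ` {..<c} = Y" "P 0 = p" using lcyc_at[OF assms(1), of p] p by (auto simp: att_iff)
  define A where "A = {i \<in> {..<c}. P i \<in> att Y D}"
  have "att Y D \<subseteq> P ` {..<c}" using P(2) by (auto simp: att_iff)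
  then have cA: "card A = card (att Y D)" using pos_card0[OF P(1)] unfolding A_def by simp
  have A0: "0 \<in> A" unfolding A_def using P(3) p L(5) by simp
  have g: "i + (card D + 1) \<le> j" "j + card D + 1 \<le> c + i" if "i \<in> A" "j \<in> A" "i < j" for i j
    using comp_gap[OF P(1) _ assms(3) that(3)] that P(2) assms(2) unfolding A_def by auto
  have fA: "finite A" "A \<noteq> {}" using A0 unfolding A_def by auto
  then obtain a b where ab: "a \<in> A" "b \<in> A" "a + (card D + 1) * (card A - 1) \<le> b"
    using spread[OF fA g(1)] by blast
  have "0 < b"
  proof -
    have "0 < (card D + 1) * (card A - 1)" using cA S(2) by simp
    then show ?thesis using ab(3) by linarith
  qed
  then have "b + card D + 1 \<le> c" using g(2)[OF A0 ab(2)] by simp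
  moreover have "(card D + 1) * card A = (card D + 1) * (card A - 1) + (card D + 1)"
  proof -
    obtain a' where "card A = Suc a'" using cA S(2) by (metis not0_implies_Suc not_numeral_le_zero)
    then show ?thesis by simp
  qed
  ultimately show B: "card (att Y D) * (card D + 1) \<le> c" using ab(3) cA by (simp add: mult.commute)
  obtain s' where s': "card (att Y D) = s' + 2" using S(2) by (metis add.commute le_Suc_ex)
  have "1 \<le> card D" using C(1,5) by (auto simp: Suc_le_eq card_gt_0_iff)
  then obtain m' where m': "card D = m' + 1" by (metis add.commute le_Suc_ex)
  have "(s' + 2) * (m' + 2) \<le> 2 * k + 1" using B ck s' m' by simp
  moreover have kk: "k = s' + m' + 2" using S(1) s' m' by simp
  \<comment> \<open>In \<open>(s' + 2) * (m' + 2) \<le> 2 * (s' + m' + 2) + 1\<close> all linear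
    terms cancel.\<close>
  ultimately have "s' * m' \<le> 1" by (simp add: algebra_simps)
  then have "s' = 0 \<or> m' = 0 \<or> (s' = 1 \<and> m' = 1)"
    by (metis One_nat_def le_Suc_eq le_zero_eq mult_is_0 nat_mult_eq_1_iff)
  then show "card D = 1 \<or> card (att Y D) = 2 \<or> (card (att Y D) = 3 \<and> card D = 2 \<and> k = 4)"
    using s' m' kk by auto
qed

end

section \<open>Paths with one extra vertex\<close>

lemma successively_upt:
  "(\<And>i. a \<le> i \<Longrightarrow> Suc i < b \<Longrightarrow> R i (Suc i)) \<Longrightarrow> successively R [a..<b]"
  by (auto simp: successively_conv_nth)

lemma successively_rev_upt:
  "(\<And>i. a \<le> i \<Longrightarrow> Suc i < b \<Longrightarrow> R (Suc i) i) \<Longrightarrow> successively R (rev [a..<b])"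
  using successively_upt[of a b "\<lambda>x y. R y x"] by simp

text \<open>The path \<open>0, \<dots>, k + 1\<close> together with one extra vertex \<open>k + 2\<close>, such that no Hamiltonian
  path joins \<open>0\<close> to \<open>k + 1\<close>. This is the long arc of a cycle of length \<open>2k + 1\<close> whose other arc is closed,
  with \<open>w\<close> as the extra vertex.\<close>

locale jpath =
  fixes F :: "nat \<Rightarrow> nat \<Rightarrow> bool" and k :: nat
  assumes k3: "3 \<le> k" and Fsym: "F i j \<Longrightarrow> F j i" and Firr: "\<not> F i i"
    and edge: "i \<le> k \<Longrightarrow> F i (Suc i)"
    and Fdeg: "1 \<le> i \<Longrightarrow> i \<le> k \<Longrightarrow> k \<le> card {j \<in> {..k + 2}. F i j}"
    and noham: "distinct xs \<Longrightarrow> set xs = {..k + 2} \<Longrightarrow> hd xs = 0 \<Longrightarrow> last xs = Suc k \<Longrightarrow>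
      successively F xs \<Longrightarrow> False"
begin

abbreviation "W \<equiv> k + 2"

lemma up: "b \<le> k + 2 \<Longrightarrow> successively F [a..<b]"
  using edge by (intro successively_upt) auto

lemma down: "b \<le> k + 2 \<Longrightarrow> successively F (rev [a..<b])"
  using edge Fsym by (intro successively_rev_upt) auto

text \<open>Otherwise \<open>W\<close> could be inserted between \<open>i\<close> and
  \<open>Suc i\<close>.\<close>

lemma noconsec: "i \<le> k \<Longrightarrow> F W i \<Longrightarrow> F W (Suc i) \<Longrightarrow> False"
proof -
  assume a: "i \<le> k" "F W i" "F W (Suc i)"
  show False using a Fsym[OF a(2)]
    by (intro noham[of "[0..<Suc i] @ [W] @ [Suc i..<k + 2]"])
      (auto simp: successively_append_iff successively_Cons up hd_append simp del: upt_Suc)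
qed

text \<open>The forbidden path runs up to \<open>a\<close>, over \<open>W\<close> to
  \<open>b\<close>, back down to \<open>Suc a\<close>, and jumps to \<open>Suc b\<close>.\<close>

lemma succ_nonadj: "a < b \<Longrightarrow> b \<le> k \<Longrightarrow> F W a \<Longrightarrow> F W b \<Longrightarrow> \<not> F (Suc a) (Suc b)"
proof
  assume a: "a < b" "b \<le> k" "F W a" "F W b" "F (Suc a) (Suc b)"
  show False using a Fsym[OF a(3)]
    by (intro noham[of "[0..<Suc a] @ [W] @ rev [Suc a..<Suc b] @ [Suc b..<k + 2]"])
      (auto simp: successively_append_iff successively_Cons up down hd_append hd_rev last_rev simp del: upt_Suc successively_rev)
qed

text \<open>The forbidden path runs up to \<open>a - 1\<close>, jumps to \<open>b - 1\<close>, goes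
  back down to \<open>a\<close>, and over \<open>W\<close> to \<open>b\<close>.\<close>

lemma pred_nonadj: "1 \<le> a \<Longrightarrow> a < b \<Longrightarrow> b \<le> Suc k \<Longrightarrow> F W a \<Longrightarrow> F W b \<Longrightarrow> \<not> F (a - 1) (b - 1)"
proof
  assume a: "1 \<le> a" "a < b" "b \<le> Suc k" "F W a" "F W b" "F (a - 1) (b - 1)"
  show False using a Fsym[OF a(4)]
    by (intro noham[of "[0..<a] @ rev [a..<b] @ [W] @ [b..<k + 2]"])
      (auto simp: successively_append_iff successively_Cons up down hd_append hd_rev last_rev simp del: upt_Suc successively_rev)
qed

text \<open>Of the \<open>k + 2\<close> other vertices \<open>i\<close> misses at most two, so two
  known non-neighbours force all remaining adjacencies.\<close>

lemma miss:
  assumes "1 \<le> i" "i \<le> k" "x \<noteq> y" "x \<noteq> z" "y \<noteq> z" "x \<noteq> i" "y \<noteq> i" "z \<noteq> i" "x \<le> k + 2" "y \<le> k + 2" "z \<le> k + 2"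
    and "\<not> F i x" "\<not> F i y"
  shows "F i z"
proof (rule ccontr)
  assume "\<not> F i z"
  then have "{j \<in> {..k + 2}. F i j} \<subseteq> {..k + 2} - {i, x, y, z}" using assms Firr by auto
  then have "card {j \<in> {..k + 2}. F i j} \<le> card ({..k + 2} - {i, x, y, z})" by (intro card_mono) auto
  also have "\<dots> = k + 3 - 4" using assms by (subst card_Diff_subset) auto
  finally show False using Fdeg[OF assms(1,2)] k3 by linarith
qed

text \<open>The successors of \<open>a\<close> and \<open>b\<close> miss \<open>W\<close> and each
  other, so by \<open>miss\<close> they see everything else. This supplies the chords of a
  Hamiltonian path, whatever the position of \<open>a\<close> and \<open>b\<close>.\<close>

lemma pair_low:
  assumes "4 \<le> k" "F W a" "F W b" "a < b" "b < k" "\<And>i. a < i \<Longrightarrow> i < b \<Longrightarrow> \<not> F W i"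
  shows False
proof -
  have aW: "F a W" "F b W" using assms(2,3) Fsym by blast+
  have ab: "a + 2 \<le> b" using noconsec[of a] assms by (metis Suc_leI add_2_eq_Suc' le_neq_implies_less less_imp_le_nat less_trans not_less_eq_eq)
  have wx: "\<not> F W (Suc a)" using assms(6) ab by simp
  have wy: "\<not> F W (Suc b)" using noconsec[of b] assms by auto
  have xy: "\<not> F (Suc a) (Suc b)" using succ_nonadj[of a b] assms by simp
  have x: "F (Suc a) z" if "z \<noteq> Suc a" "z \<noteq> Suc b" "z < W" for z
  proof -
    have "\<not> F (Suc a) W" using wx Fsym by blast
    then show ?thesis using miss[of "Suc a" W "Suc b" z] that assms(1,4,5) xy by auto
  qed
  have y: "F (Suc b) z" if "z \<noteq> Suc a" "z \<noteq> Suc b" "z < W" for z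
  proof -
    have "\<not> F (Suc b) W" "\<not> F (Suc b) (Suc a)" using wy xy Fsym by blast+
    then show ?thesis using miss[of "Suc b" W "Suc a" z] that assms(1,4,5) by auto
  qed
  consider "a + 3 \<le> b" | "b = a + 2" "1 \<le> a" | "a = 0" "b = 2" using ab by linarith
  then show False
  proof cases
    case 1
    have "F (Suc a) b" "F (Suc a) (b - 1)" "F (Suc b) (a + 2)" using x[of b] x[of "b - 1"] y[of "a + 2"] 1 assms(5) by auto
    then have "F b (Suc a)" "F (Suc a) (b - 1)" "F (a + 2) (Suc b)" using Fsym by blast+
    then show False using 1 assms(1-5) aW
      by (intro noham[of "[0..<Suc a] @ [W] @ [b] @ [Suc a] @ rev [a + 2..<b] @ [Suc b..<k + 2]"])
        (auto simp: successively_append_iff successively_Cons up down hd_append hd_rev last_rev simp del: upt_Suc successively_rev)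
  next
    case 2
    have "F (Suc a) 0" "F (Suc a) 1" using x[of 0] x[of 1] 2 assms(5) by auto
    then have "F 0 (Suc a)" "F (Suc a) 1" using Fsym by blast+
    then show False using 2 assms(1-5) aW
      by (intro noham[of "[0] @ [Suc a] @ [1..<Suc a] @ [W] @ [a + 2..<k + 2]"])
        (auto simp: successively_append_iff successively_Cons up down hd_append hd_rev last_rev simp del: upt_Suc successively_rev)
  next
    case 3
    \<comment> \<open>Position 5 is at most \<open>Suc k\<close> because
      \<open>4 \<le> k\<close>.\<close>
    have "F (Suc 0) 4" "F (Suc 0) 5" using x[of 4] x[of 5] 3 assms(1) by auto
    then have "F 4 (Suc 0)" "F (Suc 0) 5" using Fsym by blast+
    then show False using 3 assms(1-5) aW up[of 5 2]
      by (intro noham[of "[0] @ [W] @ [2..<5] @ [Suc 0] @ [5..<k + 2]"])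
        (auto simp: successively_append_iff successively_Cons up down hd_append hd_rev last_rev simp del: upt_Suc successively_rev)
  qed
qed

text \<open>The crossing moves show that \<open>2\<close> misses \<open>Suc k\<close> and that
  \<open>k - 1\<close> misses \<open>0\<close>, hence \<open>k - 1\<close> sees
  \<open>Suc k\<close>. The first \<open>j\<close> from 2 on that sees \<open>Suc k\<close> has a
  predecessor \<open>i\<close> missing \<open>W\<close> and \<open>Suc k\<close>, so
  \<open>i\<close> sees \<open>0\<close>, and \<open>0, i, ..., 1, W, k, ..., j, Suc k\<close> is
  Hamiltonian.\<close>

lemma pair_1k:
  assumes "F W 1" "F W k" "\<And>i. 1 < i \<Longrightarrow> i < k \<Longrightarrow> \<not> F W i"
  shows False
proof -
  have n2: "\<not> F 2 (Suc k)" using succ_nonadj[of 1 k] assms k3 by (simp add: numeral_2_eq_2)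
  have "\<not> F 0 (k - 1)" using pred_nonadj[of 1 k] assms k3 by simp
  then have n0: "\<not> F (k - 1) 0" using Fsym by blast
  have nW: "\<not> F i W" if "1 < i" "i < k" for i using assms(3)[OF that] Fsym by blast
  have k1: "F (k - 1) (Suc k)" using miss[of "k - 1" W 0 "Suc k"] n0 nW[of "k - 1"] k3 by simp
  define j where "j = (LEAST j. 2 \<le> j \<and> F j (Suc k))"
  have P: "2 \<le> k - 1 \<and> F (k - 1) (Suc k)" using k1 k3 by simp
  have j: "2 \<le> j" "F j (Suc k)" "j \<le> k - 1"
    unfolding j_def using LeastI[of "\<lambda>j. 2 \<le> j \<and> F j (Suc k)", OF P] Least_le[of "\<lambda>j. 2 \<le> j \<and> F j (Suc k)", OF P] by auto
  have "j \<noteq> 2" using n2 j(2) by auto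
  then obtain i where i: "j = Suc i" "2 \<le> i" using j(1) by (cases j) auto
  have "\<not> F i (Suc k)" using not_less_Least[of i "\<lambda>j. 2 \<le> j \<and> F j (Suc k)"] i unfolding j_def by auto
  then have "F i 0" using miss[of i W "Suc k" 0] nW[of i] i j(3) by simp
  then have "F 0 i" using Fsym by blast
  then show False using i j assms(1,2) Fsym[OF assms(1)] Fsym[OF assms(2)] k3
    by (intro noham[of "[0] @ rev [1..<Suc i] @ [W] @ rev [Suc i..<Suc k] @ [Suc k]"])
      (auto simp: successively_append_iff successively_Cons up down hd_append hd_rev last_rev simp del: upt_Suc successively_rev)
qed

text \<open>Vertex \<open>1\<close> misses \<open>W\<close> and \<open>Suc k\<close>, so it sees
  \<open>Suc i\<close>; then \<open>0, W, k, ..., Suc i, 1, ..., i, Suc k\<close> would be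
  Hamiltonian.\<close>

lemma pair_0k:
  assumes "F W 0" "F W k" "\<And>i. 0 < i \<Longrightarrow> i < k \<Longrightarrow> \<not> F W i" "1 \<le> i" "i < k"
  shows "\<not> F i (Suc k)"
proof
  assume F: "F i (Suc k)"
  have n1: "\<not> F 1 (Suc k)" using succ_nonadj[of 0 k] assms k3 by simp
  then have i: "2 \<le> i" using F assms(4) by (cases "i = 1") auto
  have "\<not> F 1 W" using assms(3)[of 1] k3 Fsym by auto
  then have "F 1 (Suc i)" using miss[of 1 W "Suc k" "Suc i"] n1 i assms(5) by simp
  then have "F (Suc i) 1" using Fsym by blast
  then show False using F i assms(1,2,4,5) Fsym[OF assms(1)] k3
    by (intro noham[of "[0] @ [W] @ rev [Suc i..<Suc k] @ [1..<Suc i] @ [Suc k]"])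
      (auto simp: successively_append_iff successively_Cons up down hd_append hd_rev last_rev simp del: upt_Suc successively_rev)
qed

definition mir :: "nat \<Rightarrow> nat" where
  "mir i = (if i \<le> Suc k then Suc k - i else i)"

lemma mir_mir: "mir (mir i) = i"
  unfolding mir_def by auto

lemma mir_le: "mir i \<le> W \<longleftrightarrow> i \<le> W"
  unfolding mir_def by auto

lemma mir_le2: "mir i \<le> Suc (Suc k) \<longleftrightarrow> i \<le> Suc (Suc k)"
  using mir_le[of i] by simp

lemma mirror: "jpath (\<lambda>i j. F (mir i) (mir j)) k"
proof
  show "3 \<le> k" using k3 .
  show "F (mir i) (mir j) \<Longrightarrow> F (mir j) (mir i)" "\<not> F (mir i) (mir i)" for i j using Fsym Firr by auto
  show "F (mir i) (mir (Suc i))" if "i \<le> k" for i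
    using that edge[of "k - i"] Fsym unfolding mir_def by (simp add: Suc_diff_le)
  show "k \<le> card {j \<in> {..k + 2}. F (mir i) (mir j)}" if "1 \<le> i" "i \<le> k" for i
  proof -
    have "bij_betw mir {j \<in> {..k + 2}. F (mir i) (mir j)} {j \<in> {..k + 2}. F (mir i) j}"
      by (rule bij_betw_byWitness[of _ mir]) (auto simp: mir_mir mir_le2)
    then have "card {j \<in> {..k + 2}. F (mir i) (mir j)} = card {j \<in> {..k + 2}. F (mir i) j}"
      by (rule bij_betw_same_card)
    moreover have "1 \<le> mir i" "mir i \<le> k" using that unfolding mir_def by auto
    ultimately show ?thesis using Fdeg by simp
  qed
  show False if xs: "distinct xs" "set xs = {..k + 2}" "hd xs = 0" "last xs = Suc k"
      "successively (\<lambda>i j. F (mir i) (mir j)) xs" for xs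
  proof (rule noham[of "rev (map mir xs)"])
    have ne: "xs \<noteq> []" using xs(2) by auto
    have "inj mir" by (rule inj_on_inverseI[of _ mir]) (simp add: mir_mir)
    then show "distinct (rev (map mir xs))" using xs(1) inj_on_subset[of mir UNIV] by (auto simp: distinct_map)
    have "mir ` {..k + 2} = {..k + 2}"
    proof
      show "{..k + 2} \<subseteq> mir ` {..k + 2}"
      proof
        fix x assume "x \<in> {..k + 2}"
        then show "x \<in> mir ` {..k + 2}" using mir_mir[of x] mir_le[of x] by (metis atMost_iff imageI)
      qed
    qed (auto simp: mir_le2)
    then show "set (rev (map mir xs)) = {..k + 2}" using xs(2) by simp
    show "hd (rev (map mir xs)) = 0" "last (rev (map mir xs)) = Suc k"
      using xs(3,4) ne by (auto simp: hd_rev last_rev last_map hd_map mir_def)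
    show "successively F (rev (map mir xs))"
      using xs(5) Fsym by (auto simp: successively_map elim!: successively_mono)
  qed
qed

text \<open>If \<open>k = 3\<close> and \<open>W\<close> sees the middle vertex 2, the last
  alternative results. Otherwise the first two neighbours \<open>a < b\<close> of \<open>W\<close>
  satisfy \<open>a \<le> 1\<close> and \<open>k \<le> b\<close>, by \<open>pair_low\<close> and its
  mirror image when \<open>4 \<le> k\<close>. Of the four pairs left, \<open>(0, k)\<close> and
  \<open>(1, Suc k)\<close> give the first two alternatives; \<open>(0, Suc k)\<close> contradicts
  the inner neighbour \<open>i0\<close>, and \<open>(1, k)\<close> contradicts
  \<open>pair_1k\<close>.\<close>

lemma classify:
  assumes "1 \<le> i0" "i0 \<le> k" "F W i0" "j0 \<le> Suc k" "j0 \<noteq> i0" "F W j0"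
  shows "(\<forall>i. 1 \<le> i \<longrightarrow> i < k \<longrightarrow> \<not> F W i \<and> \<not> F i (Suc k)) \<or>
    (\<forall>i. 2 \<le> i \<longrightarrow> i \<le> k \<longrightarrow> \<not> F W i \<and> \<not> F i 0) \<or>
    (k = 3 \<and> \<not> F 1 3 \<and> \<not> F W 1 \<and> \<not> F W 3)"
proof (cases "k = 3 \<and> F W 2")
  case True
  then have k: "k = 3" "F 5 2" by auto
  have n13: "\<not> F W 1" "\<not> F W 3" using noconsec[of 1] noconsec[of 2] k by (auto simp: numeral_eq_Suc)
  have "\<exists>j\<le>4. j \<noteq> 2 \<and> F 5 j"
  proof (cases "i0 = 2")
    case True then show ?thesis using assms k by (intro exI[of _ j0]) auto
  next
    case False then show ?thesis using assms k by (intro exI[of _ i0]) auto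
  qed
  then obtain j where j: "j \<le> 4" "j \<noteq> 2" "F 5 j" by blast
  have "j \<noteq> 1" "j \<noteq> 3" using j n13 k by auto
  then have "j = 0 \<or> j = 4" using j by linarith
  moreover have ed: "F 0 1" "F 1 2" "F 2 3" "F 3 4" using edge[of 0] edge[of 1] edge[of 2] edge[of 3] k by (auto simp: numeral_eq_Suc)
  have set5: "{..5::nat} = {0,1,2,3,4,5}" by (auto simp: atMost_Suc numeral_eq_Suc)
  have "\<not> F 1 3" if "F 5 0"
  proof
    assume "F 1 3"
    then show False using that k ed Fsym set5 by (intro noham[of "[0,5,2,1,3,4]"]) auto
  qed
  moreover have "\<not> F 1 3" if "F 5 4"
  proof
    assume "F 1 3"
    then show False using that k ed Fsym set5 by (intro noham[of "[0,1,3,2,5,4]"]) auto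
  qed
  ultimately show ?thesis using j n13 k by auto
next
  case False
  define N where "N = {i. i \<le> Suc k \<and> F W i}"
  have finN: "finite N" unfolding N_def by simp
  define a where "a = Min N"
  have neN: "N \<noteq> {}" using assms unfolding N_def by auto
  have a: "a \<in> N" "\<And>i. i \<in> N \<Longrightarrow> a \<le> i" unfolding a_def using finN neN by auto
  have "i0 \<in> N" "j0 \<in> N" using assms unfolding N_def by auto
  then have "N - {a} \<noteq> {}" using assms(5) by blast
  define b where "b = Min (N - {a})"
  have b: "b \<in> N" "b \<noteq> a" "\<And>i. i \<in> N \<Longrightarrow> i \<noteq> a \<Longrightarrow> b \<le> i"
    unfolding b_def using finN \<open>N - {a} \<noteq> {}\<close> Min_in[of "N - {a}"] Min_le[of "N - {a}"] by auto
  have ab: "a < b" using a(2)[OF b(1)] b(2) by simp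
  have Fab: "F W a" "F W b" "b \<le> Suc k" using a b unfolding N_def by auto
  have btw: "\<not> F W i" if "a < i" "i < b" for i
    using b(3)[of i] that Fab(3) unfolding N_def by auto
  have nc: "b \<noteq> Suc a" using noconsec[of a] Fab ab by auto
  have kb: "k \<le> b"
  proof (rule ccontr)
    assume "\<not> k \<le> b"
    then have bk: "b < k" by simp
    show False
    proof (cases "4 \<le> k")
      case True then show False using pair_low[OF _ Fab(1,2) ab bk btw] by blast
    next
      case F4: False
      then have "k = 3" using k3 by simp
      then have "b = 2" using bk ab nc by linarith
      then show False using False Fab \<open>k = 3\<close> by simp
    qed
  qed
  have a1: "a \<le> 1"
  proof (rule ccontr)
    assume a2: "\<not> a \<le> 1"
    show False
    proof (cases "4 \<le> k")
      case True
      interpret M: jpath "\<lambda>i j. F (mir i) (mir j)" k by (rule mirror)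
      show False
      proof (rule M.pair_low[OF True, of "Suc k - b" "Suc k - a"])
        have "mir W = W" "mir (Suc k - b) = b" "mir (Suc k - a) = a" using Fab(3) ab unfolding mir_def by auto
        then show "F (mir W) (mir (Suc k - b))" "F (mir W) (mir (Suc k - a))" using Fab by auto
        show "Suc k - b < Suc k - a" "Suc k - a < k" using ab Fab(3) a2 by auto
        show "\<not> F (mir W) (mir i)" if "Suc k - b < i" "i < Suc k - a" for i
        proof -
          have "mir W = W" "mir i = Suc k - i" using that unfolding mir_def by auto
          moreover have "a < Suc k - i" "Suc k - i < b" using that Fab(3) by auto
          ultimately show ?thesis using btw[of "Suc k - i"] by simp
        qed
      qed
    next
      case F4: False
      then have "k = 3" using k3 by simp
      then have "a = 2" using a2 ab nc Fab(3) by linarith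
      then show False using False Fab \<open>k = 3\<close> by simp
    qed
  qed
  have only: "i = a \<or> i = b" if "F W i" "i \<le> Suc k" for i
  proof (rule ccontr)
    assume n: "\<not> (i = a \<or> i = b)"
    then have "b \<le> i" using b(3)[of i] that unfolding N_def by auto
    then have "b = k" "i = Suc k" using n kb that(2) by linarith+
    then show False using noconsec[of k] Fab that by auto
  qed
  consider "a = 0" "b = k" | "a = 1" "b = Suc k" | "a = 0" "b = Suc k" | "a = 1" "b = k"
    using kb a1 Fab(3) by linarith
  then show ?thesis
  proof cases
    case 1
    have "\<not> F W i \<and> \<not> F i (Suc k)" if "1 \<le> i" "i < k" for i
      using pair_0k[of i] that Fab 1 btw by auto
    then show ?thesis by blast
  next
    case 2
    interpret M: jpath "\<lambda>i j. F (mir i) (mir j)" k by (rule mirror)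
    have e: "mir W = W" "mir 0 = Suc k" "mir k = 1" "mir (Suc k) = 0" unfolding mir_def by auto
    have "\<not> F W i \<and> \<not> F i 0" if i: "2 \<le> i" "i \<le> k" for i
    proof -
      have m: "mir (Suc k - i) = i" using i unfolding mir_def by auto
      have "\<not> F (mir (Suc k - i)) (mir (Suc k))"
      proof (rule M.pair_0k)
        show "F (mir W) (mir 0)" "F (mir W) (mir k)" using e Fab 2 by auto
        show "\<not> F (mir W) (mir i)" if "0 < i" "i < k" for i
        proof -
          have "mir i = Suc k - i" using that unfolding mir_def by auto
          then show ?thesis using btw[of "Suc k - i"] that 2 e by auto
        qed
      qed (use i in auto)
      moreover have "\<not> F W i" using btw[of i] i 2 by auto
      ultimately show ?thesis using m e by simp
    qed
    then show ?thesis by blast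
  next
    case 3
    then show ?thesis using only[OF assms(3)] assms(1,2) by auto
  next
    case 4
    then show ?thesis using pair_1k Fab btw by auto
  qed
qed

end

section \<open>Arcs closed under adjacency\<close>

context degree_graph
begin

definition sep :: "'a set \<Rightarrow> 'a set \<Rightarrow> bool" where
  "sep X S \<longleftrightarrow> X \<subseteq> V \<and> X \<inter> S = {} \<and> (\<forall>v\<in>X. \<forall>u. E v u \<longrightarrow> u \<in> X \<or> u \<in> S)"

text \<open>The next five properties describe subgraphs of the extremal graphs by separations. The remaining
  family \<open>K\<^sub>2 + M\<^sub>t\<close> for \<open>k = 3\<close> is not needed.\<close>

definition shape_F1 :: bool where
  "shape_F1 \<longleftrightarrow> (\<exists>p q J. p \<in> V \<and> q \<in> V \<and> p \<noteq> q \<and> sep J {p, q} \<and> card J \<le> k \<and>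
     (\<forall>v\<in>V - {p, q} - J. \<exists>X. v \<in> X \<and> sep X {p, q} \<and> card X \<le> k - 1))"

definition shape_F :: bool where
  "shape_F \<longleftrightarrow> (\<exists>x y z. x \<in> V \<and> y \<in> V \<and> z \<in> V \<and> x \<noteq> y \<and> x \<noteq> z \<and> y \<noteq> z \<and>
     (\<forall>v\<in>V - {x, y, z}. \<exists>X. v \<in> X \<and> card X \<le> k - 1 \<and> X \<inter> {x, y, z} = {} \<and> (sep X {x, z} \<or> sep X {y, z})))"

definition shape_M :: bool where
  "shape_M \<longleftrightarrow> k = 4 \<and> (\<exists>S\<subseteq>V. card S = 3 \<and> (\<forall>v\<in>V - S. \<exists>X. v \<in> X \<and> sep X S \<and> card X \<le> 2))"

text \<open>\<open>j\<close> is the centre of the star, vertices of the first kind are its leaves,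
  and \<open>p\<close>, \<open>q\<close> form the complete graph that is joined to
  everything.\<close>

definition shape_S :: bool where
  "shape_S \<longleftrightarrow> k = 3 \<and> (\<exists>p q j. p \<in> V \<and> q \<in> V \<and> j \<in> V \<and> p \<noteq> q \<and> p \<noteq> j \<and> q \<noteq> j \<and>
     (\<forall>v\<in>V - {p, q, j}. (\<forall>u. E v u \<longrightarrow> u \<in> {p, q, j}) \<or>
        (\<exists>X. v \<in> X \<and> j \<notin> X \<and> card X \<le> 2 \<and> sep X {p, q})))"

text \<open>Part \<open>C\<close> of \<open>H_graph\<close> has one vertex for
  \<open>l = 2 * k + 1\<close> and two for \<open>l = 2 * k + 2\<close>; the pair \<open>y\<close>,
  \<open>y'\<close> is the edge inside \<open>C\<close> in the second case.\<close>

definition shape_H :: bool where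
  "shape_H \<longleftrightarrow> 2 * k + 1 \<le> card V \<and> (\<exists>A\<subseteq>V. card A = k \<and> ((\<forall>u\<in>V - A. \<forall>v\<in>V - A. \<not> E u v) \<or>
     (2 * k + 2 \<le> card V \<and> (\<exists>y y'. \<forall>u\<in>V - A. \<forall>v\<in>V - A. E u v \<longrightarrow> {u, v} = {y, y'}))))"

lemma comp_sep: "cpt Y D \<Longrightarrow> sep D (att Y D)"
  unfolding sep_def using compD(2,3,6) by (fastforce simp: att_iff)

lemma sep_mono: "sep X S \<Longrightarrow> S \<subseteq> T \<Longrightarrow> X \<inter> T = {} \<Longrightarrow> sep X T"
  unfolding sep_def by blast

lemma sepD: "sep X S \<Longrightarrow> v \<in> X \<Longrightarrow> E v u \<Longrightarrow> u \<in> X \<or> u \<in> S"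
  unfolding sep_def by blast

text \<open>By symmetry an edge from \<open>D\<close> into \<open>X\<close> would lead from
  \<open>X\<close> to a vertex off \<open>Y\<close>, hence outside \<open>X\<close> and
  \<open>S\<close>.\<close>

lemma sep_att: "sep X S \<Longrightarrow> X \<subseteq> Y \<Longrightarrow> S \<subseteq> Y \<Longrightarrow> cpt Y D \<Longrightarrow> att Y D \<inter> X = {}"
  unfolding sep_def using compD(3) sym by (fastforce simp: att_iff)

lemma att_sub:
  assumes "cpt Y D" "Y = R \<union> I" "S \<subseteq> Y" "sep I S"
  shows "att Y D \<subseteq> R"
  using sep_att[OF assms(4) _ assms(3,1)] assms(2) unfolding att_def by blast

lemma att_sub2:
  assumes "cpt Y D" "Y = R \<union> I \<union> J" "S \<subseteq> Y" "sep I S" "T \<subseteq> Y" "sep J T"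
  shows "att Y D \<subseteq> R"
proof -
  have "att Y D \<subseteq> R \<union> I" using att_sub[OF assms(1) _ assms(5,6)] assms(2) by blast
  moreover have "att Y D \<inter> I = {}" using sep_att[OF assms(4) _ assms(3,1)] assms(2) by blast
  ultimately show ?thesis by blast
qed

lemma sep_comp:
  assumes "cpt Y D" "att Y D \<subseteq> S" "S \<subseteq> Y"
  shows "sep D S"
  using sep_mono[OF comp_sep[OF assms(1)] assms(2)] compD(3)[OF assms(1)] assms(3) by blast

lemma card_seg: "cyc P c \<Longrightarrow> b \<le> c \<Longrightarrow> card (P ` {a..<b}) = b - a"
  using cyc_card[of P c "{a..<b}"] by (auto simp: subset_iff)

lemma card_seg2: "cyc P c \<Longrightarrow> b \<le> c \<Longrightarrow> card (P ` {a<..<b}) = b - a - 1"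
  using cyc_card[of P c "{a<..<b}"] by (auto simp: subset_iff)

end

section \<open>Exchanging a component with an arc of the same size\<close>

context circumference_graph
begin

lemma comp_small:
  assumes "lcyc Y" "cpt Y D" "3 \<le> k"
  shows "card D \<le> k - 1"
proof (cases "D \<subseteq> {w}")
  case True
  then have "card D \<le> card {w}" by (intro card_mono) auto
  then show ?thesis using assms(3) by simp
next
  case False
  then show ?thesis using comp_struct(1,2)[OF assms(1,2)] by fastforce
qed

text \<open>\<open>D\<close> always contains a vertex that sees all attachments: any vertex other
  than \<open>w\<close>, or \<open>w\<close> itself when \<open>D = {w}\<close>.\<close>

lemma comp_consec:
  assumes "cyc P c" "cpt (P ` {..<c}) D" "i < j" "j < c" "j < i + 2 \<or> c + i < j + 2"
    "P i \<in> att (P ` {..<c}) D" "P j \<in> att (P ` {..<c}) D"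
  shows False
proof -
  note C = compD[OF assms(2)]
  have "\<exists>v\<in>D. E v (P i) \<and> E v (P j)"
  proof (cases "D \<subseteq> {w}")
    case True
    then show ?thesis using assms(6,7) unfolding att_iff by blast
  next
    case False
    then obtain v where v: "v \<in> D" "v \<noteq> w" by blast
    have "P i \<noteq> v" "P j \<noteq> v" using v C(3) assms(3,4) by auto
    then show ?thesis using comp_struct(3)[OF lcyc_cyc[OF assms(1)] assms(2) False v] assms(6,7) v by blast
  qed
  then obtain v where v: "v \<in> D" "E v (P i)" "E v (P j)" by blast
  have "v \<notin> P ` {..<c}" using v C(3) by blast
  then show False using not_consecutive[OF assms(1,3,4) v(2,3)] assms(5) by linarith
qed

text \<open>After the exchange the released arc lies in one component \<open>D'\<close> off the new
  longest cycle. Two attachments are the least possible number, so \<open>card D = k - 1\<close> is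
  the greatest possible size. Hence \<open>D'\<close> is just the arc, and its two attachments are
  the ends of the arc.\<close>

lemma arc_closed:
  assumes "cyc P c" "cpt (P ` {..<c}) D" "w \<notin> D \<or> 3 \<le> card D" "att (P ` {..<c}) D = {P i, P j}"
    and "i < j" "j < c" "j = i + card D + 1" "2 \<le> card D"
  shows "sep (P ` {i<..<j}) {P i, P j}"
proof -
  let ?Y = "P ` {..<c}"
  note L = lcyc_cyc[OF assms(1)] and C = compD[OF assms(2)] and inj = cyc_inj[OF assms(1)]
  have Dw: "\<not> D \<subseteq> {w}"
  proof
    assume "D \<subseteq> {w}"
    then have "card D \<le> card {w}" by (intro card_mono) auto
    then show False using assms(8) by simp
  qed
  have "card (att ?Y D) = 2" using assms(4-6) inj by simp
  then have k: "Suc k = card D + 2" using comp_struct(1)[OF L assms(2) Dw] by simp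
  obtain x t where xt: "E (P i) x" "E t (P j)" "pth x t D"
    using span_all[OF L assms(2,3), of "P i" "P j"] assms(4) by blast
  let ?Z = "D \<union> P ` ({..i} \<union> {j..<c})"
  note Z = ear_out[OF assms(1,5,6) xt(3) C(3) xt(1,2)]
  have LZ: "lcyc ?Z" unfolding lcyc_def using Z assms(7) by simp
  have out: "P l \<notin> ?Z" if "i < l" "l < j" for l
    using that assms(5,6) by (intro pos_notin[OF assms(1) C(3)]) auto
  have i1: "Suc i < j" using assms(7,8) by simp
  have "P (Suc i) \<in> V" using lcycD(3)[OF L] i1 assms(6) by auto
  then obtain D' where D': "cpt ?Z D'" "P (Suc i) \<in> D'" using comp_ex out i1 by blast
  have all: "P l \<in> D'" if "i < l" "l < j" for l
    using that
  proof (induction l)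
    case (Suc l)
    show ?case
    proof (cases "l = i")
      case False
      then have "P l \<in> D'" using Suc by simp
      moreover have "E (P l) (P (Suc l))" using cyc_edge[OF assms(1)] Suc.prems assms(6) by simp
      ultimately show ?thesis using compD(6)[OF D'(1)] out[OF Suc.prems] by blast
    qed (use D' in simp)
  qed simp
  have cI: "card (P ` {i<..<j}) = card D"
    using card_seg2[OF assms(1), of j i] assms(6,7) by simp
  have sub: "P ` {i<..<j} \<subseteq> D'" using all by auto
  have fD': "finite D'" using compD(5)[OF D'(1)] .
  have "P (Suc i) \<noteq> P (Suc (Suc i))" using inj[of "Suc i" "Suc (Suc i)"] assms(6-8) by simp
  then have D'w: "\<not> D' \<subseteq> {w}" using all[of "Suc i"] all[of "Suc (Suc i)"] assms(7,8) by auto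
  note S = comp_struct(1,2)[OF LZ D'(1) D'w]
  have "card D \<le> card D'" using card_mono[OF fD' sub] cI by simp
  then have cc: "card D' = card D" "card (att ?Z D') = 2" using S k by linarith+
  have eq: "P ` {i<..<j} = D'" using sub fD' cI cc by (intro card_subset_eq) auto
  have "E (P (Suc i)) (P i)" using cyc_edge[OF assms(1), of i] sym i1 assms(6) by simp
  moreover have "E (P (j - 1)) (P j)" using cyc_edge[OF assms(1), of "j - 1"] i1 assms(6) by simp
  moreover have "P (j - 1) \<in> D'" using all i1 by simp
  moreover have "P i \<in> ?Z" "P j \<in> ?Z" using assms(6) by auto
  ultimately have "P i \<in> att ?Z D'" "P j \<in> att ?Z D'" unfolding att_iff using D'(2) by blast+
  then have "{P i, P j} \<subseteq> att ?Z D'" by simp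
  moreover have "card {P i, P j} = 2" using inj[of i j] assms(5,6) by simp
  moreover have "finite (att ?Z D')" using lcycD(4)[OF LZ] by (simp add: att_def)
  ultimately have "att ?Z D' = {P i, P j}" using cc by (metis card_subset_eq)
  then show ?thesis using comp_sep[OF D'(1)] eq by simp
qed

text \<open>Serves to exchange the roles of the two ends \<open>0\<close> and \<open>Suc k\<close>
  of the long arc.\<close>

lemma mirror_cycle:
  assumes "cyc P c" "c = 2 * k + 1"
  shows "\<exists>Q. cyc Q c \<and> Q ` {..<c} = P ` {..<c} \<and> (\<forall>i\<le>Suc k. Q i = P (Suc k - i)) \<and> Q ` {k + 2..<c} = P ` {k + 2..<c}"
proof -
  let ?R = "\<lambda>i. P ((c - i) mod c)"
  let ?Q = "\<lambda>i. ?R ((i + k) mod c)"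
  have R: "cyc ?R c" "?R ` {..<c} = P ` {..<c}" using cyc_reflect[OF assms(1)] by auto
  have Q: "cyc ?Q c" "?Q ` {..<c} = P ` {..<c}" using cyc_rotate[OF R(1), of k] R(2) assms(2) by auto
  have q1: "?Q i = P (Suc k - i)" if "i \<le> Suc k" for i
  proof (cases "i = Suc k")
    case True
    then have "i + k = c" using assms(2) by simp
    then show ?thesis using True by simp
  next
    case False
    then have "(c - (i + k) mod c) mod c = Suc k - i" using that assms(2) k2 by simp
    then show ?thesis by simp
  qed
  have q2: "?Q i = P (3 * k + 2 - i)" if "k + 2 \<le> i" "i < c" for i
  proof -
    have "(i + k) mod c = i - k - 1" using that assms(2) by (simp add: le_mod_geq)
    then have "(c - (i + k) mod c) mod c = 3 * k + 2 - i" using that assms(2) by simp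
    then show ?thesis by simp
  qed
  have "?Q ` {k + 2..<c} = P ` (\<lambda>i. 3 * k + 2 - i) ` {k + 2..<c}"
    using q2 by (auto simp: image_image)
  moreover have "(\<lambda>i. 3 * k + 2 - i) ` {k + 2..<c} = {k + 2..<c}"
  proof (rule endo_inj_surj)
    show "inj_on (\<lambda>i. 3 * k + 2 - i) {k + 2..<c}" using assms(2) by (auto simp: inj_on_def)
  qed (use assms(2) in auto)
  ultimately have "?Q ` {k + 2..<c} = P ` {k + 2..<c}" by simp
  then show ?thesis using Q q1 by (intro exI[of _ ?Q]) auto
qed

lemma split_I: "cyc P c \<Longrightarrow> c = 2 * k + 1 \<Longrightarrow> P ` {..<c} = P ` {..Suc k} \<union> P ` {k + 2..<c}"
proof -
  assume "c = 2 * k + 1"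
  then have "{..<c} = {..Suc k} \<union> {k + 2..<c}" using k2 by auto
  then show ?thesis by (metis image_Un)
qed

lemma att_low:
  assumes "cyc P c" "c = 2 * k + 1" "sep (P ` {k + 2..<c}) {P 0, P (Suc k)}" "cpt (P ` {..<c}) D"
  shows "att (P ` {..<c}) D \<subseteq> P ` {..Suc k}"
proof -
  have "{P 0, P (Suc k)} \<subseteq> P ` {..<c}" using assms(2) k2 by auto
  then show ?thesis using att_sub[OF assms(4) split_I[OF assms(1,2)] _ assms(3)] by blast
qed

text \<open>The hubs are \<open>x = P (Suc k)\<close>, \<open>y = P k\<close> and
  \<open>z = P 0\<close>. A component off the cycle attaches to hubs only, and never to both
  \<open>x\<close> and \<open>y\<close>, which are consecutive.\<close>

lemma closed_arc_F:
  assumes "cyc P c" "c = 2 * k + 1" "3 \<le> k" "sep (P ` {k + 2..<c}) {P 0, P (Suc k)}"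
    and "sep (P ` {0<..<k}) {P 0, P k}"
  shows shape_F
proof -
  let ?Y = "P ` {..<c}" and ?I = "P ` {k + 2..<c}" and ?J = "P ` {0<..<k}"
  note L = lcyc_cyc[OF assms(1)] and inj = cyc_inj[OF assms(1)]
  have YV: "?Y \<subseteq> V" using lcycD(3)[OF L] .
  have dist: "P (Suc k) \<noteq> P k" "P (Suc k) \<noteq> P 0" "P k \<noteq> P 0" using inj assms(2,3) by auto
  have cI: "card ?I = k - 1" "card ?J = k - 1"
    using card_seg[OF assms(1), of c "k + 2"] card_seg2[OF assms(1), of k 0] assms(2) by auto
  have sI: "sep ?I {P (Suc k), P 0}" using assms(4) by (simp add: insert_commute)
  have sJ: "sep ?J {P k, P 0}" using assms(5) by (simp add: insert_commute)
  have dI: "?I \<inter> {P (Suc k), P k, P 0} = {}" "?J \<inter> {P (Suc k), P k, P 0} = {}"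
    using inj assms(2) by fastforce+
  have Yeq: "?Y = {P (Suc k), P k, P 0} \<union> ?I \<union> ?J"
  proof -
    have "{..<c} = {Suc k, k, 0} \<union> {k + 2..<c} \<union> {0<..<k}" using assms(2,3) by auto
    then have "?Y = P ` ({Suc k, k, 0} \<union> {k + 2..<c} \<union> {0<..<k})" by simp
    then show ?thesis by (simp add: image_Un)
  qed
  have "\<exists>X. v \<in> X \<and> card X \<le> k - 1 \<and> X \<inter> {P (Suc k), P k, P 0} = {} \<and> (sep X {P (Suc k), P 0} \<or> sep X {P k, P 0})"
    if v: "v \<in> V - {P (Suc k), P k, P 0}" for v
  proof -
    consider "v \<in> ?I" | "v \<in> ?J" | "v \<in> V - ?Y" using v unfolding Yeq by auto
    then show ?thesis
    proof cases
      case 1 then show ?thesis using cI sI dI by (intro exI[of _ ?I]) simp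
    next
      case 2 then show ?thesis using cI sJ dI by (intro exI[of _ ?J]) simp
    next
      case 3
      obtain D where D: "cpt ?Y D" "v \<in> D" using comp_ex[OF 3] by blast
      have sub: "{P (Suc k), P k, P 0} \<subseteq> ?Y" using assms(2,3) by auto
      have a: "att ?Y D \<subseteq> {P (Suc k), P k, P 0}"
        by (rule att_sub2[OF D(1) Yeq _ sI _ sJ]) (use sub in auto)
      have "\<not> (P k \<in> att ?Y D \<and> P (Suc k) \<in> att ?Y D)"
        using comp_consec[OF assms(1) D(1), of k "Suc k"] assms(2,3) by auto
      then have "att ?Y D \<subseteq> {P (Suc k), P 0} \<or> att ?Y D \<subseteq> {P k, P 0}" using a by auto
      moreover have dd: "D \<inter> {P (Suc k), P k, P 0} = {}" using compD(3)[OF D(1)] sub by auto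
      ultimately have "sep D {P (Suc k), P 0} \<or> sep D {P k, P 0}"
        using sep_comp[OF D(1)] sub by auto
      then show ?thesis using D(2) dd comp_small[OF L D(1) assms(3)] by blast
    qed
  qed
  moreover have "P (Suc k) \<in> V" "P k \<in> V" "P 0 \<in> V" using YV assms(2,3) by auto
  ultimately show ?thesis unfolding shape_F_def using dist
    by (intro exI[of _ "P (Suc k)"] exI[of _ "P k"] exI[of _ "P 0"]) auto
qed

lemma closed_arc_F_mirror:
  assumes "cyc P c" "c = 2 * k + 1" "3 \<le> k" "sep (P ` {k + 2..<c}) {P 0, P (Suc k)}"
    and "sep (P ` {1<..<Suc k}) {P 1, P (Suc k)}"
  shows shape_F
proof -
  obtain Q where Q: "cyc Q c" "Q ` {..<c} = P ` {..<c}" "\<And>i. i \<le> Suc k \<Longrightarrow> Q i = P (Suc k - i)"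
    "Q ` {k + 2..<c} = P ` {k + 2..<c}" using mirror_cycle[OF assms(1,2)] by blast
  have "Q ` {0<..<k} = P ` (\<lambda>i. Suc k - i) ` {0<..<k}" using Q(3) by (auto simp: image_image)
  also have "(\<lambda>i. Suc k - i) ` {0<..<k} = {1<..<Suc k}"
  proof -
    have "x \<in> (\<lambda>i. Suc k - i) ` {0<..<k}" if "x \<in> {1<..<Suc k}" for x
      using that by (intro image_eqI[of _ _ "Suc k - x"]) auto
    then show ?thesis by auto
  qed
  finally have "sep (Q ` {0<..<k}) {Q 0, Q k}" using assms(5) Q(3)[of 0] Q(3)[of k] by (simp add: insert_commute)
  moreover have "sep (Q ` {k + 2..<c}) {Q 0, Q (Suc k)}"
    using assms(4) Q(4) Q(3)[of 0] Q(3)[of "Suc k"] by (simp add: insert_commute)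
  ultimately show ?thesis using closed_arc_F[OF Q(1) assms(2,3)] by blast
qed

text \<open>\<open>P 4\<close> and \<open>P 0\<close> are the two joined vertices and
  \<open>P 2\<close> is the centre of the star. A component of two vertices cannot attach to
  \<open>P 2\<close>: its attachments are at least three steps apart, while \<open>P 0\<close> and
  \<open>P 4\<close> are only two steps away from \<open>P 2\<close>.\<close>

lemma closed_arc_S:
  assumes "cyc P c" "c = 2 * k + 1" "k = 3" "sep (P ` {k + 2..<c}) {P 0, P (Suc k)}"
    and "\<And>u. E (P 1) u \<Longrightarrow> u \<in> {P 4, P 0, P 2}" "\<And>u. E (P 3) u \<Longrightarrow> u \<in> {P 4, P 0, P 2}"
    and W: "\<And>D. cpt (P ` {..<c}) D \<Longrightarrow> w \<in> D \<Longrightarrow> D = {w}"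
  shows shape_S
proof -
  let ?Y = "P ` {..<c}" and ?I = "P ` {k + 2..<c}"
  note L = lcyc_cyc[OF assms(1)] and inj = cyc_inj[OF assms(1)]
  have YV: "?Y \<subseteq> V" using lcycD(3)[OF L] .
  have c: "c = 7" using assms(2,3) by simp
  have lessc: "{..<c} = {0,1,2,3,4} \<union> {k + 2..<c}" using assms(2,3) by auto
  have Yeq: "?Y = {P 0, P 1, P 2, P 3, P 4} \<union> ?I"
    unfolding lessc[THEN arg_cong[where f = "\<lambda>A. P ` A"]] by auto
  have cI: "card ?I = 2" using card_seg[OF assms(1), of c "k + 2"] assms(2,3) by simp
  have dI: "P 2 \<notin> ?I" using inj c assms(3) by fastforce
  have sI: "sep ?I {P 4, P 0}" using assms(3,4) by (simp add: insert_commute)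
  have M: "(\<forall>u. E v u \<longrightarrow> u \<in> {P 4, P 0, P 2}) \<or> (\<exists>X. v \<in> X \<and> P 2 \<notin> X \<and> card X \<le> 2 \<and> sep X {P 4, P 0})"
    if v: "v \<in> V - {P 4, P 0, P 2}" for v
  proof -
    consider "v \<in> ?I" | "v = P 1" | "v = P 3" | "v \<in> V - ?Y" using v unfolding Yeq by auto
    then show ?thesis
    proof cases
      case 1 then show ?thesis using cI sI dI by (intro disjI2 exI[of _ ?I]) simp
    next
      case 2 then show ?thesis using assms(5) by blast
    next
      case 3 then show ?thesis using assms(6) by blast
    next
      case 4
      obtain D where D: "cpt ?Y D" "v \<in> D" using comp_ex[OF 4] by blast
      note C = compD[OF D(1)]
      have sub: "{P 4, P 0, P 2} \<subseteq> ?Y" using c by auto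
      have "att ?Y D \<subseteq> {P 0, P 1, P 2, P 3, P 4}"
        by (rule att_sub[OF D(1) Yeq _ sI]) (use sub in auto)
      moreover have "P 1 \<notin> att ?Y D" "P 3 \<notin> att ?Y D"
      proof -
        have "P 4 \<notin> D" "P 0 \<notin> D" "P 2 \<notin> D" using C(3) c by auto
        then show "P 1 \<notin> att ?Y D" "P 3 \<notin> att ?Y D"
          using assms(5,6) sym unfolding att_iff by blast+
      qed
      ultimately have a: "att ?Y D \<subseteq> {P 4, P 0, P 2}" by auto
      show ?thesis
      proof (cases "card D = 1")
        case True
        then have "D = {v}" using D(2) by (metis card_1_singletonE singletonD)
        then have "u \<in> att ?Y D" if "E v u" for u using C(6)[OF D(2) that] that irrefl by (auto simp: att_iff)
        then have "\<forall>u. E v u \<longrightarrow> u \<in> {P 4, P 0, P 2}" using a by blast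
        then show ?thesis by blast
      next
        case False
        have wD: "w \<notin> D" using W[OF D(1)] False by auto
        then have Dw: "\<not> D \<subseteq> {w}" using D(2) by blast
        have "card D \<noteq> 0" using C(1,5) by auto
        then have c2: "card D = 2" using comp_small[OF L D(1)] assms(3) False by simp
        have "P 2 \<notin> att ?Y D"
        proof
          assume p2: "P 2 \<in> att ?Y D"
          have "att ?Y D \<noteq> {P 2}" using comp_struct(2)[OF L D(1) Dw] by auto
          then have "P 0 \<in> att ?Y D \<or> P 4 \<in> att ?Y D" using a p2 by auto
          then show False
            using comp_gap[OF assms(1) D(1) _ _ _ _ p2, of 0] comp_gap[OF assms(1) D(1) _ _ _ p2, of 4] wD c c2 by auto
        qed
        then have "att ?Y D \<subseteq> {P 4, P 0}" using a by auto
        then have "sep D {P 4, P 0}" by (rule sep_comp[OF D(1)]) (use sub in auto)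
        moreover have "P 2 \<notin> D" using C(3) sub by auto
        ultimately show ?thesis using D(2) c2 by (intro disjI2 exI[of _ D]) simp
      qed
    qed
  qed
  have VV: "P 4 \<in> V" "P 0 \<in> V" "P 2 \<in> V" using YV c by auto
  have NE: "P 4 \<noteq> P 0" "P 4 \<noteq> P 2" "P 0 \<noteq> P 2" using inj c by auto
  show ?thesis unfolding shape_S_def
    by (rule conjI, rule assms(3), rule exI[of _ "P 4"], rule exI[of _ "P 0"], rule exI[of _ "P 2"])
      (use M VV NE in simp)
qed

end

section \<open>The long arc opposite a closed arc\<close>

context circumference_graph
begin

lemma list_bound:
  assumes "distinct xs" "successively E xs" "E (last xs) (hd xs)" "3 \<le> length xs"
  shows "length xs \<le> c"
proof -
  have "pth (hd xs) (last xs) (set xs)" using assms by (intro pthI) auto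
  moreover have "card (set xs) = length xs" using assms(1) distinct_card by blast
  ultimately have "cycset (set xs)" using assms by (intro cycsetI) auto
  then show ?thesis using bound \<open>card (set xs) = length xs\<close> by metis
qed

lemma w_nbrs:
  assumes "lcyc Y" "w \<in> V - Y" and W: "\<And>D. cpt Y D \<Longrightarrow> w \<in> D \<Longrightarrow> D = {w}"
  shows "cpt Y {w}" "\<And>u. E w u \<Longrightarrow> u \<in> Y" "\<exists>u. E w u \<and> u \<noteq> z"
proof -
  obtain D where D: "cpt Y D" "w \<in> D" using comp_ex[OF assms(2)] by blast
  then show cw: "cpt Y {w}" using W by metis
  show "\<And>u. E w u \<Longrightarrow> u \<in> Y" using compD(6)[OF cw] irrefl by blast
  have "2 \<le> card (att Y {w})" using att_two[OF cw] lcycD[OF assms(1)] by simp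
  then have "\<not> att Y {w} \<subseteq> {z}"
    using card_mono[of "{z}" "att Y {w}"] by auto
  then show "\<exists>u. E w u \<and> u \<noteq> z" by (auto simp: att_iff)
qed

text \<open>The long arc with \<open>w\<close> as extra vertex satisfies \<open>jpath\<close>: a
  Hamiltonian path between its ends, completed by the closed arc, would be a cycle of length
  \<open>c + 1\<close>. The outcomes of \<open>classify\<close> are a second closed arc at either
  end, and the star.\<close>

lemma closed_arc_w:
  assumes "cyc P c" "c = 2 * k + 1" "3 \<le> k" "sep (P ` {k + 2..<c}) {P 0, P (Suc k)}"
    and W: "\<And>D. cpt (P ` {..<c}) D \<Longrightarrow> w \<in> D \<Longrightarrow> D = {w}"
    and w: "w \<in> V - P ` {..<c}" "1 \<le> i0" "i0 \<le> k" "E w (P i0)"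
    and oth: "\<And>v i. v \<in> V - P ` {..<c} \<Longrightarrow> v \<noteq> w \<Longrightarrow> 1 \<le> i \<Longrightarrow> i \<le> k \<Longrightarrow> \<not> E v (P i)"
  shows "shape_F \<or> shape_S"
proof -
  let ?Y = "P ` {..<c}" and ?I = "P ` {k + 2..<c}"
  note L = lcyc_cyc[OF assms(1)] and inj = cyc_inj[OF assms(1)]
  \<comment> \<open>Position \<open>k + 2\<close> belongs to the closed arc and is reused as the
    index of \<open>w\<close>.\<close>
  define P' where "P' = P(k + 2 := w)"
  define F where "F i j = E (P' i) (P' j)" for i j
  have P'w: "P' (k + 2) = w" and P'P: "\<And>i. i \<le> Suc k \<Longrightarrow> P' i = P i" unfolding P'_def by auto
  have inY: "P i \<in> ?Y" if "i \<le> Suc k" for i using that assms(2,3) by auto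
  have injP': "inj_on P' {..k + 2}"
  proof (rule inj_onI)
    fix i j assume ij: "i \<in> {..k + 2}" "j \<in> {..k + 2}" "P' i = P' j"
    have "P i \<noteq> w" if "i \<le> Suc k" for i using inY[OF that] w(1) by auto
    then show "i = j" using ij P'w P'P inj[of i j] assms(2,3)
      by (cases "i = k + 2"; cases "j = k + 2") (auto simp: le_Suc_eq)
  qed
  have lowY: "\<exists>j\<le>Suc k. u = P j" if "u \<in> ?Y" "u \<notin> ?I" for u
  proof -
    have "u \<in> P ` {..Suc k}" using that split_I[OF assms(1,2)] by auto
    then show ?thesis by auto
  qed
  have nbr: "(\<exists>j\<le>Suc k. u = P j \<and> F i j) \<or> u = w" if i: "1 \<le> i" "i \<le> k" and e: "E (P i) u" for i u
  proof (cases "u \<in> ?Y")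
    case True
    have "P i \<noteq> P 0" "P i \<noteq> P (Suc k)" "P i \<notin> ?I" using inj i assms(2,3) by fastforce+
    then have "u \<notin> ?I" using sepD[OF assms(4) _ sym[OF e]] by blast
    then obtain j where "j \<le> Suc k" "u = P j" using lowY True by blast
    then show ?thesis using e i P'P unfolding F_def by auto
  next
    case False
    then show ?thesis using oth[of u i] i e sym EV2 by blast
  qed
  have nbw: "\<exists>j\<le>Suc k. u = P j" if "E w u" for u
  proof -
    have "u \<in> ?Y" using w_nbrs(2)[OF L w(1) W that] .
    moreover have "u \<notin> ?I"
    proof
      assume "u \<in> ?I"
      then have "w \<in> ?I \<or> w \<in> {P 0, P (Suc k)}" using sepD[OF assms(4) _ sym[OF that]] by blast
      then show False using w(1) inY[of 0] inY[of "Suc k"] by auto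
    qed
    ultimately show ?thesis using lowY by blast
  qed
  interpret J: jpath F k
  proof
    show "3 \<le> k" by fact
    show "F i j \<Longrightarrow> F j i" "\<not> F i i" for i j unfolding F_def using sym irrefl by auto
    show "F i (Suc i)" if "i \<le> k" for i
      using that cyc_edge[OF assms(1), of i] assms(2,3) P'P unfolding F_def by simp
    show "k \<le> card {j \<in> {..k + 2}. F i j}" if i: "1 \<le> i" "i \<le> k" for i
    proof -
      have "{u. E (P i) u} \<subseteq> P' ` {j \<in> {..k + 2}. F i j}"
      proof
        fix u assume "u \<in> {u. E (P i) u}"
        then have e: "E (P i) u" by simp
        show "u \<in> P' ` {j \<in> {..k + 2}. F i j}"
        proof (cases "u = w")
          case True
          then have "F i (k + 2)" using e i P'P P'w unfolding F_def by auto
          then show ?thesis using True P'w by (intro image_eqI[of _ _ "k + 2"]) auto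
        next
          case False
          then obtain j where "j \<le> Suc k" "u = P j" "F i j" using nbr[OF i e] by blast
          then show ?thesis using P'P by (intro image_eqI[of _ _ j]) auto
        qed
      qed
      then have "card {u. E (P i) u} \<le> card (P' ` {j \<in> {..k + 2}. F i j})" by (intro card_mono) auto
      also have "\<dots> \<le> card {j \<in> {..k + 2}. F i j}" by (intro card_image_le) auto
      finally have "card {u. E (P i) u} \<le> card {j \<in> {..k + 2}. F i j}" .
      moreover have "P i \<in> V" "P i \<noteq> w" using inY[of i] i lcycD(3)[OF L] w(1) by auto
      ultimately show ?thesis using deg[of "P i"] by simp
    qed
    show False if xs: "distinct xs" "set xs = {..k + 2}" "hd xs = 0" "last xs = Suc k" "successively F xs" for xs
    proof -
      have ne: "xs \<noteq> []" using xs(2) by auto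
      have "pth (hd (map P' xs)) (last (map P' xs)) (set (map P' xs))"
        using xs ne injP' by (intro pthI) (auto simp: distinct_map successively_map F_def)
      then have p1: "pth (P 0) (P (Suc k)) (P' ` {..k + 2})"
        using xs ne P'P by (simp add: hd_map last_map)
      have img: "P' ` {..k + 2} = insert w (P ` {..Suc k})"
      proof -
        have "{..k + 2} = insert (k + 2) {..Suc k}" by auto
        then have "P' ` {..k + 2} = insert (P' (k + 2)) (P' ` {..Suc k})" by simp
        moreover have "P' ` {..Suc k} = P ` {..Suc k}" using P'P by (intro image_cong) auto
        ultimately show ?thesis using P'w by simp
      qed
      have p2: "pth (P (k + 2)) (P (c - 1)) (P ` {k + 2..c - 1})" using assms(2,3) by (intro cyc_seg[OF assms(1)]) auto
      have I: "{k + 2..c - 1} = {k + 2..<c}" using assms(2) by auto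
      have e: "E (P (Suc k)) (P (k + 2))" using cyc_edge[OF assms(1), of "Suc k"] assms(2,3) by simp
      have d: "insert w (P ` {..Suc k}) \<inter> ?I = {}"
        using w(1) inj assms(2) by fastforce
      have "pth (P 0) (P (c - 1)) (insert w (P ` {..Suc k}) \<union> ?I)"
        using pth_join[OF p1[unfolded img] e p2[unfolded I] d] .
      then have p3: "pth (P 0) (P (c - 1)) (insert w ?Y)" using split_I[OF assms(1,2)] by simp
      have cd: "card (insert w ?Y) = Suc c" using w(1) lcycD[OF L] by simp
      have "cycset (insert w ?Y)" using cyc_close[OF assms(1)] cd lcycD(5)[OF L] by (intro cycsetI[OF p3]) auto
      then show False using bound cd by fastforce
    qed
  qed
  obtain u where "E w u" "u \<noteq> P i0" using w_nbrs(3)[OF L w(1) W] by blast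
  then obtain j0 where j0: "j0 \<le> Suc k" "E w (P j0)" "j0 \<noteq> i0" using nbw by blast
  have Fw: "F (k + 2) i \<longleftrightarrow> E w (P i)" if "i \<le> Suc k" for i using that P'w P'P unfolding F_def by simp
  have Fi: "F i j \<longleftrightarrow> E (P i) (P j)" if "i \<le> Suc k" "j \<le> Suc k" for i j using that P'P unfolding F_def by simp
  consider "\<forall>i. 1 \<le> i \<longrightarrow> i < k \<longrightarrow> \<not> F (k + 2) i \<and> \<not> F i (Suc k)"
    | "\<forall>i. 2 \<le> i \<longrightarrow> i \<le> k \<longrightarrow> \<not> F (k + 2) i \<and> \<not> F i 0"
    | "k = 3" "\<not> F 1 3" "\<not> F (k + 2) 1" "\<not> F (k + 2) 3"
    using J.classify[of i0 j0] w j0 Fw by auto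
  then show ?thesis
  proof cases
    case 1
    have "sep (P ` {0<..<k}) {P 0, P k}"
      unfolding sep_def
    proof (intro conjI ballI allI impI)
      show "P ` {0<..<k} \<subseteq> V" using lcycD(3)[OF L] assms(2) by auto
      show "P ` {0<..<k} \<inter> {P 0, P k} = {}" using inj assms(2) by fastforce
      fix v u assume "v \<in> P ` {0<..<k}" and e: "E v u"
      then obtain i where i: "v = P i" "0 < i" "i < k" by auto
      have "u \<noteq> w" using 1 i e sym Fw[of i] by auto
      then obtain j where j: "j \<le> Suc k" "u = P j" "F i j" using nbr[of i u] i e by auto
      have "\<not> F i (Suc k)" using 1 i by simp
      then have "j \<noteq> Suc k" using j(3) by metis
      then show "u \<in> P ` {0<..<k} \<or> u \<in> {P 0, P k}" using j by (cases "j = 0 \<or> j = k") auto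
    qed
    then show ?thesis using closed_arc_F assms(1-4) by blast
  next
    case 2
    have "sep (P ` {1<..<Suc k}) {P 1, P (Suc k)}"
      unfolding sep_def
    proof (intro conjI ballI allI impI)
      show "P ` {1<..<Suc k} \<subseteq> V" using lcycD(3)[OF L] assms(2) by auto
      show "P ` {1<..<Suc k} \<inter> {P 1, P (Suc k)} = {}" using inj assms(2) by fastforce
      fix v u assume "v \<in> P ` {1<..<Suc k}" and e: "E v u"
      then obtain i where i: "v = P i" "1 < i" "i \<le> k" by auto
      have "u \<noteq> w" using 2 i e sym Fw[of i] by auto
      then obtain j where j: "j \<le> Suc k" "u = P j" "F i j" using nbr[of i u] i e by auto
      have "\<not> F i 0" using 2 i by simp
      then have "j \<noteq> 0" using j(3) by metis
      then show "u \<in> P ` {1<..<Suc k} \<or> u \<in> {P 1, P (Suc k)}" using j by (cases "j = 1 \<or> j = Suc k") auto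
    qed
    then show ?thesis using closed_arc_F_mirror assms(1-4) by blast
  next
    case 3
    have "u \<in> {P 4, P 0, P 2}" if iu: "i = 1 \<or> i = 3" "E (P i) u" for i u
    proof -
      have i: "1 \<le> i" "i \<le> k" using iu 3(1) by auto
      have "u \<noteq> w" using 3 iu sym Fw[of i] by auto
      then obtain j where j: "j \<le> Suc k" "u = P j" "F i j" using nbr[OF i iu(2)] by blast
      have "j \<noteq> 1" "j \<noteq> 3" using j 3 iu(1) J.Fsym J.Firr by blast+
      then have "j = 0 \<or> j = 2 \<or> j = 4" using j(1) 3(1) by auto
      then show ?thesis using j(2) by auto
    qed
    then have "shape_S" by (intro closed_arc_S[OF assms(1,2) 3(1) assms(4) _ _ W]) blast+
    then show ?thesis by blast
  qed
qed

text \<open>The outcome depends on what attaches to the interior of the long arc. A component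
  avoiding \<open>w\<close> gives a second closed arc or, for \<open>k = 3\<close>, the star; if
  only \<open>w\<close> attaches there, \<open>closed_arc_w\<close> applies; if nothing does, the
  \<open>k\<close> inner vertices are closed too and form the set \<open>J\<close> of
  \<open>shape_F1\<close>.\<close>

lemma closed_arc:
  assumes "cyc P c" "c = 2 * k + 1" "3 \<le> k" "sep (P ` {k + 2..<c}) {P 0, P (Suc k)}"
    and W: "\<And>D. cpt (P ` {..<c}) D \<Longrightarrow> w \<in> D \<Longrightarrow> D = {w}"
  shows "shape_F \<or> shape_S \<or> shape_F1"
proof (rule ccontr)
  assume neg: "\<not> ?thesis"
  let ?Y = "P ` {..<c}" and ?I = "P ` {k + 2..<c}" and ?J = "P ` {0<..<Suc k}"
  note L = lcyc_cyc[OF assms(1)] and inj = cyc_inj[OF assms(1)]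
  have YV: "?Y \<subseteq> V" using lcycD(3)[OF L] .
  have Yeq: "?Y = {P 0, P (Suc k)} \<union> ?I \<union> ?J"
  proof -
    have "{..<c} = {0, Suc k} \<union> {k + 2..<c} \<union> {0<..<Suc k}" using assms(2,3) by auto
    then have "?Y = P ` ({0, Suc k} \<union> {k + 2..<c} \<union> {0<..<Suc k})" by simp
    then show ?thesis by (simp add: image_Un)
  qed
  have sub: "{P 0, P (Suc k)} \<subseteq> ?Y" using assms(2,3) by auto
  have n1: "\<not> sep (P ` {0<..<k}) {P 0, P k}" using neg closed_arc_F assms(1-4) by blast
  have n2: "\<not> sep (P ` {1<..<Suc k}) {P 1, P (Suc k)}" using neg closed_arc_F_mirror assms(1-4) by blast
  \<comment> \<open>The attachments lie in positions \<open>0\<close> to \<open>Suc k\<close>. A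
    single vertex has \<open>k\<close> of them with gaps 2, so
    \<open>2 * (k - 1) \<le> k + 1\<close> and \<open>k = 3\<close>. Two attachments, one of them
    inside, yield a closed arc already excluded. Three attachments with \<open>k = 4\<close> would
    span 6 steps in a range of 5.\<close>
  have B: "k = 3 \<and> card D = 1 \<and> att ?Y D = {P 0, P 2, P 4}"
    if D: "cpt ?Y D" "w \<notin> D" and i0: "1 \<le> i0" "i0 \<le> k" "P i0 \<in> att ?Y D" for D i0
  proof -
    note C = compD[OF D(1)]
    have Dw: "\<not> D \<subseteq> {w}" using C(1) D(2) by blast
    note S = comp_struct(1,2)[OF L D(1) Dw] and T = comp_types(2)[OF L D(1)]
    define A where "A = {i \<in> {..<c}. P i \<in> att ?Y D}"
    have atY: "att ?Y D \<subseteq> P ` {..<c}" by (auto simp: att_iff)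
    have cA: "card A = card (att ?Y D)" using pos_card0[OF assms(1) atY] unfolding A_def .
    have PA: "att ?Y D = P ` A" unfolding A_def using atY by blast
    have lowA: "i \<le> Suc k" if "i \<in> A" for i
    proof -
      have "P i \<in> P ` {..Suc k}" using att_low[OF assms(1,2,4) D(1)] that unfolding A_def by blast
      then obtain j where "j \<le> Suc k" "P i = P j" by auto
      then show ?thesis using inj[of i j] that assms(2,3) unfolding A_def by auto
    qed
    have i0A: "i0 \<in> A" unfolding A_def using i0 assms(2,3) by auto
    have g: "i + (card D + 1) \<le> j" if "i \<in> A" "j \<in> A" "i < j" for i j
      using comp_gap(1)[OF assms(1) D(1) _ that(3)] that D(2) unfolding A_def by auto
    have fA: "finite A" "A \<noteq> {}" using i0A unfolding A_def by auto
    obtain a b where ab: "a \<in> A" "b \<in> A" "a + (card D + 1) * (card A - 1) \<le> b" using spread[OF fA g] by blast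
    have bk: "b \<le> Suc k" using lowA ab by blast
    consider "card D = 1" | "card (att ?Y D) = 2" "card D \<noteq> 1" | "card (att ?Y D) = 3" "card D = 2" "k = 4"
      using T D(2) by blast
    then show ?thesis
    proof cases
      case 1
      have "card A = k" using cA S 1 by simp
      then have "a + 2 * (k - 1) \<le> Suc k" using ab bk 1 by simp
      then have k: "k = 3" "a = 0" using assms(3) by linarith+
      then have "b = 4" using ab bk 1 \<open>card A = k\<close> by simp
      have "card (A - {a, b}) = 1" using \<open>card A = k\<close> ab k \<open>b = 4\<close> by (subst card_Diff_subset) auto
      then obtain m where m: "A - {a, b} = {m}" by (meson card_1_singletonE)
      have "m \<in> A - {a, b}" using m by simp
      then have mA: "m \<in> A" "m \<noteq> 0" "m \<noteq> 4" using k(2) \<open>b = 4\<close> by simp_all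
      have "0 < m" "m < 4" using mA lowA[OF mA(1)] k by auto
      then have "m = 2" using g[of 0 m] g[of m 4] mA ab k \<open>b = 4\<close> 1 by auto
      then have "A = {0, 2, 4}" using m ab k \<open>b = 4\<close> by auto
      then show ?thesis using PA 1 k by simp
    next
      case 2
      have cD: "card D = k - 1" using S 2 by simp
      have cA2: "card A = 2" using cA 2 by simp
      have "a + k \<le> b" using ab cA2 cD assms(3) by simp
      then have "a \<noteq> b" using assms(3) by auto
      then have "card {a, b} = card A" using cA2 by simp
      then have Aab: "A = {a, b}" using card_subset_eq[of A "{a, b}"] fA(1) ab by simp
      have PP: "att ?Y D = {P a, P b}" using PA Aab by simp
      have "a \<noteq> 0 \<or> b \<noteq> Suc k" using i0A Aab i0 by auto
      then consider "a = 0" "b = k" | "a = 1" "b = Suc k" using \<open>a + k \<le> b\<close> bk by linarith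
      then have False
      proof cases
        case 1
        have "sep (P ` {0<..<k}) {P 0, P k}"
          using PP 1 D(2) cD assms(2,3) by (intro arc_closed[OF assms(1) D(1)]) auto
        then show False using n1 by blast
      next
        case 2
        have "sep (P ` {1<..<Suc k}) {P 1, P (Suc k)}"
          using PP 2 D(2) cD assms(2,3) by (intro arc_closed[OF assms(1) D(1)]) auto
        then show False using n2 by blast
      qed
      then show ?thesis ..
    next
      case 3
      then show ?thesis using ab bk cA by simp
    qed
  qed
  have Jout: "u \<in> ?J \<or> u \<in> {P 0, P (Suc k)} \<or> u \<in> V - ?Y" if v: "v \<in> ?J" "E v u" for v u
  proof -
    have "v \<notin> ?I" "v \<notin> {P 0, P (Suc k)}" using v(1) inj assms(2,3) by fastforce+
    then have "u \<notin> ?I" using sepD[OF assms(4) _ sym[OF v(2)]] by blast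
    then show ?thesis using Yeq EV2[OF v(2)] by auto
  qed
  show False
  proof (cases "\<exists>D i0. cpt ?Y D \<and> w \<notin> D \<and> 1 \<le> i0 \<and> i0 \<le> k \<and> P i0 \<in> att ?Y D")
    case True
    then obtain D i0 where D: "cpt ?Y D" "w \<notin> D" "1 \<le> i0" "i0 \<le> k" "P i0 \<in> att ?Y D" by blast
    then have k: "k = 3" "card D = 1" "att ?Y D = {P 0, P 2, P 4}" using B by blast+
    then obtain u where u: "D = {u}" by (meson card_1_singletonE)
    have c7: "c = 7" using assms(2) k by simp
    have Eu: "E u (P 0)" "E u (P 2)" "E u (P 4)" using k(3) u by (auto simp: att_def)
    have uY: "u \<notin> ?Y" using compD(3)[OF D(1)] u by blast
    have ed: "E (P i) (P (Suc i))" if "i < 6" for i using cyc_edge[OF assms(1)] that c7 by simp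
    have eds: "E (P 0) (P 1)" "E (P 1) (P 2)" "E (P 2) (P 3)" "E (P 3) (P 4)" "E (P 4) (P 5)" "E (P 5) (P 6)" "E (P 6) (P 0)"
      using ed[of 0] ed[of 1] ed[of 2] ed[of 3] ed[of 4] ed[of 5] cyc_close[OF assms(1)] c7
      by (simp_all add: numeral_eq_Suc)
    note edr = eds[THEN sym]
    have ne: "P i \<noteq> P j" if "i < 7" "j < 7" "i \<noteq> j" for i j using inj that c7 by simp
    have notY: "u \<noteq> P i" if "i < 7" for i using uY that c7 by auto
    have n13: "\<not> E (P 1) (P 3)"
    proof
      assume e: "E (P 1) (P 3)"
      have "length [P 1, P 2, u, P 0, P 6, P 5, P 4, P 3] \<le> c"
        using e[THEN sym] eds edr Eu Eu[THEN sym] ne notY notY[THEN not_sym] by (intro list_bound) auto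
      then show False using c7 by simp
    qed
    have key: "v \<in> {P 4, P 0, P 2}" if i: "i = 1 \<or> i = 3" "E (P i) v" for i v
    proof -
      have "P i \<in> ?J" using i k(1) by auto
      then consider "v \<in> ?J" | "v \<in> {P 0, P 4}" | "v \<in> V - ?Y" using Jout[OF _ i(2)] k(1) by auto
      then show ?thesis
      proof cases
        case 1
        then obtain j where j: "v = P j" "0 < j" "j < 4" using k(1) by auto
        then have "j = 1 \<or> j = 2 \<or> j = 3" by linarith
        then show ?thesis using i j n13 irrefl sym by auto
      next
        case 2 then show ?thesis by auto
      next
        case 3
        obtain D' where D': "cpt ?Y D'" "v \<in> D'" using comp_ex[OF 3] by blast
        have at: "P i \<in> att ?Y D'" using i D'(2) c7 sym unfolding att_iff by auto
        show ?thesis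
        proof (cases "w \<in> D'")
          case False
          then have "P i \<in> {P 0, P 2, P 4}" using B[OF D'(1) False _ _ at] i k(1) at by auto
          then show ?thesis using ne[of i 0] ne[of i 2] ne[of i 4] i by auto
        next
          case True
          then have vw: "v = w" using W[OF D'(1)] D'(2) by auto
          have wV: "w \<in> V - ?Y" using 3 vw by simp
          have Ew: "E w (P i)" using i vw sym by blast
          obtain s where s: "E w s" "s \<noteq> P i" using w_nbrs(3)[OF L wV W] by blast
          have "s \<in> att ?Y {w}" using w_nbrs(2)[OF L wV W s(1)] s(1) by (simp add: att_iff)
          then have "s \<in> P ` {..4}" using att_low[OF assms(1,2,4) w_nbrs(1)[OF L wV W]] k(1) by (auto simp: numeral_eq_Suc)
          then obtain j where j: "j \<le> 4" "s = P j" by auto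
          have cw: "cpt ?Y {w}" using w_nbrs(1)[OF L wV W] .
          have nc: False if "E w (P l)" "E w (P (Suc l))" "l < 6" for l
            using not_consecutive(1)[OF assms(1), of l "Suc l" w] that wV c7 by auto
          have wn: "w \<noteq> P l" if "l < 7" for l using wV that c7 by auto
          have wu: "w \<noteq> u" using D(2) u by auto
          have dis: "distinct [P 0, P 1, P 2, P 3, P 4, P 5, P 6, u, w]"
            using ne notY[THEN not_sym] wn[THEN not_sym] wu by simp
          \<comment> \<open>Besides consecutive pairs, these three combinations are the ones to
            exclude for a second neighbour of \<open>w\<close>. Each gives a cycle of length 8 or 9
            through \<open>u\<close>, while \<open>c = 7\<close>.\<close>
          have n3: "\<not> (E w (P 1) \<and> E w (P 3))"
          proof
            assume e: "E w (P 1) \<and> E w (P 3)"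
            have "length [P 1, P 2, u, P 0, P 6, P 5, P 4, P 3, w] \<le> c"
              using dis e eds edr Eu Eu[THEN sym] sym[of w "P 3"] by (intro list_bound) auto
            then show False using c7 by simp
          qed
          have n4: "\<not> (E w (P 1) \<and> E w (P 4))"
          proof
            assume e: "E w (P 1) \<and> E w (P 4)"
            have "length [P 0, P 6, P 5, P 4, w, P 1, P 2, u] \<le> c"
              using dis e eds edr Eu Eu[THEN sym] sym[of w "P 4"] by (intro list_bound) auto
            then show False using c7 by simp
          qed
          have n0: "\<not> (E w (P 3) \<and> E w (P 0))"
          proof
            assume e: "E w (P 3) \<and> E w (P 0)"
            have "length [P 4, P 5, P 6, P 0, w, P 3, P 2, u] \<le> c"
              using dis e eds edr Eu Eu[THEN sym] sym[of w "P 0"] by (intro list_bound) auto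
            then show False using c7 by simp
          qed
          have ncs: "\<not> (E w (P 0) \<and> E w (P 1))" "\<not> (E w (P 1) \<and> E w (P 2))" "\<not> (E w (P 2) \<and> E w (P 3))" "\<not> (E w (P 3) \<and> E w (P 4))"
            using nc[of 0] nc[of 1] nc[of 2] nc[of 3] by (auto simp: numeral_eq_Suc)
          have "j = 0 \<or> j = 1 \<or> j = 2 \<or> j = 3 \<or> j = 4" using j(1) by linarith
          then have False using i(1) Ew s j(2) n3 n4 n0 ncs by (elim disjE) simp_all
          then show ?thesis ..
        qed
      qed
    qed
    have shape_S by (rule closed_arc_S[OF assms(1,2) k(1) assms(4) _ _ W]) (use key in blast)+
    then show False using neg by blast
  next
    case noD: False
    have off: "v = w" if v: "v \<in> V - ?Y" "1 \<le> i" "i \<le> k" "E v (P i)" for v i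
    proof -
      obtain D where D: "cpt ?Y D" "v \<in> D" using comp_ex[OF v(1)] by blast
      have "P i \<in> att ?Y D" using v D(2) assms(2) unfolding att_iff by auto
      then have "w \<in> D" using noD D(1) v by blast
      then show ?thesis using W[OF D(1)] D(2) by auto
    qed
    show False
    proof (cases "\<exists>i. w \<in> V - ?Y \<and> 1 \<le> i \<and> i \<le> k \<and> E w (P i)")
      case True
      then obtain i where i: "w \<in> V - ?Y" "1 \<le> i" "i \<le> k" "E w (P i)" by blast
      have "shape_F \<or> shape_S"
        by (rule closed_arc_w[OF assms(1-4) W i]) (use off in blast)+
      then show False using neg by blast
    next
      case False
      then have offJ: "\<not> E v (P i)" if "v \<in> V - ?Y" "1 \<le> i" "i \<le> k" for v i using off that by blast
      have cI: "card ?I = k - 1" "card ?J = k"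
        using card_seg[OF assms(1), of c "k + 2"] card_seg2[OF assms(1), of "Suc k" 0] assms(2,3) by auto
      have sJ: "sep ?J {P 0, P (Suc k)}"
        unfolding sep_def
      proof (intro conjI ballI allI impI)
        show "?J \<subseteq> V" using YV Yeq by blast
        show "?J \<inter> {P 0, P (Suc k)} = {}" using inj assms(2) by fastforce
        fix v u assume v: "v \<in> ?J" "E v u"
        have "u \<notin> V - ?Y"
        proof
          assume "u \<in> V - ?Y"
          moreover obtain i where "v = P i" "1 \<le> i" "i \<le> k" using v(1) by auto
          ultimately show False using offJ v(2) sym by blast
        qed
        then show "u \<in> ?J \<or> u \<in> {P 0, P (Suc k)}" using Jout[OF v] by blast
      qed
      have "\<exists>X. v \<in> X \<and> sep X {P 0, P (Suc k)} \<and> card X \<le> k - 1" if v: "v \<in> V - {P 0, P (Suc k)} - ?J" for v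
      proof (cases "v \<in> ?Y")
        case True
        then have "v \<in> ?I" using v unfolding Yeq by auto
        then show ?thesis using cI assms(4) by (intro exI[of _ ?I]) simp
      next
        case False
        then obtain D where D: "cpt ?Y D" "v \<in> D" using comp_ex v by blast
        have "att ?Y D \<subseteq> {P 0, P (Suc k)}"
          by (rule att_sub2[OF D(1) Yeq _ assms(4) _ sJ]) (use sub in auto)
        then have "sep D {P 0, P (Suc k)}" by (rule sep_comp[OF D(1)]) (use sub in auto)
        then show ?thesis using D comp_small[OF L D(1) assms(3)] by blast
      qed
      moreover have "P 0 \<in> V" "P (Suc k) \<in> V" using sub YV by auto
      moreover have "P 0 \<noteq> P (Suc k)" using inj assms(2,3) by auto
      ultimately have shape_F1 unfolding shape_F1_def using sJ cI
        by (intro exI[of _ "P 0"] exI[of _ "P (Suc k)"] exI[of _ ?J]) simp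
      then show False using neg by blast
    qed
  qed
qed

end

section \<open>Components with at least two vertices\<close>

context circumference_graph
begin

lemma reflect_image:
  assumes "b \<le> c" "S = (\<lambda>i. R ((c - i) mod c))"
  shows "S ` {c - b<..<c} = R ` {0<..<b}"
proof -
  have "(\<lambda>i. (c - i) mod c) ` {c - b<..<c} = {0<..<b}"
  proof -
    have "x \<in> (\<lambda>i. (c - i) mod c) ` {c - b<..<c}" if "x \<in> {0<..<b}" for x
      using that assms(1) by (intro image_eqI[of _ _ "c - x"]) auto
    then show ?thesis using assms(1) by auto
  qed
  then show ?thesis unfolding assms(2) by (metis image_image)
qed

text \<open>Here \<open>card D = k - 1\<close>, and both arcs between the attachments have at least
  \<open>k - 1\<close> inner vertices. So \<open>c\<close> is \<open>2 * k\<close> or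
  \<open>2 * k + 1\<close>, and an arc with exactly \<open>k - 1\<close> inner vertices is closed.
  For \<open>c = 2 * k\<close> both arcs are.\<close>

lemma case_two:
  assumes "lcyc Y" "cpt Y D" "w \<notin> D" "card (att Y D) = 2" "2 \<le> card D"
    and W: "\<And>D. cpt Y D \<Longrightarrow> w \<in> D \<Longrightarrow> D = {w}"
  shows "shape_F \<or> shape_S \<or> shape_F1"
proof -
  note Ly = lcycD[OF assms(1)] and C = compD[OF assms(2)]
  have Dw: "\<not> D \<subseteq> {w}" using C(1) assms(3) by blast
  have cD: "card D = k - 1" using comp_struct(1)[OF assms(1,2) Dw] assms(4) by simp
  have k3: "3 \<le> k" using cD assms(5) by simp
  obtain p q where pq: "att Y D = {p, q}" "p \<noteq> q" using assms(4) by (meson card_2_iff)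
  have pY: "p \<in> Y" "q \<in> Y" using pq by (auto simp: att_def)
  obtain P where P: "cyc P c" "P ` {..<c} = Y" "P 0 = p" using lcyc_at[OF assms(1) pY(1)] .
  obtain j where j: "j < c" "q = P j" using pY(2) P(2) by auto
  have j0: "0 < j" using j pq(2) P(3) by (cases j) auto
  have g: "k \<le> j" "j + k \<le> c"
    using comp_gap[OF P(1) _ _ j0 j(1), of D] P(2,3) assms(2,3) pq(1) j(2) cD k3 by auto
  have cc: "c = 2 * k \<or> c = 2 * k + 1" using g ck by linarith
  have "\<exists>R. cyc R c \<and> R ` {..<c} = Y \<and> att Y D = {R 0, R k}"
  proof (cases "j = k")
    case True
    then show ?thesis using P pq j by blast
  next
    case False
    then have jk: "j = k + 1" "c = 2 * k + 1" using g cc by linarith+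
    let ?R = "\<lambda>i. P ((c - i) mod c)"
    have "?R 0 = p" "?R k = q" using P(3) j jk k3 by auto
    then show ?thesis using cyc_reflect[OF P(1)] P(2) pq(1) by blast
  qed
  then obtain R where R: "cyc R c" "R ` {..<c} = Y" "att Y D = {R 0, R k}" by blast
  have kc: "k < c" using cc k3 by auto
  note inj = cyc_inj[OF R(1)]
  have sR: "sep (R ` {0<..<k}) {R 0, R k}"
    using assms(2,3) R cD k3 kc by (intro arc_closed[OF R(1), of D]) auto
  define S where "S = (\<lambda>i. R ((c - i) mod c))"
  have S: "cyc S c" "S ` {..<c} = Y" "S 0 = R 0"
    using cyc_reflect[OF R(1)] R(2) unfolding S_def by auto
  have Sk: "S (c - k) = R k" unfolding S_def using kc by simp
  have imS: "S ` {c - k<..<c} = R ` {0<..<k}" using reflect_image[OF _ S_def] kc by simp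
  show ?thesis
  proof (cases "c = 2 * k + 1")
    case True
    have "{c - k<..<c} = {k + 2..<c}" using True by auto
    then have "sep (S ` {k + 2..<c}) {S 0, S (Suc k)}" using sR imS S(3) Sk True by simp
    then show ?thesis using closed_arc[OF S(1) True k3 _ ] W S(2) by blast
  next
    case False
    then have c2: "c = 2 * k" using cc by simp
    have "att Y D = {S 0, S k}" using R(3) S(3) Sk c2 by simp
    then have sS: "sep (S ` {0<..<k}) {S 0, S k}"
      using assms(2,3) S cD k3 kc by (intro arc_closed[OF S(1), of D]) auto
    have SR: "S 0 = R 0" "S k = R k" using S(3) Sk c2 by auto
    have imR: "S ` {0<..<k} = R ` {k<..<c}"
    proof -
      have "R i = S ((c - i) mod c)" if "i < c" for i
        unfolding S_def using that by (cases "i = 0") auto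
      then have "R ` {c - k<..<c} = S ` {0<..<k}"
        using reflect_image[of k "\<lambda>i. S ((c - i) mod c)" S] kc by auto
      then show ?thesis using c2 by simp
    qed
    have sJ: "sep (R ` {k<..<c}) {R 0, R k}" using sS imR SR by simp
    have Yeq: "Y = {R 0, R k} \<union> R ` {0<..<k} \<union> R ` {k<..<c}"
    proof -
      have "{..<c} = {0, k} \<union> {0<..<k} \<union> {k<..<c}" using kc by auto
      then have "Y = R ` ({0, k} \<union> {0<..<k} \<union> {k<..<c})" using R(2) by simp
      then show ?thesis by (simp add: image_Un)
    qed
    have cI: "card (R ` {0<..<k}) = k - 1" "card (R ` {k<..<c}) = k - 1"
      using card_seg2[OF R(1), of k 0] card_seg2[OF R(1), of c k] kc c2 by auto
    have sub: "{R 0, R k} \<subseteq> Y" using R(3) by (auto simp: att_def)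
    \<comment> \<open>The subtracted empty set is the set \<open>J\<close> of
      \<open>shape_F1\<close>.\<close>
    have "\<exists>X. v \<in> X \<and> sep X {R 0, R k} \<and> card X \<le> k - 1" if v: "v \<in> V - {R 0, R k} - {}" for v
    proof -
      consider "v \<in> R ` {0<..<k}" | "v \<in> R ` {k<..<c}" | "v \<in> V - Y" using v unfolding Yeq by auto
      then show ?thesis
      proof cases
        case 1 then show ?thesis using sR cI by (intro exI[of _ "R ` {0<..<k}"]) simp
      next
        case 2 then show ?thesis using sJ cI by (intro exI[of _ "R ` {k<..<c}"]) simp
      next
        case 3
        then obtain D' where D': "cpt Y D'" "v \<in> D'" using comp_ex by blast
        have "att Y D' \<subseteq> {R 0, R k}"
          by (rule att_sub2[OF D'(1) Yeq _ sR _ sJ]) (use sub in auto)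
        then have "sep D' {R 0, R k}" by (rule sep_comp[OF D'(1)]) (use sub in auto)
        then show ?thesis using D' comp_small[OF assms(1) D'(1) k3] by blast
      qed
    qed
    moreover have "R 0 \<in> V" "R k \<in> V" using sub Ly(3) by auto
    moreover have "R 0 \<noteq> R k" using inj kc k3 by auto
    moreover have "sep {} {R 0, R k}" unfolding sep_def by simp
    ultimately have shape_F1 unfolding shape_F1_def
      by (intro exI[of _ "R 0"] exI[of _ "R k"] exI[of _ "{}"]) simp
    then show ?thesis by blast
  qed
qed

text \<open>Exchanging \<open>D\<close> with the arc \<open>{P 1, P 2}\<close> puts this arc into a
  component \<open>D'\<close> of the new complement. Three vertices in \<open>D'\<close> would allow
  a cycle of length 10, so \<open>D'\<close> is the arc and has a third attachment; every position
  for it other than 6 leads to an explicit cycle longer than 9.\<close>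

lemma arc_three:
  assumes "cyc P c" "c = 9" "k = 4" "cpt (P ` {..<c}) D" "w \<notin> D" "card D = 2"
    and at: "att (P ` {..<c}) D = {P 0, P 3, P 6}"
  shows "sep {P 1, P 2} {P 0, P 3, P 6}"
proof -
  let ?Y = "P ` {..<c}"
  note L = lcyc_cyc[OF assms(1)] and C = compD[OF assms(4)] and inj = cyc_inj[OF assms(1)]
  have Dw: "\<not> D \<subseteq> {w}" using C(1) assms(5) by blast
  obtain d d' where d: "D = {d, d'}" "d \<noteq> d'" using assms(6) by (meson card_2_iff)
  have Ed: "E d d'" using comp_clique[OF L assms(4) Dw] d by auto
  have dY: "d \<notin> ?Y" "d' \<notin> ?Y" using C(3) d by auto
  have Eat: "E x (P 0)" "E x (P 3)" "E x (P 6)" if "x \<in> D" for x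
  proof -
    have "x \<noteq> P 0" "x \<noteq> P 3" "x \<noteq> P 6" using that dY d assms(2) by auto
    then show "E x (P 0)" "E x (P 3)" "E x (P 6)"
      using comp_struct(3)[OF L assms(4) Dw that] that assms(5) at by auto
  qed
  have ED: "E d (P 0)" "E d (P 3)" "E d (P 6)" "E d' (P 0)" "E d' (P 3)" "E d' (P 6)"
    using Eat[of d] Eat[of d'] d by auto
  have ed: "E (P i) (P (Suc i))" if "i < 8" for i using cyc_edge[OF assms(1)] that assms(2) by simp
  have eds: "E (P 0) (P 1)" "E (P 1) (P 2)" "E (P 2) (P 3)" "E (P 3) (P 4)" "E (P 4) (P 5)" "E (P 5) (P 6)"
    "E (P 6) (P 7)" "E (P 7) (P 8)" "E (P 8) (P 0)"
    using ed[of 0] ed[of 1] ed[of 2] ed[of 3] ed[of 4] ed[of 5] ed[of 6] ed[of 7] cyc_close[OF assms(1)] assms(2)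
    by (simp_all add: numeral_eq_Suc)
  note edr = eds[THEN sym] and EDr = ED[THEN sym]
  have ne: "P i \<noteq> P j" if "i < 9" "j < 9" "i \<noteq> j" for i j using inj that assms(2) by simp
  have nd: "d \<noteq> P i" "d' \<noteq> P i" "P i \<noteq> d" "P i \<noteq> d'" if "i < 9" for i using dY that assms(2) by auto
  note dis = ne nd d(2) d(2)[THEN not_sym]
  let ?Z = "D \<union> P ` ({..0} \<union> {3..<c})"
  have path: "pth d d' D"
  proof -
    have "pth (hd [d, d']) (last [d, d']) (set [d, d'])" using Ed d(2) by (intro pthI) auto
    then show ?thesis using d(1) by simp
  qed
  have c3: "(0::nat) < 3" "3 < c" using assms(2) by auto
  note Z = ear_out[OF assms(1) c3 path C(3) EDr(1) ED(5)]
  have LZ: "lcyc ?Z" unfolding lcyc_def using Z assms(2,6) by simp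
  have out: "P 1 \<notin> ?Z" "P 2 \<notin> ?Z"
    using assms(2) by (intro pos_notin[OF assms(1) C(3)]; auto)+
  have "P 1 \<in> V" using eds EV by blast
  then obtain D' where D': "cpt ?Z D'" "P 1 \<in> D'" using comp_ex[of "P 1" ?Z] out by blast
  note C' = compD[OF D'(1)]
  have P2: "P 2 \<in> D'" using C'(6)[OF D'(2) eds(2)] out by blast
  have D'w: "\<not> D' \<subseteq> {w}" using D'(2) P2 ne[of 1 2] by auto
  note S' = comp_struct(1,2)[OF LZ D'(1) D'w]
  have inZ: "P 0 \<in> ?Z" "P 3 \<in> ?Z" using assms(2) by auto
  have a03: "P 0 \<in> att ?Z D'" "P 3 \<in> att ?Z D'"
    unfolding att_iff using inZ D'(2) P2 eds edr by blast+
  have "2 \<le> card D'" using card_two[OF C'(5) D'(2) P2] ne[of 1 2] by simp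
  moreover have "card D' \<noteq> 3"
  proof
    assume c3': "card D' = 3"
    then obtain x t where xt: "E (P 0) x" "E t (P 3)" "pth x t D'" using span_all[OF LZ D'(1) _ a03] by auto
    have o: "pth (P 3) (P 0) (P ` ({..0} \<union> {3..<c}))" using cyc_outer[OF assms(1) c3] .
    have dd: "D' \<inter> P ` ({..0} \<union> {3..<c}) = {}" using C'(3) by blast
    have "pth x (P 0) (D' \<union> P ` ({..0} \<union> {3..<c}))" using pth_join[OF xt(3,2) o dd] .
    moreover have "card (D' \<union> P ` ({..0} \<union> {3..<c})) = 10"
    proof -
      have "card (P ` ({..0} \<union> {3..<c})) = card ({..0} \<union> {3..<c})"
        using assms(2) by (intro cyc_card[OF assms(1)]) auto
      moreover have "{..0} \<union> {3..<c} = {0,3,4,5,6,7,8::nat}" using assms(2) by auto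
      then have "card ({..0} \<union> {3..<c}) = 7" by simp
      ultimately have "card (P ` ({..0} \<union> {3..<c})) = 7" by (rule trans)
      then show ?thesis using card_Un_disjoint[OF C'(5) _ dd] c3' by (simp only: finite_imageI finite_UnI finite_atMost finite_atLeastLessThan)
    qed
    ultimately have "cycset (D' \<union> P ` ({..0} \<union> {3..<c}))" using xt(1) by (intro cycsetI) auto
    then show False using bound \<open>card (D' \<union> _) = 10\<close> assms(2) by fastforce
  qed
  ultimately have cD': "card D' = 2" "card (att ?Z D') = 3" using S' assms(3) by linarith+
  have D'eq: "D' = {P 1, P 2}"
    using card_subset_eq[of D' "{P 1, P 2}"] C'(5) D'(2) P2 cD'(1) ne[of 1 2] by simp
  have fat: "finite (att ?Z D')" using lcycD(4)[OF LZ] by (simp add: att_def)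
  have "card (att ?Z D' - {P 0, P 3}) = 1"
    using cD'(2) a03 ne[of 0 3] fat by (subst card_Diff_subset) auto
  then obtain r where r: "att ?Z D' - {P 0, P 3} = {r}" by (meson card_1_singletonE)
  then have rat: "r \<in> att ?Z D'" "r \<noteq> P 0" "r \<noteq> P 3" by auto
  have atr: "att ?Z D' = {P 0, P 3, r}" using r a03 by auto
  have "r \<notin> D"
  proof
    assume "r \<in> D"
    moreover obtain v where v: "v \<in> D'" "E v r" using rat(1) unfolding att_iff by blast
    ultimately have rv: "E r v" "r \<in> D" using sym by blast+
    have "v \<in> ?Y" using v(1) D'eq assms(2) by auto
    then have "v \<in> att ?Y D" using rv unfolding att_iff by blast
    then have "v = P 0 \<or> v = P 3 \<or> v = P 6" using at by simp
    moreover have "v = P 1 \<or> v = P 2" using v(1) D'eq by simp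
    ultimately show False
      using ne[of 1 0] ne[of 1 3] ne[of 1 6] ne[of 2 0] ne[of 2 3] ne[of 2 6] by (elim disjE) simp_all
  qed
  then have "r \<in> P ` ({..0} \<union> {3..<c})" using rat(1) unfolding att_iff by blast
  then obtain i where i: "r = P i" "i \<in> {..0} \<union> {3..<c}" by blast
  then have i48: "i = 4 \<or> i = 5 \<or> i = 6 \<or> i = 7 \<or> i = 8" using rat(2,3) assms(2) by (cases "i = 0 \<or> i = 3") auto
  have "i = 6"
  proof (rule ccontr)
    assume i6: "i \<noteq> 6"
    \<comment> \<open>Only a vertex other than \<open>w\<close> is known to see all three
      attachments. It may be \<open>P 1\<close> or \<open>P 2\<close>, which doubles the number of
      cases.\<close>
    obtain v where v: "v \<in> D'" "v \<noteq> w" using D'w by blast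
    have "v \<noteq> P 0" "v \<noteq> P 3" "v \<noteq> r" using v C'(3) a03 rat unfolding att_iff by blast+
    then have Ev: "E v (P 0)" "E v (P 3)" "E v (P i)"
      using comp_struct(3)[OF LZ D'(1) D'w v] atr i(1) by auto
    note Evr = Ev[THEN sym]
    have b: "length xs \<le> 9" if "distinct xs" "successively E xs" "E (last xs) (hd xs)" "3 \<le> length xs" for xs
      using list_bound[OF that] assms(2) by simp
    consider "v = P 1" "i = 4" | "v = P 1" "i = 5" | "v = P 1" "i = 7" | "v = P 1" "i = 8"
      | "v = P 2" "i = 4" | "v = P 2" "i = 5" | "v = P 2" "i = 7" | "v = P 2" "i = 8"
      using v(1) D'eq i48 i6 by auto
    then show False
    proof cases
      case 1
      then show False using b[of "[P 0, d, d', P 3, P 1, P 4, P 5, P 6, P 7, P 8]"] Ev Evr eds edr ED EDr Ed dis by auto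
    next
      case 2
      then show False using b[of "[P 0, P 8, P 7, P 6, P 5, P 1, P 2, P 3, d, d']"] Ev Evr eds edr ED EDr Ed dis by auto
    next
      case 3
      then show False using b[of "[P 0, d, d', P 6, P 5, P 4, P 3, P 2, P 1, P 7, P 8]"] Ev Evr eds edr ED EDr Ed dis by auto
    next
      case 4
      then show False using b[of "[d, d', P 3, P 4, P 5, P 6, P 7, P 8, P 1, P 0]"] Ev Evr eds edr ED EDr Ed dis by auto
    next
      case 5
      then show False using b[of "[P 0, d, d', P 3, P 2, P 4, P 5, P 6, P 7, P 8]"] Ev Evr eds edr ED EDr Ed dis by auto
    next
      case 6
      then show False using b[of "[P 3, d, d', P 6, P 7, P 8, P 0, P 1, P 2, P 5, P 4]"] Ev Evr eds edr ED EDr Ed dis by auto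
    next
      case 7
      then show False using b[of "[P 3, P 4, P 5, P 6, P 7, P 2, P 1, P 0, d, d']"] Ev Evr eds edr ED EDr Ed dis by auto
    next
      case 8
      then show False using b[of "[d, d', P 3, P 4, P 5, P 6, P 7, P 8, P 2, P 0]"] Ev Evr eds edr ED EDr Ed dis by auto
    qed
  qed
  then have "att ?Z D' = {P 0, P 3, P 6}" using atr i(1) by simp
  then show ?thesis using comp_sep[OF D'(1)] D'eq by simp
qed

text \<open>Three gaps of at least 3 fill the cycle of length 9 without slack, so rotations carry
  \<open>arc_three\<close> to all three arcs.\<close>

lemma case_three:
  assumes "lcyc Y" "cpt Y D" "w \<notin> D" "card (att Y D) = 3" "card D = 2" "k = 4"
  shows shape_M
proof -
  note Ly = lcycD[OF assms(1)] and C = compD[OF assms(2)]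
  have "9 \<le> c" using comp_types(1)[OF assms(1,2)] assms(3-5) by simp
  then have c9: "c = 9" using ck assms(6) by simp
  have "att Y D \<noteq> {}" using assms(4) by force
  then obtain p where p: "p \<in> att Y D" by blast
  obtain P where P: "cyc P c" "P ` {..<c} = Y" "P 0 = p" using lcyc_at[OF assms(1), of p] p by (auto simp: att_iff)
  note inj = cyc_inj[OF P(1)]
  define A where "A = {i \<in> {..<c}. P i \<in> att Y D}"
  have atY: "att Y D \<subseteq> P ` {..<c}" using P(2) by (auto simp: att_iff)
  have cA: "card A = 3" using pos_card0[OF P(1) atY] assms(4) unfolding A_def by simp
  have A0: "0 \<in> A" unfolding A_def using P(3) p c9 by simp
  have g: "i + 3 \<le> j" "j + 3 \<le> c + i" if "i \<in> A" "j \<in> A" "i < j" for i j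
    using comp_gap[OF P(1) _ _ that(3), of D] that P(2) assms(2,3,5) unfolding A_def by auto
  have "card (A - {0}) = 2" using cA A0 by simp
  then obtain a0 b0 where ab0: "A - {0} = {a0, b0}" "a0 \<noteq> b0" by (meson card_2_iff)
  have "\<exists>a b. A - {0} = {a, b} \<and> a < b"
  proof (cases "a0 < b0")
    case True
    with ab0(1) show ?thesis by metis
  next
    case False
    then have "b0 < a0" using ab0(2) by linarith
    moreover have "A - {0} = {b0, a0}" unfolding ab0(1) by (rule insert_commute)
    ultimately show ?thesis by metis
  qed
  then obtain a b where ab: "A - {0} = {a, b}" "a < b" by blast
  have "a \<in> A - {0}" "b \<in> A - {0}" unfolding ab(1) by simp_all
  then have abA: "a \<in> A" "b \<in> A" "0 < a" "0 < b" by simp_all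
  have "a = 3" "b = 6" using g[OF A0 abA(1,3)] g[OF abA(1,2) ab(2)] g[OF A0 abA(2,4)] c9 by linarith+
  then have "A = {0, 3, 6}" using ab A0 by auto
  moreover have "att Y D = P ` A" unfolding A_def using atY by blast
  ultimately have at: "att Y D = {P 0, P 3, P 6}" by simp
  have s1: "sep {P 1, P 2} {P 0, P 3, P 6}"
    using arc_three[OF P(1) c9 assms(6)] P(2) assms at by simp
  have rot: "sep {P ((1 + r) mod 9), P ((2 + r) mod 9)} {P ((0 + r) mod 9), P ((3 + r) mod 9), P ((6 + r) mod 9)}"
    if "r = 3 \<or> r = 6" for r
  proof -
    have R: "cyc (\<lambda>i. P ((i + r) mod c)) c" "(\<lambda>i. P ((i + r) mod c)) ` {..<c} = Y"
      using cyc_rotate[OF P(1), of r] that c9 P(2) by auto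
    have "{P ((0 + r) mod c), P ((3 + r) mod c), P ((6 + r) mod c)} = {P 0, P 3, P 6}"
      using that c9 by auto
    then show ?thesis using arc_three[OF R(1) c9 assms(6)] R(2) assms at c9 by simp
  qed
  have s2: "sep {P 4, P 5} {P 0, P 3, P 6}" and s3: "sep {P 7, P 8} {P 0, P 3, P 6}"
    using rot[of 3] rot[of 6] by (simp_all add: insert_commute)
  have sub: "{P 0, P 3, P 6} \<subseteq> Y" using at by (auto simp: att_def)
  have Yeq: "Y = {P 0, P 3, P 6} \<union> {P 1, P 2} \<union> {P 4, P 5} \<union> {P 7, P 8}"
  proof -
    have "{..<c} = {0,3,6,1,2,4,5,7,8}" using c9 by auto
    then have "Y = P ` {0,3,6,1,2,4,5,7,8}" using P(2) by simp
    then show ?thesis by auto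
  qed
  have "\<exists>X. v \<in> X \<and> sep X {P 0, P 3, P 6} \<and> card X \<le> 2" if v: "v \<in> V - {P 0, P 3, P 6}" for v
  proof -
    have c2: "card {x, y} \<le> 2" for x y :: 'a by (simp add: card_insert_if)
    consider "v \<in> {P 1, P 2}" | "v \<in> {P 4, P 5}" | "v \<in> {P 7, P 8}" | "v \<in> V - Y" using v unfolding Yeq by auto
    then show ?thesis
    proof cases
      case 1 then show ?thesis using s1 c2 by blast
    next
      case 2 then show ?thesis using s2 c2 by blast
    next
      case 3 then show ?thesis using s3 c2 by blast
    next
      case 4
      then obtain D' where D': "cpt Y D'" "v \<in> D'" using comp_ex by blast
      have a1: "att Y D' \<subseteq> Y" by (auto simp: att_def)
      have "att Y D' \<inter> {P 1, P 2} = {}" "att Y D' \<inter> {P 4, P 5} = {}" "att Y D' \<inter> {P 7, P 8} = {}"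
        using sep_att[OF s1 _ sub D'(1)] sep_att[OF s2 _ sub D'(1)] sep_att[OF s3 _ sub D'(1)] Yeq by auto
      then have at': "att Y D' \<subseteq> {P 0, P 3, P 6}" using a1 Yeq by auto
      then have sD': "sep D' {P 0, P 3, P 6}" by (rule sep_comp[OF D'(1) _ sub])
      have "card D' \<le> 2"
      proof (cases "D' \<subseteq> {w}")
        case True
        then have "card D' \<le> card {w}" by (intro card_mono) auto
        then show ?thesis by simp
      next
        case False
        note S = comp_struct(1,2)[OF assms(1) D'(1) False]
        show ?thesis
        proof (rule ccontr)
          assume "\<not> ?thesis"
          then have c3: "card D' = 3" "card (att Y D') = 2" using S assms(6) by linarith+
          obtain x y where xy: "att Y D' = {x, y}" "x \<noteq> y" using c3(2) by (meson card_2_iff)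
          have pr: False if "P i \<in> att Y D'" "P j \<in> att Y D'" "(i, j) \<in> {(0, 3), (3, 6), (0, 6)}" for i j
            using comp_gap[OF P(1), of D' i j] P(2) D'(1) c3(1) that c9 by auto
          have "{x, y} \<subseteq> {P 0, P 3, P 6}" using at' xy by simp
          then have "{x, y} = {P 0, P 3} \<or> {x, y} = {P 3, P 6} \<or> {x, y} = {P 0, P 6}" using xy(2) by auto
          then show False using pr[of 0 3] pr[of 3 6] pr[of 0 6] xy(1) by auto
        qed
      qed
      then show ?thesis using D'(2) sD' by blast
    qed
  qed
  moreover have "{P 0, P 3, P 6} \<subseteq> V" using sub Ly(3) by auto
  moreover have "card {P 0, P 3, P 6} = 3" using at assms(4) by simp
  ultimately show ?thesis unfolding shape_M_def using assms(6) by blast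
qed

lemma case_large_component:
  assumes "lcyc Y" "cpt Y D" "w \<notin> D" "2 \<le> card D"
    and W: "\<And>D. cpt Y D \<Longrightarrow> w \<in> D \<Longrightarrow> D = {w}"
  shows "shape_F \<or> shape_S \<or> shape_F1 \<or> shape_M"
proof -
  have "card (att Y D) = 2 \<or> (card (att Y D) = 3 \<and> card D = 2 \<and> k = 4)"
    using comp_types(2)[OF assms(1,2)] assms(3,4) by auto
  then show ?thesis
    using case_two[OF assms(1-3) _ assms(4) W] case_three[OF assms(1-3)] by blast
qed

end

section \<open>Independent complements\<close>

text \<open>Halving maps \<open>A\<close> bijectively onto \<open>{..<k}\<close>. The top element is
  even because \<open>2 * k - 1\<close> is excluded, and evenness descends through the gap
  condition.\<close>

lemma even_positions:
  fixes A :: "nat set"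
  assumes "card A = k" "\<And>i j. i \<in> A \<Longrightarrow> j \<in> A \<Longrightarrow> i < j \<Longrightarrow> i + 2 \<le> j" "\<And>i. i \<in> A \<Longrightarrow> i + 1 < 2 * k"
  shows "i \<in> A \<longleftrightarrow> even i \<and> i < 2 * k"
proof -
  have "A \<subseteq> {..<2 * k}" using assms(3) by fastforce
  then have fA: "finite A" by (rule finite_subset) simp
  have inj: "inj_on (\<lambda>i. i div 2) A"
  proof (rule inj_onI)
    fix i j assume ij: "i \<in> A" "j \<in> A" "i div 2 = j div 2"
    show "i = j"
    proof (rule ccontr)
      assume "i \<noteq> j"
      then have "i + 2 \<le> j \<or> j + 2 \<le> i" using assms(2) ij by (meson linorder_neqE_nat)
      then show False using ij(3) by linarith
    qed
  qed
  have "(\<lambda>i. i div 2) ` A = {..<k}"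
  proof (rule card_subset_eq)
    show "(\<lambda>i. i div 2) ` A \<subseteq> {..<k}"
    proof
      fix x assume "x \<in> (\<lambda>i. i div 2) ` A"
      then obtain i where "i \<in> A" "x = i div 2" by blast
      then show "x \<in> {..<k}" using assms(3)[of i] by simp
    qed
    show "card ((\<lambda>i. i div 2) ` A) = card {..<k}" using card_image[OF inj] assms(1) by simp
  qed simp
  then have ex: "\<exists>x\<in>A. x div 2 = i" if "i < k" for i
  proof -
    have "i \<in> (\<lambda>i. i div 2) ` A" using that \<open>_ ` A = {..<k}\<close> by simp
    then show ?thesis by auto
  qed
  have ev: "2 * (k - Suc j) \<in> A" if "j < k" for j
    using that
  proof (induction j)
    case 0
    then obtain x where x: "x \<in> A" "x div 2 = k - 1" using ex[of "k - 1"] by auto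
    then have "x = 2 * (k - 1)" using assms(3)[OF x(1)] 0 by linarith
    then show ?case using x by simp
  next
    case (Suc j)
    then obtain x where x: "x \<in> A" "x div 2 = k - Suc (Suc j)" using ex[of "k - Suc (Suc j)"] by auto
    have y: "2 * (k - Suc j) \<in> A" using Suc by simp
    have "x + 2 \<le> 2 * (k - Suc j)" using assms(2)[OF x(1) y] x(2) Suc.prems by linarith
    then have "x = 2 * (k - Suc (Suc j))" using x(2) Suc.prems by linarith
    then show ?case using x by simp
  qed
  have "(\<lambda>i. 2 * i) ` {..<k} \<subseteq> A"
  proof
    fix x assume "x \<in> (\<lambda>i. 2 * i) ` {..<k}"
    then obtain i where "i < k" "x = 2 * i" by auto
    then show "x \<in> A" using ev[of "k - Suc i"] by simp
  qed
  moreover have "card ((\<lambda>i. 2 * i) ` {..<k}) = k" by (subst card_image) (auto simp: inj_on_def)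
  ultimately have "A = (\<lambda>i. 2 * i) ` {..<k}" using card_subset_eq[OF fA] assms(1) by metis
  then show ?thesis by (auto elim: evenE)
qed

lemma distinct_insert_two:
  "distinct ([a, b] @ xs @ ys) \<Longrightarrow> v \<notin> set ([a, b] @ xs @ ys) \<Longrightarrow> u \<notin> set ([a, b] @ xs @ ys) \<Longrightarrow> v \<noteq> u \<Longrightarrow>
    distinct ([a, b, v] @ xs @ [u] @ ys)"
  by auto

context circumference_graph
begin

text \<open>\<open>{u}\<close> is a component with \<open>k\<close> pairwise non-consecutive
  neighbours on at most \<open>2 * k + 1\<close> positions, so all gaps are 2 except possibly one of
  3. The numbering is rotated to put that gap at the end.\<close>

lemma u_cycle:
  assumes "lcyc Y" "u \<in> V - Y" "u \<noteq> w" and ind: "\<And>v. v \<in> V - Y \<Longrightarrow> \<not> E u v"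
  shows "\<exists>P. cyc P c \<and> P ` {..<c} = Y \<and> (\<forall>i<c. E u (P i) \<longleftrightarrow> even i \<and> i < 2 * k)" "c = 2 * k \<or> c = 2 * k + 1"
proof -
  obtain D where D: "cpt Y D" "u \<in> D" using comp_ex[OF assms(2)] by blast
  note C = compD[OF D(1)]
  have "D = {u}"
  proof (rule ccontr)
    assume "D \<noteq> {u}"
    then obtain v z where "v \<in> {u}" "z \<in> D - {u}" "E v z" using connD[OF C(4), of "{u}"] D(2) by blast
    then show False using ind C(2,3) by blast
  qed
  then have cu: "cpt Y {u}" using D by simp
  have Dw: "\<not> {u} \<subseteq> {w}" using assms(3) by simp
  have ck': "card (att Y {u}) = k" using comp_struct(1)[OF assms(1) cu Dw] by simp
  have at: "att Y {u} = {x \<in> Y. E u x}" unfolding att_def by blast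
  have uY: "u \<notin> Y" using assms(2) by blast
  define pos where "pos P = {i \<in> {..<c}. P i \<in> att Y {u}}" for P
  have cpos: "card (pos P) = k" if "cyc P c" "P ` {..<c} = Y" for P
    using pos_card0[OF that(1), of "att Y {u}"] that(2) ck' at unfolding pos_def by auto
  have dif: "i + 2 \<le> j" "j + 2 \<le> c + i" if "cyc P c" "P ` {..<c} = Y" "i \<in> pos P" "j \<in> pos P" "i < j" for P i j
    using not_consecutive[OF that(1,5), of u] that(2-5) uY at unfolding pos_def by auto
  have conc: "\<exists>P. cyc P c \<and> P ` {..<c} = Y \<and> (\<forall>i<c. E u (P i) \<longleftrightarrow> even i \<and> i < 2 * k)"
    if P: "cyc P c" "P ` {..<c} = Y" and le: "\<And>i. i \<in> pos P \<Longrightarrow> i + 1 < 2 * k" for P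
  proof -
    have "i \<in> pos P \<longleftrightarrow> even i \<and> i < 2 * k" for i
      by (rule even_positions[OF cpos[OF P] dif(1)[OF P] le])
    moreover have "i \<in> pos P \<longleftrightarrow> E u (P i)" if "i < c" for i
      using that P(2) at unfolding pos_def by auto
    ultimately show ?thesis using P by blast
  qed
  have "att Y {u} \<noteq> {}" using ck' k2 by force
  then obtain p where p: "p \<in> att Y {u}" by blast
  obtain P where P: "cyc P c" "P ` {..<c} = Y" "P 0 = p" using lcyc_at[OF assms(1), of p] p at by auto
  have c3: "3 \<le> c" using lcycD[OF assms(1)] by blast
  have A0: "0 \<in> pos P" using P(3) p c3 unfolding pos_def by simp
  have fA: "finite (pos P)" "pos P \<noteq> {}" using A0 unfolding pos_def by auto
  have hi: "i + 2 \<le> c" if "i \<in> pos P" for i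
    using dif(2)[OF P(1,2) A0 that] c3 by (cases "i = 0") auto
  obtain a b where ab: "a \<in> pos P" "b \<in> pos P" "a + 2 * (card (pos P) - 1) \<le> b"
    using spread[OF fA dif(1)[OF P(1,2)]] by blast
  have "2 * k \<le> c" using ab(3) hi[OF ab(2)] cpos[OF P(1,2)] k2 by linarith
  then show cc: "c = 2 * k \<or> c = 2 * k + 1" using ck by linarith
  show "\<exists>P. cyc P c \<and> P ` {..<c} = Y \<and> (\<forall>i<c. E u (P i) \<longleftrightarrow> even i \<and> i < 2 * k)"
  proof (cases "c = 2 * k")
    case True
    then show ?thesis using conc[OF P(1,2)] hi by fastforce
  next
    case False
    then have c2: "c = 2 * k + 1" using cc by simp
    \<comment> \<open>If no two consecutive positions were free, the neighbours would be the even
      positions, and \<open>2 * k\<close> would be next to \<open>0\<close> on the cycle.\<close>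
    have "\<exists>i. Suc i < c \<and> i \<notin> pos P \<and> Suc i \<notin> pos P"
    proof (rule ccontr)
      assume no: "\<not> ?thesis"
      have "i \<in> pos P \<longleftrightarrow> even i" if "i < c" for i
        using that
      proof (induction i)
        case 0 then show ?case using A0 by simp
      next
        case (Suc i)
        have "i \<in> pos P \<longleftrightarrow> Suc i \<notin> pos P"
          using no Suc.prems dif(1)[OF P(1,2), of i "Suc i"] by auto
        then show ?case using Suc by simp
      qed
      then have "2 * k \<in> pos P" using c2 by simp
      then show False using hi[of "2 * k"] c2 by simp
    qed
    then obtain i where i: "Suc i < c" "i \<notin> pos P" "Suc i \<notin> pos P" by blast
    \<comment> \<open>Starting the numbering at \<open>i + 2\<close> moves the free pair
      \<open>i\<close>, \<open>Suc i\<close> to the last positions \<open>2 * k - 1\<close> and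
      \<open>2 * k\<close>.\<close>
    define r where "r = (i + 2) mod c"
    have r: "r < c" unfolding r_def using c3 by simp
    let ?Q = "\<lambda>l. P ((l + r) mod c)"
    have Q: "cyc ?Q c" "?Q ` {..<c} = Y" using cyc_rotate[OF P(1) r] P(2) by auto
    have sh: "(l + r) mod c = (l + i + 2) mod c" for l
      unfolding r_def by (simp add: mod_add_right_eq add.assoc)
    have "(2 * k - 1 + i + 2) mod c = i" "(2 * k + i + 2) mod c = Suc i"
    proof -
      have e: "2 * k - 1 + i + 2 = c + i" "2 * k + i + 2 = c + Suc i" using c2 k2 by auto
      show "(2 * k - 1 + i + 2) mod c = i" "(2 * k + i + 2) mod c = Suc i" unfolding e using i(1) by (simp_all only: mod_add_self1 mod_less Suc_lessD)
    qed
    then have "?Q (2 * k - 1) = P i" "?Q (2 * k) = P (Suc i)" using sh by simp_all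
    then have "2 * k - 1 \<notin> pos ?Q" "2 * k \<notin> pos ?Q" using i unfolding pos_def by auto
    then have "l + 1 < 2 * k" if "l \<in> pos ?Q" for l
    proof -
      have "l < c" using that unfolding pos_def by simp
      moreover have "l \<noteq> 2 * k - 1" "l \<noteq> 2 * k" using that \<open>2 * k - 1 \<notin> pos ?Q\<close> \<open>2 * k \<notin> pos ?Q\<close> by blast+
      ultimately show ?thesis using c2 by linarith
    qed
    then show ?thesis using conc[OF Q] by blast
  qed
qed

section \<open>Cycles on which an outside vertex sees every second position\<close>

definition even_nbrs :: "(nat \<Rightarrow> 'a) \<Rightarrow> 'a \<Rightarrow> bool" where
  "even_nbrs P u \<longleftrightarrow> cyc P c \<and> u \<in> V - P ` {..<c} \<and> u \<noteq> w \<and> (\<forall>i<c. E u (P i) \<longleftrightarrow> even i \<and> i < 2 * k)"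

lemma even_nbrsD:
  assumes "even_nbrs P u"
  shows "cyc P c" "u \<in> V" "u \<notin> P ` {..<c}" "u \<noteq> w" "\<And>i. i < c \<Longrightarrow> E u (P i) \<longleftrightarrow> even i \<and> i < 2 * k"
  using assms unfolding even_nbrs_def by auto

text \<open>Odd positions are successors of neighbours of \<open>u\<close>, so
  \<open>cross_succ\<close> applies with \<open>u\<close> as the ear.\<close>

lemma even_nbrs_odd:
  assumes "even_nbrs P u" "2 * k \<le> c" "odd i" "odd j" "i < j" "j < 2 * k"
  shows "\<not> E (P i) (P j)"
proof
  assume e: "E (P i) (P j)"
  note U = even_nbrsD[OF assms(1)]
  have i: "Suc (i - 1) = i" "Suc (j - 1) = j" using assms(3,4) by (auto elim: oddE)
  have "cycset ({u} \<union> P ` {..<c})"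
  proof (rule cross_succ[OF U(1) _ _ pth_single])
    show "i - 1 < j - 1" "j - 1 < c" using assms i by linarith+
    have "even (i - 1)" "even (j - 1)" using assms(3,4) by simp_all
    then show "E (P (i - 1)) u" "E u (P (j - 1))" using U(5) assms i sym by simp_all
    show "E (P (Suc (i - 1))) (P (Suc (j - 1) mod c))" using e i assms by simp
  qed (use U(3) in simp)
  moreover have "card ({u} \<union> P ` {..<c}) = Suc c" using U(3) cyc_card[OF U(1), of "{..<c}"] by simp
  ultimately show False using bound by fastforce
qed

text \<open>Makes the two free positions at the end interchangeable: what holds for
  \<open>P (2 * k - 1)\<close> carries over to \<open>P (2 * k)\<close>.\<close>

lemma even_nbrs_mirror:
  assumes "even_nbrs P u" "c = 2 * k + 1"
  shows "\<exists>R. even_nbrs R u \<and> R ` {..<c} = P ` {..<c} \<and> R (2 * k) = P (2 * k - 1) \<and> (\<forall>i<2 * k - 1. R i = P (2 * k - 2 - i)) \<and> R (2 * k - 1) = P (2 * k)"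
proof -
  note U = even_nbrsD[OF assms(1)]
  let ?B = "\<lambda>i. P (c - 1 - i)"
  let ?R = "\<lambda>i. ?B ((i + 2) mod c)"
  have R0: "cyc ?B c" "?B ` {..<c} = P ` {..<c}" using cyc_reverse[OF U(1)] by auto
  have c2: "2 < c" using assms(2) k2 by simp
  have R: "cyc ?R c" using cyc_rotate(1)[OF R0(1) c2] .
  have R2: "?R ` {..<c} = P ` {..<c}" using cyc_rotate(2)[OF R0(1) c2] R0(2) by (rule trans)
  have r1: "?R i = P (2 * k - 2 - i)" if "i < 2 * k - 1" for i
  proof -
    have "(i + 2) mod c = i + 2" using that assms(2) by simp
    moreover have "c - 1 - (i + 2) = 2 * k - 2 - i" using assms(2) by simp
    ultimately show ?thesis by simp
  qed
  have "(2 * k - 1 + 2) mod c = 0" "(2 * k + 2) mod c = 1"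
  proof -
    have e: "2 * k - 1 + 2 = c" "2 * k + 2 = c + 1" using assms(2) k2 by auto
    show "(2 * k - 1 + 2) mod c = 0" "(2 * k + 2) mod c = 1" unfolding e using c2 by (simp_all add: mod_Suc)
  qed
  then have r2: "?R (2 * k - 1) = P (2 * k)" "?R (2 * k) = P (2 * k - 1)" using assms(2) by simp_all
  have "E u (?R i) \<longleftrightarrow> even i \<and> i < 2 * k" if i: "i < c" for i
  proof -
    consider "i < 2 * k - 1" | "i = 2 * k - 1" | "i = 2 * k" using i assms(2) by linarith
    then show ?thesis
    proof cases
      case 1
      have "E u (P (2 * k - 2 - i)) \<longleftrightarrow> even (2 * k - 2 - i)" using U(5)[of "2 * k - 2 - i"] assms(2) k2 by auto
      moreover have "2 * k - 2 - i + i = 2 * (k - 1)" using 1 by simp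
      then have "even (2 * k - 2 - i) \<longleftrightarrow> even i" by (metis even_add dvd_triv_left)
      moreover have "i < 2 * k" using 1 by simp
      ultimately show ?thesis using r1[OF 1] by simp
    next
      case 2
      have "\<not> E u (P (2 * k))" using U(5)[of "2 * k"] assms(2) by simp
      moreover have "odd (2 * k - 1)" using k2 by simp
      ultimately show ?thesis using r2(1) 2 by simp
    next
      case 3
      have "odd (2 * k - 1)" using k2 by simp
      then have "\<not> E u (P (2 * k - 1))" using U(5)[of "2 * k - 1"] assms(2) by simp
      then show ?thesis using r2(2) 3 by simp
    qed
  qed
  then have "even_nbrs ?R u" unfolding even_nbrs_def using R R2 U by simp
  then show ?thesis using R2 r1 r2 by (intro exI[of _ ?R]) simp
qed

text \<open>\<open>P i\<close> lies between two neighbours of \<open>u\<close>, so \<open>u\<close>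
  can take its place on the cycle. Then \<open>P i\<close> and any \<open>v \<noteq> u\<close> both
  lie off a longest cycle.\<close>

lemma even_nbrs_swap:
  assumes ind: "\<And>Y u v. lcyc Y \<Longrightarrow> u \<in> V - Y \<Longrightarrow> v \<in> V - Y \<Longrightarrow> \<not> E u v"
    and "even_nbrs P u" "odd i" "i < 2 * k" "Suc i < c \<or> Suc i = 2 * k \<and> c = 2 * k" "v \<in> V - P ` {..<c}"
  and i': "Suc i < c \<Longrightarrow> Suc i < 2 * k"
  shows "\<not> E (P i) v"
proof (cases "v = u")
  case True
  note U = even_nbrsD[OF assms(2)]
  have "i < c" using assms(5) by auto
  then have "\<not> E u (P i)" using U(5) assms(3) by simp
  then show ?thesis using True sym by blast
next
  case False
  note U = even_nbrsD[OF assms(2)] and L = lcyc_cyc[OF even_nbrsD(1)[OF assms(2)]]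
  have ii: "Suc (i - 1) = i" "even (i - 1)" using assms(3) by (auto elim: oddE)
  have i0: "0 < i" using assms(3) by (cases i) auto
  have iV: "P i \<in> V" using lcycD(3)[OF L] assms(5) by auto
  have dX: "{u} \<inter> P ` {..<c} = {}" using U(3) by simp
  have "\<exists>Z. lcyc Z \<and> P i \<notin> Z \<and> v \<notin> Z"
  proof (cases "Suc i < c")
    case True
    have a: "i - 1 < Suc i" by simp
    have Eu: "E (P (i - 1)) u" "E u (P (Suc i))" using U(5) ii assms(3,4) True sym i' by simp_all
    note Z = ear_out[OF U(1) a True pth_single dX Eu]
    have "lcyc ({u} \<union> P ` ({..i - 1} \<union> {Suc i..<c}))" unfolding lcyc_def using Z ii by simp
    moreover have "P i \<notin> {u} \<union> P ` ({..i - 1} \<union> {Suc i..<c})"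
      using True ii i0 by (intro pos_notin[OF U(1) dX]) auto
    moreover have "v \<notin> {u} \<union> P ` ({..i - 1} \<union> {Suc i..<c})" using False assms(6) True by auto
    ultimately show ?thesis by blast
  next
    case F: False
    then have c2: "c = 2 * k" "i = 2 * k - 1" using assms(5) by auto
    have a: "0 < i - 1" "i - 1 < c" using c2 k2 by auto
    have Eu: "E (P 0) u" "E u (P (i - 1))" using U(5) ii c2 a k2 sym by simp_all
    note Z = ear_in[OF U(1) a pth_single dX Eu]
    have "lcyc ({u} \<union> P ` {0..i - 1})" unfolding lcyc_def using Z c2 k2 by simp
    moreover have "P i \<notin> {u} \<union> P ` {0..i - 1}"
      using c2 ii by (intro pos_notin[OF U(1) dX]) auto
    moreover have "P ` {0..i - 1} \<subseteq> P ` {..<c}" using a by (intro image_mono) auto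
    then have "v \<notin> {u} \<union> P ` {0..i - 1}" using False assms(6) by auto
    ultimately show ?thesis by blast
  qed
  then show ?thesis using ind[of _ "P i" v] iV assms(6) by blast
qed

text \<open>If an off-cycle vertex \<open>v\<close> sees the end \<open>P (2 * k - 1)\<close> of the long gap, every further neighbour
  \<open>P i\<close> with \<open>i \<ge> 2\<close> gives the longer cycle
  \<open>P (2 * k), P (2 * k - 1), v, P i, \<dots>, P (2 * k - 2), u, P (i - 2), \<dots>, P 0\<close>.\<close>

lemma even_nbrs_off:
  assumes ind: "\<And>Y u v. lcyc Y \<Longrightarrow> u \<in> V - Y \<Longrightarrow> v \<in> V - Y \<Longrightarrow> \<not> E u v"
    and "even_nbrs P u" "c = 2 * k + 1" "v \<in> V - P ` {..<c}" "E v (P (2 * k - 1))" "E v x"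
  shows "x = P (2 * k - 1) \<or> x = P 0"
proof -
  note U = even_nbrsD[OF assms(2)] and L = lcyc_cyc[OF even_nbrsD(1)[OF assms(2)]]
  have c3: "3 \<le> c" "2 * k - 1 < c" "2 * k < c" using assms(3) k2 by auto
  have vu: "v \<noteq> u"
  proof
    assume "v = u"
    then have "even (2 * k - 1)" using U(5)[OF c3(2)] assms(5) by simp
    then show False using k2 by simp
  qed
  have "x \<in> P ` {..<c}" using ind[OF L assms(4), of x] assms(6) EV2 by blast
  then obtain i where i: "i < c" "x = P i" by auto
  have vY: "v \<notin> P ` {..<c}" using assms(4) by blast
  show ?thesis
  proof (rule ccontr)
    assume n: "\<not> ?thesis"
    have "i \<noteq> 2 * k - 1" "i \<noteq> 0" using n unfolding i(2) by metis+
    moreover have "i \<noteq> 2 * k"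
    proof
      assume "i = 2 * k"
      then show False using not_consecutive(1)[OF U(1) _ _ assms(5) _ vY, of i] assms(6) i assms(3) k2 by auto
    qed
    ultimately have i2: "0 < i" "i < 2 * k - 1" using i(1) assms(3) by linarith+
    show False
    proof (cases "odd i")
      case True
      have "\<not> E (P i) v"
        using i2 assms(3) by (intro even_nbrs_swap[OF ind assms(2) True _ _ assms(4)]) auto
      then show False using assms(6) i sym by blast
    next
      case False
      then have ie: "2 \<le> i" "even (i - 2)" using i2 by (auto elim: evenE)
      let ?xs = "[P (2 * k), P (2 * k - 1), v] @ map P [i..<2 * k - 1] @ [u] @ rev (map P [0..<i - 1])"
      have Eu: "E (P (2 * k - 2)) u" "E u (P (i - 2))" using U(5) assms(3) i2 ie sym by auto
      have st: "E (P l) (P (Suc l))" if "Suc l < c" for l using cyc_edge[OF U(1) that] .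
      have e1: "E (P (2 * k)) (P (2 * k - 1))" using st[of "2 * k - 1"] assms(3) k2 sym by simp
      have e0: "E (P 0) (P (2 * k))" using cyc_close[OF U(1)] assms(3) sym by simp
      have s1: "successively E (map P [i..<2 * k - 1])"
        unfolding successively_map using st assms(3) by (intro successively_upt) auto
      have s2: "successively E (rev (map P [0..<i - 1]))"
        unfolding rev_map successively_map using st assms(3) i2 sym by (intro successively_rev_upt) auto
      have h1: "hd (map P [i..<2 * k - 1]) = P i" "last (map P [i..<2 * k - 1]) = P (2 * k - 2)"
        using i2 by (simp_all add: hd_map last_map numeral_2_eq_2)
      have h2: "hd (rev (map P [0..<i - 1])) = P (i - 2)" "last (rev (map P [0..<i - 1])) = P 0"
        using ie by (simp_all add: hd_rev last_rev hd_map last_map numeral_2_eq_2)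
      have ne: "map P [i..<2 * k - 1] \<noteq> []" "rev (map P [0..<i - 1]) \<noteq> []" using i2 ie by auto
      have Evx: "E v (P i)" using assms(6) i(2) by simp
      have suc: "successively E ?xs"
        using s1 s2 h1 h2 ne Eu e1 sym[OF assms(5)] Evx
        by (simp add: successively_append_iff successively_Cons del: upt_Suc rev_map)
      have lst: "last ?xs = P 0" "hd ?xs = P (2 * k)" using h2(2) ne(2) by (simp_all del: rev_map upt_Suc)
      have dis: "distinct ?xs"
      proof -
        have injP: "inj_on P {..<c}" using U(1) unfolding cyc_def by blast
        have "distinct (map P ([2 * k, 2 * k - 1] @ [i..<2 * k - 1] @ rev [0..<i - 1]))"
          unfolding distinct_map
        proof
          show "distinct ([2 * k, 2 * k - 1] @ [i..<2 * k - 1] @ rev [0..<i - 1])" using i2 by auto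
          show "inj_on P (set ([2 * k, 2 * k - 1] @ [i..<2 * k - 1] @ rev [0..<i - 1]))"
            by (rule inj_on_subset[OF injP]) (use assms(3) i2 in auto)
        qed
        moreover have "set (map P ([2 * k, 2 * k - 1] @ [i..<2 * k - 1] @ rev [0..<i - 1])) \<subseteq> P ` {..<c}"
          unfolding set_map by (intro image_mono) (use assms(3) i2 in auto)
        ultimately have "distinct ([P (2 * k), P (2 * k - 1)] @ map P [i..<2 * k - 1] @ rev (map P [0..<i - 1]))"
          "v \<notin> set ([P (2 * k), P (2 * k - 1)] @ map P [i..<2 * k - 1] @ rev (map P [0..<i - 1]))"
          "u \<notin> set ([P (2 * k), P (2 * k - 1)] @ map P [i..<2 * k - 1] @ rev (map P [0..<i - 1]))"
          using vY U(3) unfolding rev_map map_append list.map by blast+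
        then show ?thesis using vu by (rule distinct_insert_two)
      qed
      have "length ?xs \<le> c" using dis suc lst e0 by (intro list_bound) auto
      moreover have "length ?xs = 2 * k + 2" using i2 ie by simp
      ultimately show False using assms(3) by simp
    qed
  qed
qed

text \<open>Replacing \<open>P (2 * k)\<close> by \<open>v\<close> gives another cycle of the same
  kind. Now \<open>P (2 * k)\<close> is an outside vertex that sees position
  \<open>2 * k - 1\<close>, so \<open>even_nbrs_off\<close> applies to it.\<close>

lemma even_nbrs_end_swap:
  assumes ind: "\<And>Y u v. lcyc Y \<Longrightarrow> u \<in> V - Y \<Longrightarrow> v \<in> V - Y \<Longrightarrow> \<not> E u v"
    and "even_nbrs P u" "c = 2 * k + 1" "v \<in> V - P ` {..<c}" "E v (P (2 * k - 1))" "E v (P 0)" "E (P (2 * k)) x"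
  shows "x = P (2 * k - 1) \<or> x = P 0"
proof -
  note U = even_nbrsD[OF assms(2)] and L = lcyc_cyc[OF even_nbrsD(1)[OF assms(2)]]
  have vY: "v \<notin> P ` {..<c}" using assms(4) by blast
  have c3: "3 \<le> c" "2 * k - 1 < c" "2 * k < c" using assms(3) k2 by auto
  have vu: "v \<noteq> u"
  proof
    assume "v = u"
    then have "even (2 * k - 1)" using U(5)[OF c3(2)] assms(5) by simp
    then show False using k2 by simp
  qed
  define Q where "Q = P(2 * k := v)"
  have Qi: "Q i = P i" if "i < 2 * k" for i using that unfolding Q_def by simp
  have Q2: "Q (2 * k) = v" unfolding Q_def by simp
  have cQ: "cyc Q c"
    unfolding cyc_def
  proof (intro conjI allI impI)
    show "inj_on Q {..<c}"
    proof (rule inj_onI)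
      fix i j assume ij: "i \<in> {..<c}" "j \<in> {..<c}" "Q i = Q j"
      have "P l \<noteq> v" if "l < c" for l using vY that by auto
      then show "i = j" using ij cyc_inj[OF U(1), of i j] unfolding Q_def by (auto split: if_splits)
    qed
    show "E (Q i) (Q (Suc i))" if "Suc i < c" for i
    proof (cases "Suc i = 2 * k")
      case True
      then have "Q i = P (2 * k - 1)" using Qi[of i] by (metis diff_Suc_1 lessI)
      then show ?thesis using True Q2 assms(5) sym by simp
    next
      case False
      then show ?thesis using Qi[of i] Qi[of "Suc i"] that assms(3) cyc_edge[OF U(1) that] by simp
    qed
    show "E (Q (c - 1)) (Q 0)" using Q2 Qi[of 0] assms(3,6) k2 by simp
  qed (rule c3)
  have im: "Q ` {..<c} = insert v (P ` {..<2 * k})"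
  proof -
    have "{..<c} = insert (2 * k) {..<2 * k}" using assms(3) by auto
    moreover have "Q ` {..<2 * k} = P ` {..<2 * k}" using Qi by (intro image_cong) auto
    ultimately show ?thesis using Q2 by simp
  qed
  have "u \<notin> Q ` {..<c}" using U(3) vu im assms(3) by auto
  moreover have "E u (Q i) \<longleftrightarrow> even i \<and> i < 2 * k" if "i < c" for i
  proof (cases "i = 2 * k")
    case True
    have "\<not> E u v" using ind[OF L, of u v] U(2,3) assms(4) by blast
    then show ?thesis using True Q2 by simp
  next
    case False then show ?thesis using Qi[of i] U(5)[of i] that assms(3) by simp
  qed
  ultimately have eQ: "even_nbrs Q u" unfolding even_nbrs_def using cQ U by blast
  have "P (2 * k) \<notin> Q ` {..<c}"
  proof
    assume "P (2 * k) \<in> Q ` {..<c}"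
    then have "P (2 * k) \<in> P ` {..<2 * k}" using im vY c3(3) by auto
    then obtain l where "l < 2 * k" "P (2 * k) = P l" by auto
    then show False using cyc_inj[OF U(1), of "2 * k" l] assms(3) by simp
  qed
  moreover have "P (2 * k) \<in> V" using lcycD(3)[OF L] c3(3) by auto
  moreover have "E (P (2 * k)) (Q (2 * k - 1))"
  proof -
    have "Suc (2 * k - 1) = 2 * k" using k2 by simp
    then show ?thesis using cyc_edge[OF U(1), of "2 * k - 1"] Qi[of "2 * k - 1"] c3(3) sym k2 by simp
  qed
  ultimately have "x = Q (2 * k - 1) \<or> x = Q 0"
    by (intro even_nbrs_off[OF ind eQ assms(3) _ _ assms(7)]) auto
  then show ?thesis using Qi[of "2 * k - 1"] Qi[of 0] k2 by simp
qed

text \<open>Such a \<open>v\<close> has at most two neighbours, hence \<open>v = w\<close>. Then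
  \<open>P (2 * k)\<close> has at most two neighbours as well, although it is not
  \<open>w\<close>.\<close>

lemma even_nbrs_off_none:
  assumes ind: "\<And>Y u v. lcyc Y \<Longrightarrow> u \<in> V - Y \<Longrightarrow> v \<in> V - Y \<Longrightarrow> \<not> E u v"
    and "even_nbrs P u" "c = 2 * k + 1" "v \<in> V - P ` {..<c}" "3 \<le> k"
  shows "\<not> E v (P (2 * k - 1))"
proof
  assume e: "E v (P (2 * k - 1))"
  note U = even_nbrsD[OF assms(2)] and L = lcyc_cyc[OF even_nbrsD(1)[OF assms(2)]]
  have small: False if "\<And>x. E v x \<Longrightarrow> x = P (2 * k - 1) \<or> x = P 0" "v \<in> V" "v \<noteq> w" for v
  proof -
    have "card {x. E v x} \<le> card {P (2 * k - 1), P 0}" using that(1) by (intro card_mono) auto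
    then have "card {x. E v x} \<le> 2" by (simp add: card_insert_if split: if_splits)
    then show False using deg[OF that(2,3)] assms(5) by simp
  qed
  have nb: "\<And>x. E v x \<Longrightarrow> x = P (2 * k - 1) \<or> x = P 0" using even_nbrs_off[OF ind assms(2-4) e] .
  have vw: "v = w" using small[OF nb] assms(4) by blast
  have "E v (P 0)"
  proof (rule ccontr)
    assume "\<not> E v (P 0)"
    then have "V \<subseteq> insert (P (2 * k - 1)) {v}" using nb assms(4) by (intro two) blast+
    then have "card V \<le> card {P (2 * k - 1), v}" by (intro card_mono) auto
    also have "\<dots> \<le> 2" by (simp add: card_insert_if)
    finally show False using V3 by simp
  qed
  then have e0: "E v (P 0)" .
  have "x = P (2 * k - 1) \<or> x = P 0" if "E (P (2 * k)) x" for x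
    by (rule even_nbrs_end_swap[OF ind assms(2-4) e e0 that])
  moreover have "P (2 * k) \<in> V" "P (2 * k) \<noteq> w" using lcycD(3)[OF L] assms(3,4) vw by auto
  ultimately show False using small by blast
qed

text \<open>The neighbourhood \<open>A\<close> of \<open>u\<close> is the part of size
  \<open>k\<close>. Outside \<open>A\<close> the only possible edge joins the two free positions for
  \<open>c = 2 * k + 1\<close>, unless these have neighbours off the cycle. That happens only for
  \<open>k = 2\<close>, where the cycle has length 5 and the graph fits into \<open>F\<close> with
  hubs \<open>Q 2\<close>, \<open>Q 3\<close> and \<open>Q 0\<close>.\<close>

lemma case_independent:
  assumes ind: "\<And>Y u v. lcyc Y \<Longrightarrow> u \<in> V - Y \<Longrightarrow> v \<in> V - Y \<Longrightarrow> \<not> E u v"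
    and "lcyc Y" "u \<in> V - Y" "u \<noteq> w"
  shows "shape_H \<or> shape_F"
proof -
  note UC = u_cycle[OF assms(2-4) ind[OF assms(2,3)]]
  obtain P where P: "cyc P c" "P ` {..<c} = Y" "\<And>i. i < c \<Longrightarrow> E u (P i) \<longleftrightarrow> even i \<and> i < 2 * k" using UC(1) by blast
  have ev: "even_nbrs P u" unfolding even_nbrs_def using P assms by blast
  note U = even_nbrsD[OF ev] and L = lcyc_cyc[OF P(1)]
  define A where "A = {x \<in> Y. E u x}"
  have YV: "Y \<subseteq> V" using lcycD(3)[OF assms(2)] .
  have AY: "A \<subseteq> V" using YV unfolding A_def by blast
  have A: "A = P ` {i \<in> {..<c}. even i \<and> i < 2 * k}" unfolding A_def using P(2,3) by auto
  have ckc: "2 * k \<le> c" using UC(2) by linarith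
  have cA: "card A = k"
  proof -
    have "card A = card {i \<in> {..<c}. even i \<and> i < 2 * k}" unfolding A by (intro cyc_card[OF P(1)]) auto
    also have "{i \<in> {..<c}. even i \<and> i < 2 * k} = (\<lambda>i. 2 * i) ` {..<k}" using ckc by (auto elim!: evenE)
    also have "card \<dots> = k" by (subst card_image) (auto simp: inj_on_def)
    finally show ?thesis .
  qed
  have cV: "2 * k + 1 \<le> card V" using cn ckc by linarith
  have outA: "(\<exists>i<c. v = P i \<and> (odd i \<or> i = 2 * k)) \<or> v \<in> V - Y" if "v \<in> V - A" for v
  proof (cases "v \<in> Y")
    case True
    then obtain i where i: "i < c" "v = P i" using P(2) by auto
    then have "\<not> (even i \<and> i < 2 * k)" using that P(3)[OF i(1)] True unfolding A_def by blast
    moreover have "i \<le> 2 * k" using i(1) ck by simp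
    ultimately show ?thesis using i by (intro disjI1 exI[of _ i]) auto
  qed (use that in blast)
  show ?thesis
  proof (cases "c = 2 * k")
    case True
    have oo: "\<not> E (P i) (P j)" if "odd i" "odd j" "i < c" "j < c" for i j
      using even_nbrs_odd[OF ev ckc that(1,2)] even_nbrs_odd[OF ev ckc that(2,1)] that True irrefl sym
      by (metis linorder_neqE_nat)
    have ov: "\<not> E (P i) v" if "odd i" "i < c" "v \<in> V - Y" for i v
    proof (rule even_nbrs_swap[OF ind ev that(1)])
      show "Suc i < c \<or> Suc i = 2 * k \<and> c = 2 * k" using that(2) True by linarith
    qed (use that True P(2) in auto)
    have "\<not> E x y" if xy: "x \<in> V - A" "y \<in> V - A" for x y
    proof
      assume e: "E x y"
      consider i j where "x = P i" "y = P j" "odd i" "odd j" "i < c" "j < c"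
        | i where "x = P i" "odd i" "i < c" "y \<in> V - Y" | j where "y = P j" "odd j" "j < c" "x \<in> V - Y"
        | "x \<in> V - Y" "y \<in> V - Y"
        using outA[OF xy(1)] outA[OF xy(2)] True by auto
      then show False using oo ov e sym ind[OF assms(2)] by cases blast+
    qed
    then have shape_H unfolding shape_H_def using cV cA AY by blast
    then show ?thesis ..
  next
    case False
    then have c2: "c = 2 * k + 1" using UC(2) by simp
    obtain R where R: "even_nbrs R u" "R ` {..<c} = P ` {..<c}" "R (2 * k) = P (2 * k - 1)"
      "\<And>i. i < 2 * k - 1 \<Longrightarrow> R i = P (2 * k - 2 - i)" "R (2 * k - 1) = P (2 * k)"
      using even_nbrs_mirror[OF ev c2] by blast
    have o2: "odd (2 * k - 1)" "2 * k - 1 < 2 * k" using k2 by auto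
    have oo: "\<not> E (P i) (P j)" if "odd i" "odd j" "i < 2 * k" "j < 2 * k" for i j
      using even_nbrs_odd[OF ev ckc that(1,2)] even_nbrs_odd[OF ev ckc that(2,1)] that irrefl sym
      by (metis linorder_neqE_nat)
    have oy: "\<not> E (P i) (P (2 * k))" if "odd i" "i < 2 * k - 1" for i
    proof -
      have i: "odd (2 * k - 2 - i)" "2 * k - 2 - i < 2 * k - 1" "2 * k - 2 - (2 * k - 2 - i) = i"
        using that by (auto simp: even_diff_nat)
      have "\<not> E (R (2 * k - 2 - i)) (R (2 * k - 1))"
        using i o2 by (intro even_nbrs_odd[OF R(1) ckc]) auto
      then show ?thesis using R(4)[OF i(2)] R(5) i(3) by simp
    qed
    have ov: "\<not> E (P i) v" if "odd i" "i < 2 * k - 1" "v \<in> V - Y" for i v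
      by (rule even_nbrs_swap[OF ind ev that(1)]) (use that c2 P(2) in auto)
    show ?thesis
    proof (cases "\<exists>v\<in>V - Y. E v (P (2 * k - 1)) \<or> E v (P (2 * k))")
      case no: False
      have H: "{x, y} = {P (2 * k - 1), P (2 * k)}" if xy: "x \<in> V - A" "y \<in> V - A" and e: "E x y" for x y
      proof -
        have cl: "(\<exists>i. v = P i \<and> odd i \<and> i < 2 * k - 1) \<or> v = P (2 * k - 1) \<or> v = P (2 * k) \<or> v \<in> V - Y" if "v \<in> V - A" for v
        proof -
          have "(\<exists>i. v = P i \<and> odd i \<and> i < 2 * k - 1) \<or> v = P (2 * k - 1) \<or> v = P (2 * k)" if "i < c" "v = P i" "odd i \<or> i = 2 * k" for i
          proof -
            have "i < 2 * k - 1 \<or> i = 2 * k - 1 \<or> i = 2 * k" using that(1) c2 by linarith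
            then show ?thesis using that(2,3) by auto
          qed
          then show ?thesis using outA[OF that] by blast
        qed
        have o1: "\<not> E (P i) z" if "odd i" "i < 2 * k - 1" "z \<in> V - A" for i z
          using cl[OF that(3)] oo[OF that(1)] oo[OF that(1) o2(1)] oy[OF that(1,2)] ov[OF that(1,2)] that(2) o2 by auto
        have ve: "\<not> E v z" if "v \<in> V - Y" "z \<in> V - A" for v z
          using cl[OF that(2)] no that(1) ind[OF assms(2) that(1)] ov sym by blast
        have "x = P (2 * k - 1) \<or> x = P (2 * k)" using cl[OF xy(1)] o1 ve xy(2) e by blast
        moreover have "y = P (2 * k - 1) \<or> y = P (2 * k)" using cl[OF xy(2)] o1 ve xy(1) sym[OF e] by blast
        moreover have "x \<noteq> y" using e irrefl by blast
        ultimately show ?thesis by auto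
      qed
      have n2: "2 * k + 2 \<le> card V" using cn c2 by simp
      have shape_H unfolding shape_H_def
        by (rule conjI[OF cV], rule exI[of _ A], rule conjI[OF AY], rule conjI[OF cA], rule disjI2,
            rule conjI[OF n2], rule exI[of _ "P (2 * k - 1)"], rule exI[of _ "P (2 * k)"]) (use H in blast)
      then show ?thesis ..
    next
      case True
      then obtain v0 where v0: "v0 \<in> V - Y" "E v0 (P (2 * k - 1)) \<or> E v0 (P (2 * k))" by blast
      have "k = 2"
      proof (rule ccontr)
        assume "k \<noteq> 2"
        then have "3 \<le> k" using k2 by simp
        then have "\<not> E v0 (P (2 * k - 1))" "\<not> E v0 (R (2 * k - 1))"
          using even_nbrs_off_none[OF ind ev c2] even_nbrs_off_none[OF ind R(1) c2] v0(1) R(2) P(2) by auto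
        then show False using v0(2) R(5) by simp
      qed
      \<comment> \<open>If \<open>v0\<close> sees the other free position, the mirrored numbering is
        taken, so that the neighbour is \<open>Q 3\<close> in either case.\<close>
      have "\<exists>Q. even_nbrs Q u \<and> Q ` {..<c} = Y \<and> E v0 (Q 3)"
        using v0(2) ev R P(2) \<open>k = 2\<close> by (auto simp: numeral_eq_Suc)
      then obtain Q where Q: "even_nbrs Q u" "Q ` {..<c} = Y" "E v0 (Q 3)" by blast
      have c5: "c = 5" using c2 \<open>k = 2\<close> by simp
      have k23: "2 * k - 1 = 3" "2 * k = 4" using \<open>k = 2\<close> by auto
      obtain R' where R': "even_nbrs R' u" "R' ` {..<c} = Q ` {..<c}" "R' (2 * k) = Q (2 * k - 1)"
        "\<And>i. i < 2 * k - 1 \<Longrightarrow> R' i = Q (2 * k - 2 - i)" "R' (2 * k - 1) = Q (2 * k)"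
        using even_nbrs_mirror[OF Q(1) c2] by blast
      note inj = cyc_inj[OF even_nbrsD(1)[OF Q(1)]]
      have Yeq: "Y = {Q 0, Q 1, Q 2, Q 3, Q 4}"
      proof -
        have "{..<c} = {0, 1, 2, 3, 4}" using c5 by auto
        then have "Y = Q ` {0, 1, 2, 3, 4}" using Q(2) by simp
        then show ?thesis by simp
      qed
      have off3: "x = Q 3 \<or> x = Q 0" if "v \<in> V - Y" "E v (Q 3)" "E v x" for v x
        using even_nbrs_off[OF ind Q(1) c2 _ _ that(3)] that(1,2) Q(2) k23 by simp
      have v00: "E v0 (Q 0)"
      proof (rule ccontr)
        assume "\<not> E v0 (Q 0)"
        then have "V \<subseteq> insert (Q 3) {v0}" using off3[OF v0(1) Q(3)] v0(1) by (intro two) blast+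
        then have "card V \<le> card {Q 3, v0}" by (intro card_mono) auto
        also have "\<dots> \<le> 2" by (simp add: card_insert_if)
        finally show False using V3 by simp
      qed
      have n4: "x = Q 3 \<or> x = Q 0" if "E (Q 4) x" for x
        using even_nbrs_end_swap[OF ind Q(1) c2 _ _ v00] v0(1) Q(2,3) that k23 by simp
      have n1off: "\<not> E (Q 1) v" if "v \<in> V - Y" for v
        by (rule even_nbrs_swap[OF ind Q(1)]) (use that c5 k23 Q(2) in auto)
      have n13: "\<not> E (Q 1) (Q 3)" using even_nbrs_odd[OF Q(1) ckc, of 1 3] k23 by simp
      have n1: "x = Q 2 \<or> x = Q 0" if "E (Q 1) x" for x
      proof -
        have "x \<in> Y" using n1off that EV2 by blast
        moreover have "x \<noteq> Q 4"
        proof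
          assume "x = Q 4"
          then have "Q 1 = Q 3 \<or> Q 1 = Q 0" using n4[of "Q 1"] that sym by blast
          then show False using inj[of 1 3] inj[of 1 0] c5 by simp
        qed
        ultimately show ?thesis using Yeq that n13 irrefl by auto
      qed
      have noff: "(\<forall>x. E v x \<longrightarrow> x = Q 2 \<or> x = Q 0) \<or> (\<forall>x. E v x \<longrightarrow> x = Q 3 \<or> x = Q 0)" if v: "v \<in> V - Y" for v
      proof (cases "E v (Q 3)")
        case True
        then show ?thesis using off3[OF v] by blast
      next
        case False
        have "x = Q 2 \<or> x = Q 0" if "E v x" for x
        proof -
          have "x \<in> Y" using ind[OF assms(2) v] that EV2 by blast
          moreover have "x \<noteq> Q 1" using n1off[OF v] that sym by blast
          moreover have "x \<noteq> Q 4"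
          proof
            assume "x = Q 4"
            then have "v = Q 3 \<or> v = Q 0" using n4[of v] that sym by blast
            then show False using v Yeq by blast
          qed
          ultimately show ?thesis using Yeq that False by auto
        qed
        then show ?thesis by blast
      qed
      have ne: "Q 2 \<noteq> Q 3" "Q 2 \<noteq> Q 0" "Q 3 \<noteq> Q 0" using inj[of 2 3] inj[of 2 0] inj[of 3 0] c5 by auto
      have "\<exists>X. v \<in> X \<and> card X \<le> k - 1 \<and> X \<inter> {Q 2, Q 3, Q 0} = {} \<and> (sep X {Q 2, Q 0} \<or> sep X {Q 3, Q 0})"
        if v: "v \<in> V - {Q 2, Q 3, Q 0}" for v
      proof -
        have "(\<forall>x. E v x \<longrightarrow> x = Q 2 \<or> x = Q 0) \<or> (\<forall>x. E v x \<longrightarrow> x = Q 3 \<or> x = Q 0)"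
        proof (cases "v \<in> Y")
          case True
          then have "v = Q 1 \<or> v = Q 4" using Yeq v by auto
          then show ?thesis using n1 n4 by blast
        qed (use noff v in blast)
        then have "sep {v} {Q 2, Q 0} \<or> sep {v} {Q 3, Q 0}" unfolding sep_def using v by auto
        then show ?thesis using v \<open>k = 2\<close> by (intro exI[of _ "{v}"]) auto
      qed
      moreover have "Q 2 \<in> V" "Q 3 \<in> V" "Q 0 \<in> V" using Yeq YV by auto
      ultimately have shape_F unfolding shape_F_def using ne
        by (intro exI[of _ "Q 2"] exI[of _ "Q 3"] exI[of _ "Q 0"]) simp
      then show ?thesis ..
    qed
  qed
qed

end

section \<open>An exceptional vertex missed by every longest cycle\<close>

text \<open>\<open>cw\<close> is the length of a longest cycle through \<open>w\<close>.\<close>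

locale exceptional_graph = circumference_graph E V k w c for E :: "'a \<Rightarrow> 'a \<Rightarrow> bool" and V k w c +
  fixes cw :: nat
  assumes maxw: "cycset Z \<Longrightarrow> w \<in> Z \<Longrightarrow> card Z \<le> cw" and cwc: "cw < c"
    and dw: "card {u. E w u} < k" and only_w: "lcyc Y \<Longrightarrow> V - Y = {w}"
begin

lemma card_V: "card V = c + 1"
proof -
  obtain Y where Y: "lcyc Y" using exc unfolding lcyc_def by blast
  have "card (V - Y) = 1" using only_w[OF Y] by simp
  then show ?thesis using card_Diff_subset[OF lcycD(4,3)[OF Y]] lcycD(2)[OF Y] cn by simp
qed

lemma cw_le: "cw \<le> 2 * k" and n_le: "card V \<le> 2 * k + 2"
  using cwc ck card_V by auto

text \<open>Only cycles through \<open>w = P 0\<close> are bounded by \<open>cw\<close>. Bypassing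
  the arc from \<open>i\<close> to \<open>j\<close> keeps position 0, but keeping only that arc does
  so just for \<open>i = 0\<close>; hence the restricted second bound.\<close>

lemma gapw:
  assumes "cyc P cw" "P 0 = w" "i < j" "j < cw" "pth x t X" "X \<inter> P ` {..<cw} = {}" "E (P i) x" "E t (P j)"
  shows "i + card X + 1 \<le> j" "i = 0 \<Longrightarrow> j + card X + 1 \<le> cw"
proof -
  have "P 0 \<in> P ` ({..i} \<union> {j..<cw})" by auto
  then have "card (X \<union> P ` ({..i} \<union> {j..<cw})) \<le> cw"
    using maxw[OF ear_out(1)[OF assms(1,3-8)]] assms(2) by auto
  then show "i + card X + 1 \<le> j" using ear_out(2)[OF assms(1,3-8)] by linarith
  assume i: "i = 0"
  have "P 0 \<in> P ` {i..j}" using i by auto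
  then have "card (X \<union> P ` {i..j}) \<le> cw"
    using maxw[OF ear_in(1)[OF assms(1,3-8)]] assms(2) by auto
  then show "j + card X + 1 \<le> cw" using ear_in(2)[OF assms(1,3-8)] i by linarith
qed

text \<open>The neighbours of \<open>t\<close> are split at the position \<open>r\<close> of
  \<open>p\<close>. If they lie on both sides, or if \<open>w\<close> is \<open>p\<close> or a
  neighbour of \<open>t\<close>, the count goes all round the cycle and
  \<open>cw \<le> 2 * k\<close> suffices. Otherwise the arc through \<open>w\<close> is not
  controlled and only \<open>2 * nf Y p t + card X + 1 \<le> cw\<close> remains;
  \<open>cw + card X \<le> card V\<close> then closes the argument.\<close>

lemma no_wpath_w:
  assumes P: "cyc P cw" "P 0 = w" and Y: "Y = P ` {..<cw}" "Y \<subseteq> V" and D: "D \<subseteq> V" "D \<inter> Y = {}" and p: "p \<in> Y"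
  shows "\<not> wpath p D (nf Y p) (Suc k)"
proof
  assume "wpath p D (nf Y p) (Suc k)"
  then obtain x t X where X: "E p x" "pth x t X" "X \<subseteq> D" "1 \<le> nf Y p t" "Suc k \<le> card X + nf Y p t"
    unfolding wpath_def by blast
  note inj = cyc_inj[OF P(1)]
  obtain r where r: "r < cw" "p = P r" using p Y(1) by auto
  define S where "S = {u \<in> Y - {p}. E t u}"
  define N where "N = {i \<in> {..<cw}. P i \<in> S}"
  have cN: "card N = nf Y p t"
    using pos_card0[OF P(1), of S] Y(1) unfolding N_def S_def nf_def by auto
  have dX: "X \<inter> P ` {..<cw} = {}" using X(3) D(2) Y(1) by blast
  have tY: "{t} \<inter> P ` {..<cw} = {}" using pth_ends[OF X(2)] dX by blast
  have Nd: "i < cw" "E t (P i)" "i \<noteq> r" if "i \<in> N" for i using that r(2) unfolding N_def S_def by auto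
  have fX: "finite X" using pth_finite[OF X(2)] .
  have n: "cw + card X \<le> card V"
  proof -
    have "card (Y \<union> X) \<le> card V" using X(3) D(1) Y(2) finV by (intro card_mono) auto
    moreover have "card (Y \<union> X) = cw + card X"
    proof -
      have fY: "finite Y" using Y(2) finV finite_subset by blast
      have "Y \<inter> X = {}" using dX Y(1) by auto
      then show ?thesis using card_Un_disjoint[OF fY fX] cyc_card[OF P(1), of "{..<cw}"] Y(1) by simp
    qed
    ultimately show ?thesis by simp
  qed
  have g1: "i + 2 \<le> j" "i = 0 \<Longrightarrow> j + 2 \<le> cw" if "i \<in> N" "j \<in> N" "i < j" for i j
    using gapw[OF P that(3) Nd(1)[OF that(2)] pth_single tY sym[OF Nd(2)[OF that(1)]] Nd(2)[OF that(2)]] by auto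
  have g2: "i + card X + 1 \<le> r" "i = 0 \<Longrightarrow> r + card X + 1 \<le> cw" if "i \<in> N" "i < r" for i
    using gapw[OF P that(2) r(1) pth_rev[OF X(2)] dX sym[OF Nd(2)[OF that(1)]]] X(1) r(2) sym by auto
  have g3: "r + card X + 1 \<le> i" "r = 0 \<Longrightarrow> i + card X + 1 \<le> cw" if "i \<in> N" "r < i" for i
    using gapw[OF P that(2) Nd(1)[OF that(1)] X(2) dX _ Nd(2)[OF that(1)]] X(1) r(2) by auto
  define L where "L = {i \<in> N. i < r}"
  define U where "U = {i \<in> N. r < i}"
  have fin: "finite L" "finite U" unfolding L_def U_def N_def by auto
  have "N = L \<union> U" using Nd(3) unfolding L_def U_def by (auto simp: linorder_neq_iff)
  moreover have "L \<inter> U = {}" unfolding L_def U_def by auto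
  ultimately have f: "card L + card U = nf Y p t" using card_Un_disjoint[OF fin] cN by simp
  have spL: "\<exists>a b. a \<in> L \<and> b \<in> L \<and> a + 2 * (card L - 1) \<le> b" if "L \<noteq> {}"
    by (rule spread[OF fin(1) that]) (use g1(1) in \<open>auto simp: L_def\<close>)
  have spU: "\<exists>a b. a \<in> U \<and> b \<in> U \<and> a + 2 * (card U - 1) \<le> b" if "U \<noteq> {}"
    by (rule spread[OF fin(2) that]) (use g1(1) in \<open>auto simp: U_def\<close>)
  have posL: "1 \<le> card L" if "L \<noteq> {}" using that fin by (simp add: Suc_le_eq card_gt_0_iff)
  have posU: "1 \<le> card U" if "U \<noteq> {}" using that fin by (simp add: Suc_le_eq card_gt_0_iff)
  have small: "\<not> 2 * card X + 2 * nf Y p t \<le> cw" using cw_le X(5) by linarith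
  have small2: "\<not> 2 * nf Y p t + card X + 1 \<le> cw" using n n_le X(5) by linarith
  consider "L \<noteq> {}" "U \<noteq> {}" | "L \<noteq> {}" "U = {}" | "L = {}" "U \<noteq> {}" | "L = {}" "U = {}" by blast
  then show False
  proof cases
    case 1
    obtain a b where ab: "a \<in> L" "b \<in> L" "a + 2 * (card L - 1) \<le> b" using spL 1 by blast
    obtain a' b' where ab': "a' \<in> U" "b' \<in> U" "a' + 2 * (card U - 1) \<le> b'" using spU 1 by blast
    have "b + card X + 1 \<le> r" "r + card X + 1 \<le> a'" using ab ab' g2 g3 unfolding L_def U_def by auto
    moreover have "1 \<le> a \<and> b' + 1 \<le> cw \<or> b' + 2 \<le> cw"
      using g1(2)[of a b'] Nd(1)[of b'] ab ab' unfolding L_def U_def by (cases "a = 0") auto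
    ultimately have "2 * card X + 2 * nf Y p t \<le> cw" using ab(3) ab'(3) f posL posU 1 by linarith
    then show False using small by simp
  next
    case 2
    obtain a b where ab: "a \<in> L" "b \<in> L" "a + 2 * (card L - 1) \<le> b" using spL 2 by blast
    have b: "b + card X + 1 \<le> r" using ab g2 unfolding L_def by auto
    have f': "card L = nf Y p t" using f 2 by simp
    show False
    proof (cases "a = 0")
      case True
      then have "r + card X + 1 \<le> cw" using ab g2(2) unfolding L_def by auto
      then have "2 * card X + 2 * nf Y p t \<le> cw" using ab(3) b f' posL 2 by linarith
      then show False using small by simp
    next
      case False
      then have "2 * nf Y p t + card X + 1 \<le> cw" using ab(3) b f' posL 2 r(1) by linarith
      then show False using small2 by simp
    qed
  next
    case 3
    obtain a b where ab: "a \<in> U" "b \<in> U" "a + 2 * (card U - 1) \<le> b" using spU 3 by blast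
    have a: "r + card X + 1 \<le> a" using ab g3 unfolding U_def by auto
    have f': "card U = nf Y p t" using f 3 by simp
    show False
    proof (cases "r = 0")
      case True
      then have "b + card X + 1 \<le> cw" using ab g3(2) unfolding U_def by auto
      then have "2 * card X + 2 * nf Y p t \<le> cw" using ab(3) a f' posU 3 by linarith
      then show False using small by simp
    next
      case False
      have "b < cw" using ab Nd(1) unfolding U_def by auto
      then have "2 * nf Y p t + card X + 1 \<le> cw" using False ab(3) a f' posU 3 by linarith
      then show False using small2 by simp
    qed
  next
    case 4
    then show False using f X(4) by simp
  qed
qed

lemma wcycD:
  assumes "cyc P cw" "P 0 = w"
  shows "P ` {..<cw} \<subseteq> V" "w \<in> P ` {..<cw}" "card (P ` {..<cw}) = cw" "3 \<le> cw"
proof -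
  show "P ` {..<cw} \<subseteq> V" using cycset_V[OF cyc_cycset[OF assms(1)]] .
  show "3 \<le> cw" using assms(1) unfolding cyc_def by blast
  then show "w \<in> P ` {..<cw}" using assms(2) by force
  show "card (P ` {..<cw}) = cw" using cyc_card[OF assms(1), of "{..<cw}"] by simp
qed

lemma comp_struct_w:
  assumes P: "cyc P cw" "P 0 = w" and D: "cpt (P ` {..<cw}) D"
  shows "card (att (P ` {..<cw}) D) + card D = Suc k" "2 \<le> card (att (P ` {..<cw}) D)"
    "\<And>v u. v \<in> D \<Longrightarrow> u \<in> D \<union> att (P ` {..<cw}) D \<Longrightarrow> u \<noteq> v \<Longrightarrow> E v u"
proof -
  let ?Y = "P ` {..<cw}"
  note W = wcycD[OF P] and C = compD[OF D]
  have c2: "2 \<le> card ?Y" using W by simp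
  have wD: "w \<notin> D" using W(2) C(3) by blast
  have NV: "\<not> wpath p D (nf ?Y p) (Suc k)" if "p \<in> ?Y" for p
    by (rule no_wpath_w[OF P refl W(1) C(2,3) that])
  show "card (att ?Y D) + card D = Suc k" "\<And>v u. v \<in> D \<Longrightarrow> u \<in> D \<union> att ?Y D \<Longrightarrow> u \<noteq> v \<Longrightarrow> E v u"
    using comp_struct_now[OF D W(1) c2 wD NV] by blast+
  show "2 \<le> card (att ?Y D)" using att_two[OF D W(1) c2] .
qed

lemma att_gap_w:
  assumes P: "cyc P cw" "P 0 = w" and D: "cpt (P ` {..<cw}) D"
    and "i < j" "j < cw" "P i \<in> att (P ` {..<cw}) D" "P j \<in> att (P ` {..<cw}) D"
  shows "i + card D + 1 \<le> j" "i = 0 \<Longrightarrow> j + card D + 1 \<le> cw"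
proof -
  let ?Y = "P ` {..<cw}"
  note C = compD[OF D] and S = comp_struct_w(3)[OF P D]
  have n: "P i \<noteq> v" "P j \<noteq> v" if "v \<in> D" for v using that C(3) assms(4,5) by auto
  obtain v where v: "v \<in> D" using C(1) by blast
  have "\<exists>x t. E (P i) x \<and> E t (P j) \<and> pth x t D"
  proof (cases "D = {v}")
    case True
    have "E v (P i)" "E v (P j)" using S[OF v] n[OF v] assms(6,7) by auto
    then show ?thesis using True pth_single[of v] sym by blast
  next
    case False
    then obtain u where u: "u \<in> D" "u \<noteq> v" using v by blast
    have "pth u v D" using clique_pth[OF C(5) _ u(1) v u(2)] S by blast
    moreover have "E u (P i)" "E v (P j)" using S[OF u(1)] S[OF v] n[OF v] n[OF u(1)] assms(6,7) by auto
    ultimately show ?thesis using sym by blast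
  qed
  then obtain x t where xt: "E (P i) x" "E t (P j)" "pth x t D" by blast
  show "i + card D + 1 \<le> j" "i = 0 \<Longrightarrow> j + card D + 1 \<le> cw"
    using gapw[OF P assms(4,5) xt(3) C(3) xt(1,2)] by auto
qed

text \<open>If \<open>w\<close> is an attachment, the gaps are counted all round the cycle, and the
  low degree of \<open>w\<close> leaves only single vertices. If not, the gap containing
  \<open>w\<close> is lost from the count, but \<open>cw + card D \<le> card V\<close> compensates
  and again gives \<open>s' * m' \<le> 1\<close>.\<close>

lemma comp_numbers_w:
  assumes P: "cyc P cw" "P 0 = w" and D: "cpt (P ` {..<cw}) D"
  shows "cw + card D \<le> card V"
    and "w \<in> att (P ` {..<cw}) D \<Longrightarrow> card D = 1 \<and> 2 * k \<le> cw"
    and "w \<notin> att (P ` {..<cw}) D \<Longrightarrow> (card D + 1) * (card (att (P ` {..<cw}) D) - 1) + 2 \<le> cw"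
    and "card D = 1 \<or> (w \<notin> att (P ` {..<cw}) D \<and> (card (att (P ` {..<cw}) D) = 2 \<or>
      (card (att (P ` {..<cw}) D) = 3 \<and> card D = 2 \<and> k = 4)))"
proof -
  let ?Y = "P ` {..<cw}"
  let ?s = "card (att ?Y D)" and ?m = "card D"
  note W = wcycD[OF P] and C = compD[OF D] and S = comp_struct_w[OF P D]
  have fY: "finite ?Y" by simp
  have m1: "1 \<le> ?m" using C(1,5) by (auto simp: Suc_le_eq card_gt_0_iff)
  have "card (?Y \<union> D) \<le> card V" using C(2) W(1) finV by (intro card_mono) auto
  moreover have "card (?Y \<union> D) = cw + ?m" using C(3,5) W(3) by (subst card_Un_disjoint) auto
  ultimately show n: "cw + ?m \<le> card V" by simp
  define A where "A = {i \<in> {..<cw}. P i \<in> att ?Y D}"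
  have cA: "card A = ?s" unfolding A_def by (rule pos_card0[OF P(1)]) (auto simp: att_iff)
  have "finite A" unfolding A_def by simp
  moreover have "A \<noteq> {}" using cA S(2) by force
  ultimately have fA: "finite A" "A \<noteq> {}" by blast+
  have g: "i + (?m + 1) \<le> j" "i = 0 \<Longrightarrow> j + ?m + 1 \<le> cw" if "i \<in> A" "j \<in> A" "i < j" for i j
    using att_gap_w[OF P D that(3)] that unfolding A_def by auto
  obtain a b where ab: "a \<in> A" "b \<in> A" "a + (?m + 1) * (card A - 1) \<le> b" using spread[OF fA g(1)] by blast
  have bcw: "b < cw" using ab unfolding A_def by simp
  obtain s' where s': "?s = s' + 2" using S(2) by (metis add.commute le_Suc_ex)
  obtain m' where m': "?m = m' + 1" using m1 by (metis add.commute le_Suc_ex)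
  have kk: "k = s' + m' + 2" using S(1) s' m' by simp
  have n2: "card V \<le> 2 * k + 2" using n_le .
  show w1: "?m = 1 \<and> 2 * k \<le> cw" if w: "w \<in> att ?Y D"
  proof -
    have "0 \<in> A" using w P(2) W(4) unfolding A_def by simp
    moreover have b0: "0 < b" using ab(3) cA s' by (cases b) auto
    ultimately have "b + ?m + 1 \<le> cw" using g(2)[of 0 b] ab(2) by simp
    then have "(m' + 2) * (s' + 2) \<le> cw" using ab(3) cA s' m' by (simp add: algebra_simps)
    then have le: "(m' + 2) * (s' + 2) \<le> 2 * (s' + m' + 2)" using cw_le unfolding kk by (rule order_trans)
    then have "s' * m' = 0" by (simp add: algebra_simps)
    \<comment> \<open>With two attachments \<open>card D = k - 1\<close>; then \<open>w\<close> sees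
      all of \<open>D\<close> and its two neighbours on the cycle, against
      \<open>dw\<close>.\<close>
    moreover have "s' \<noteq> 0"
    proof
      assume "s' = 0"
      have "E w v" if v: "v \<in> D" for v
      proof -
        have "w \<noteq> v" using v W(2) C(3) by blast
        then show ?thesis using S(3)[OF v, of w] w sym by blast
      qed
      then have "D \<subseteq> {u. E w u}" by blast
      moreover have "P 1 \<in> {u. E w u} - D" "P (cw - 1) \<in> {u. E w u} - D" "P 1 \<noteq> P (cw - 1)"
      proof -
        have "E w (P 1)" "E w (P (cw - 1))"
          using cyc_edge[OF P(1), of 0] sym[OF cyc_close[OF P(1)]] P(2) W(4) by simp_all
        moreover have "P 1 \<notin> D" "P (cw - 1) \<notin> D" using C(3) W(4) by auto
        ultimately show "P 1 \<in> {u. E w u} - D" "P (cw - 1) \<in> {u. E w u} - D" by simp_all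
        show "P 1 \<noteq> P (cw - 1)" using cyc_inj[OF P(1), of 1 "cw - 1"] W(4) by simp
      qed
      ultimately have "D \<union> {P 1, P (cw - 1)} \<subseteq> {u. E w u}" "card (D \<union> {P 1, P (cw - 1)}) = ?m + 2"
        using C(5) by auto
      then have "?m + 2 \<le> card {u. E w u}" using card_mono[OF fin_nbrs] by metis
      then show False using dw kk m' \<open>s' = 0\<close> by simp
    qed
    ultimately have "m' = 0" by simp
    then show ?thesis using \<open>(m' + 2) * (s' + 2) \<le> cw\<close> m' kk by simp
  qed
  show w2: "(?m + 1) * (?s - 1) + 2 \<le> cw" if w: "w \<notin> att ?Y D"
  proof -
    have "a \<noteq> 0" using ab(1) w P(2) unfolding A_def by (cases "a = 0") auto
    then show ?thesis using ab(3) bcw unfolding cA by linarith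
  qed
  show "?m = 1 \<or> (w \<notin> att ?Y D \<and> (?s = 2 \<or> (?s = 3 \<and> ?m = 2 \<and> k = 4)))"
  proof (cases "w \<in> att ?Y D")
    case True then show ?thesis using w1 by blast
  next
    case False
    have "(m' + 2) * (s' + 1) + 2 + (m' + 1) \<le> 2 * (s' + m' + 2) + 2"
      using w2[OF False] n n2 s' m' kk by simp
    then have "s' * m' \<le> 1" by (simp add: algebra_simps)
    then have "s' = 0 \<or> m' = 0 \<or> (s' = 1 \<and> m' = 1)"
      by (metis One_nat_def le_Suc_eq le_zero_eq mult_is_0 nat_mult_eq_1_iff)
    then show ?thesis using s' m' kk False by auto
  qed
qed

text \<open>If \<open>u\<close> sees \<open>w\<close>, the gap bound also holds across position 0
  and the neighbours are the even positions. Otherwise position 0 is free, and shifting all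
  positions down by one gives the odd ones.\<close>

lemma parity_class:
  assumes P: "cyc P cw" "P 0 = w" and u: "cpt (P ` {..<cw}) {u}"
  shows "cw = 2 * k" "\<exists>r\<le>1. \<forall>i<2 * k. E u (P i) \<longleftrightarrow> even (i + r)"
proof -
  let ?Y = "P ` {..<cw}"
  note W = wcycD[OF P] and S = comp_struct_w[OF P u] and N = comp_numbers_w[OF P u]
  have sk: "card (att ?Y {u}) = k" using S(1) by simp
  have "2 * k \<le> cw"
  proof (cases "w \<in> att ?Y {u}")
    case True then show ?thesis using N(2) by blast
  next
    case False
    then have "2 * (k - 1) + 2 \<le> cw" using N(3) sk by (simp add: numeral_2_eq_2)
    then show ?thesis using k2 by simp
  qed
  then show c: "cw = 2 * k" using cw_le by simp
  define A where "A = {i \<in> {..<cw}. P i \<in> att ?Y {u}}"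
  have cA: "card A = k" unfolding A_def using pos_card0[OF P(1), of "att ?Y {u}"] sk by (auto simp: att_def)
  have g: "i + 2 \<le> j" "i = 0 \<Longrightarrow> j + 2 \<le> cw" if "i \<in> A" "j \<in> A" "i < j" for i j
    using att_gap_w[OF P u that(3)] that unfolding A_def by auto
  have EA: "E u (P i) \<longleftrightarrow> i \<in> A" if "i < 2 * k" for i using that c unfolding A_def att_def by auto
  show "\<exists>r\<le>1. \<forall>i<2 * k. E u (P i) \<longleftrightarrow> even (i + r)"
  proof (cases "0 \<in> A")
    case True
    have "i \<in> A \<longleftrightarrow> even i \<and> i < 2 * k" for i
    proof (rule even_positions[OF cA g(1)])
      show "i + 1 < 2 * k" if "i \<in> A" for i
        using g(2)[OF True that] c k2 by (cases "i = 0") auto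
    qed
    then show ?thesis using EA by (intro exI[of _ 0]) auto
  next
    case False
    define B where "B = (\<lambda>i. i - 1) ` A"
    have ge1: "1 \<le> i" if "i \<in> A" for i using False that by (cases i) auto
    have "inj_on (\<lambda>i. i - 1) A"
    proof (rule inj_onI)
      fix i j assume "i \<in> A" "j \<in> A" "i - 1 = j - 1"
      then show "i = j" using ge1[of i] ge1[of j] by simp
    qed
    then have cB: "card B = k" unfolding B_def using cA card_image by metis
    have "i \<in> B \<longleftrightarrow> even i \<and> i < 2 * k" for i
    proof (rule even_positions[OF cB])
      show "i + 2 \<le> j" if B: "i \<in> B" "j \<in> B" "i < j" for i j
      proof -
        obtain i' j' where ij: "i' \<in> A" "j' \<in> A" "i = i' - 1" "j = j' - 1" using B(1,2) unfolding B_def by blast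
        then have "i' < j'" using B(3) by simp
        then show ?thesis using g(1)[OF ij(1,2)] ij(3,4) ge1[OF ij(1)] by linarith
      qed
      show "i + 1 < 2 * k" if i: "i \<in> B" for i
      proof -
        obtain i' where i': "i' \<in> A" "i = i' - 1" using i unfolding B_def by blast
        then have "i' < 2 * k" using c unfolding A_def by simp
        then show ?thesis using i' ge1[OF i'(1)] by linarith
      qed
    qed
    note evB = this
    have "i \<in> A \<longleftrightarrow> even (i + 1)" if i: "i < 2 * k" for i
    proof (cases i)
      case 0 then show ?thesis using False by simp
    next
      case (Suc j)
      have "i \<in> A \<longleftrightarrow> j \<in> B"
      proof
        show "i \<in> A \<Longrightarrow> j \<in> B" unfolding B_def using Suc by force
        assume "j \<in> B"
        then obtain l where l: "l \<in> A" "j = l - 1" unfolding B_def by blast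
        then have "l = i" using ge1[OF l(1)] Suc by simp
        then show "i \<in> A" using l by simp
      qed
      then show ?thesis using evB[of j] Suc i by simp
    qed
    then show ?thesis using EA by (intro exI[of _ 1]) auto
  qed
qed

text \<open>The positions \<open>0, u, 2, 1, u', 3, ..., 2 * k - 1\<close> form a cycle of length
  \<open>2 * k + 2\<close>, which exceeds \<open>c\<close>.\<close>

lemma ham_two:
  assumes P: "cyc P (2 * k)" and "u \<notin> P ` {..<2 * k}" "u' \<notin> P ` {..<2 * k}" "u \<noteq> u'"
    and "\<And>i. i < 2 * k \<Longrightarrow> even i \<Longrightarrow> E u (P i)" "\<And>i. i < 2 * k \<Longrightarrow> odd i \<Longrightarrow> E u' (P i)"
  shows False
proof -
  have k4: "4 \<le> 2 * k" using k2 by simp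
  let ?L = "[0] @ [2] @ [1] @ [3..<2 * k]"
  let ?xs = "[P 0, u, P 2, P 1, u'] @ map P [3..<2 * k]"
  have sL: "set ?L \<subseteq> {..<2 * k}" using k4 by auto
  have injP: "inj_on P {..<2 * k}" using P unfolding cyc_def by blast
  have "distinct (map P ?L)" unfolding distinct_map using inj_on_subset[OF injP sL] by auto
  moreover have "u \<notin> set (map P ?L)" "u' \<notin> set (map P ?L)" using sL assms(2,3) unfolding set_map by blast+
  ultimately have dis: "distinct ?xs" using assms(4) by auto
  have s: "successively E (map P [3..<2 * k])"
    unfolding successively_map using cyc_edge[OF P] by (intro successively_upt) auto
  have "E u (P 0)" "E u (P 2)" "E u' (P 1)" "E u' (P 3)"
    using assms(5)[of 0] assms(5)[of 2] assms(6)[of 1] assms(6)[of 3] k4 by simp_all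
  moreover have "E (P 1) (P 2)" using cyc_edge[OF P, of 1] k4 by (simp add: numeral_2_eq_2)
  ultimately have e: "E (P 0) u" "E u (P 2)" "E (P 2) (P 1)" "E (P 1) u'" "E u' (P 3)" using sym by blast+
  have h: "map P [3..<2 * k] \<noteq> []" "hd (map P [3..<2 * k]) = P 3" "last (map P [3..<2 * k]) = P (2 * k - 1)"
    using k4 by (simp_all add: hd_map last_map)
  have suc: "successively E ?xs" using s e h by (simp add: successively_append_iff successively_Cons)
  have "last ?xs = P (2 * k - 1)" using h by simp
  then have "length ?xs \<le> c" using cyc_close[OF P] dis suc by (intro list_bound) auto
  moreover have "length ?xs = 2 * k + 2" using k4 by simp
  ultimately show False using ck by simp
qed

text \<open>Now \<open>card V = 2 * k + 2\<close>, so just two vertices lie off the cycle. By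
  \<open>ham_two\<close> they see the same parity class, and the other class is independent because
  a chord would give a longer cycle through \<open>w\<close>.\<close>

lemma case_single:
  assumes P: "cyc P cw" "P 0 = w" and u: "cpt (P ` {..<cw}) {u}"
  shows shape_H
proof -
  let ?Y = "P ` {..<cw}"
  note W = wcycD[OF P]
  have c2: "cw = 2 * k" using parity_class(1)[OF P u] .
  then have c: "c = 2 * k + 1" "card V = 2 * k + 2" using cwc ck card_V by auto
  have uV: "u \<in> V - ?Y" using compD(2,3)[OF u] by blast
  have "card (V - ?Y) = 2" using card_Diff_subset[OF _ W(1)] W(3) c c2 by simp
  then have "card (V - ?Y - {u}) = 1" using uV by simp
  then obtain u' where u': "V - ?Y - {u} = {u'}" by (meson card_1_singletonE)
  then have off: "V - ?Y = {u, u'}" "u \<noteq> u'" using uV by auto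
  have unb: "\<And>x. E u x \<Longrightarrow> x \<in> ?Y" using compD(6)[OF u] irrefl by blast
  obtain D where D: "cpt ?Y D" "u' \<in> D" using comp_ex[of u' ?Y] off by blast
  note C = compD[OF D(1)]
  have "u \<notin> D"
  proof
    assume "u \<in> D"
    then have "D \<noteq> {u}" "{u} \<subseteq> D" using D(2) off(2) by auto
    then obtain z where "z \<in> D - {u}" "E u z" using connD[OF C(4), of "{u}"] by blast
    then show False using unb C(3) by blast
  qed
  moreover have "D \<subseteq> V - ?Y" using C(2,3) by blast
  then have "D \<subseteq> {u, u'}" unfolding off(1) .
  ultimately have "D = {u'}" using D(2) by blast
  then have cu': "cpt ?Y {u'}" using D by simp
  obtain r where r: "r \<le> 1" "\<And>i. i < 2 * k \<Longrightarrow> E u (P i) \<longleftrightarrow> even (i + r)" using parity_class(2)[OF P u] by blast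
  obtain r' where r': "r' \<le> 1" "\<And>i. i < 2 * k \<Longrightarrow> E u' (P i) \<longleftrightarrow> even (i + r')" using parity_class(2)[OF P cu'] by blast
  have P2: "cyc P (2 * k)" using P(1) c2 by simp
  have nY: "u \<notin> P ` {..<2 * k}" "u' \<notin> P ` {..<2 * k}" using off c2 by auto
  have "r = r'"
  proof (rule ccontr)
    assume "r \<noteq> r'"
    then consider "r = 0" "r' = 1" | "r = 1" "r' = 0" using r(1) r'(1) by linarith
    then show False
    proof cases
      case 1 then show False using ham_two[OF P2 nY off(2)] r r' by auto
    next
      case 2 then show False using ham_two[OF P2 nY(2,1) off(2)[THEN not_sym]] r r' by auto
    qed
  qed
  define A where "A = {x \<in> ?Y. E u x}"
  have AV: "A \<subseteq> V" using W(1) unfolding A_def by blast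
  have "A = att ?Y {u}" unfolding A_def att_def by blast
  then have cA: "card A = k" using comp_struct_w(1)[OF P u] by simp
  have outA: "(\<exists>i<2 * k. v = P i \<and> odd (i + r)) \<or> v = u \<or> v = u'" if "v \<in> V - A" for v
  proof (cases "v \<in> ?Y")
    case True
    then obtain i where "i < 2 * k" "v = P i" using c2 by auto
    then show ?thesis using r(2)[of i] that True unfolding A_def by auto
  qed (use off that in blast)
  have ub: "\<not> E u (P i)" "\<not> E u' (P i)" if "i < 2 * k" "odd (i + r)" for i
    using r(2)[OF that(1)] r'(2)[OF that(1)] that(2) \<open>r = r'\<close> by auto
  have cross: False if "i < j" "j < 2 * k" "E u (P i)" "E u (P j)" "E (P (Suc i)) (P (Suc j mod (2 * k)))" for i j
  proof -
    have "cycset ({u} \<union> P ` {..<2 * k})"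
      by (rule cross_succ[OF P2 that(1,2) pth_single]) (use nY that sym in auto)
    moreover have "w \<in> {u} \<union> P ` {..<2 * k}" using W(2) c2 by simp
    moreover have "card ({u} \<union> P ` {..<2 * k}) = Suc (2 * k)" using nY W(3) c2 by simp
    ultimately show False using maxw c2 by fastforce
  qed
  have bb: "\<not> E (P i) (P j)" if ij: "i < j" "j < 2 * k" "odd (i + r)" "odd (j + r)" for i j
  proof
    assume e: "E (P i) (P j)"
    show False
    proof (cases "i = 0")
      case True
      \<comment> \<open>Position 0 is the successor of \<open>2 * k - 1\<close>, so the crossing
        uses \<open>j - 1\<close> and \<open>2 * k - 1\<close>.\<close>
      then have "r = 1" using ij(3) r(1) by (cases r) auto
      then have j: "even j" using ij(4) by simp
      then have j2: "2 \<le> j" using ij(1) True by (auto elim: evenE)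
      have "E u (P (j - 1))" "E u (P (2 * k - 1))"
        using r(2)[of "j - 1"] r(2)[of "2 * k - 1"] \<open>r = 1\<close> j j2 ij(2) k2 by auto
      moreover have "E (P (Suc (j - 1))) (P (Suc (2 * k - 1) mod (2 * k)))"
        using e sym True j2 k2 by simp
      ultimately show False by (intro cross[of "j - 1" "2 * k - 1"]) (use j2 ij(2) in auto)
    next
      case False
      have "even (i - 1 + r)" "even (j - 1 + r)" using ij False by auto
      then have "E u (P (i - 1))" "E u (P (j - 1))" using r(2) ij by auto
      moreover have "E (P (Suc (i - 1))) (P (Suc (j - 1) mod (2 * k)))" using e ij False by simp
      ultimately show False by (intro cross[of "i - 1" "j - 1"]) (use ij False in auto)
    qed
  qed
  have uu: "\<not> E u u'" using unb off by blast
  have "\<not> E x y" if xy: "x \<in> V - A" "y \<in> V - A" for x y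
  proof
    assume e: "E x y"
    have b2: "\<not> E (P i) (P j)" if "i < 2 * k" "j < 2 * k" "odd (i + r)" "odd (j + r)" for i j
      using bb[of i j] bb[of j i] that irrefl sym by (metis linorder_neqE_nat)
    show False using outA[OF xy(1)] outA[OF xy(2)] e
    proof (elim disjE exE conjE)
      fix i j assume "i < 2 * k" "x = P i" "odd (i + r)" "j < 2 * k" "y = P j" "odd (j + r)"
      then show False using b2 e by blast
    qed (use ub uu irrefl sym in blast)+
  qed
  then show ?thesis unfolding shape_H_def using c cA AV by (intro conjI exI[of _ A]) auto
qed

text \<open>Three attachments at distance at least 3 that avoid position 0 fit into eight positions
  in one way only.\<close>

lemma arc_w:
  assumes P: "cyc P cw" "P 0 = w" and D: "cpt (P ` {..<cw}) D" and k: "k = 4" "card D = 2"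
  shows "att (P ` {..<cw}) D = {P 1, P 4, P 7}" "cw = 8" "card V = 10"
proof -
  let ?Y = "P ` {..<cw}"
  note W = wcycD[OF P] and S = comp_struct_w[OF P D] and N = comp_numbers_w[OF P D]
  have s3: "card (att ?Y D) = 3" using S(1) k by simp
  have wn: "w \<notin> att ?Y D" using N(2) k by auto
  have "8 \<le> cw" using N(3)[OF wn] s3 k by simp
  then show c8: "cw = 8" "card V = 10" using cw_le N(1) n_le k by auto
  define A where "A = {i \<in> {..<cw}. P i \<in> att ?Y D}"
  have cA: "card A = 3" unfolding A_def using pos_card0[OF P(1), of "att ?Y D"] s3 by (auto simp: att_def)
  have g: "i + 3 \<le> j" if "i \<in> A" "j \<in> A" "i < j" for i j
    using att_gap_w(1)[OF P D that(3)] that k unfolding A_def by auto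
  have n0: "0 \<notin> A" unfolding A_def using wn P(2) by simp
  have lt: "i < 8" if "i \<in> A" for i using that c8 unfolding A_def by simp
  have fA: "finite A" "A \<noteq> {}" using cA by (auto intro: card_ge_0_finite)
  obtain a b where ab: "a \<in> A" "b \<in> A" "a + 3 * (card A - 1) \<le> b" using spread[OF fA g] by blast
  have "a \<noteq> 0" using n0 ab(1) by metis
  then have "a = 1" "b = 7" using ab(3) cA lt[OF ab(2)] by auto
  then have A17: "1 \<in> A" "7 \<in> A" using ab by auto
  have "card (A - {1, 7}) = 1" using cA A17 fA by (subst card_Diff_subset) auto
  then obtain m where m: "A - {1, 7} = {m}" by (meson card_1_singletonE)
  have "m \<in> A - {1, 7}" using m by simp
  then have mA: "m \<in> A" "m \<noteq> 1" "m \<noteq> 7" by auto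
  have "m \<noteq> 0" using n0 mA(1) by metis
  then have "1 < m" "m < 7" using mA lt[OF mA(1)] by auto
  then have "m = 4" using g[OF A17(1) mA(1)] g[OF mA(1) A17(2)] by simp
  then have "A = {1, 4, 7}" using m A17 by auto
  moreover have "att ?Y D = P ` A" unfolding A_def by (auto simp: att_def)
  ultimately show "att ?Y D = {P 1, P 4, P 7}" by simp
qed

text \<open>Exchanging the pair with \<open>D\<close> keeps \<open>w\<close> and the length 8, so
  \<open>arc_w\<close> applies to the released pair; the three attachment positions are untouched by
  the exchange.\<close>

lemma arc_w_swap:
  assumes P: "cyc P cw" "P 0 = w" and D: "cpt (P ` {..<cw}) D" and k: "k = 4" "card D = 2"
    and i: "i = 2 \<or> i = 5"
  shows "sep {P i, P (Suc i)} {P 1, P 4, P 7}"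
proof -
  let ?Y = "P ` {..<cw}"
  note C = compD[OF D] and S = comp_struct_w[OF P D] and at = arc_w[OF P D k] and inj = cyc_inj[OF P(1)]
  obtain d d' where d: "D = {d, d'}" "d \<noteq> d'" using k(2) by (meson card_2_iff)
  have nd: "P l \<noteq> d" "P l \<noteq> d'" if "l < 8" for l using C(3) d that at(2) by auto
  have Ed: "E d d'" "E d (P 1)" "E d (P 4)" "E d' (P 4)" "E d' (P 7)"
    using S(3)[of d d'] S(3)[of d "P 1"] S(3)[of d "P 4"] S(3)[of d' "P 4"] S(3)[of d' "P 7"] nd[of 1] nd[of 4] nd[of 7] d at(1)
    by auto
  define Q where "Q = P(i := d, Suc i := d')"
  have Q: "Q i = d" "Q (Suc i) = d'" "\<And>l. l \<noteq> i \<Longrightarrow> l \<noteq> Suc i \<Longrightarrow> Q l = P l" unfolding Q_def by auto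
  have cQ: "cyc Q cw"
    unfolding cyc_def
  proof (intro conjI allI impI)
    show "3 \<le> cw" using at(2) by simp
    show "inj_on Q {..<cw}"
    proof (rule inj_onI)
      fix a b assume "a \<in> {..<cw}" "b \<in> {..<cw}" "Q a = Q b"
      then show "a = b" using inj[of a b] nd[of a] nd[of b] d(2) at(2) unfolding Q_def by (auto split: if_splits)
    qed
    show "E (Q l) (Q (Suc l))" if l: "Suc l < cw" for l
    proof -
      have pl: "E (P l) (P (Suc l))" using cyc_edge[OF P(1) l] .
      consider "Suc l = i" | "l = i" | "l = Suc i" | "l \<noteq> i" "l \<noteq> Suc i" "Suc l \<noteq> i" by auto
      then show ?thesis
      proof cases
        case 1
        then have "l = 1 \<and> Q l = P 1 \<or> l = 4 \<and> Q l = P 4" using i Q(3)[of l] by auto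
        then show ?thesis using 1 Q(1) Ed sym by auto
      next
        case 2 then show ?thesis using Q Ed by simp
      next
        case 3
        then have "Suc l = 4 \<and> Q (Suc l) = P 4 \<or> Suc l = 7 \<and> Q (Suc l) = P 7" using i Q(3)[of "Suc l"] by auto
        then show ?thesis using 3 Q(2) Ed by auto
      next
        case 4 then show ?thesis using Q(3)[of l] Q(3)[of "Suc l"] pl by simp
      qed
    qed
    show "E (Q (cw - 1)) (Q 0)" using cyc_close[OF P(1)] Q(3)[of 0] Q(3)[of "cw - 1"] at(2) i by auto
  qed
  have Q0: "Q 0 = w" using Q(3)[of 0] P(2) i by auto
  let ?Z = "Q ` {..<cw}"
  have "P i \<notin> ?Z" "P (Suc i) \<notin> ?Z"
  proof -
    have "Q l \<noteq> P i \<and> Q l \<noteq> P (Suc i)" if "l < cw" for l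
      using that Q inj[of l i] inj[of l "Suc i"] nd[of i] nd[of "Suc i"] at(2) i by (cases "l = i \<or> l = Suc i") auto
    then show "P i \<notin> ?Z" "P (Suc i) \<notin> ?Z" by (metis imageE lessThan_iff)+
  qed
  note out = this
  have e: "E (P i) (P (Suc i))" using cyc_edge[OF P(1), of i] i at(2) by auto
  then obtain D' where D': "cpt ?Z D'" "P i \<in> D'" using comp_ex[of "P i" ?Z] EV out by blast
  note C' = compD[OF D'(1)]
  have m2: "P (Suc i) \<in> D'" using C'(6)[OF D'(2) e] out by blast
  have "P i \<noteq> P (Suc i)" using inj[of i "Suc i"] i at(2) by auto
  then have ge: "2 \<le> card D'" using card_two[OF C'(5) D'(2) m2] by blast
  have "card D' \<le> 2" using comp_numbers_w(1)[OF cQ Q0 D'(1)] at by simp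
  then have c2: "card D' = 2" using ge by simp
  then have eq: "D' = {P i, P (Suc i)}"
    using card_subset_eq[OF C'(5), of "{P i, P (Suc i)}"] D'(2) m2 \<open>P i \<noteq> P (Suc i)\<close> by simp
  have "att ?Z D' = {Q 1, Q 4, Q 7}" using arc_w(1)[OF cQ Q0 D'(1) k(1) c2] .
  also have "\<dots> = {P 1, P 4, P 7}" using i Q(3)[of 1] Q(3)[of 4] Q(3)[of 7] by auto
  finally show ?thesis using comp_sep[OF D'(1)] eq by simp
qed

text \<open>The cycle and \<open>D\<close> exhaust the graph. Once \<open>D\<close> and the two
  exchanged pairs are closed, only the three attachments remain as neighbours of
  \<open>w = P 0\<close>.\<close>

lemma case_w_three:
  assumes P: "cyc P cw" "P 0 = w" and D: "cpt (P ` {..<cw}) D" and k: "k = 4" "card D = 2"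
  shows shape_M
proof -
  let ?Y = "P ` {..<cw}" and ?S = "{P 1, P 4, P 7}"
  note C = compD[OF D] and at = arc_w[OF P D k] and W = wcycD[OF P]
  have sD: "sep D ?S" using comp_sep[OF D] at(1) by simp
  have s2: "sep {P 2, P 3} ?S" and s5: "sep {P 5, P 6} ?S"
    using arc_w_swap[OF P D k, of 2] arc_w_swap[OF P D k, of 5] by (simp_all add: numeral_eq_Suc)
  have Yeq: "?Y = {P 0, P 1, P 2, P 3, P 4, P 5, P 6, P 7}"
  proof -
    have "{..<cw} = {0, 1, 2, 3, 4, 5, 6, 7}" using at(2) by auto
    then have "?Y = P ` {0, 1, 2, 3, 4, 5, 6, 7}" by simp
    then show ?thesis by simp
  qed
  have "card (?Y \<union> D) = card V" using C(3,5) W(3) at k by (subst card_Un_disjoint) auto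
  then have VY: "V = ?Y \<union> D" using card_subset_eq[OF finV, of "?Y \<union> D"] W(1) C(2) by blast
  have ne: "P 0 \<noteq> P l" if "0 < l" "l < 8" for l using cyc_inj[OF P(1), of 0 l] that at(2) by auto
  have cl: "P 0 \<notin> {P 2, P 3}" "P 0 \<notin> {P 5, P 6}" "P 0 \<notin> D" "P 0 \<notin> ?S"
    using ne[of 1] ne[of 2] ne[of 3] ne[of 4] ne[of 5] ne[of 6] ne[of 7] C(3) Yeq by auto
  have "u \<in> ?S" if e: "E (P 0) u" for u
  proof -
    have "u \<notin> {P 2, P 3}" "u \<notin> {P 5, P 6}" "u \<notin> D"
      using sepD[OF s2 _ sym[OF e]] sepD[OF s5 _ sym[OF e]] sepD[OF sD _ sym[OF e]] cl by blast+
    moreover have "u \<noteq> P 0" using e irrefl by blast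
    moreover have "u \<in> ?Y \<union> D" using EV2[OF e] VY by simp
    ultimately show ?thesis using Yeq by auto
  qed
  then have s0: "sep {P 0} ?S" unfolding sep_def using cl W(1) Yeq by auto
  have c2: "card {x, y} \<le> 2" "card {x} \<le> 2" for x y :: 'a by (simp_all add: card_insert_if)
  have "\<exists>X. v \<in> X \<and> sep X ?S \<and> card X \<le> 2" if v: "v \<in> V - ?S" for v
  proof -
    have "v \<in> {P 0} \<or> v \<in> {P 2, P 3} \<or> v \<in> {P 5, P 6} \<or> v \<in> D" using v VY Yeq by auto
    then show ?thesis using s0 s2 s5 sD c2 k(2) by (metis order_refl)
  qed
  moreover have "?S \<subseteq> V" using W(1) Yeq by auto
  moreover have "card ?S = 3" using comp_struct_w(1)[OF P D] at(1) k by simp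
  ultimately show ?thesis unfolding shape_M_def using k by blast
qed

text \<open>Along a stretch of the cycle that avoids \<open>S\<close>, no edge enters or leaves
  \<open>D\<close>.\<close>

lemma seg_in:
  assumes "cyc P n" "sep D S" "\<And>l. a < l \<Longrightarrow> l < b \<Longrightarrow> P l \<notin> S" "b \<le> n" "a < l" "l < b" "P l \<in> D" "a < l'" "l' < b"
  shows "P l' \<in> D"
proof -
  have st: "P (Suc i) \<in> D \<longleftrightarrow> P i \<in> D" if "a < i" "Suc i < b" for i
  proof -
    have e: "E (P i) (P (Suc i))" using cyc_edge[OF assms(1)] that assms(4) by simp
    have "P i \<notin> S" "P (Suc i) \<notin> S" using assms(3)[of i] assms(3)[of "Suc i"] that by auto
    then show ?thesis using sepD[OF assms(2) _ e] sepD[OF assms(2) _ sym[OF e]] by metis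
  qed
  have "P (Suc a + j) \<in> D \<longleftrightarrow> P (Suc a) \<in> D" if "Suc a + j < b" for j
    using that
  proof (induction j)
    case (Suc j) then show ?case using st[of "Suc a + j"] by simp
  qed simp
  from this[of "l - Suc a"] this[of "l' - Suc a"] show ?thesis using assms(5-9) by simp
qed

text \<open>A longest cycle contains every vertex except \<open>w\<close>, in particular
  \<open>D\<close>. As \<open>D\<close> meets the rest only in \<open>p\<close> and
  \<open>q\<close>, it is one of the two arcs between them. This reduces the claim to
  \<open>closed_arc\<close> or, for \<open>c = 2 * k\<close>, to showing that \<open>w\<close> sees
  only the ends of the other arc.\<close>

lemma case_w_two:
  assumes D: "sep D {p, q}" "p \<noteq> q" "card D = k - 1" "w \<notin> D" "p \<noteq> w" "q \<noteq> w" "p \<in> V" "q \<in> V" "2 * k \<le> c" "3 \<le> k"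
  shows "shape_F \<or> shape_S \<or> shape_F1"
proof -
  obtain Y where Y: "lcyc Y" using exc unfolding lcyc_def by blast
  note L = lcycD[OF Y]
  have off: "V - Y = {w}" using only_w[OF Y] .
  have DV: "D \<subseteq> V" "D \<inter> {p, q} = {}" using D(1) unfolding sep_def by auto
  have DY: "D \<subseteq> Y"
  proof
    fix x assume x: "x \<in> D"
    then have "x \<noteq> w" "x \<in> V" using D(4) DV(1) by auto
    then have "x \<notin> V - Y" unfolding off by simp
    then show "x \<in> Y" using \<open>x \<in> V\<close> by simp
  qed
  have pY: "p \<in> Y" "q \<in> Y" using D off by blast+
  have fD: "finite D" using DV(1) finV finite_subset by blast
  obtain P where P: "cyc P c" "P ` {..<c} = Y" "P 0 = p" using lcyc_at[OF Y pY(1)] .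
  note inj = cyc_inj[OF P(1)]
  obtain j where j: "j < c" "q = P j" using pY(2) P(2) by auto
  have j0: "0 < j" using j D(2) P(3) by (cases j) auto
  have noS: "P l \<notin> {p, q}" if "l \<noteq> 0" "l \<noteq> j" "l < c" for l
    using inj[of l 0] inj[of l j] that j P(3) L(5) by auto
  have seg1: "P l' \<in> D" if "0 < l" "l < j" "P l \<in> D" "0 < l'" "l' < j" for l l'
    by (rule seg_in[OF P(1) D(1), of 0 j l l']) (use that noS j in auto)
  have seg2: "P l' \<in> D" if "j < l" "l < c" "P l \<in> D" "j < l'" "l' < c" for l l'
    by (rule seg_in[OF P(1) D(1), of j c l l']) (use that noS j in auto)
  have Dsub: "D \<subseteq> P ` {0<..<j} \<union> P ` {j<..<c}"
  proof
    fix x assume x: "x \<in> D"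
    then obtain l where l: "l < c" "x = P l" using DY P(2) by auto
    have "P l \<noteq> p" "P l \<noteq> q" using x l DV(2) by auto
    then have "l \<noteq> 0" "l \<noteq> j" using P(3) j(2) by metis+
    then have "l \<in> {0<..<j} \<or> l \<in> {j<..<c}" using l(1) by auto
    then show "x \<in> P ` {0<..<j} \<union> P ` {j<..<c}" unfolding l(2) by blast
  qed
  have c1: "card (P ` {0<..<j}) = j - 1" "card (P ` {j<..<c}) = c - j - 1"
    using card_seg2[OF P(1), of j 0] card_seg2[OF P(1), of c j] j by auto
  have alt: "D = P ` {0<..<j} \<and> j = k \<or> D = P ` {j<..<c} \<and> c = j + k"
  proof -
    define a1 where "a1 \<longleftrightarrow> (\<exists>l. 0 < l \<and> l < j \<and> P l \<in> D)"
    define a2 where "a2 \<longleftrightarrow> (\<exists>l. j < l \<and> l < c \<and> P l \<in> D)"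
    have s1: "P ` {0<..<j} \<subseteq> D" if a1 using that seg1 unfolding a1_def by auto
    have s2: "P ` {j<..<c} \<subseteq> D" if a2 using that seg2 unfolding a2_def by auto
    have t1: "D \<inter> P ` {0<..<j} = {}" if "\<not> a1" using that unfolding a1_def by auto
    have t2: "D \<inter> P ` {j<..<c} = {}" if "\<not> a2" using that unfolding a2_def by auto
    have gen: "D \<subseteq> B \<Longrightarrow> D \<inter> B = {} \<Longrightarrow> D = {}" "D \<subseteq> B \<union> B' \<Longrightarrow> D \<inter> B' = {} \<Longrightarrow> D \<subseteq> B"
      "D \<subseteq> B \<union> B' \<Longrightarrow> D \<inter> B = {} \<Longrightarrow> D \<subseteq> B'" for B B' by blast+
    have "D \<noteq> {}" using D(3,10) by auto
    then have "a1 \<or> a2" using gen(1)[OF gen(2)[OF Dsub t2] t1] by blast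
    \<comment> \<open>Otherwise \<open>D\<close> would contain all but two vertices of the cycle,
      more than its \<open>k - 1\<close>.\<close>
    moreover have "\<not> (a1 \<and> a2)"
    proof
      assume "a1 \<and> a2"
      then have "P ` {0<..<j} \<union> P ` {j<..<c} \<subseteq> D" using s1 s2 by simp
      moreover have "card (P ` {0<..<j} \<union> P ` {j<..<c}) = (j - 1) + (c - j - 1)"
      proof -
        have "P ` {0<..<j} \<inter> P ` {j<..<c} = {}" using inj j by fastforce
        then show ?thesis using c1 by (simp add: card_Un_disjoint)
      qed
      ultimately have "(j - 1) + (c - j - 1) \<le> k - 1" using card_mono[OF fD] D(3) by metis
      then show False using D(9,10) j j0 by linarith
    qed
    ultimately consider "a1" "\<not> a2" | "a2" "\<not> a1" by blast
    then show ?thesis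
    proof cases
      case 1
      then have "D = P ` {0<..<j}" using s1 gen(2)[OF Dsub t2] by (intro equalityI)
      then show ?thesis using c1(1) D(3,10) by auto
    next
      case 2
      then have "D = P ` {j<..<c}" using s2 gen(3)[OF Dsub t1] by (intro equalityI)
      then have "c - j - 1 = k - 1" using c1(2) D(3) by simp
      then have "c = j + k" using D(10) j(1) by linarith
      then show ?thesis using \<open>D = P ` {j<..<c}\<close> by blast
    qed
  qed
  have "\<exists>S. cyc S c \<and> S ` {..<c} = Y \<and> S ` {c - k<..<c} = D \<and> {S 0, S (c - k)} = {p, q}"
    using alt
  proof
    assume a: "D = P ` {0<..<j} \<and> j = k"
    let ?S = "\<lambda>i. P ((c - i) mod c)"
    have "cyc ?S c" "?S ` {..<c} = Y" using cyc_reflect[OF P(1)] P(2) by auto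
    moreover have "?S ` {c - k<..<c} = D" using reflect_image[of k ?S P] a j by auto
    moreover have "?S 0 = p" "?S (c - k) = q" using a j P(3) j0 by auto
    ultimately show ?thesis by (intro exI[of _ ?S]) simp
  next
    assume a: "D = P ` {j<..<c} \<and> c = j + k"
    then show ?thesis using P j by (intro exI[of _ P]) auto
  qed
  then obtain S where S: "cyc S c" "S ` {..<c} = Y" "S ` {c - k<..<c} = D" "{S 0, S (c - k)} = {p, q}" by blast
  note injS = cyc_inj[OF S(1)]
  have W: "\<And>D'. cpt Y D' \<Longrightarrow> w \<in> D' \<Longrightarrow> D' = {w}" using compD(2,3) off by blast
  show ?thesis
  proof (cases "c = 2 * k + 1")
    case True
    have "{c - k<..<c} = {k + 2..<c}" using True by auto
    then have "sep (S ` {k + 2..<c}) {S 0, S (Suc k)}" using S(3,4) D(1) True by simp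
    then show ?thesis using closed_arc[OF S(1) True D(10)] W S(2) by blast
  next
    case False
    then have c2: "c = 2 * k" using ck D(9) by simp
    have sD: "sep D {S 0, S k}" "D = S ` {k<..<c}" using S(3,4) D(1) c2 by auto
    let ?J = "S ` {0<..<k}"
    have Yeq: "Y = {S 0, S k} \<union> D \<union> ?J"
    proof -
      have "{..<c} = {0, k} \<union> {k<..<c} \<union> {0<..<k}" using c2 D(10) by auto
      then have "Y = S ` ({0, k} \<union> {k<..<c} \<union> {0<..<k})" using S(2) by simp
      then show ?thesis using sD(2) by (simp add: image_Un)
    qed
    have wV: "w \<in> V - Y" using off by blast
    have wn: "\<And>u. E w u \<Longrightarrow> u \<in> Y" using w_nbrs(2)[OF Y wV W] .
    have wI: "w \<notin> S ` {..<c}" using wV S(2) by simp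
    have wD: "\<not> E w u" if "u \<in> D" for u
    proof
      assume "E w u"
      then have "w \<in> D \<or> w \<in> {S 0, S k}" using sepD[OF sD(1) that] sym by blast
      then show False using wV Yeq by auto
    qed
    have SJ: "{S 0, S k} \<union> ?J = S ` {..k}"
    proof -
      have "{..k} = {0, k} \<union> {0<..<k}" by auto
      then have "S ` {..k} = S ` ({0, k} \<union> {0<..<k})" by simp
      then show ?thesis by (simp add: image_Un)
    qed
    have wpos: "\<exists>l\<le>k. u = S l" if "E w u" for u
    proof -
      have "u \<in> {S 0, S k} \<union> ?J" using wn[OF that] wD that Yeq by blast
      then show ?thesis unfolding SJ by auto
    qed
    have SV: "S l \<in> V" "S l \<noteq> w" if "l < c" for l using S(2) that L(3) wV by auto
    have Jnb: "u = w \<or> (\<exists>l\<le>k. u = S l)" if l: "0 < l" "l < k" and e: "E (S l) u" for l u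
    proof -
      have lJ: "S l \<notin> D" "S l \<notin> {S 0, S k}"
        using injS l c2 unfolding sD(2) by fastforce+
      have "u \<notin> D" using sepD[OF sD(1) _ sym[OF e]] lJ by blast
      then have "u = w \<or> u \<in> {S 0, S k} \<union> ?J" using EV2[OF e] off Yeq by blast
      then show ?thesis unfolding SJ by auto
    qed
    \<comment> \<open>An inner vertex of the other arc has only \<open>k\<close> possible neighbours
      besides \<open>w\<close>, so if it misses \<open>w\<close> it sees all of them.\<close>
    have full: False if l: "0 < l" "l < k" and n1: "\<not> E (S l) w" and n2: "\<not> E (S l) (S l')" "l' \<le> k" "l' \<noteq> l" for l l'
    proof -
      have "{u. E (S l) u} \<subseteq> S ` ({..k} - {l, l'})"
      proof
        fix u assume "u \<in> {u. E (S l) u}"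
        then have e: "E (S l) u" by simp
        then obtain i where "i \<le> k" "u = S i" using Jnb[OF l e] n1 by blast
        then show "u \<in> S ` ({..k} - {l, l'})" using e n2 irrefl by auto
      qed
      then have "card {u. E (S l) u} \<le> card (S ` ({..k} - {l, l'}))" by (intro card_mono) auto
      also have "\<dots> \<le> card ({..k} - {l, l'})" by (intro card_image_le) auto
      also have "\<dots> = k - 1" using l n2 by (subst card_Diff_subset) auto
      finally show False using deg[of "S l"] SV[of l] l c2 D(10) by simp
    qed
    have nc: "\<not> (E w (S a) \<and> E w (S (Suc a)))" if "Suc a < c" for a
      using not_consecutive(1)[OF S(1), of a "Suc a" w] that wI by auto
    have cyc1: False if "cycset ({w} \<union> S ` {..<c})"
    proof -
      have "card ({w} \<union> S ` {..<c}) = Suc c" using wI L(2,4) S(2) by simp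
      then show False using bound[OF that] by simp
    qed
    have dX: "{w} \<inter> S ` {..<c} = {}" using wI by blast
    \<comment> \<open>By crossing, \<open>S (Suc a)\<close> misses \<open>S (Suc b)\<close>, and
      being next to \<open>S a\<close> it also misses \<open>w\<close>, against \<open>full\<close>.
      The next claim does the same with predecessors.\<close>
    have low: False if ab: "a < b" "b < k" "E w (S a)" "E w (S b)" for a b
    proof -
      have kc: "k < c" using c2 D(10) by simp
      have "\<not> E (S (Suc a)) (S (Suc b))"
      proof
        assume e: "E (S (Suc a)) (S (Suc b))"
        have "cycset ({w} \<union> S ` {..<c})"
          by (rule cross_succ[OF S(1) ab(1) _ pth_single dX]) (use ab e kc sym in auto)
        then show False by (rule cyc1)
      qed
      moreover have "\<not> E (S (Suc a)) w" using nc[of a] ab kc sym by auto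
      ultimately show False using full[of "Suc a" "Suc b"] ab by auto
    qed
    have high: False if ab: "0 < a" "a < b" "b \<le> k" "E w (S a)" "E w (S b)" for a b
    proof -
      have kc: "k < c" using c2 D(10) by simp
      have "\<not> E (S (b - 1)) (S (a - 1))"
      proof
        assume e: "E (S (b - 1)) (S (a - 1))"
        have "cycset ({w} \<union> S ` {..<c})"
          by (rule cross_pred[OF S(1) ab(1,2) _ pth_single dX]) (use ab e kc sym in auto)
        then show False by (rule cyc1)
      qed
      moreover have "\<not> E (S (b - 1)) w" using nc[of "b - 1"] ab kc sym by auto
      ultimately show False by (intro full[of "b - 1" "a - 1"]) (use ab in auto)
    qed
    have wends: "u \<in> {S 0, S k}" if e: "E w u" for u
    proof (rule ccontr)
      assume n: "u \<notin> {S 0, S k}"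
      obtain l where l: "l \<le> k" "u = S l" using wpos[OF e] by blast
      then have l0: "0 < l" "l < k" using n by (cases "l = 0 \<or> l = k"; auto)+
      obtain u' where u': "E w u'" "u' \<noteq> u" using w_nbrs(3)[OF Y wV W] by blast
      obtain l' where l': "l' \<le> k" "u' = S l'" using wpos[OF u'(1)] by blast
      have "l' < l \<or> l < l'" using u'(2) l(2) l'(2) by (metis linorder_neqE_nat)
      then show False using low[of l' l] high[of l l'] e u'(1) l l' l0 by auto
    qed
    have sw: "sep {w} {S 0, S k}" unfolding sep_def using wends wV Yeq by auto
    have sJ: "sep ?J {S 0, S k}"
      unfolding sep_def
    proof (intro conjI ballI allI impI)
      show "?J \<subseteq> V" using Yeq L(3) by blast
      show "?J \<inter> {S 0, S k} = {}" using injS c2 by fastforce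
      fix v u assume v: "v \<in> ?J" and e: "E v u"
      then obtain l where l: "v = S l" "0 < l" "l < k" by auto
      have "u \<noteq> w"
      proof
        assume "u = w"
        then have "v \<in> {S 0, S k}" using wends e sym by blast
        then show False using l injS[of l 0] injS[of l k] c2 by auto
      qed
      then obtain l' where "l' \<le> k" "u = S l'" using Jnb[of l u] l e by blast
      then show "u \<in> ?J \<or> u \<in> {S 0, S k}" by (cases "l' = 0 \<or> l' = k") auto
    qed
    have cJ: "card ?J \<le> k" using card_seg2[OF S(1), of k 0] c2 by simp
    have "\<exists>X. v \<in> X \<and> sep X {S 0, S k} \<and> card X \<le> k - 1" if v: "v \<in> V - {S 0, S k} - ?J" for v
    proof -
      have "v \<in> D \<or> v \<in> {w}" using v off Yeq by blast
      then show ?thesis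
      proof
        assume "v \<in> D" then show ?thesis using sD(1) D(3) by (intro exI[of _ D]) simp
      next
        assume "v \<in> {w}" then show ?thesis using sw D(10) by (intro exI[of _ "{w}"]) simp
      qed
    qed
    moreover have "S 0 \<in> V" "S k \<in> V" using SV c2 D(10) by auto
    moreover have "S 0 \<noteq> S k" using injS[of 0 k] c2 D(10) by auto
    ultimately have shape_F1 unfolding shape_F1_def using sJ cJ
      by (intro exI[of _ "S 0"] exI[of _ "S k"] exI[of _ ?J]) simp
    then show ?thesis by blast
  qed
qed

lemma case_exceptional:
  assumes P: "cyc P cw" "P 0 = w"
  shows "shape_F \<or> shape_S \<or> shape_F1 \<or> shape_M \<or> shape_H"
proof -
  let ?Y = "P ` {..<cw}"
  note W = wcycD[OF P]
  have "\<not> V \<subseteq> ?Y" using W(3) card_mono[of ?Y V] card_V cwc by auto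
  then obtain v where "v \<in> V - ?Y" by blast
  then obtain D where D: "cpt ?Y D" using comp_ex by blast
  note C = compD[OF D] and S = comp_struct_w[OF P D] and N = comp_numbers_w[OF P D]
  consider "card D = 1" | "card D \<noteq> 1" "w \<notin> att ?Y D" "card (att ?Y D) = 2" | "card D = 2" "k = 4"
    using N(4) by blast
  then show ?thesis
  proof cases
    case 1
    then obtain u where "D = {u}" by (meson card_1_singletonE)
    then show ?thesis using case_single[OF P] D by blast
  next
    case 2
    obtain p q where pq: "att ?Y D = {p, q}" "p \<noteq> q" using 2(3) by (meson card_2_iff)
    have cD: "card D = k - 1" using S(1) 2 by simp
    have "card D \<noteq> 0" using C(1,5) by simp
    then have k3: "3 \<le> k" using cD 2(1) by simp
    have "2 * k \<le> c"
      using N(1) N(3)[OF 2(2)] 2(3) cD card_V k3 by simp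
    moreover have "p \<in> ?Y" "q \<in> ?Y" using pq by (auto simp: att_def)
    ultimately have "shape_F \<or> shape_S \<or> shape_F1"
      using comp_sep[OF D] pq cD k3 2(2) W(1,2) C(3) by (intro case_w_two[of D p q]) auto
    then show ?thesis by blast
  next
    case 3
    then show ?thesis using case_w_three[OF P D] by blast
  qed
qed

end

section \<open>Classification\<close>

context degree_graph
begin

lemma two_nbrs: "v \<in> V \<Longrightarrow> \<exists>u. E v u \<and> u \<noteq> z"
proof (rule ccontr)
  assume v: "v \<in> V" "\<not> (\<exists>u. E v u \<and> u \<noteq> z)"
  then have "V \<subseteq> insert z {v}" by (intro two) auto
  then have "card V \<le> card {z, v}" by (intro card_mono) auto
  also have "\<dots> \<le> 2" by (simp add: card_insert_if)
  finally show False using V3 by simp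
qed

text \<open>Since \<open>v\<close> is no cut vertex, two of its neighbours are joined by a path
  avoiding \<open>v\<close>.\<close>

lemma cycle_through:
  assumes "v \<in> V"
  shows "\<exists>Y. cycset Y \<and> v \<in> Y"
proof -
  obtain a where a: "E v a" using two_nbrs[OF assms] by blast
  obtain b where b: "E v b" "b \<noteq> a" using two_nbrs[OF assms] by blast
  have av: "a \<in> V - {v}" using a irrefl EV2 by blast
  obtain Z where Z: "Z \<subseteq> V - {v}" "a \<in> Z" "\<And>x y. x \<in> Z \<Longrightarrow> y \<in> V - {v} - Z \<Longrightarrow> \<not> E x y"
    "\<And>u. u \<in> Z \<Longrightarrow> \<exists>X\<subseteq>V - {v}. pth a u X" using reach[OF av] by metis
  have "V \<subseteq> insert v Z" using Z(1-3) EV2 by (intro two) blast+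
  then have "b \<in> Z" using b EV2 irrefl by blast
  then obtain X where X: "X \<subseteq> V - {v}" "pth a b X" using Z(4) by metis
  have vX: "v \<notin> X" using X(1) by blast
  have p: "pth v b (insert v X)" using pth_Cons[OF a X(2) vX] .
  have "2 \<le> card X" using card_mono[of X "{a, b}"] pth_ends[OF X(2)] pth_finite[OF X(2)] b(2) by simp
  then have "3 \<le> card (insert v X)" using vX pth_finite[OF X(2)] by simp
  then show ?thesis using cycsetI[OF p] b(1) sym by blast
qed

lemma comp_sub:
  assumes "cpt S D" "sep X S'" "S' \<subseteq> S" "v \<in> D" "v \<in> X"
  shows "D \<subseteq> X"
proof (rule ccontr)
  assume "\<not> D \<subseteq> X"
  then have "D \<inter> X \<noteq> D" "D \<inter> X \<subseteq> D" "D \<inter> X \<noteq> {}" using assms by blast+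
  then obtain a b where ab: "a \<in> D \<inter> X" "b \<in> D - D \<inter> X" "E a b"
    using connD[OF compD(4)[OF assms(1)]] by meson
  then have "b \<in> X \<or> b \<in> S'" using sepD[OF assms(2)] by blast
  then show False using ab(2) assms(3) compD(3)[OF assms(1)] by blast
qed

lemma comp_unique:
  assumes "cpt S D" "cpt S D'" "v \<in> D" "v \<in> D'"
  shows "D = D'"
proof -
  have a: "att S D \<subseteq> S" "att S D' \<subseteq> S" by (auto simp: att_iff)
  show ?thesis
    using comp_sub[OF assms(1) comp_sep[OF assms(2)] a(2) assms(3,4)]
      comp_sub[OF assms(2) comp_sep[OF assms(1)] a(1) assms(4,3)] by blast
qed

text \<open>Coordinates for the components of \<open>V - S\<close>: \<open>cl\<close> numbers the components and \<open>en\<close> enumerates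
  the vertices inside each of them.\<close>

definition coordinates :: "'a set \<Rightarrow> ('a \<Rightarrow> nat) \<Rightarrow> ('a \<Rightarrow> nat) \<Rightarrow> nat \<Rightarrow> bool" where
  "coordinates S cl en N \<longleftrightarrow>
     (\<forall>u\<in>V - S. \<forall>v\<in>V - S. E u v \<longrightarrow> cl u = cl v) \<and>
     (\<forall>u\<in>V - S. \<forall>v\<in>V - S. cl u = cl v \<longrightarrow> en u = en v \<longrightarrow> u = v) \<and>
     (\<forall>v\<in>V - S. cl v < N) \<and>
     (\<forall>v X S'. v \<in> V - S \<longrightarrow> v \<in> X \<longrightarrow> sep X S' \<longrightarrow> S' \<subseteq> S \<longrightarrow>
        en v < card X \<and> (\<forall>u\<in>V - S. cl u = cl v \<longrightarrow> u \<in> X))"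

lemma coordinatesI:
  assumes "\<And>u v. u \<in> V - S \<Longrightarrow> v \<in> V - S \<Longrightarrow> E u v \<Longrightarrow> cl u = cl v"
    and "\<And>u v. u \<in> V - S \<Longrightarrow> v \<in> V - S \<Longrightarrow> cl u = cl v \<Longrightarrow> en u = en v \<Longrightarrow> u = v"
    and "\<And>v. v \<in> V - S \<Longrightarrow> cl v < N"
    and "\<And>v X S'. v \<in> V - S \<Longrightarrow> v \<in> X \<Longrightarrow> sep X S' \<Longrightarrow> S' \<subseteq> S \<Longrightarrow>
      en v < card X \<and> (\<forall>u\<in>V - S. cl u = cl v \<longrightarrow> u \<in> X)"
  shows "coordinates S cl en N"
proof -
  have "\<forall>u\<in>V - S. \<forall>v\<in>V - S. E u v \<longrightarrow> cl u = cl v" using assms(1) by blast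
  moreover have "\<forall>u\<in>V - S. \<forall>v\<in>V - S. cl u = cl v \<longrightarrow> en u = en v \<longrightarrow> u = v" using assms(2) by blast
  moreover have "\<forall>v\<in>V - S. cl v < N" using assms(3) by blast
  moreover have "\<forall>v X S'. v \<in> V - S \<longrightarrow> v \<in> X \<longrightarrow> sep X S' \<longrightarrow> S' \<subseteq> S \<longrightarrow>
    en v < card X \<and> (\<forall>u\<in>V - S. cl u = cl v \<longrightarrow> u \<in> X)" by (intro allI impI, rule assms(4))
  ultimately show ?thesis unfolding coordinates_def by (intro conjI)
qed

lemma coordinatesD:
  assumes "coordinates S cl en N"
  shows "u \<in> V - S \<Longrightarrow> v \<in> V - S \<Longrightarrow> E u v \<Longrightarrow> cl u = cl v"
    and "u \<in> V - S \<Longrightarrow> v \<in> V - S \<Longrightarrow> cl u = cl v \<Longrightarrow> en u = en v \<Longrightarrow> u = v"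
    and "v \<in> V - S \<Longrightarrow> cl v < N"
    and "v \<in> V - S \<Longrightarrow> v \<in> X \<Longrightarrow> sep X S' \<Longrightarrow> S' \<subseteq> S \<Longrightarrow>
      en v < card X \<and> (\<forall>u\<in>V - S. cl u = cl v \<longrightarrow> u \<in> X)"
proof -
  note C = assms[unfolded coordinates_def]
  show "u \<in> V - S \<Longrightarrow> v \<in> V - S \<Longrightarrow> E u v \<Longrightarrow> cl u = cl v" using C[THEN conjunct1] by blast
  show "u \<in> V - S \<Longrightarrow> v \<in> V - S \<Longrightarrow> cl u = cl v \<Longrightarrow> en u = en v \<Longrightarrow> u = v"
    using C[THEN conjunct2, THEN conjunct1] by blast
  show "v \<in> V - S \<Longrightarrow> cl v < N" using C[THEN conjunct2, THEN conjunct2, THEN conjunct1] by blast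
  show "v \<in> V - S \<Longrightarrow> v \<in> X \<Longrightarrow> sep X S' \<Longrightarrow> S' \<subseteq> S \<Longrightarrow>
      en v < card X \<and> (\<forall>u\<in>V - S. cl u = cl v \<longrightarrow> u \<in> X)"
    by (rule C[THEN conjunct2, THEN conjunct2, THEN conjunct2, THEN spec, THEN spec, THEN spec,
        THEN mp, THEN mp, THEN mp, THEN mp])
qed

lemma coordinates_exist: "\<exists>cl en N. coordinates S cl en N"
proof -
  define K where "K v = (SOME D. cpt S D \<and> v \<in> D)" for v
  have K: "cpt S (K v)" "v \<in> K v" if "v \<in> V - S" for v
    using someI_ex[OF comp_ex[OF that]] unfolding K_def by auto
  have KE: "K u = K v" if "u \<in> V - S" "v \<in> V - S" "E u v" for u v
  proof -
    have "v \<in> K u" using compD(6)[OF K(1)[OF that(1)] K(2)[OF that(1)] that(3)] that(2) by blast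
    then show ?thesis using comp_unique[OF K(1)[OF that(1)] K(1)[OF that(2)] _ K(2)[OF that(2)]] by blast
  qed
  have fV: "finite (V - S)" using finV by simp
  obtain g :: "'a set \<Rightarrow> nat" where g: "inj_on g (K ` (V - S))"
    using finite_imp_inj_to_nat_seg[of "K ` (V - S)"] fV by auto
  have "\<exists>e. inj_on e D \<and> e ` D \<subseteq> {..<card D}" if "finite D" for D :: "'a set"
    using finite_imp_inj_to_nat_seg[OF that]
  proof (elim exE conjE)
    fix n and f :: "'a \<Rightarrow> nat" assume f: "f ` D = {i. i < n}" "inj_on f D"
    have "card D = n" using card_image[OF f(2)] f(1) by simp
    then show ?thesis using f by (intro exI[of _ f]) auto
  qed
  then obtain e :: "'a set \<Rightarrow> 'a \<Rightarrow> nat" where e: "\<And>D. finite D \<Longrightarrow> inj_on (e D) D \<and> e D ` D \<subseteq> {..<card D}" by metis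
  \<comment> \<open>The inserted \<open>0\<close> keeps \<open>Max\<close> meaningful when
    \<open>V - S\<close> is empty.\<close>
  define N where "N = Suc (Max (insert 0 ((\<lambda>v. g (K v)) ` (V - S))))"
  have c1: "g (K u) = g (K v) \<longleftrightarrow> K u = K v" if "u \<in> V - S" "v \<in> V - S" for u v
    using inj_on_eq_iff[OF g, of "K u" "K v"] that by simp
  have 1: "u = v" if uv: "u \<in> V - S" "v \<in> V - S" "g (K u) = g (K v)" "e (K u) u = e (K v) v" for u v
  proof -
    have "K u = K v" using c1 uv by blast
    moreover have "inj_on (e (K u)) (K u)" using e compD(5)[OF K(1)[OF uv(1)]] by blast
    ultimately show ?thesis using K(2)[OF uv(1)] K(2)[OF uv(2)] uv(4) by (metis inj_onD)
  qed
  have 2: "g (K v) < N" if "v \<in> V - S" for v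
  proof -
    have "g (K v) \<le> Max (insert 0 ((\<lambda>v. g (K v)) ` (V - S)))"
      using that fV by (intro Max_ge) auto
    then show ?thesis unfolding N_def by simp
  qed
  have 3: "e (K v) v < card X \<and> (\<forall>u\<in>V - S. g (K u) = g (K v) \<longrightarrow> u \<in> X)"
    if v: "v \<in> V - S" "v \<in> X" "sep X S'" "S' \<subseteq> S" for v X S'
  proof
    have sub: "K v \<subseteq> X" using comp_sub[OF K(1)[OF v(1)] v(3,4) K(2)[OF v(1)] v(2)] .
    have fX: "finite X" using v(3) finV finite_subset unfolding sep_def by blast
    have "e (K v) v < card (K v)" using e[OF compD(5)[OF K(1)[OF v(1)]]] K(2)[OF v(1)] by auto
    also have "\<dots> \<le> card X" using card_mono[OF fX sub] .
    finally show "e (K v) v < card X" .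
    show "\<forall>u\<in>V - S. g (K u) = g (K v) \<longrightarrow> u \<in> X"
    proof (intro ballI impI)
      fix u assume u: "u \<in> V - S" "g (K u) = g (K v)"
      then have "K u = K v" using c1 v(1) by blast
      then show "u \<in> X" using K(2)[OF u(1)] sub by blast
    qed
  qed
  have 0: "g (K u) = g (K v)" if "u \<in> V - S" "v \<in> V - S" "E u v" for u v
    using KE[OF that] by simp
  have "coordinates S (\<lambda>v. g (K v)) (\<lambda>v. e (K v) v) N" by (rule coordinatesI[OF 0 1 2 3])
  then show ?thesis by blast
qed

end

context circumference_graph
begin

lemma classification: "shape_F \<or> shape_S \<or> shape_F1 \<or> shape_M \<or> shape_H"
  using dichotomy
proof
  assume "\<exists>Y D. lcyc Y \<and> cpt Y D \<and> w \<notin> D \<and> 2 \<le> card D \<and> (\<forall>D'. cpt Y D' \<longrightarrow> w \<in> D' \<longrightarrow> D' = {w})"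
  then show ?thesis using case_large_component by blast
next
  assume ind: "\<forall>Y u v. lcyc Y \<longrightarrow> u \<in> V - Y \<longrightarrow> v \<in> V - Y \<longrightarrow> \<not> E u v"
  show ?thesis
  proof (cases "\<exists>Y u. lcyc Y \<and> u \<in> V - Y \<and> u \<noteq> w")
    case True
    then show ?thesis using case_independent ind by blast
  next
    case False
    have only: "V - Y = {w}" if "lcyc Y" for Y
    proof -
      have "V - Y \<noteq> {}" using card_mono[OF lcycD(4)[OF that], of V] lcycD(2)[OF that] cn by auto
      then show ?thesis using False that by blast
    qed
    obtain Y where Y: "lcyc Y" using exc unfolding lcyc_def by blast
    have wV: "w \<in> V" "w \<notin> Y" using only[OF Y] by blast+
    show ?thesis
    proof (cases "k \<le> card {u. E w u}")
      case True
      have "\<exists>w'\<in>V. w' \<noteq> w"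
        using only[OF Y] lcycD[OF Y] by (metis card.empty equals0I not_numeral_le_zero subsetD wV(2))
      then obtain w' where w': "w' \<noteq> w" by blast
      \<comment> \<open>All degrees are at least \<open>k\<close> here, so the exceptional role can
        pass to another vertex \<open>w'\<close>, and \<open>w\<close> becomes the off-cycle vertex
        in \<open>case_independent\<close>.\<close>
      interpret L': circumference_graph E V k w' c
      proof
        show "k \<le> card {u. E v u}" if "v \<in> V" for v using deg[OF that] True by (cases "v = w") auto
      qed (use finV EV V3 two k2 bound exc cn ck in blast)+
      have "L'.lcyc Y" using Y unfolding lcyc_def L'.lcyc_def .
      then have "shape_H \<or> shape_F"
        using ind wV w' unfolding lcyc_def by (intro L'.case_independent[of Y w]) (auto simp: L'.lcyc_def)
      then show ?thesis by blast
    next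
      case F: False
      define M where "M = {card Z | Z. cycset Z \<and> w \<in> Z}"
      have "finite M" by (rule finite_subset[of _ "{..c}"]) (use bound in \<open>auto simp: M_def\<close>)
      moreover have "M \<noteq> {}" using cycle_through[OF wV(1)] unfolding M_def by blast
      ultimately have mx: "Max M \<in> M" "\<And>x. x \<in> M \<Longrightarrow> x \<le> Max M" by auto
      from mx(1) obtain Z where Z0: "Max M = card Z" "cycset Z" "w \<in> Z" unfolding M_def by blast
      have "card Z' \<le> card Z" if "cycset Z'" "w \<in> Z'" for Z'
        using mx(2)[of "card Z'"] Z0(1) that unfolding M_def by auto
      then have Z: "cycset Z" "w \<in> Z" "\<And>Z'. cycset Z' \<Longrightarrow> w \<in> Z' \<Longrightarrow> card Z' \<le> card Z"
        using Z0 by blast+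
      have "card Z \<noteq> c" using only[of Z] Z(1,2) unfolding lcyc_def by blast
      then have "card Z < c" using bound[OF Z(1)] by simp
      then interpret exceptional_graph E V k w c "card Z"
        using Z F only by unfold_locales auto
      obtain P where "cyc P (card Z)" "P 0 = w" using cycset_at[OF Z(1,2)] by blast
      then show ?thesis by (rule case_exceptional)
    qed
  qed
qed

end

section \<open>From graph records to the adjacency relation\<close>

definition adj :: "'a ugraph \<Rightarrow> 'a \<Rightarrow> 'a \<Rightarrow> bool" where
  "adj G u v \<longleftrightarrow> {u, v} \<in> edges G"

lemma simple_edge:
  assumes "simple_graph G" "e \<in> edges G"
  shows "\<exists>u v. e = {u, v} \<and> u \<noteq> v \<and> u \<in> verts G \<and> v \<in> verts G"
proof -
  have "e \<subseteq> verts G" "card e = 2" using assms unfolding simple_graph_def by auto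
  then show ?thesis by (metis card_2_iff insert_subset)
qed

lemma is_subgraphI:
  assumes "simple_graph G" "inj_on f (verts G)" "\<And>v. v \<in> verts G \<Longrightarrow> f v \<in> verts H"
    and "\<And>u v. adj G u v \<Longrightarrow> u \<noteq> v \<Longrightarrow> {f u, f v} \<in> edges H"
  shows "is_subgraph G H"
  unfolding is_subgraph_def
proof (intro exI[of _ f] conjI ballI)
  show "f ` e \<in> edges H" if e: "e \<in> edges G" for e
  proof -
    obtain u v where "e = {u, v}" "u \<noteq> v" using simple_edge[OF assms(1) e] by blast
    then show ?thesis using assms(4)[of u v] e unfolding adj_def by simp
  qed
qed (use assms in auto)

lemma sgraph_adj: "simple_graph G \<Longrightarrow> sgraph (adj G)"
proof
  assume "simple_graph G"
  then show "\<not> adj G v v" for v unfolding simple_graph_def adj_def by force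
  show "adj G u v \<Longrightarrow> adj G v u" for u v unfolding adj_def by (simp add: insert_commute)
qed

lemma degree_graph_adj:
  assumes "simple_graph G" "k_connected 2 G" "2 \<le> k"
    and "\<And>v. v \<in> verts G \<Longrightarrow> v \<noteq> w \<Longrightarrow> k \<le> degree G v"
  shows "degree_graph (adj G) (verts G) k w"
proof -
  interpret sgraph "adj G" using sgraph_adj[OF assms(1)] .
  show ?thesis
  proof
    show "finite (verts G)" using assms(1) unfolding simple_graph_def by blast
    show "adj G u v \<Longrightarrow> u \<in> verts G" for u v using assms(1) unfolding simple_graph_def adj_def by auto
    show "3 \<le> card (verts G)" using assms(2) unfolding k_connected_def by simp
    show "v \<in> verts G \<Longrightarrow> v \<noteq> w \<Longrightarrow> k \<le> card {u. adj G v u}" for v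
      using assms(4) unfolding degree_def adj_def by blast
    show "2 \<le> k" by fact
    show "verts G \<subseteq> insert z K"
      if K: "K \<subseteq> verts G" "K \<noteq> {}" "\<And>v u. v \<in> K \<Longrightarrow> adj G v u \<Longrightarrow> u \<in> K \<or> u = z" for K z
    proof
      fix x assume x: "x \<in> verts G"
      show "x \<in> insert z K"
      proof (rule ccontr)
        assume nx: "x \<notin> insert z K"
        obtain y where y: "y \<in> K" using K(2) by blast
        \<comment> \<open>\<open>z\<close> is deleted only if it is a vertex outside
          \<open>K\<close>. Then \<open>K\<close> is closed in what remains, so a walk from
          \<open>y\<close> cannot reach \<open>x\<close>.\<close>
        let ?X = "({z} - K) \<inter> verts G"
        have "card ?X \<le> card {z}" by (intro card_mono) auto
        then have "connected_graph (delete_verts G ?X)"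
          using assms(2) unfolding k_connected_def by simp
        moreover have "x \<in> verts (delete_verts G ?X)" "y \<in> verts (delete_verts G ?X)"
          using x y nx K(1) unfolding delete_verts_def by auto
        ultimately have "(y, x) \<in> {(a, b). {a, b} \<in> edges (delete_verts G ?X)}\<^sup>*"
          unfolding connected_graph_def by blast
        then have "x \<in> K"
        proof (induction rule: rtrancl_induct)
          case base then show ?case by (rule y)
        next
          case (step a b)
          have e: "adj G a b" "b \<notin> ?X" using step.hyps unfolding delete_verts_def adj_def by auto
          have "b \<in> verts G" using e(1) assms(1) unfolding simple_graph_def adj_def by auto
          then show ?case using K(3)[OF step.IH e(1)] e(2) step.IH by blast
        qed
        then show False using nx by blast
      qed
    qed
  qed
qed

lemma (in sgraph) cycset_list:
  assumes "distinct p" "3 \<le> length p" "\<And>i. i < length p \<Longrightarrow> E (p ! i) (p ! ((i + 1) mod length p))"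
  shows "cycset (set p)" "card (set p) = length p"
proof -
  show c: "card (set p) = length p" using assms(1) by (rule distinct_card)
  have ne: "p \<noteq> []" using assms(2) by auto
  have "E (p ! i) (p ! Suc i)" if "Suc i < length p" for i using assms(3)[of i] that by simp
  then have "successively E p" by (simp add: successively_conv_nth)
  then have "pth (hd p) (last p) (set p)" using assms ne by (intro pthI) auto
  moreover have "E (last p) (hd p)"
    using assms(3)[of "length p - 1"] assms(2) ne by (simp add: last_conv_nth hd_conv_nth)
  ultimately show "cycset (set p)" using c assms(2) by (intro cycsetI) auto
qed

lemma is_cycle_cycset:
  assumes "simple_graph G" "is_cycle G p"
  shows "sgraph.cycset (adj G) (set p)" "card (set p) = length p"
proof -
  interpret sgraph "adj G" using sgraph_adj[OF assms(1)] .
  have "distinct p" "3 \<le> length p" "\<And>i. i < length p \<Longrightarrow> adj G (p ! i) (p ! ((i + 1) mod length p))"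
    using assms(2) unfolding is_cycle_def adj_def by auto
  then show "cycset (set p)" "card (set p) = length p" using cycset_list by blast+
qed

lemma cycset_is_cycle:
  assumes "degree_graph (adj G) (verts G) k w" "sgraph.cycset (adj G) Y"
  shows "\<exists>p. is_cycle G p \<and> set p = Y \<and> length p = card Y"
proof -
  interpret degree_graph "adj G" "verts G" k w by fact
  obtain P where P: "cyc P (card Y)" "P ` {..<card Y} = Y" using cycset_cyc[OF assms(2)] by blast
  let ?n = "card Y" and ?p = "map P [0..<card Y]"
  have n3: "3 \<le> ?n" using P(1) unfolding cyc_def by blast
  have st: "adj G (P i) (P ((i + 1) mod ?n))" if "i < ?n" for i
  proof (cases "Suc i < ?n")
    case True then show ?thesis using cyc_edge[OF P(1) True] by simp
  next
    case False
    then have "Suc i = ?n" using that by simp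
    then show ?thesis using cyc_close[OF P(1)] by (metis Suc_eq_plus1 diff_Suc_1 mod_self)
  qed
  have sY: "set ?p = Y" using P(2) by (simp add: atLeast0LessThan)
  have "Y \<subseteq> verts G"
  proof
    fix y assume "y \<in> Y"
    then obtain i where "i < ?n" "y = P i" using P(2) by auto
    then show "y \<in> verts G" using st EV by blast
  qed
  moreover have "distinct ?p" using P(1) unfolding cyc_def by (simp add: distinct_map atLeast0LessThan)
  moreover have "\<forall>i<length ?p. {?p ! i, ?p ! ((i + 1) mod length ?p)} \<in> edges G"
  proof (intro allI impI)
    fix i assume i: "i < length ?p"
    have "(i + 1) mod ?n < ?n" using n3 by (intro mod_less_divisor) simp
    then show "{?p ! i, ?p ! ((i + 1) mod length ?p)} \<in> edges G" using st[of i] i unfolding adj_def by simp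
  qed
  moreover have "3 \<le> length ?p" using n3 by simp
  ultimately have "is_cycle G ?p" unfolding is_cycle_def sY by (intro conjI)
  then show ?thesis using sY by (intro exI[of _ ?p]) simp
qed

text \<open>The maximum defining \<open>circumference\<close> is attained: cycle lengths are bounded
  by the number of vertices, and 2-connectedness provides a cycle. Since the graph is not
  Hamiltonian, a longest cycle misses a vertex.\<close>

lemma circumference_graph_adj:
  assumes "simple_graph G" "k_connected 2 G" "2 \<le> k" "\<not> hamiltonian G" "circumference G \<le> 2 * k + 1"
    and "\<And>v. v \<in> verts G \<Longrightarrow> v \<noteq> w \<Longrightarrow> k \<le> degree G v"
  shows "circumference_graph (adj G) (verts G) k w (circumference G)"
proof -
  have L0: "degree_graph (adj G) (verts G) k w" using degree_graph_adj[OF assms(1-3)] assms(6) by simp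
  interpret degree_graph "adj G" "verts G" k w by (rule L0)
  let ?M = "{length p | p. is_cycle G p}"
  have "?M \<subseteq> {..card (verts G)}"
  proof
    fix l assume "l \<in> ?M"
    then obtain p where p: "l = length p" "is_cycle G p" by blast
    have "set p \<subseteq> verts G" using p(2) unfolding is_cycle_def by blast
    then have "card (set p) \<le> card (verts G)" using card_mono finV by blast
    then show "l \<in> {..card (verts G)}" using is_cycle_cycset(2)[OF assms(1) p(2)] p(1) by simp
  qed
  then have fM: "finite ?M" by (rule finite_subset) simp
  have b: "card Y \<le> circumference G" if Y: "cycset Y" for Y
  proof -
    obtain p where "is_cycle G p" "length p = card Y" using cycset_is_cycle[OF L0 Y] by blast
    then have "card Y \<in> ?M" by (metis (mono_tags, lifting) mem_Collect_eq)
    then show ?thesis unfolding circumference_def using fM by simp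
  qed
  have "verts G \<noteq> {}" using V3 by auto
  then obtain v where "v \<in> verts G" by blast
  then obtain Y0 where "cycset Y0" using cycle_through by blast
  then have "?M \<noteq> {}" using cycset_is_cycle[OF L0] by blast
  then have "circumference G \<in> ?M" unfolding circumference_def using fM by (rule Max_in[rotated])
  then obtain p where p: "circumference G = length p" "is_cycle G p" by blast
  note cp = is_cycle_cycset[OF assms(1) p(2)]
  have sp: "set p \<subseteq> verts G" using p(2) unfolding is_cycle_def by blast
  have "set p \<noteq> verts G" using assms(4) p(2) unfolding hamiltonian_def by blast
  then have "card (set p) < card (verts G)" using sp finV by (intro psubset_card_mono) auto
  then show ?thesis
    using b cp p(1) assms(5) by unfold_locales auto
qed

section \<open>Embeddings into the extremal graphs\<close>

lemma complete_verts: "verts (complete_graph m) = {..<m}"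
  unfolding complete_graph_def by simp

lemma complete_edge: "u < m \<Longrightarrow> v < m \<Longrightarrow> u \<noteq> v \<Longrightarrow> {u, v} \<in> edges (complete_graph m)"
  unfolding complete_graph_def by auto

lemma union_verts: "verts (disjoint_union G H) = Inl ` verts G \<union> Inr ` verts H"
  unfolding disjoint_union_def by simp

lemma union_edge:
  fixes G :: "'a ugraph" and H :: "'b ugraph"
  shows "{u, v} \<in> edges G \<Longrightarrow> {Inl u, Inl v} \<in> edges (disjoint_union G H)"
  "{a, b} \<in> edges H \<Longrightarrow> {Inr a, Inr b} \<in> edges (disjoint_union G H)"
proof -
  show "{Inl u, Inl v} \<in> edges (disjoint_union G H)" if "{u, v} \<in> edges G"
    using imageI[OF that, of "\<lambda>e. Inl ` e :: ('a + 'b) set"] unfolding disjoint_union_def image_insert image_empty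
    by (simp only: ugraph.simps) (rule UnI1)
  show "{Inr a, Inr b} \<in> edges (disjoint_union G H)" if "{a, b} \<in> edges H"
    using imageI[OF that, of "\<lambda>e. Inr ` e :: ('a + 'b) set"] unfolding disjoint_union_def image_insert image_empty
    by (simp only: ugraph.simps) (rule UnI2)
qed

lemma between_verts: "verts (add_all_between X Y G) = verts G"
  unfolding add_all_between_def by simp

lemma between_edge:
  "e \<in> edges G \<Longrightarrow> e \<in> edges (add_all_between X Y G)"
  "u \<in> X \<Longrightarrow> v \<in> Y \<Longrightarrow> {u, v} \<in> edges (add_all_between X Y G)"
  unfolding add_all_between_def by auto

lemma join_verts: "verts (join_graph G H) = Inl ` verts G \<union> Inr ` verts H"
  unfolding join_graph_def between_verts union_verts ..

lemma join_edge:
  "{u, v} \<in> edges G \<Longrightarrow> {Inl u, Inl v} \<in> edges (join_graph G H)"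
  "{a, b} \<in> edges H \<Longrightarrow> {Inr a, Inr b} \<in> edges (join_graph G H)"
  "u \<in> verts G \<Longrightarrow> a \<in> verts H \<Longrightarrow> {Inl u, Inr a} \<in> edges (join_graph G H)"
  unfolding join_graph_def
  by (rule between_edge(1), rule union_edge(1), assumption)
    (rule between_edge(1), rule union_edge(2), assumption, rule between_edge(2), simp_all)

lemma copies_verts: "verts (copies m H) = {..<m} \<times> verts H"
  unfolding copies_def by simp

lemma copies_edge: "i < m \<Longrightarrow> {u, v} \<in> edges H \<Longrightarrow> {(i, u), (i, v)} \<in> edges (copies m H)"
proof -
  assume a: "i < m" "{u, v} \<in> edges H"
  have "{(i, u), (i, v)} = Pair i ` {u, v}" by simp
  then show ?thesis using a unfolding copies_def ugraph.simps by blast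
qed

lemma matching_verts: "verts (matching_graph t) = {..<t}"
  unfolding matching_graph_def by simp

lemma matching_edge:
  assumes "2 * c + 1 < t" "a < 2" "b < 2" "a \<noteq> b"
  shows "{2 * c + a, 2 * c + b} \<in> edges (matching_graph t)"
proof -
  have "{2 * c, 2 * c + 1} \<in> edges (matching_graph t)"
    unfolding matching_graph_def using assms(1) by auto
  moreover have "a = 0 \<and> b = 1 \<or> a = 1 \<and> b = 0" using assms(2-4) by auto
  ultimately show ?thesis by (auto simp: insert_commute)
qed

lemma star_verts: "verts (star_graph s) = {..<s}"
  unfolding star_graph_def by simp

lemma star_edge: "0 < v \<Longrightarrow> v < s \<Longrightarrow> {0, v} \<in> edges (star_graph s)"
  unfolding star_graph_def by auto

lemmas graph_verts = complete_verts union_verts between_verts join_verts copies_verts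
  matching_verts star_verts

lemma finite_numbering:
  assumes "finite D"
  obtains e :: "'a \<Rightarrow> nat" where "inj_on e D" "e ` D = {..<card D}"
proof -
  obtain n and e :: "'a \<Rightarrow> nat" where e: "e ` D = {i. i < n}" "inj_on e D"
    using finite_imp_inj_to_nat_seg[OF assms] by blast
  have "card D = n" using card_image[OF e(2)] e(1) by simp
  then show ?thesis using that[of e] e by auto
qed

section \<open>A vertex map for each shape\<close>

locale host = degree_graph "adj G" "verts G" k w for G :: "'a ugraph" and k w +
  assumes simple: "simple_graph G"
begin

text \<open>\<open>J\<close> goes to the copy of \<open>complete_graph k\<close>, and every other
  component to the copy of \<open>complete_graph (k - 1)\<close> carrying its number;
  \<open>Suc N\<close> copies make \<open>t\<close> positive.\<close>

lemma embedding_F1: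
  assumes shape_F1
  shows "\<exists>t\<ge>1. is_subgraph G (F1_graph t k)"
proof -
  obtain p q J where pq: "p \<in> verts G" "q \<in> verts G" "p \<noteq> q" and J: "sep J {p, q}" "card J \<le> k"
    and X: "\<And>v. v \<in> verts G - {p, q} - J \<Longrightarrow> \<exists>X. v \<in> X \<and> sep X {p, q} \<and> card X \<le> k - 1"
    using assms unfolding shape_F1_def by blast
  obtain cl en N where C: "coordinates {p, q} cl en N" using coordinates_exist by blast
  note c1 = coordinatesD(1)[OF C] and c2 = coordinatesD(2)[OF C]
    and c3 = coordinatesD(3)[OF C] and c4 = coordinatesD(4)[OF C]
  have JV: "J \<subseteq> verts G" "p \<notin> J" "q \<notin> J" using J(1) unfolding sep_def by auto
  obtain eJ :: "'a \<Rightarrow> nat" where eJ: "inj_on eJ J" "eJ ` J = {..<card J}"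
    using finite_numbering[OF finite_subset[OF JV(1) finV]] .
  have eJk: "eJ v < k" if "v \<in> J" for v using imageI[OF that, of eJ] eJ(2) J(2) by simp
  have en: "en v < k - 1" if v: "v \<in> verts G - {p, q} - J" for v
  proof -
    obtain X where X: "v \<in> X" "sep X {p, q}" "card X \<le> k - 1" using X[OF v] by blast
    have "en v < card X" using c4[OF _ X(1,2)] v by blast
    then show ?thesis using X(3) by simp
  qed
  define f :: "'a \<Rightarrow> nat + ((nat \<times> nat) + nat) + nat" where "f v = (if v = p then Inl 0 else if v = q then Inl 1
    else if v \<in> J then Inr (Inl (Inr (eJ v))) else Inr (Inl (Inl (cl v, en v))))" for v
  have fp: "f p = Inl 0" and fq: "f q = Inl 1" unfolding f_def using pq(3) by auto
  have fJ: "f v = Inr (Inl (Inr (eJ v)))" if "v \<in> J" for v unfolding f_def using that JV by auto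
  have fo: "f v = Inr (Inl (Inl (cl v, en v)))" if "v \<in> verts G - {p, q} - J" for v
    unfolding f_def using that by auto
  let ?H = "F1_graph (Suc N) k"
  have ver: "f v \<in> verts ?H" if "v \<in> verts G" for v
    using that eJk[of v] en[of v] c3[of v] unfolding f_def F1_graph_def graph_verts by auto
  have inj: "inj_on f (verts G)"
  proof (rule inj_onI)
    fix u v assume "u \<in> verts G" "v \<in> verts G" "f u = f v"
    then show "u = v" using c2[of u v] inj_onD[OF eJ(1), of u v] unfolding f_def by (auto split: if_splits)
  qed
  have join: "{f a, f b} \<in> edges ?H" if a: "a \<in> {p, q}" and b: "b \<in> verts G - {p, q}" for a b
  proof -
    have "\<exists>i<2. f a = Inl i" using a fp fq by auto
    then obtain i where i: "f a = Inl i" "i \<in> {..<2}" by blast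
    have "f b \<in> verts ?H" using ver b by blast
    moreover have "\<exists>j. f b = Inr j" using b unfolding f_def by auto
    then obtain j where j: "f b = Inr j" by blast
    ultimately show ?thesis unfolding i(1) j F1_graph_def join_verts
      using i(2) by (intro join_edge(3)) (auto simp: complete_verts)
  qed
  have edge: "{f u, f v} \<in> edges ?H" if uv: "adj G u v" "u \<noteq> v" for u v
  proof -
    have V: "u \<in> verts G" "v \<in> verts G" using EV EV2 uv(1) by blast+
    consider "u \<in> {p, q}" "v \<in> {p, q}" | "u \<in> {p, q}" "v \<notin> {p, q}" | "u \<notin> {p, q}" "v \<in> {p, q}"
      | "u \<notin> {p, q}" "v \<notin> {p, q}" by blast
    then show ?thesis
    proof cases
      case 1
      then have "{f u, f v} = {Inl 0, Inl 1}" using uv(2) fp fq by auto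
      moreover have "{Inl 0, Inl 1} \<in> edges ?H"
        unfolding F1_graph_def by (intro join_edge(1) complete_edge) simp_all
      ultimately show ?thesis by simp
    next
      case 2 then show ?thesis using join V by blast
    next
      case 3 then show ?thesis using join[of v u] V by (simp add: insert_commute)
    next
      case 4
      then have iff: "u \<in> J \<longleftrightarrow> v \<in> J" using sepD[OF J(1)] uv(1) sym by blast
      show ?thesis
      proof (cases "u \<in> J")
        case True
        then have J2: "u \<in> J" "v \<in> J" using iff by auto
        have "eJ u \<noteq> eJ v" using inj_onD[OF eJ(1)] J2 uv(2) by blast
        then show ?thesis unfolding fJ[OF J2(1)] fJ[OF J2(2)] F1_graph_def
          using eJk J2 by (intro join_edge(2) union_edge complete_edge)
      next
        case False
        then have o: "u \<in> verts G - {p, q} - J" "v \<in> verts G - {p, q} - J" using iff V 4 by auto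
        have cl: "cl u = cl v" using c1 uv(1) o by blast
        have ne: "en u \<noteq> en v" using c2[OF _ _ cl] uv(2) o by blast
        have N: "cl v < Suc N" using c3[of v] o by simp
        show ?thesis unfolding fo[OF o(1)] fo[OF o(2)] cl F1_graph_def
          by (intro join_edge(2) union_edge copies_edge complete_edge) (use en[OF o(1)] en[OF o(2)] ne N in simp_all)
      qed
    qed
  qed
  have "is_subgraph G ?H" using is_subgraphI[OF simple inj ver edge] .
  then show ?thesis by (intro exI[of _ "Suc N"]) simp
qed

lemma embedding_F:
  assumes shape_F
  shows "\<exists>s\<ge>1. \<exists>t\<ge>1. is_subgraph G (F_graph s t k)"
proof -
  obtain x y z where V3: "x \<in> verts G" "y \<in> verts G" "z \<in> verts G" and ne3: "x \<noteq> y" "x \<noteq> z" "y \<noteq> z"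
    and X: "\<And>v. v \<in> verts G - {x, y, z} \<Longrightarrow>
      \<exists>X. v \<in> X \<and> card X \<le> k - 1 \<and> X \<inter> {x, y, z} = {} \<and> (sep X {x, z} \<or> sep X {y, z})"
    using assms unfolding shape_F_def by blast
  obtain cl en N where C: "coordinates {x, y, z} cl en N" using coordinates_exist by blast
  note c1 = coordinatesD(1)[OF C] and c2 = coordinatesD(2)[OF C]
    and c3 = coordinatesD(3)[OF C] and c4 = coordinatesD(4)[OF C]
  \<comment> \<open>The side is chosen for whole components: those with a neighbour of
    \<open>y\<close> go to the side joined to \<open>y\<close> and \<open>z\<close>, all others to
    the side of \<open>x\<close> and \<open>z\<close>.\<close>
  define T where "T v \<longleftrightarrow> (\<exists>u\<in>verts G - {x, y, z}. cl u = cl v \<and> adj G u y)" for v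
  have props: "en v < k - 1 \<and> (T v \<longrightarrow> \<not> adj G v x)" if v: "v \<in> verts G - {x, y, z}" for v
  proof -
    obtain X where X: "v \<in> X" "card X \<le> k - 1" "X \<inter> {x, y, z} = {}" "sep X {x, z} \<or> sep X {y, z}"
      using X[OF v] by blast
    obtain S' where S': "sep X S'" "S' \<subseteq> {x, y, z}" "S' = {x, z} \<or> S' = {y, z}" using X(4) by blast
    note c = c4[OF v X(1) S'(1,2)]
    have "\<not> adj G v x" if t: "T v"
    proof -
      obtain u where u': "u \<in> verts G - {x, y, z}" "cl u = cl v" and uy: "adj G u y"
        using t unfolding T_def by blast
      have u: "u \<in> X" using c u' by blast
      have "y \<in> S'" using sepD[OF S'(1) u uy] X(3) by blast
      then have "x \<notin> S'" using S'(3) ne3 by auto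
      then show ?thesis using sepD[OF S'(1) X(1)] X(3) by blast
    qed
    then show ?thesis using c X(2) by auto
  qed
  have T: "\<not> adj G v y" if "\<not> T v" "v \<in> verts G - {x, y, z}" for v
    using that unfolding T_def by blast
  define f :: "'a \<Rightarrow> nat + ((nat \<times> nat) + nat) + (nat \<times> nat)" where "f v = (if v = x then Inl 0 else if v = y then Inl 1 else if v = z then Inl 2
    else if T v then Inr (Inr (cl v, en v)) else Inr (Inl (Inl (cl v, en v))))" for v
  have fx: "f x = Inl 0" and fy: "f y = Inl 1" and fz: "f z = Inl 2" unfolding f_def using ne3 by auto
  have fT: "f v = Inr (Inr (cl v, en v))" if "v \<in> verts G - {x, y, z}" "T v" for v
    unfolding f_def using that by auto
  have fo: "f v = Inr (Inl (Inl (cl v, en v)))" if "v \<in> verts G - {x, y, z}" "\<not> T v" for v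
    unfolding f_def using that by auto
  let ?H = "F_graph (Suc N) (Suc N) k"
  have ver: "f v \<in> verts ?H" if "v \<in> verts G" for v
    using that props[of v] c3[of v] unfolding f_def F_graph_def Let_def graph_verts by auto
  have inj: "inj_on f (verts G)"
  proof (rule inj_onI)
    fix u v assume "u \<in> verts G" "v \<in> verts G" "f u = f v"
    then show "u = v" using c2[of u v] unfolding f_def by (auto split: if_splits)
  qed
  have join: "{f a, f b} \<in> edges ?H" if a: "a \<in> {x, y, z}" and b: "b \<in> verts G - {x, y, z}" and e: "adj G b a" for a b
  proof (cases "T b")
    case True
    then have "a \<noteq> x" using props[OF b] e by blast
    then have "f a \<in> {Inl 1, Inl 2}" using a fy fz by auto
    moreover have "f b \<in> Inr ` Inr ` verts (copies (Suc N) (complete_graph (k - 1)))"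
      unfolding fT[OF b True] graph_verts using props[OF b] c3[OF b] by auto
    ultimately show ?thesis unfolding F_graph_def Let_def by (intro between_edge(1)[OF between_edge(2)])
  next
    case False
    then have "a \<noteq> y" using T[OF False b] e by blast
    then have "f a \<in> {Inl 0, Inl 2}" using a fx fz by auto
    moreover have "f b \<in> Inr ` Inl ` verts (disjoint_union (copies (Suc N) (complete_graph (k - 1))) (complete_graph 1))"
      unfolding fo[OF b False] graph_verts using props[OF b] c3[OF b] by auto
    ultimately show ?thesis unfolding F_graph_def Let_def by (intro between_edge(2))
  qed
  have edge: "{f u, f v} \<in> edges ?H" if uv: "adj G u v" "u \<noteq> v" for u v
  proof -
    have V: "u \<in> verts G" "v \<in> verts G" using EV EV2 uv(1) by blast+
    consider "u \<in> {x, y, z}" "v \<in> {x, y, z}" | "u \<in> {x, y, z}" "v \<notin> {x, y, z}" | "u \<notin> {x, y, z}" "v \<in> {x, y, z}"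
      | "u \<notin> {x, y, z}" "v \<notin> {x, y, z}" by blast
    then show ?thesis
    proof cases
      case 1
      have "\<exists>i<3. f a = Inl i" if "a \<in> {x, y, z}" for a using that fx fy fz by auto
      then obtain i j where ij: "f u = Inl i" "i < 3" "f v = Inl j" "j < 3" using 1 by blast
      have "f u \<noteq> f v" using inj_onD[OF inj _ V] uv(2) by blast
      then have "i \<noteq> j" using ij by auto
      then show ?thesis unfolding ij(1,3) F_graph_def Let_def
        using ij by (intro between_edge(1) union_edge complete_edge)
    next
      case 2 then show ?thesis using join V uv(1) sym by blast
    next
      case 3 then show ?thesis using join[of v u] V uv(1) by (simp add: insert_commute)
    next
      case 4
      then have o: "u \<in> verts G - {x, y, z}" "v \<in> verts G - {x, y, z}" using V by auto
      have cl: "cl u = cl v" using c1 uv(1) o by blast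
      have ne: "en u \<noteq> en v" using c2[OF o cl] uv(2) by blast
      have N: "cl v < Suc N" using c3[of v] o by simp
      have ek: "en u < k - 1" "en v < k - 1" using props o by blast+
      have iff: "T u \<longleftrightarrow> T v" unfolding T_def cl ..
      show ?thesis
      proof (cases "T u")
        case True
        then show ?thesis unfolding fT[OF o(1) True] fT[OF o(2) True[unfolded iff]] cl F_graph_def Let_def
          using ek ne N by (intro between_edge(1) union_edge copies_edge complete_edge)
      next
        case False
        then show ?thesis unfolding fo[OF o(1) False] fo[OF o(2) False[unfolded iff]] cl F_graph_def Let_def
          using ek ne N by (intro between_edge(1) union_edge copies_edge complete_edge)
      qed
    qed
  qed
  have "is_subgraph G ?H" using is_subgraphI[OF simple inj ver edge] .
  then show ?thesis by (intro exI[of _ "Suc N"] conjI) simp_all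
qed

lemma embedding_M:
  assumes shape_M
  shows "k = 4 \<and> (\<exists>t\<ge>7. is_subgraph G (join_graph (complete_graph 3) (matching_graph t)))"
proof -
  obtain S where k4: "k = 4" and S: "S \<subseteq> verts G" "card S = 3"
    and X: "\<And>v. v \<in> verts G - S \<Longrightarrow> \<exists>X. v \<in> X \<and> sep X S \<and> card X \<le> 2"
    using assms unfolding shape_M_def by blast
  obtain cl en N where C: "coordinates S cl en N" using coordinates_exist by blast
  note c1 = coordinatesD(1)[OF C] and c2 = coordinatesD(2)[OF C]
    and c3 = coordinatesD(3)[OF C] and c4 = coordinatesD(4)[OF C]
  obtain b :: "'a \<Rightarrow> nat" where b: "inj_on b S" "b ` S = {..<3}"
    using finite_numbering[OF finite_subset[OF S(1) finV]] S(2) by metis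
  have bS: "b v < 3" if "v \<in> S" for v using b(2) that by auto
  have en: "en v < 2" if v: "v \<in> verts G - S" for v
  proof -
    obtain X where X: "v \<in> X" "sep X S" "card X \<le> 2" using X[OF v] by blast
    have "en v < card X" using c4[OF v X(1,2)] by blast
    then show ?thesis using X(3) by simp
  qed
  \<comment> \<open>Components have at most two vertices, so component \<open>cl v\<close> occupies
    the matching edge from \<open>2 * cl v\<close> to \<open>2 * cl v + 1\<close>. The size
    \<open>2 * N + 8\<close> below also meets the lower bound 7 for small \<open>N\<close>.\<close>
  define f where "f v = (if v \<in> S then Inl (b v) else Inr (2 * cl v + en v))" for v
  let ?H = "join_graph (complete_graph 3) (matching_graph (2 * N + 8))"
  have ver: "f v \<in> verts ?H" if "v \<in> verts G" for v
    using that bS[of v] en[of v] c3[of v] unfolding f_def graph_verts by auto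
  have inj: "inj_on f (verts G)"
  proof (rule inj_onI)
    fix u v assume uv: "u \<in> verts G" "v \<in> verts G" "f u = f v"
    show "u = v"
    proof (cases "u \<in> S")
      case True
      then have "v \<in> S \<and> b u = b v" using uv(3) unfolding f_def by (auto split: if_splits)
      then show ?thesis using inj_onD[OF b(1)] True by blast
    next
      case False
      then have v: "v \<notin> S" "2 * cl u + en u = 2 * cl v + en v" using uv(3) unfolding f_def by (auto split: if_splits)
      have "en u < 2" "en v < 2" using en uv False v by blast+
      then have c: "cl u = cl v" using v(2) by linarith
      then have "en u = en v" using v(2) by simp
      then show ?thesis using c2 c uv v False by blast
    qed
  qed
  have join: "{f a, f b} \<in> edges ?H" if ab: "a \<in> S" "b \<in> verts G - S" for a b
    using ab bS[of a] en[of b] c3[of b] unfolding f_def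
    by (auto intro!: join_edge(3) simp: graph_verts)
  have edge: "{f u, f v} \<in> edges ?H" if uv: "adj G u v" "u \<noteq> v" for u v
  proof -
    have V: "u \<in> verts G" "v \<in> verts G" using EV EV2 uv(1) by blast+
    consider "u \<in> S" "v \<in> S" | "u \<in> S" "v \<notin> S" | "u \<notin> S" "v \<in> S"
      | "u \<notin> S" "v \<notin> S" by blast
    then show ?thesis
    proof cases
      case 1
      have "b u \<noteq> b v" using inj_onD[OF b(1)] uv(2) 1 by blast
      then show ?thesis unfolding f_def using 1 bS by (auto intro!: join_edge(1) complete_edge)
    next
      case 2 then show ?thesis using join V by blast
    next
      case 3 then show ?thesis using join[of v u] V by (simp add: insert_commute)
    next
      case 4
      then have o: "u \<in> verts G - S" "v \<in> verts G - S" using V by auto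
      have cl: "cl u = cl v" using c1 uv(1) o by blast
      have ne: "en u \<noteq> en v" using c2[OF o cl] uv(2) by blast
      have "f u = Inr (2 * cl v + en u)" "f v = Inr (2 * cl v + en v)" unfolding f_def using 4 cl by auto
      then show ?thesis using en[OF o(1)] en[OF o(2)] ne c3[OF o(2)]
        by (simp only:) (intro join_edge(2) matching_edge; simp)
    qed
  qed
  have "is_subgraph G ?H" using is_subgraphI[OF simple inj ver edge] .
  then show ?thesis using k4 by (intro conjI exI[of _ "2 * N + 8"]) simp_all
qed

text \<open>Coordinates are taken relative to \<open>{p, q}\<close> and applied only to the vertices
  outside the star; their components have at most two vertices and avoid \<open>j\<close>. The
  centre \<open>j\<close> gets number 0 of the star and the leaves get the numbers from 1
  on.\<close>

lemma embedding_S: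
  assumes shape_S
  shows "k = 3 \<and> (\<exists>s t. s \<ge> 1 \<and> s + t \<ge> 6 \<and> is_subgraph G (join_graph (complete_graph 2)
    (disjoint_union (star_graph s) (matching_graph t))))"
proof -
  obtain p q j where k3: "k = 3" and pqj: "p \<in> verts G" "q \<in> verts G" "j \<in> verts G" "p \<noteq> q" "p \<noteq> j" "q \<noteq> j"
    and X: "\<And>v. v \<in> verts G - {p, q, j} \<Longrightarrow> (\<forall>u. adj G v u \<longrightarrow> u \<in> {p, q, j}) \<or>
        (\<exists>X. v \<in> X \<and> j \<notin> X \<and> card X \<le> 2 \<and> sep X {p, q})"
    using assms unfolding shape_S_def by blast
  obtain cl en N where C: "coordinates {p, q} cl en N" using coordinates_exist by blast
  note c1 = coordinatesD(1)[OF C] and c2 = coordinatesD(2)[OF C]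
    and c3 = coordinatesD(3)[OF C] and c4 = coordinatesD(4)[OF C]
  define L where "L = {v \<in> verts G - {p, q, j}. \<forall>u. adj G v u \<longrightarrow> u \<in> {p, q, j}}"
  have LV: "L \<subseteq> verts G" "p \<notin> L" "q \<notin> L" "j \<notin> L" unfolding L_def by auto
  obtain g :: "'a \<Rightarrow> nat" where g: "inj_on g L" "g ` L = {..<card L}"
    using finite_numbering[OF finite_subset[OF LV(1) finV]] .
  have gL: "g v < card L" if "v \<in> L" for v using g(2) that by auto
  let ?O = "verts G - {p, q, j} - L"
  have props: "en v < 2 \<and> \<not> adj G v j" if v: "v \<in> ?O" for v
  proof -
    obtain X where X: "v \<in> X" "j \<notin> X" "card X \<le> 2" "sep X {p, q}" using X[of v] v unfolding L_def by blast
    have "en v < card X" using c4[OF _ X(1,4)] v by blast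
    then show ?thesis using X sepD[OF X(4,1), of j] pqj by auto
  qed
  define f :: "'a \<Rightarrow> nat + nat + nat" where "f v = (if v = p then Inl 0 else if v = q then Inl 1 else if v = j then Inr (Inl 0)
    else if v \<in> L then Inr (Inl (Suc (g v))) else Inr (Inr (2 * cl v + en v)))" for v
  have fp: "f p = Inl 0" and fq: "f q = Inl 1" and fj: "f j = Inr (Inl 0)" unfolding f_def using pqj by auto
  have fL: "f v = Inr (Inl (Suc (g v)))" if "v \<in> L" for v unfolding f_def using that LV by auto
  have fo: "f v = Inr (Inr (2 * cl v + en v))" if "v \<in> ?O" for v unfolding f_def using that by auto
  let ?H = "join_graph (complete_graph 2) (disjoint_union (star_graph (Suc (card L))) (matching_graph (2 * N + 6)))"
  have ver: "f v \<in> verts ?H" if v: "v \<in> verts G" for v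
  proof -
    consider "v = p" | "v = q" | "v = j" | "v \<in> L" | "v \<in> ?O" using v by blast
    then show ?thesis
    proof cases
      case 5 then show ?thesis using fo[OF 5] props[OF 5] c3[of v] by (auto simp: graph_verts)
    qed (use fp fq fj fL gL in \<open>auto simp: graph_verts\<close>)
  qed
  have inj: "inj_on f (verts G)"
  proof (rule inj_onI)
    fix u v assume uv: "u \<in> verts G" "v \<in> verts G" "f u = f v"
    have num: "u = v" if "u \<in> ?O" "v \<in> ?O" "2 * cl u + en u = 2 * cl v + en v"
    proof -
      have c: "cl u = cl v"
        using that(3) conjunct1[OF props[OF that(1)]] conjunct1[OF props[OF that(2)]] by linarith
      then have "en u = en v" using that(3) by simp
      then show ?thesis using c2[of u v] c that by blast
    qed
    show "u = v" using uv num inj_onD[OF g(1), of u v] unfolding f_def by (auto split: if_splits)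
  qed
  have join: "{f a, f b} \<in> edges ?H" if a: "a \<in> {p, q}" and b: "b \<in> verts G - {p, q}" for a b
  proof -
    have "\<exists>i<2. f a = Inl i" using a fp fq by auto
    then obtain i where i: "f a = Inl i" "i \<in> {..<2}" by blast
    have "f b \<in> verts ?H" using ver b by blast
    moreover have "\<exists>m. f b = Inr m" using b unfolding f_def by auto
    then obtain m where m: "f b = Inr m" by blast
    ultimately show ?thesis unfolding i(1) m join_verts
      using i(2) by (intro join_edge(3)) (auto simp: complete_verts)
  qed
  have star: "{f j, f b} \<in> edges ?H" if "b \<in> L" for b
    unfolding fj fL[OF that] using gL[OF that] by (intro join_edge(2) union_edge star_edge) simp_all
  have edge: "{f u, f v} \<in> edges ?H" if uv: "adj G u v" "u \<noteq> v" for u v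
  proof -
    have V: "u \<in> verts G" "v \<in> verts G" using EV EV2 uv(1) by blast+
    consider "u \<in> {p, q}" "v \<in> {p, q}" | "u \<in> {p, q}" "v \<notin> {p, q}" | "u \<notin> {p, q}" "v \<in> {p, q}"
      | "u \<notin> {p, q}" "v \<notin> {p, q}" "u = j" | "u \<notin> {p, q}" "v \<notin> {p, q}" "v = j"
      | "u \<notin> {p, q, j}" "v \<notin> {p, q, j}" by blast
    then show ?thesis
    proof cases
      case 1
      then have "{f u, f v} = {Inl 0, Inl 1}" using uv(2) fp fq by auto
      moreover have "{Inl 0, Inl 1} \<in> edges ?H" by (intro join_edge(1) complete_edge) simp_all
      ultimately show ?thesis by simp
    next
      case 2 then show ?thesis using join V by blast
    next
      case 3 then show ?thesis using join[of v u] V by (simp add: insert_commute)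
    next
      case 4
      then have "v \<in> L" using props[of v] V sym[OF uv(1)] uv(2) by blast
      then show ?thesis using star 4 by blast
    next
      case 5
      then have "u \<in> L" using props[of u] V uv by blast
      then show ?thesis using star[of u] 5 by (simp add: insert_commute)
    next
      case 6
      then have o: "u \<in> ?O" "v \<in> ?O" using V uv(1) sym[OF uv(1)] unfolding L_def by blast+
      have cl: "cl u = cl v" using c1 uv(1) o by blast
      have ne: "en u \<noteq> en v" using c2[OF _ _ cl] uv(2) o by blast
      have N: "cl v < N" using c3 o by blast
      show ?thesis unfolding fo[OF o(1)] fo[OF o(2)] cl using props[OF o(1)] props[OF o(2)] ne N
        by (intro join_edge(2) union_edge matching_edge) simp_all
    qed
  qed
  have "is_subgraph G ?H" using is_subgraphI[OF simple inj ver edge] .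
  then show ?thesis using k3 by (intro conjI exI[of _ "Suc (card L)"] exI[of _ "2 * N + 6"]) simp_all
qed

text \<open>With \<open>l = 2 * k + card T\<close> the part \<open>C\<close> of
  \<open>H_graph\<close> has \<open>card T\<close> elements, so the sets \<open>A\<close>,
  \<open>T\<close> and the rest are in bijection with the parts \<open>A\<close>, \<open>C\<close>
  and \<open>B\<close>.\<close>

lemma embedding_H0:
  assumes A: "A \<subseteq> verts G" "card A = k" and T: "T \<subseteq> verts G - A" "2 * k + card T \<le> card (verts G)"
    and e: "\<And>u v. u \<in> verts G - A \<Longrightarrow> v \<in> verts G - A \<Longrightarrow> adj G u v \<Longrightarrow> u \<in> T \<and> v \<in> T"
  shows "is_subgraph G (H_graph (card (verts G)) (2 * k + card T) k)"
proof -
  let ?n = "card (verts G)" let ?m = "card (verts G) - (2 * k + card T) + 2 * k"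
  have fin: "finite A" "finite T" "finite (verts G - A - T)"
    using finV finite_subset[OF A(1)] finite_subset[OF T(1)] by auto
  have "card (verts G - A - T) = ?n - k - card T"
    using A T fin by (simp add: card_Diff_subset)
  then have cB: "card (verts G - A - T) = card {k..<?m}" using T(2) by simp
  obtain hA where hA: "bij_betw hA A {..<k}"
    using finite_same_card_bij[OF fin(1), of "{..<k}"] A(2) by auto
  obtain hB where hB: "bij_betw hB (verts G - A - T) {k..<?m}"
    using finite_same_card_bij[OF fin(3) _ cB] by auto
  obtain hC where hC: "bij_betw hC T {?m..<?n}"
    using finite_same_card_bij[OF fin(2), of "{?m..<?n}"] T(2) by auto
  define f where "f v = (if v \<in> A then hA v else if v \<in> T then hC v else hB v)" for v
  have fA: "f v = hA v" "f v < k" if "v \<in> A" for v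
    using that bij_betwE[OF hA] unfolding f_def by auto
  have fC: "f v = hC v" "?m \<le> f v \<and> f v < ?n" if "v \<in> T" for v
    using that bij_betwE[OF hC] T(1) unfolding f_def by auto
  have fB: "f v = hB v" "k \<le> f v \<and> f v < ?m" if "v \<in> verts G - A - T" for v
    using that bij_betwE[OF hB] unfolding f_def by auto
  have inj: "inj_on f (verts G)"
  proof (rule inj_onI)
    fix u v assume uv: "u \<in> verts G" "v \<in> verts G" "f u = f v"
    have km: "k \<le> ?m" by simp
    have "u \<in> A \<or> u \<in> T \<or> u \<in> verts G - A - T" "v \<in> A \<or> v \<in> T \<or> v \<in> verts G - A - T"
      using uv by blast+
    then consider "u \<in> A" "v \<in> A" | "u \<in> T" "v \<in> T" | "u \<in> verts G - A - T" "v \<in> verts G - A - T"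
      using uv(3) fA(2)[of u] fA(2)[of v] fB(2)[of u] fB(2)[of v] fC(2)[of u] fC(2)[of v] km
      by (elim disjE) simp_all
    then show "u = v"
    proof cases
      case 1 then show ?thesis using fA uv(3) bij_betw_imp_inj_on[OF hA] by (metis inj_onD)
    next
      case 2 then show ?thesis using fC uv(3) bij_betw_imp_inj_on[OF hC] by (metis inj_onD)
    next
      case 3 then show ?thesis using fB uv(3) bij_betw_imp_inj_on[OF hB] by (metis inj_onD)
    qed
  qed
  have AC: "{f u, f v} \<in> edges (H_graph ?n (2 * k + card T) k)" if "u \<in> A \<union> T" "v \<in> A \<union> T" "f u \<noteq> f v" for u v
  proof -
    have "f u \<in> {..<k} \<union> {?m..<?n}" "f v \<in> {..<k} \<union> {?m..<?n}" using that fA(2) fC(2) by auto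
    then show ?thesis unfolding H_graph_def Let_def using that(3) by auto
  qed
  have AB: "{f u, f v} \<in> edges (H_graph ?n (2 * k + card T) k)" if "u \<in> A" "v \<in> verts G - A - T" for u v
  proof -
    have "f u \<in> {..<k}" "f v \<in> {k..<?m}" using that fA(2) fB(2) by auto
    then show ?thesis unfolding H_graph_def Let_def by auto
  qed
  show ?thesis
  proof (rule is_subgraphI[OF simple inj])
    show "f v \<in> verts (H_graph ?n (2 * k + card T) k)" if "v \<in> verts G" for v
      using that fA(2)[of v] fB(2)[of v] fC(2)[of v] T(2) unfolding H_graph_def Let_def by auto
  next
    fix u v assume uv: "adj G u v" "u \<noteq> v"
    have V: "u \<in> verts G" "v \<in> verts G" using EV EV2 uv(1) by blast+
    have ne: "f u \<noteq> f v" using inj_onD[OF inj _ V] uv(2) by blast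
    consider "u \<in> A \<union> T" "v \<in> A \<union> T" | "u \<in> A" "v \<in> verts G - A - T" | "v \<in> A" "u \<in> verts G - A - T"
      using e[of u v] uv(1) V by blast
    then show "{f u, f v} \<in> edges (H_graph ?n (2 * k + card T) k)"
    proof cases
      case 3 then show ?thesis using AB[of v u] by (simp add: insert_commute)
    qed (use AC AB ne in blast)+
  qed
qed

lemma embedding_H:
  assumes shape_H
  shows "card (verts G) = 2 * k + 1 \<and> is_subgraph G (H_graph (2 * k + 1) (2 * k + 1) k) \<or>
    2 * k + 2 \<le> card (verts G) \<and> is_subgraph G (H_graph (card (verts G)) (2 * k + 2) k)"
proof -
  obtain A where n: "2 * k + 1 \<le> card (verts G)" and A: "A \<subseteq> verts G" "card A = k"
    and alt: "(\<forall>u\<in>verts G - A. \<forall>v\<in>verts G - A. \<not> adj G u v) \<or>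
     (2 * k + 2 \<le> card (verts G) \<and> (\<exists>y y'. \<forall>u\<in>verts G - A. \<forall>v\<in>verts G - A. adj G u v \<longrightarrow> {u, v} = {y, y'}))"
    using assms unfolding shape_H_def by blast
  have cA: "card (verts G - A) = card (verts G) - k"
    using A finite_subset[OF A(1) finV] by (simp add: card_Diff_subset)
  have fA: "finite (verts G - A)" using finV by simp
  show ?thesis
  proof (cases "2 * k + 2 \<le> card (verts G)")
    case True
    obtain Y where Y: "Y \<subseteq> verts G - A" "card Y \<le> 2"
      "\<And>u v. u \<in> verts G - A \<Longrightarrow> v \<in> verts G - A \<Longrightarrow> adj G u v \<Longrightarrow> u \<in> Y \<and> v \<in> Y"
    proof (cases "\<forall>u\<in>verts G - A. \<forall>v\<in>verts G - A. \<not> adj G u v")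
      case True then show ?thesis using that[of "{}"] by auto
    next
      case False
      then obtain y y' where y: "\<And>u v. u \<in> verts G - A \<Longrightarrow> v \<in> verts G - A \<Longrightarrow> adj G u v \<Longrightarrow> {u, v} = {y, y'}"
        using alt by blast
      have "card ({y, y'} \<inter> (verts G - A)) \<le> card {y, y'}" by (intro card_mono) auto
      also have "\<dots> \<le> 2" by (simp add: card_insert_if)
      finally show ?thesis
        using y by (intro that[of "{y, y'} \<inter> (verts G - A)"]) blast+
    qed
    have "2 \<le> card (verts G - A)" using cA True k2 by linarith
    \<comment> \<open>The ends of the possible edge outside \<open>A\<close> are padded to exactly
      two vertices, the size of \<open>C\<close> for \<open>l = 2 * k + 2\<close>.\<close>
    then obtain T where T: "Y \<subseteq> T" "T \<subseteq> verts G - A" "card T = 2"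
      using exists_subset_between[OF Y(2) _ Y(1) fA] by blast
    have "is_subgraph G (H_graph (card (verts G)) (2 * k + card T) k)"
      using Y(3) T True by (intro embedding_H0[OF A T(2)]) auto
    then show ?thesis using True T(3) by simp
  next
    case False
    then have n1: "card (verts G) = 2 * k + 1" using n by simp
    obtain T where T: "T \<subseteq> verts G - A" "card T = 1"
      using exists_subset_between[of "{}" 1 "verts G - A"] cA n1 fA by auto
    have "is_subgraph G (H_graph (card (verts G)) (2 * k + card T) k)"
      using alt False T n1 by (intro embedding_H0[OF A T(1)]) auto
    then show ?thesis using n1 T(2) by simp
  qed
qed

end

theorem theorem1p6:
  fixes G :: "'a ugraph" and n k :: nat
  assumes "k \<ge> 2"
    and "simple_graph G"
    and "card (verts G) = n"
    and "k_connected 2 G"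
    and "\<not> hamiltonian G"
    and "circumference G \<le> 2 * k + 1"
    and "card {v \<in> verts G. \<not> degree G v \<ge> k} \<le> 1"
  shows
    "(n = 2 * k + 1 \<and> is_subgraph G (H_graph (2 * k + 1) (2 * k + 1) k)) \<or>
     (n \<ge> 2 * k + 2 \<and> is_subgraph G (H_graph n (2 * k + 2) k)) \<or>
     (\<exists>s\<ge>1. \<exists>t\<ge>1. is_subgraph G (F_graph s t k)) \<or>
     (\<exists>t\<ge>1. is_subgraph G (F1_graph t k)) \<or>
     (k = 3 \<and> (\<exists>t\<ge>6. is_subgraph G (join_graph (complete_graph 2) (matching_graph t)))) \<or>
     (k = 3 \<and> (\<exists>s t. s \<ge> 1 \<and> s + t \<ge> 6 \<and>
        is_subgraph G (join_graph (complete_graph 2)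
                         (disjoint_union (star_graph s) (matching_graph t))))) \<or>
     (k = 4 \<and> (\<exists>t\<ge>7. is_subgraph G (join_graph (complete_graph 3) (matching_graph t))))"
proof -
  let ?L = "{v \<in> verts G. \<not> degree G v \<ge> k}"
  have "finite ?L" using assms(2) unfolding simple_graph_def by simp
  then have "\<forall>u\<in>?L. \<forall>v\<in>?L. u = v" using assms(7) card_le_Suc0_iff_eq[of ?L] by (simp only: One_nat_def)
  \<comment> \<open>If no degree is below \<open>k\<close>, any value can be taken for
    \<open>w\<close>.\<close>
  then have "\<exists>w. ?L \<subseteq> {w}" by blast
  then obtain w where "?L \<subseteq> {w}" by blast
  then have low: "k \<le> degree G v" if "v \<in> verts G" "v \<noteq> w" for v using that by blast
  interpret circumference_graph "adj G" "verts G" k w "circumference G"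
    by (rule circumference_graph_adj[OF assms(2,4,1,5,6) low])
  interpret host G k w using assms(2) by unfold_locales
  show ?thesis
    using classification embedding_F embedding_S embedding_F1 embedding_M embedding_H assms(3) by metis
qed

end
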